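(* Let $\kappa\in\{1,-1\}$ and let $\Phi_t$ be the flow on $X_5$ of $i\partial_tq=-\frac12\partial_x^2q+\kappa|q|^2q$. If $f_n,f\in X_5$, $\sup_n\|f_n\|_5+\|f\|_5<\infty$, and $f_n\to f$ in $C^4_{\rm loc}(\mathbb R)$, then, for every $A,T<\infty$, $$\sup_{|t|\le T}\|\Phi_t(f_n)-\Phi_t(f)\|_{C^4([-A,A])}\longrightarrow0.$$
   Context: Choose a real, even $\chi\in C_c^\infty((-1,1))$ with $\sum_{k\in\mathbb Z}\chi(\xi-k)=1$. With $\widehat f(\xi)=\int e^{-ix\xi}f(x)\,dx$, put $\Box_kf=\mathcal F^{-1}(\chi(\xi-k)\widehat f(\xi))$, $\langle k\rangle=(1+k^2)^{1/2}$. For $s\ge0$, $X_s=\{f\in\mathcal S'(\mathbb R):\|f\|_s:=\sum_{k}\langle k\rangle^s\|\Box_kf\|_\infty<\infty\}$ (complex-valued; elements of $X_5$ are $C^5$ with bounded derivatives through order five). Flow: for every $q_0\in X_5$ there is a global classical solution $q\in C(\mathbb R;X_5)\cap C^1(\mathbb R;X_3)$ of the equation with $q(0)=q_0$, unique among classical solutions $v$ with $v,v_x$ bounded on every strip $[-T,T]\times\mathbb R$, $T<\infty$; $\Phi_t(q_0)=q(t)$. *)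

theory Defs
  imports "HOL-Analysis.Analysis"
begin

section \<open>Schwartz functions and tempered distributions on the line\<close>

definition iter_deriv :: "nat \<Rightarrow> (real \<Rightarrow> 'a::real_normed_vector) \<Rightarrow> real \<Rightarrow> 'a" where
  "iter_deriv m f = ((\<lambda>g x. vector_derivative g (at x)) ^^ m) f"

definition smooth :: "(real \<Rightarrow> 'a::real_normed_vector) \<Rightarrow> bool" where
  "smooth f \<longleftrightarrow> (\<forall>m x. iter_deriv m f differentiable (at x))"

definition schwartz :: "(real \<Rightarrow> complex) set" where
  "schwartz = {\<phi>. smooth \<phi> \<and> (\<forall>a b. bounded (range (\<lambda>x. x ^ a *\<^sub>R iter_deriv b \<phi> x)))}"

definition schwartz_seminorm :: "nat \<Rightarrow> nat \<Rightarrow> (real \<Rightarrow> complex) \<Rightarrow> real" where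
  "schwartz_seminorm a b \<phi> = (SUP x. norm (x ^ a *\<^sub>R iter_deriv b \<phi> x))"

text \<open>A distribution is a functional on all functions of which only the values on Schwartz
  functions matter. Continuity is expressed by the usual seminorm estimate.\<close>

type_synonym distribution = "(real \<Rightarrow> complex) \<Rightarrow> complex"

definition tempered :: "distribution \<Rightarrow> bool" where
  "tempered u \<longleftrightarrow>
     (\<forall>\<phi>\<in>schwartz. \<forall>\<psi>\<in>schwartz. u (\<lambda>x. \<phi> x + \<psi> x) = u \<phi> + u \<psi>) \<and>
     (\<forall>c. \<forall>\<phi>\<in>schwartz. u (\<lambda>x. c * \<phi> x) = c * u \<phi>) \<and>
     (\<exists>C N. \<forall>\<phi>\<in>schwartz. norm (u \<phi>) \<le> C * (\<Sum>a\<le>N. \<Sum>b\<le>N. schwartz_seminorm a b \<phi>))"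

definition distribution_of :: "(real \<Rightarrow> complex) \<Rightarrow> distribution" where
  "distribution_of g = (\<lambda>\<phi>. LINT x|lborel. g x * \<phi> x)"

definition fourier :: "(real \<Rightarrow> complex) \<Rightarrow> real \<Rightarrow> complex" where
  "fourier \<phi> \<xi> = (LINT x|lborel. exp (- \<i> * of_real (x * \<xi>)) * \<phi> x)"

definition fourier_inv :: "(real \<Rightarrow> complex) \<Rightarrow> real \<Rightarrow> complex" where
  "fourier_inv \<phi> x = (1 / (2 * of_real pi)) * (LINT \<xi>|lborel. exp (\<i> * of_real (x * \<xi>)) * \<phi> \<xi>)"

definition dist_fourier :: "distribution \<Rightarrow> distribution" where
  "dist_fourier u = (\<lambda>\<phi>. u (fourier \<phi>))"

definition dist_fourier_inv :: "distribution \<Rightarrow> distribution" where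
  "dist_fourier_inv u = (\<lambda>\<phi>. u (fourier_inv \<phi>))"

definition dist_mult :: "(real \<Rightarrow> complex) \<Rightarrow> distribution \<Rightarrow> distribution" where
  "dist_mult m u = (\<lambda>\<phi>. u (\<lambda>x. m x * \<phi> x))"

text \<open>The \<open>L\<^sup>\<infinity>\<close> norm of a distribution: the least bound of a bounded function representing it,
  and \<open>\<infinity>\<close> if there is none.\<close>

definition dist_sup_norm :: "distribution \<Rightarrow> ennreal" where
  "dist_sup_norm u = Inf {ennreal C | C. \<exists>g\<in>borel_measurable lborel.
      (\<forall>x. norm (g x) \<le> C) \<and> (\<forall>\<phi>\<in>schwartz. u \<phi> = distribution_of g \<phi>)}"

section \<open>The spaces \<open>X\<^sub>s\<close>\<close>

definition admissible_window :: "(real \<Rightarrow> real) \<Rightarrow> bool" where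
  "admissible_window \<eta> \<longleftrightarrow> smooth \<eta> \<and> closure {\<xi>. \<eta> \<xi> \<noteq> 0} \<subseteq> {-1<..<1} \<and>
     (\<forall>\<xi>. \<eta> (- \<xi>) = \<eta> \<xi>) \<and>
     (\<forall>\<xi>. ((\<lambda>k::int. \<eta> (\<xi> - of_int k)) has_sum 1) UNIV)"

definition freq_box :: "(real \<Rightarrow> real) \<Rightarrow> int \<Rightarrow> distribution \<Rightarrow> distribution" where
  "freq_box \<eta> k u =
     dist_fourier_inv (dist_mult (\<lambda>\<xi>. of_real (\<eta> (\<xi> - of_int k))) (dist_fourier u))"

definition bracket :: "int \<Rightarrow> real" where
  "bracket k = sqrt (1 + (of_int k)\<^sup>2)"

definition dist_X_norm :: "(real \<Rightarrow> real) \<Rightarrow> real \<Rightarrow> distribution \<Rightarrow> ennreal" where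
  "dist_X_norm \<eta> s u =
     (\<Sum>\<^sub>\<infinity>k\<in>UNIV. ennreal (bracket k powr s) * dist_sup_norm (freq_box \<eta> k u))"

definition dist_X :: "(real \<Rightarrow> real) \<Rightarrow> real \<Rightarrow> distribution set" where
  "dist_X \<eta> s = {u. tempered u \<and> dist_X_norm \<eta> s u < \<infinity>}"

text \<open>For \<open>s \<ge> 0\<close> the blocks of an element of \<open>X\<^sub>s\<close> sum uniformly, so it is represented by exactly
  one bounded continuous function. From here on elements of \<open>X\<^sub>s\<close> are these functions.\<close>

definition X_norm :: "(real \<Rightarrow> real) \<Rightarrow> real \<Rightarrow> (real \<Rightarrow> complex) \<Rightarrow> ennreal" where
  "X_norm \<eta> s f = dist_X_norm \<eta> s (distribution_of f)"

definition X_space :: "(real \<Rightarrow> real) \<Rightarrow> real \<Rightarrow> (real \<Rightarrow> complex) set" where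
  "X_space \<eta> s =
     {f. continuous_on UNIV f \<and> bounded (range f) \<and> distribution_of f \<in> dist_X \<eta> s}"

definition X_continuous :: "(real \<Rightarrow> real) \<Rightarrow> real \<Rightarrow> (real \<Rightarrow> real \<Rightarrow> complex) \<Rightarrow> bool" where
  "X_continuous \<eta> s q \<longleftrightarrow> (\<forall>t. q t \<in> X_space \<eta> s) \<and>
     (\<forall>t. ((\<lambda>r. X_norm \<eta> s (\<lambda>x. q r x - q t x)) \<longlongrightarrow> 0) (at t))"

definition X_C1 :: "(real \<Rightarrow> real) \<Rightarrow> real \<Rightarrow> (real \<Rightarrow> real \<Rightarrow> complex) \<Rightarrow> bool" where
  "X_C1 \<eta> s q \<longleftrightarrow> X_continuous \<eta> s q \<and>
     (\<exists>q'. X_continuous \<eta> s q' \<and>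
       (\<forall>t. ((\<lambda>h. X_norm \<eta> s (\<lambda>x. (q (t + h) x - q t x) / of_real h - q' t x)) \<longlongrightarrow> 0) (at 0)))"

section \<open>The equation and its flow\<close>

text \<open>Functions of time and space are curried as \<open>v t x\<close>.\<close>

definition classical_solution :: "real \<Rightarrow> (real \<Rightarrow> real \<Rightarrow> complex) \<Rightarrow> bool" where
  "classical_solution \<kappa> v \<longleftrightarrow> (\<exists>v\<^sub>t v\<^sub>x v\<^sub>x\<^sub>x.
     continuous_on UNIV (\<lambda>(t, x). v t x) \<and> continuous_on UNIV (\<lambda>(t, x). v\<^sub>t t x) \<and>
     continuous_on UNIV (\<lambda>(t, x). v\<^sub>x t x) \<and> continuous_on UNIV (\<lambda>(t, x). v\<^sub>x\<^sub>x t x) \<and>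
     (\<forall>t x. ((\<lambda>r. v r x) has_vector_derivative v\<^sub>t t x) (at t) \<and>
            ((\<lambda>y. v t y) has_vector_derivative v\<^sub>x t x) (at x) \<and>
            ((\<lambda>y. v\<^sub>x t y) has_vector_derivative v\<^sub>x\<^sub>x t x) (at x) \<and>
            \<i> * v\<^sub>t t x = - (1 / 2) * v\<^sub>x\<^sub>x t x + of_real (\<kappa> * (norm (v t x))\<^sup>2) * v t x))"

definition strip_bounded :: "(real \<Rightarrow> real \<Rightarrow> complex) \<Rightarrow> bool" where
  "strip_bounded v \<longleftrightarrow> (\<forall>T. bounded ((\<lambda>(t, x). v t x) ` ({-T..T} \<times> UNIV)) \<and>
     bounded ((\<lambda>(t, x). iter_deriv 1 (v t) x) ` ({-T..T} \<times> UNIV)))"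

definition is_flow ::
    "(real \<Rightarrow> real) \<Rightarrow> real \<Rightarrow> (real \<Rightarrow> (real \<Rightarrow> complex) \<Rightarrow> real \<Rightarrow> complex) \<Rightarrow> bool" where
  "is_flow \<eta> \<kappa> \<Phi> \<longleftrightarrow> (\<forall>q\<^sub>0\<in>X_space \<eta> 5. let q = (\<lambda>t. \<Phi> t q\<^sub>0) in
     classical_solution \<kappa> q \<and> q 0 = q\<^sub>0 \<and> X_continuous \<eta> 5 q \<and> X_C1 \<eta> 3 q \<and>
     (\<forall>v. classical_solution \<kappa> v \<and> strip_bounded v \<and> v 0 = q\<^sub>0 \<longrightarrow> v = q))"

text \<open>The \<open>C\<^sup>k([-A, A])\<close> norm, with extended values so that no supremum is a default value.\<close>

definition Ck_norm :: "nat \<Rightarrow> real \<Rightarrow> (real \<Rightarrow> complex) \<Rightarrow> ennreal" where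
  "Ck_norm k A g = (\<Sum>j\<le>k. SUP x\<in>{-A..A}. ennreal (norm (iter_deriv j g x)))"

definition Ck_loc_tendsto :: "nat \<Rightarrow> (nat \<Rightarrow> real \<Rightarrow> complex) \<Rightarrow> (real \<Rightarrow> complex) \<Rightarrow> bool" where
  "Ck_loc_tendsto k f g \<longleftrightarrow> (\<forall>A. (\<lambda>n. Ck_norm k A (\<lambda>x. f n x - g x)) \<longlonglongrightarrow> 0)"

end

theory Submission
  imports Defs "HOL-Probability.Probability" "HOL-Real_Asymp.Real_Asymp"
begin

text \<open>An energy estimate for the difference of two solutions with the slowly varying weight
  \<open>1 / (1 + (x / R)\<^sup>2)\<close> shows that a common bound of the \<open>X\<^sub>5\<close> norms on \<open>[0, T]\<close> turns local
  closeness of the data into local closeness of every frequency block of the solutions; as \<open>X\<^sub>5\<close>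
  controls the high frequencies of four derivatives, everything reduces to bounding the solutions of
  a bounded sequence of data uniformly. If the data share a summable envelope of their block norms,
  far apart translates of them can be glued to a single datum of \<open>X\<^sub>5\<close>; near the translate of each
  member the glued solution looks like the solution of that member, and as it stays bounded on
  \<open>[0, T]\<close>, so do they. In general a subsequence has convergent block norms. Its low frequencies then
  share an envelope, while its high frequencies are small in the norm with the flattened weight
  \<open>(1 + \<epsilon> \<bar>k\<bar>)\<^sup>5\<close>, in which the flow is Lipschitz with constants that do not depend on \<open>\<epsilon>\<close>.\<close>

section \<open>Integrals on the line\<close>

text \<open>The data need not decay, so the integrals of mass and energy may diverge, and
  \<open>is_flow\<close> asserts global solutions without any bound in terms of the datum. A bound
  for a sequence of data is therefore extracted from existence alone: if it failed, one glued datum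
  would have a solution that is unbounded on a compact time interval. The glued datum lies in the
  space only if the data share a summable envelope, and a bound on l^1 type norms does not supply
  one, since mass can escape to infinite frequency. The flattened weight
  \<open>wt \<epsilon> 5\<close> repairs this. It is submultiplicative with constant 1 for every
  \<epsilon>, so cubic estimates do not degrade; beyond frequency j it is at most
  \<open>(\<epsilon> + 1 / (j + 1)) ^ 5\<close> times the full weight, so escaping mass becomes
  small; for fixed \<epsilon> it gives an equivalent norm, at the price
  \<open>(1 / \<epsilon>) ^ 5\<close>. The order of choices closes the argument: the bound B for the
  solutions of all truncated data, then the stability radius \<delta>, then \<epsilon>, and the
  truncation frequency j last, beyond the fixed bound that results.\<close>

lemma has_vector_derivative_iff_quotient:
  fixes f :: "real \<Rightarrow> 'a::real_normed_vector"
  shows "(f has_vector_derivative f') (at s within S) \<longleftrightarrow>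
    ((\<lambda>r. (f r - f s) /\<^sub>R (r - s)) \<longlongrightarrow> f') (at s within S)"
proof -
  have "((\<lambda>y. norm ((f y - f s) - (y - s) *\<^sub>R f') / norm (y - s)) \<longlongrightarrow> 0) (at s within S) \<longleftrightarrow>
    ((\<lambda>y. norm ((f y - f s) /\<^sub>R (y - s) - f')) \<longlongrightarrow> 0) (at s within S)"
  proof (rule filterlim_cong[OF refl refl])
    show "\<forall>\<^sub>F y in at s within S. norm ((f y - f s) - (y - s) *\<^sub>R f') / norm (y - s) = norm ((f y - f s) /\<^sub>R (y - s) - f')"
      unfolding eventually_at_filter
    proof (intro always_eventually allI impI)
      fix y assume "y \<noteq> s"
      hence "(f y - f s) /\<^sub>R (y - s) - f' = ((f y - f s) - (y - s) *\<^sub>R f') /\<^sub>R (y - s)"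
        by (simp add: scaleR_diff_right)
      thus "norm ((f y - f s) - (y - s) *\<^sub>R f') / norm (y - s) = norm ((f y - f s) /\<^sub>R (y - s) - f')"
        by (simp add: divide_inverse mult.commute)
    qed
  qed
  thus ?thesis
    by (simp add: has_vector_derivative_def has_derivative_iff_norm bounded_linear_scaleR_left
        tendsto_norm_zero_iff LIM_zero_iff)
qed

text \<open>The mean value inequality on the convex set turns the bound \<open>h\<close> on the
  derivatives into one on all difference quotients, as dominated convergence requires. The set
  \<open>S\<close> matters: kernels are dominated uniformly only near a point, and time derivatives
  are taken within closed intervals.\<close>

lemma has_vector_derivative_lebesgue_integral:
  fixes F F' :: "real \<Rightarrow> 'b \<Rightarrow> 'a::{banach,second_countable_topology}"
  assumes S: "convex S" "s \<in> S"
    and F: "\<And>r. r \<in> S \<Longrightarrow> integrable M (F r)"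
    and D: "\<And>r y. r \<in> S \<Longrightarrow> ((\<lambda>r. F r y) has_vector_derivative F' r y) (at r within S)"
    and bd: "\<And>r y. r \<in> S \<Longrightarrow> norm (F' r y) \<le> h y"
    and h: "integrable M h"
    and meas: "F' s \<in> borel_measurable M"
  shows "((\<lambda>r. integral\<^sup>L M (F r)) has_vector_derivative integral\<^sup>L M (F' s)) (at s within S)"
proof -
  let ?q = "\<lambda>r y. (F r y - F s y) /\<^sub>R (r - s)"
  have lip: "norm (F r y - F s y) \<le> h y * norm (r - s)" if "r \<in> S" for r y
    by (rule differentiable_bound[OF S(1), where f'="\<lambda>r u. u *\<^sub>R F' r y"])
      (use D bd that S in \<open>auto simp: has_vector_derivative_def onorm_scaleR_left onorm_id\<close>)
  have "((\<lambda>r. (integral\<^sup>L M (F r) - integral\<^sup>L M (F s)) /\<^sub>R (r - s)) \<longlongrightarrow> integral\<^sup>L M (F' s)) (at s within S)"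
    unfolding tendsto_at_iff_sequentially
  proof safe
    fix X :: "nat \<Rightarrow> real" assume X: "\<forall>i. X i \<in> S - {s}" "X \<longlonglongrightarrow> s"
    have "(\<lambda>i. integral\<^sup>L M (?q (X i))) \<longlonglongrightarrow> integral\<^sup>L M (F' s)"
    proof (rule integral_dominated_convergence[where w=h])
      show "AE y in M. (\<lambda>i. ?q (X i) y) \<longlonglongrightarrow> F' s y"
      proof (rule AE_I2)
        fix y
        have "((\<lambda>r. ?q r y) \<longlongrightarrow> F' s y) (at s within S)"
          using D[OF S(2), of y] by (simp add: has_vector_derivative_iff_quotient)
        thus "(\<lambda>i. ?q (X i) y) \<longlonglongrightarrow> F' s y"
          using X unfolding tendsto_at_iff_sequentially o_def by blast
      qed
      show "AE y in M. norm (?q (X i) y) \<le> h y" for i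
      proof (rule AE_I2)
        fix y
        have "X i \<noteq> s" "X i \<in> S" using X by auto
        thus "norm (?q (X i) y) \<le> h y"
          using lip[of "X i" y] by (simp add: divide_simps mult.commute)
      qed
      show "?q (X i) \<in> borel_measurable M" for i
        using F[of "X i"] F[OF S(2)] X by (auto intro!: borel_measurable_scaleR borel_measurable_diff)
    qed (use h meas in auto)
    also have "(\<lambda>i. integral\<^sup>L M (?q (X i))) = (\<lambda>r. (integral\<^sup>L M (F r) - integral\<^sup>L M (F s)) /\<^sub>R (r - s)) \<circ> X"
      using F X S by (auto simp: fun_eq_iff)
    finally show "((\<lambda>r. (integral\<^sup>L M (F r) - integral\<^sup>L M (F s)) /\<^sub>R (r - s)) \<circ> X) \<longlonglongrightarrow> integral\<^sup>L M (F' s)" .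
  qed
  thus ?thesis by (simp add: has_vector_derivative_iff_quotient)
qed

section \<open>The majorant 1 / (1 + x^2)\<close>

definition dk :: "real \<Rightarrow> real" where "dk x = 1 / (1 + x\<^sup>2)"

lemma dk_pos: "dk x > 0" by (simp add: dk_def add_pos_nonneg)
lemma dk_nonneg [simp]: "dk x \<ge> 0" using dk_pos[of x] by simp
lemma dk_minus [simp]: "dk (- x) = dk x" by (simp add: dk_def)
lemma continuous_on_dk [continuous_intros]: "continuous_on S f \<Longrightarrow> continuous_on S (\<lambda>x. dk (f x))"
  unfolding dk_def by (intro continuous_intros) (auto simp: add_nonneg_eq_0_iff)

lemma dk_measurable [measurable]: "dk \<in> borel_measurable borel"
  by (intro borel_measurable_continuous_onI continuous_intros)

text \<open>A Peetre type inequality, coming from the square of \<open>x + 2 * y\<close>. It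
  recentres a majorant at a polynomial price in the displacement.\<close>

lemma dk_shift: "dk (x + y) \<le> 2 * (1 + y\<^sup>2) * dk x"
proof -
  have "1 + x\<^sup>2 \<le> 1 + 2 * (x + y)\<^sup>2 + 2 * y\<^sup>2"
    using zero_le_power2[of "x + 2 * y"] by (simp add: power2_eq_square algebra_simps)
  also have "\<dots> \<le> 2 * (1 + y\<^sup>2) * (1 + (x + y)\<^sup>2)"
    by (simp add: algebra_simps add_nonneg_nonneg)
  finally show ?thesis
    unfolding dk_def by (simp add: divide_simps add_nonneg_eq_0_iff add_pos_nonneg)
qed

lemma integrable_dk [simp]: "integrable lborel dk"
proof -
  have 1: "integrable lborel (\<lambda>x. indicator {0<..} x *\<^sub>R dk x)"
    using integrable_I0i_1_div_plus_square
    by (simp add: interval_lebesgue_integrable_def set_integrable_def einterval_def dk_def zero_ereal_def)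
      (simp add: greaterThan_def)
  have 2: "integrable lborel (\<lambda>x. indicator {0<..} (-x) *\<^sub>R dk (-x))"
    using lborel_integrable_real_affine[OF 1, of "-1" 0] by simp
  show ?thesis
  proof (rule integrable_cong_AE_imp[OF Bochner_Integration.integrable_add[OF 1 2]])
    show "AE x in lborel. indicator {0<..} x *\<^sub>R dk x + indicator {0<..} (- x) *\<^sub>R dk (- x) = dk x"
      using AE_lborel_singleton[of "0::real"] by eventually_elim (auto simp: indicator_def)
  qed simp
qed

lemma integrable_dk_shift: "integrable lborel (\<lambda>y. dk (x - y))"
  using lborel_integrable_real_affine[OF integrable_dk, of "-1" x] by simp

text \<open>The number pi, kept as a symbol because estimates only carry it along.\<close>

definition dkc :: real where "dkc = integral\<^sup>L lborel dk"

lemma integral_dk_shift: "(LINT y|lborel. dk (x - y)) = dkc"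
  using lborel_integral_real_affine[of "-1" dk x] by (simp add: dkc_def)

lemma integrable_dk_scale: "R > 0 \<Longrightarrow> integrable lborel (\<lambda>y. dk (y / R))"
  using lborel_integrable_real_affine[OF integrable_dk, of "1/R" 0] by simp

lemma integral_dk_scale: "R > 0 \<Longrightarrow> (LINT y|lborel. dk (y / R)) = R * dkc"
  using lborel_integral_real_affine[of "1/R" dk 0] by (simp add: dkc_def field_simps)

lemma dkc_nonneg: "dkc \<ge> 0" unfolding dkc_def by (rule integral_nonneg_AE) simp

lemma integrable_dk_bound:
  fixes f :: "real \<Rightarrow> 'a::{banach,second_countable_topology}"
  assumes "f \<in> borel_measurable borel" "\<And>y. norm (f y) \<le> C * dk (x - y)"
  shows "integrable lborel f" "norm (integral\<^sup>L lborel f) \<le> C * dkc"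
proof -
  have i: "integrable lborel (\<lambda>y. C * dk (x - y))" using integrable_dk_shift by auto
  show 1: "integrable lborel f"
    by (rule Bochner_Integration.integrable_bound[OF i]) (use assms order_trans[OF assms(2)] in \<open>auto intro!: AE_I2\<close>)
  have "norm (integral\<^sup>L lborel f) \<le> (LINT y|lborel. C * dk (x - y))"
    by (rule Bochner_Integration.integral_norm_bound_integral[OF 1 i]) (use assms in auto)
  thus "norm (integral\<^sup>L lborel f) \<le> C * dkc" by (simp add: integral_dk_shift)
qed

text \<open>When kernels are composed, the functions between them are merely bounded, so decay in y
  is available only relative to x. By translation invariance a majorant of convolution shape still
  has a finite double integral.\<close>

lemma Fubini_conv_kernel:
  fixes F :: "real \<Rightarrow> real \<Rightarrow> complex"
  assumes m [measurable]: "case_prod F \<in> borel_measurable (lborel \<Otimes>\<^sub>M lborel)"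
    and a: "integrable lborel a" and c: "integrable lborel c"
    and le: "\<And>x y. norm (F x y) \<le> a x * c (y - x)"
  shows "(LINT y|lborel. LINT x|lborel. F x y) = (LINT x|lborel. LINT y|lborel. F x y)"
proof (rule lborel_pair.Fubini_integral, rule lborel_pair.Fubini_integrable[OF m])
  have c': "integrable lborel (\<lambda>y. c (y - x))" for x
    using lborel_integrable_real_affine[OF c, of 1 "-x"] by simp
  have ci: "(LINT y|lborel. c (y - x)) = integral\<^sup>L lborel c" for x
    using lborel_integral_real_affine[of 1 c "-x"] by simp
  have i: "integrable lborel (\<lambda>y. F x y)" for x
  proof (rule Bochner_Integration.integrable_bound[of lborel "\<lambda>y. a x * c (y - x)"])
    show "integrable lborel (\<lambda>y. a x * c (y - x))" using c' by auto
    show "(\<lambda>y. F x y) \<in> borel_measurable lborel" by measurable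
    show "AE y in lborel. norm (F x y) \<le> norm (a x * c (y - x))"
      by (rule AE_I2) (use le in \<open>smt (verit) real_norm_def\<close>)
  qed
  show "AE x in lborel. integrable lborel (\<lambda>y. case (x, y) of (x, y) \<Rightarrow> F x y)" using i by simp
  show "integrable lborel (\<lambda>x. LINT y|lborel. norm (case (x, y) of (x, y) \<Rightarrow> F x y))"
  proof (rule Bochner_Integration.integrable_bound[of lborel "\<lambda>x. a x * integral\<^sup>L lborel c"])
    show "integrable lborel (\<lambda>x. a x * integral\<^sup>L lborel c)" using a by auto
    show "(\<lambda>x. LINT y|lborel. norm (case (x, y) of (x, y) \<Rightarrow> F x y)) \<in> borel_measurable lborel" by measurable
    show "AE x in lborel. norm (LINT y|lborel. norm (case (x, y) of (x, y) \<Rightarrow> F x y)) \<le> norm (a x * integral\<^sup>L lborel c)"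
    proof (rule AE_I2)
      fix x
      have "(LINT y|lborel. norm (F x y)) \<le> (LINT y|lborel. a x * c (y - x))"
        by (rule integral_mono) (use i c' le in auto)
      moreover have "(LINT y|lborel. norm (F x y)) \<ge> 0" by (rule integral_nonneg_AE) auto
      ultimately show "norm (LINT y|lborel. norm (case (x, y) of (x, y) \<Rightarrow> F x y)) \<le> norm (a x * integral\<^sup>L lborel c)"
        by (simp add: ci)
    qed
  qed
qed

lemma Fubini_product_bound:
  fixes F :: "real \<Rightarrow> real \<Rightarrow> complex"
  assumes m [measurable]: "case_prod F \<in> borel_measurable (lborel \<Otimes>\<^sub>M lborel)"
    and a: "integrable lborel a" and c: "integrable lborel c"
    and le: "\<And>x y. norm (F x y) \<le> a x * c y"
  shows "(LINT y|lborel. LINT x|lborel. F x y) = (LINT x|lborel. LINT y|lborel. F x y)"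
proof (rule lborel_pair.Fubini_integral, rule lborel_pair.Fubini_integrable[OF m])
  have i: "integrable lborel (\<lambda>y. F x y)" for x
  proof (rule Bochner_Integration.integrable_bound[of lborel "\<lambda>y. a x * c y"])
    show "integrable lborel (\<lambda>y. a x * c y)" using c by auto
    show "(\<lambda>y. F x y) \<in> borel_measurable lborel" by measurable
    show "AE y in lborel. norm (F x y) \<le> norm (a x * c y)"
      by (rule AE_I2) (use le in \<open>smt (verit) real_norm_def\<close>)
  qed
  show "AE x in lborel. integrable lborel (\<lambda>y. case (x, y) of (x, y) \<Rightarrow> F x y)" using i by simp
  show "integrable lborel (\<lambda>x. LINT y|lborel. norm (case (x, y) of (x, y) \<Rightarrow> F x y))"
  proof (rule Bochner_Integration.integrable_bound[of lborel "\<lambda>x. a x * integral\<^sup>L lborel c"])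
    show "integrable lborel (\<lambda>x. a x * integral\<^sup>L lborel c)" using a by auto
    show "(\<lambda>x. LINT y|lborel. norm (case (x, y) of (x, y) \<Rightarrow> F x y)) \<in> borel_measurable lborel" by measurable
    show "AE x in lborel. norm (LINT y|lborel. norm (case (x, y) of (x, y) \<Rightarrow> F x y)) \<le> norm (a x * integral\<^sup>L lborel c)"
    proof (rule AE_I2)
      fix x
      have "(LINT y|lborel. norm (F x y)) \<le> (LINT y|lborel. a x * c y)"
        by (rule integral_mono) (use i c le in auto)
      moreover have "(LINT y|lborel. norm (F x y)) \<ge> 0" by (rule integral_nonneg_AE) auto
      ultimately show "norm (LINT y|lborel. norm (case (x, y) of (x, y) \<Rightarrow> F x y)) \<le> norm (a x * integral\<^sup>L lborel c)"
        by simp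
    qed
  qed
qed

lemma integral_tail_small:
  fixes h :: "real \<Rightarrow> real"
  assumes h: "integrable lborel h" and "e > 0"
  shows "\<exists>R\<ge>0. \<forall>R'\<ge>R. (LINT y|lborel. indicator {y. \<bar>y\<bar> > R'} y * \<bar>h y\<bar>) < e"
proof -
  have lim: "((\<lambda>R. LINT y|lborel. indicator {y. \<bar>y\<bar> > R} y * \<bar>h y\<bar>) \<longlongrightarrow> (LINT y::real|lborel. 0)) at_top"
  proof (rule integral_dominated_convergence_at_top[where w="\<lambda>y. \<bar>h y\<bar>"])
    show "AE y in lborel. ((\<lambda>R. indicator {y. \<bar>y\<bar> > R} y * \<bar>h y\<bar>) \<longlongrightarrow> 0) at_top"
    proof (rule AE_I2)
      fix y
      have "eventually (\<lambda>R. indicator {y. \<bar>y\<bar> > R} y * \<bar>h y\<bar> = 0) at_top"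
        using eventually_ge_at_top[of "\<bar>y\<bar>"] by eventually_elim auto
      thus "((\<lambda>R. indicator {y. \<bar>y\<bar> > R} y * \<bar>h y\<bar>) \<longlongrightarrow> 0) at_top" by (rule tendsto_eventually)
    qed
  qed (use h in \<open>auto simp: indicator_def\<close>)
  have "eventually (\<lambda>R. (LINT y|lborel. indicator {y. \<bar>y\<bar> > R} y * \<bar>h y\<bar>) < e) at_top"
    using order_tendstoD(2)[OF lim, of e] assms(2) by simp
  then obtain R where "\<forall>R'\<ge>R. (LINT y|lborel. indicator {y. \<bar>y\<bar> > R'} y * \<bar>h y\<bar>) < e"
    by (auto simp: eventually_at_top_linorder)
  thus ?thesis by (intro exI[of _ "max R 0"]) auto
qed

lemma integral_derivative_eq_0:
  fixes H H' :: "real \<Rightarrow> 'a::euclidean_space"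
  assumes D: "\<And>x. (H has_vector_derivative H' x) (at x)"
    and c: "continuous_on UNIV H'" and i: "integrable lborel H'"
    and lim: "(H \<longlongrightarrow> 0) at_top" "(H \<longlongrightarrow> 0) at_bot"
  shows "integral\<^sup>L lborel H' = 0"
proof -
  have "(LBINT x=-\<infinity>..\<infinity>. H' x) = 0 - 0"
  proof (rule interval_integral_FTC_integrable[where F=H])
    show "isCont H' x" for x using c by (simp add: continuous_on_eq_continuous_at)
    show "set_integrable lborel (einterval (-\<infinity>) \<infinity>) H'" using i by (simp add: set_integrable_def einterval_def)
  qed (use D lim in \<open>simp_all add: ereal_tendsto_simps\<close>)
  thus ?thesis by (simp add: interval_lebesgue_integral_def einterval_def set_lebesgue_integral_def)
qed

text \<open>Integration by parts against kernels and against the energy weight: majorants of type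
  \<open>dk\<close> give both the integrability of the derivative and the vanishing of the boundary
  terms.\<close>

lemma integral_derivative_dk_eq_0:
  fixes H H' :: "real \<Rightarrow> 'a::euclidean_space"
  assumes D: "\<And>x. (H has_vector_derivative H' x) (at x)"
    and c: "continuous_on UNIV H'" and i: "\<And>y. norm (H' y) \<le> C' * dk (x - y)"
    and b: "\<And>y. norm (H y) \<le> C * dk (x - y)"
  shows "integral\<^sup>L lborel H' = 0"
proof (rule integral_derivative_eq_0[OF D c])
  show "integrable lborel H'" by (rule integrable_dk_bound(1)[OF borel_measurable_continuous_onI[OF c] i])
  have "((\<lambda>y. C * dk (x - y)) \<longlongrightarrow> 0) at_top" "((\<lambda>y. C * dk (x - y)) \<longlongrightarrow> 0) at_bot"
    unfolding dk_def by real_asymp+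
  note l = this
  show "(H \<longlongrightarrow> 0) at_top"
    by (rule Lim_null_comparison[OF _ l(1)]) (use b in simp)
  show "(H \<longlongrightarrow> 0) at_bot"
    by (rule Lim_null_comparison[OF _ l(2)]) (use b in simp)
qed

section \<open>Fourier multipliers\<close>

definition C2_with :: "(real \<Rightarrow> complex) \<Rightarrow> (real \<Rightarrow> complex) \<Rightarrow> (real \<Rightarrow> complex) \<Rightarrow> bool" where
  "C2_with m m1 m2 \<longleftrightarrow> (\<forall>x. (m has_vector_derivative m1 x) (at x)) \<and>
     (\<forall>x. (m1 has_vector_derivative m2 x) (at x)) \<and> continuous_on UNIV m2"

definition C2 :: "(real \<Rightarrow> complex) \<Rightarrow> bool" where
  "C2 m \<longleftrightarrow> (\<exists>m1 m2. C2_with m m1 m2)"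

text \<open>Two derivatives of the symbol are just enough: each integration by parts gains one power
  of the space variable, and inverse square decay is integrable on the line. Compact support makes
  the frequency integrals converge and lets a symbol meet only finitely many windows.\<close>

definition multiplier :: "(real \<Rightarrow> complex) \<Rightarrow> bool" where
  "multiplier m \<longleftrightarrow> C2 m \<and> (\<exists>L. \<forall>\<xi>. L < \<bar>\<xi>\<bar> \<longrightarrow> m \<xi> = 0)"

lemma has_vector_derivative_imp_continuous:
  assumes "\<And>x. (m has_vector_derivative m1 x) (at x)"
  shows "continuous_on UNIV m"
  using assms by (meson continuous_at_imp_continuous_on has_vector_derivative_continuous)

lemma C2_with_continuous:
  assumes "C2_with m m1 m2"
  shows "continuous_on UNIV m" "continuous_on UNIV m1" "continuous_on UNIV m2"
  using assms unfolding C2_with_def by (auto intro: has_vector_derivative_imp_continuous)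

lemma C2_with_mult:
  assumes "C2_with m m1 m2" "C2_with n n1 n2"
  shows "C2_with (\<lambda>x. m x * n x) (\<lambda>x. m1 x * n x + m x * n1 x)
    (\<lambda>x. m2 x * n x + 2 * m1 x * n1 x + m x * n2 x)"
proof -
  note c = C2_with_continuous[OF assms(1)] C2_with_continuous[OF assms(2)]
  show ?thesis using assms c unfolding C2_with_def
    by (auto intro!: continuous_intros derivative_eq_intros simp: algebra_simps)
qed

lemma C2_with_add:
  assumes "C2_with m m1 m2" "C2_with n n1 n2"
  shows "C2_with (\<lambda>x. m x + n x) (\<lambda>x. m1 x + n1 x) (\<lambda>x. m2 x + n2 x)"
  using assms unfolding C2_with_def
  by (auto intro!: continuous_intros derivative_eq_intros)

lemma C2_with_const: "C2_with (\<lambda>x. c) (\<lambda>x. 0) (\<lambda>x. 0)"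
  unfolding C2_with_def by auto

lemma C2_with_affine:
  assumes "C2_with m m1 m2"
  shows "C2_with (\<lambda>x. m (a * x + b)) (\<lambda>x. a *\<^sub>R m1 (a * x + b)) (\<lambda>x. (a * a) *\<^sub>R m2 (a * x + b))"
proof -
  have d: "((\<lambda>x. f (a * x + b)) has_vector_derivative a *\<^sub>R f' (a * x + b)) (at x)"
    if "\<And>x. (f has_vector_derivative f' x) (at x)" for f f' :: "real \<Rightarrow> complex" and x
  proof -
    have "((\<lambda>x. a * x + b) has_vector_derivative a) (at x)"
      by (auto intro!: derivative_eq_intros simp: has_real_derivative_iff_has_vector_derivative[symmetric])
    from vector_diff_chain_at[OF this that] show ?thesis by (simp add: o_def)
  qed
  have c: "continuous_on UNIV (\<lambda>x. m2 (a * x + b))"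
    by (rule continuous_on_compose2[of UNIV m2]) (use assms in \<open>auto simp: C2_with_def intro!: continuous_intros\<close>)
  have d': "((\<lambda>x. a *\<^sub>R m1 (a * x + b)) has_vector_derivative (a * a) *\<^sub>R m2 (a * x + b)) (at x)" for x
    using bounded_linear.has_vector_derivative[OF bounded_linear_scaleR_right d, of m1 m2 a x] assms
    by (simp add: C2_with_def)
  show ?thesis using assms d d' c unfolding C2_with_def by (auto intro!: continuous_intros)
qed

text \<open>The symbol of the free Schroedinger evolution. Its second derivative is wanted
  explicitly, so that kernels can be bounded uniformly for bounded times.\<close>

lemma C2_with_iexp_square:
  "C2_with (\<lambda>x. exp (- \<i> * of_real (a * x\<^sup>2))) (\<lambda>x. (- 2 * \<i> * of_real (a * x)) * exp (- \<i> * of_real (a * x\<^sup>2)))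
    (\<lambda>x. (- 2 * \<i> * of_real a - 4 * of_real (a\<^sup>2 * x\<^sup>2)) * exp (- \<i> * of_real (a * x\<^sup>2)))"
proof -
  have d: "((\<lambda>x. exp (- \<i> * of_real (a * x\<^sup>2))) has_vector_derivative
     (- 2 * \<i> * of_real (a * x)) * exp (- \<i> * of_real (a * x\<^sup>2))) (at x)" for x
  proof -
    have "((\<lambda>z. exp (- \<i> * (of_real a * z\<^sup>2))) has_field_derivative
       (- 2 * \<i> * of_real (a * x)) * exp (- \<i> * of_real (a * x\<^sup>2))) (at (of_real x))"
      by (auto intro!: derivative_eq_intros simp: algebra_simps)
    from has_vector_derivative_real_field[OF this] show ?thesis by simp
  qed
  have d': "((\<lambda>x. - 2 * \<i> * of_real (a * x)) has_vector_derivative - 2 * \<i> * of_real a) (at x)" for x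
    by (auto intro!: derivative_eq_intros)
  have "((\<lambda>x. - 2 * \<i> * of_real (a * x) * exp (- \<i> * of_real (a * x\<^sup>2))) has_vector_derivative
     (- 2 * \<i> * of_real a - 4 * of_real (a\<^sup>2 * x\<^sup>2)) * exp (- \<i> * of_real (a * x\<^sup>2))) (at x)" for x
    by (rule has_vector_derivative_eq_rhs[OF has_vector_derivative_mult[OF d' d]])
      (simp add: algebra_simps power2_eq_square)
  thus ?thesis unfolding C2_with_def using d by (auto intro!: continuous_intros)
qed

lemma C2_with_iexp:
  "C2_with (\<lambda>x. exp (\<i> * of_real (a * x))) (\<lambda>x. \<i> * of_real a * exp (\<i> * of_real (a * x)))
    (\<lambda>x. - (of_real a)\<^sup>2 * exp (\<i> * of_real (a * x)))"
proof -
  have d: "((\<lambda>x. exp (\<i> * of_real (a * x))) has_vector_derivative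
     \<i> * of_real a * exp (\<i> * of_real (a * x))) (at x)" for x
  proof -
    have "((\<lambda>z. exp (\<i> * (of_real a * z))) has_field_derivative
       \<i> * of_real a * exp (\<i> * of_real (a * x))) (at (of_real x))"
      by (auto intro!: derivative_eq_intros simp: algebra_simps)
    from has_vector_derivative_real_field[OF this] show ?thesis by simp
  qed
  have "((\<lambda>x. \<i> * of_real a * exp (\<i> * of_real (a * x))) has_vector_derivative
     - (of_real a)\<^sup>2 * exp (\<i> * of_real (a * x))) (at x)" for x
    by (rule has_vector_derivative_eq_rhs[OF has_vector_derivative_mult_right[OF d]])
      (simp add: algebra_simps power2_eq_square)
  thus ?thesis unfolding C2_with_def using d by (auto intro!: continuous_intros)
qed

lemma C2_with_of_real: "C2_with (\<lambda>x. of_real x) (\<lambda>x. 1) (\<lambda>x. 0)"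
  unfolding C2_with_def by (auto intro!: derivative_eq_intros)

lemma C2_mult: "C2 m \<Longrightarrow> C2 n \<Longrightarrow> C2 (\<lambda>x. m x * n x)"
  unfolding C2_def using C2_with_mult by blast
lemma C2_add: "C2 m \<Longrightarrow> C2 n \<Longrightarrow> C2 (\<lambda>x. m x + n x)"
  unfolding C2_def using C2_with_add by blast
lemma C2_const: "C2 (\<lambda>x. c)"
  unfolding C2_def using C2_with_const by blast
lemma C2_affine: "C2 m \<Longrightarrow> C2 (\<lambda>x. m (a * x + b))"
  unfolding C2_def using C2_with_affine by blast
lemma C2_iexp_square: "C2 (\<lambda>x. exp (- \<i> * of_real (a * x\<^sup>2)))"
  unfolding C2_def using C2_with_iexp_square by blast
lemma C2_of_real: "C2 of_real"
  unfolding C2_def using C2_with_of_real by blast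

lemma multiplier_mult: "C2 p \<Longrightarrow> multiplier m \<Longrightarrow> multiplier (\<lambda>x. p x * m x)"
  unfolding multiplier_def using C2_mult by fastforce

lemma multiplier_C2: "multiplier m \<Longrightarrow> C2 m" unfolding multiplier_def by simp

lemma multiplier_add:
  assumes "multiplier m" "multiplier n" shows "multiplier (\<lambda>x. m x + n x)"
proof -
  obtain L1 L2 where "\<forall>\<xi>. L1 < \<bar>\<xi>\<bar> \<longrightarrow> m \<xi> = 0" "\<forall>\<xi>. L2 < \<bar>\<xi>\<bar> \<longrightarrow> n \<xi> = 0"
    using assms unfolding multiplier_def by auto
  hence "\<forall>\<xi>. max L1 L2 < \<bar>\<xi>\<bar> \<longrightarrow> m \<xi> + n \<xi> = 0" by auto
  thus ?thesis using assms C2_add unfolding multiplier_def by blast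
qed

lemma multiplier_zero: "multiplier (\<lambda>x. 0)"
  unfolding multiplier_def using C2_const by auto

lemma multiplier_sum: "(\<And>i. i \<in> I \<Longrightarrow> multiplier (m i)) \<Longrightarrow> multiplier (\<lambda>x. \<Sum>i\<in>I. m i x)"
  by (induction I rule: infinite_finite_induct) (auto intro: multiplier_add multiplier_zero)

lemma multiplier_affine:
  assumes "multiplier m" "a \<noteq> 0" shows "multiplier (\<lambda>x. m (a * x + b))"
proof -
  obtain L where L: "\<forall>\<xi>. L < \<bar>\<xi>\<bar> \<longrightarrow> m \<xi> = 0"
    using assms unfolding multiplier_def by auto
  have "m (a * \<xi> + b) = 0" if "(L + \<bar>b\<bar>) / \<bar>a\<bar> < \<bar>\<xi>\<bar>" for \<xi>
  proof -
    have "L + \<bar>b\<bar> < \<bar>a * \<xi>\<bar>" using that assms by (simp add: divide_simps abs_mult mult.commute)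
    hence "L < \<bar>a * \<xi> + b\<bar>" by linarith
    thus ?thesis using L by blast
  qed
  thus ?thesis using assms C2_affine unfolding multiplier_def by blast
qed

lemma multiplier_shift: "multiplier m \<Longrightarrow> multiplier (\<lambda>x. m (x + b))"
  using multiplier_affine[of m 1 b] by simp

lemma multiplier_continuous: "multiplier m \<Longrightarrow> continuous_on UNIV m"
  unfolding multiplier_def C2_def using C2_with_continuous by blast

section \<open>Decay and regularity of kernels\<close>

lemma integral_compact_support:
  fixes g :: "real \<Rightarrow> 'a::euclidean_space"
  assumes c: "continuous_on UNIV g" and z: "\<And>\<xi>. L < \<bar>\<xi>\<bar> \<Longrightarrow> g \<xi> = 0" 
  shows "integrable lborel g" "L \<ge> 0 \<Longrightarrow> (\<And>\<xi>. norm (g \<xi>) \<le> C) \<Longrightarrow> norm (integral\<^sup>L lborel g) \<le> 2 * L * C"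
proof -
  have g: "g = (\<lambda>x. indicator {-L..L} x *\<^sub>R g x)" using z by (force simp: indicator_def fun_eq_iff)
  have "set_integrable lborel {-L..L} g"
    by (rule borel_integrable_atLeastAtMost'[OF continuous_on_subset[OF c]]) simp
  thus 1: "integrable lborel g" by (subst g) (simp add: set_integrable_def)
  assume L: "L \<ge> 0" and C: "\<And>\<xi>. norm (g \<xi>) \<le> C"
  have "norm (integral\<^sup>L lborel g) \<le> (LINT x|lborel. indicator {-L..L} x * C)"
  proof (rule Bochner_Integration.integral_norm_bound_integral[OF 1])
    show "integrable lborel (\<lambda>x. indicator {-L..L} x * C)"
      by (cases "-L \<le> L") (auto intro!: integrable_mult_left integrable_real_indicator)
    show "norm (g x) \<le> indicator {-L..L} x * C" for x
      using C[of x] z[of x] by (auto simp: indicator_def)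
  qed
  thus "norm (integral\<^sup>L lborel g) \<le> 2 * L * C" using L by simp
qed

lemma bounded_compact_support:
  fixes g :: "real \<Rightarrow> 'a::euclidean_space"
  assumes c: "continuous_on UNIV g" and z: "\<And>\<xi>. L < \<bar>\<xi>\<bar> \<Longrightarrow> g \<xi> = 0"
  shows "\<exists>C\<ge>0. \<forall>x. norm (g x) \<le> C"
proof -
  have "compact (g ` {-L..L})" by (rule compact_continuous_image[OF continuous_on_subset[OF c]]) auto
  then obtain C where "\<forall>y\<in>g ` {-L..L}. norm y \<le> C" using compact_imp_bounded bounded_iff by blast
  hence "norm (g x) \<le> max C 0" for x
    using z[of x] by (cases "L < \<bar>x\<bar>") (auto simp: le_max_iff_disj abs_le_iff not_less)
  thus ?thesis by (intro exI[of _ "max C 0"]) auto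
qed

lemma has_vector_derivative_zero_on_support:
  assumes "(m has_vector_derivative m1 \<xi>) (at \<xi>)" "\<And>\<xi>. L < \<bar>\<xi>\<bar> \<Longrightarrow> m \<xi> = 0" "L < \<bar>\<xi>\<bar>"
  shows "m1 \<xi> = (0::'a::real_normed_vector)"
proof -
  have "open {x::real. L < \<bar>x\<bar>}" by (intro open_Collect_less continuous_intros)
  hence "((\<lambda>x. 0) has_vector_derivative m1 \<xi>) (at \<xi>)"
    using assms by (intro has_vector_derivative_transform_within_open[OF assms(1), of "{x. L < \<bar>x\<bar>}"]) auto
  thus ?thesis using vector_derivative_unique_at has_vector_derivative_const by blast
qed

text \<open>The integral of \<open>m\<close> gives the bound for small x, that of \<open>m2\<close>
  the one for large x; the support has length \<open>2 * L\<close>. The constants are explicit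
  because they are needed uniformly along the family \<open>mt a m\<close>.\<close>

lemma kernel_decay:
  assumes C2: "C2_with m m1 m2" and L: "L \<ge> 0" "\<And>\<xi>. L < \<bar>\<xi>\<bar> \<Longrightarrow> m \<xi> = 0"
    and C: "\<And>\<xi>. norm (m \<xi>) \<le> C" "\<And>\<xi>. norm (m2 \<xi>) \<le> C'"
  shows "norm (fourier_inv m x) \<le> L * (C + C') * dk x"
proof -
  let ?e = "\<lambda>\<xi>. exp (\<i> * of_real (x * \<xi>))"
  note c = C2_with_continuous[OF C2]
  have d: "(m has_vector_derivative m1 \<xi>) (at \<xi>)" "(m1 has_vector_derivative m2 \<xi>) (at \<xi>)" for \<xi>
    using C2 unfolding C2_with_def by auto
  have z1: "m1 \<xi> = 0" if "L < \<bar>\<xi>\<bar>" for \<xi>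
    by (rule has_vector_derivative_zero_on_support[where m=m and L=L]) (use d(1) L(2) that in auto)
  have z2: "m2 \<xi> = 0" if "L < \<bar>\<xi>\<bar>" for \<xi>
    by (rule has_vector_derivative_zero_on_support[where m=m1 and L=L]) (use d(2) z1 that in auto)
  have ed: "(?e has_vector_derivative \<i> * of_real x * ?e \<xi>) (at \<xi>)" for \<xi>
    using C2_with_iexp[of x] unfolding C2_with_def by blast
  have i0: "integrable lborel (\<lambda>\<xi>. ?e \<xi> * m \<xi>)" and i2: "integrable lborel (\<lambda>\<xi>. ?e \<xi> * m2 \<xi>)"
    using L(2) z2 by (auto intro!: integral_compact_support(1)[of _ L] continuous_intros c)
  \<comment> \<open>Both integrations by parts at once: the terms with \<open>m1\<close> cancel in
    the derivative of \<open>H\<close>, which leaves \<open>m2\<close> and x^2 times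
    \<open>m\<close>.\<close>
  define H where "H = (\<lambda>\<xi>. ?e \<xi> * (m1 \<xi> - \<i> * of_real x * m \<xi>))"
  have "(LINT \<xi>|lborel. ?e \<xi> * m2 \<xi> + (of_real x)\<^sup>2 * (?e \<xi> * m \<xi>)) = 0"
  proof (rule integral_derivative_eq_0[where H=H])
    show "(H has_vector_derivative ?e \<xi> * m2 \<xi> + (of_real x)\<^sup>2 * (?e \<xi> * m \<xi>)) (at \<xi>)" for \<xi>
      unfolding H_def
      by (rule derivative_eq_intros ed d refl)+ (simp add: algebra_simps power2_eq_square)
    show "continuous_on UNIV (\<lambda>\<xi>. ?e \<xi> * m2 \<xi> + (of_real x)\<^sup>2 * (?e \<xi> * m \<xi>))"
      by (intro continuous_intros c)
    have H0: "H \<xi> = 0" if "L < \<bar>\<xi>\<bar>" for \<xi> using L z1 that by (simp add: H_def)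
    have "eventually (\<lambda>\<xi>. H \<xi> = 0) at_top"
      using eventually_gt_at_top[of L] by eventually_elim (auto intro!: H0)
    moreover have "eventually (\<lambda>\<xi>. H \<xi> = 0) at_bot"
      using eventually_gt_at_bot[of "-L"] by eventually_elim (use L in \<open>auto intro!: H0\<close>)
    ultimately
    show "(H \<longlongrightarrow> 0) at_top" "(H \<longlongrightarrow> 0) at_bot" by (auto intro: tendsto_eventually)
  qed (use i0 i2 in auto)
  hence eq: "(of_real x)\<^sup>2 * (LINT \<xi>|lborel. ?e \<xi> * m \<xi>) = - (LINT \<xi>|lborel. ?e \<xi> * m2 \<xi>)"
    using i0 i2 by (simp add: add_eq_0_iff)
  have b0: "norm (LINT \<xi>|lborel. ?e \<xi> * m \<xi>) \<le> 2 * L * C"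
    using L C by (intro integral_compact_support) (auto intro!: continuous_intros c simp: norm_mult)
  have b2: "norm (LINT \<xi>|lborel. ?e \<xi> * m2 \<xi>) \<le> 2 * L * C'"
    using L C z2 by (intro integral_compact_support) (auto intro!: continuous_intros c simp: norm_mult)
  have "(1 + x\<^sup>2) * norm (LINT \<xi>|lborel. ?e \<xi> * m \<xi>) = norm (LINT \<xi>|lborel. ?e \<xi> * m \<xi>) + norm ((of_real x)\<^sup>2 * (LINT \<xi>|lborel. ?e \<xi> * m \<xi>))"
    by (simp add: algebra_simps norm_mult norm_power)
  also have "\<dots> \<le> 2 * L * (C + C')" using b0 b2 unfolding eq by (simp add: algebra_simps)
  finally have b: "(1 + x\<^sup>2) * norm (LINT \<xi>|lborel. ?e \<xi> * m \<xi>) \<le> 2 * L * (C + C')" .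
  have C0: "C \<ge> 0" "C' \<ge> 0" using C order_trans[OF norm_ge_zero] by blast+
  have "norm (fourier_inv m x) = norm (LINT \<xi>|lborel. ?e \<xi> * m \<xi>) / (2 * pi)"
    by (simp add: fourier_inv_def norm_mult norm_divide)
  also have "\<dots> \<le> norm (LINT \<xi>|lborel. ?e \<xi> * m \<xi>) / 2"
    using pi_ge_two by (intro divide_left_mono) auto
  also have "\<dots> \<le> L * (C + C') * dk x"
  proof -
    have "norm (LINT \<xi>|lborel. ?e \<xi> * m \<xi>) \<le> 2 * L * (C + C') / (1 + x\<^sup>2)"
      using b by (subst pos_le_divide_eq) (auto simp: add_pos_nonneg mult.commute)
    moreover have div: "2 * a / d / 2 = a * (1 / d)" for a d :: real by simp
    ultimately have "norm (LINT \<xi>|lborel. ?e \<xi> * m \<xi>) / 2 \<le> (2 * L * (C + C') / (1 + x\<^sup>2)) / 2"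
      by (intro divide_right_mono) auto
    also have "\<dots> = L * (C + C') * dk x"
      using div[of "L * (C + C')" "1 + x\<^sup>2"] by (simp only: dk_def mult.assoc)
    finally show ?thesis .
  qed
  finally show ?thesis .
qed

lemma multiplier_decay:
  assumes "multiplier m"
  obtains C where "C \<ge> 0" "\<And>x. norm (fourier_inv m x) \<le> C * dk x"
proof -
  obtain m1 m2 L where C2: "C2_with m m1 m2" and L: "\<And>\<xi>. L < \<bar>\<xi>\<bar> \<Longrightarrow> m \<xi> = 0"
    using assms unfolding multiplier_def C2_def by blast
  have L': "max L 0 \<ge> 0" "\<And>\<xi>. max L 0 < \<bar>\<xi>\<bar> \<Longrightarrow> m \<xi> = 0" using L by auto
  note c = C2_with_continuous[OF C2]
  have d: "(m has_vector_derivative m1 \<xi>) (at \<xi>)" "(m1 has_vector_derivative m2 \<xi>) (at \<xi>)" for \<xi>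
    using C2 unfolding C2_with_def by auto
  have z1: "m1 \<xi> = 0" if "L < \<bar>\<xi>\<bar>" for \<xi>
    by (rule has_vector_derivative_zero_on_support[where m=m and L=L]) (use d(1) L that in auto)
  have z2: "m2 \<xi> = 0" if "L < \<bar>\<xi>\<bar>" for \<xi>
    by (rule has_vector_derivative_zero_on_support[where m=m1 and L=L]) (use d(2) z1 that in auto)
  obtain B B' where B: "B \<ge> 0" "\<forall>x. norm (m x) \<le> B" "B' \<ge> 0" "\<forall>x. norm (m2 x) \<le> B'"
    using bounded_compact_support[OF c(1) L] bounded_compact_support[OF c(3) z2] by metis
  show ?thesis
    by (rule that[of "max L 0 * (B + B')"])
      (use B kernel_decay[OF C2 L', of B B'] in \<open>auto intro!: mult_nonneg_nonneg\<close>)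
qed

lemma multiplier_integrable:
  assumes "multiplier m" "continuous_on UNIV p"
  shows "integrable lborel (\<lambda>\<xi>. p \<xi> * m \<xi> :: complex)"
proof -
  obtain L where "\<And>\<xi>. L < \<bar>\<xi>\<bar> \<Longrightarrow> m \<xi> = 0" using assms unfolding multiplier_def by blast
  thus ?thesis
    by (intro integral_compact_support(1)[of _ L] continuous_intros multiplier_continuous assms) auto
qed

lemma multiplier_times_id: "multiplier m \<Longrightarrow> multiplier (\<lambda>\<xi>. \<i> * of_real \<xi> * m \<xi>)"
  by (intro multiplier_mult C2_mult C2_const C2_of_real)

lemma fourier_inv_has_derivative:
  assumes m: "multiplier m"
  shows "(fourier_inv m has_vector_derivative fourier_inv (\<lambda>\<xi>. \<i> * of_real \<xi> * m \<xi>) x) (at x)"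
proof -
  have "((\<lambda>x. LINT \<xi>|lborel. exp (\<i> * of_real (x * \<xi>)) * m \<xi>) has_vector_derivative
      (LINT \<xi>|lborel. exp (\<i> * of_real (x * \<xi>)) * (\<i> * of_real \<xi> * m \<xi>))) (at x within UNIV)"
  proof (rule has_vector_derivative_lebesgue_integral[where F'="\<lambda>x \<xi>. exp (\<i> * of_real (x * \<xi>)) * (\<i> * of_real \<xi> * m \<xi>)" and h="\<lambda>\<xi>. norm (of_real \<xi> * m \<xi>)"])
    show "integrable lborel (\<lambda>\<xi>. exp (\<i> * of_real (x * \<xi>)) * m \<xi>)" for x
      by (intro multiplier_integrable m continuous_intros)
    show "integrable lborel (\<lambda>\<xi>. norm (of_real \<xi> * m \<xi>))"
      by (intro integrable_norm multiplier_integrable m continuous_intros)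
    have "continuous_on UNIV (\<lambda>\<xi>. exp (\<i> * of_real (x * \<xi>)) * (\<i> * of_real \<xi> * m \<xi>))"
      by (intro continuous_intros multiplier_continuous m)
    thus "(\<lambda>\<xi>. exp (\<i> * of_real (x * \<xi>)) * (\<i> * of_real \<xi> * m \<xi>)) \<in> borel_measurable lborel"
      by (simp add: borel_measurable_continuous_onI)
    fix r \<xi>
    have "((\<lambda>x. exp (\<i> * of_real (\<xi> * x))) has_vector_derivative \<i> * of_real \<xi> * exp (\<i> * of_real (\<xi> * r))) (at r)"
      using C2_with_iexp[of \<xi>] unfolding C2_with_def by blast
    hence e: "((\<lambda>x. exp (\<i> * of_real (x * \<xi>))) has_vector_derivative \<i> * of_real \<xi> * exp (\<i> * of_real (r * \<xi>))) (at r)"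
      by (simp add: mult.commute)
    show "((\<lambda>r. exp (\<i> * of_real (r * \<xi>)) * m \<xi>) has_vector_derivative exp (\<i> * of_real (r * \<xi>)) * (\<i> * of_real \<xi> * m \<xi>)) (at r)"
      by (rule derivative_eq_intros e refl)+ (simp add: algebra_simps)
    show "norm (exp (\<i> * of_real (r * \<xi>)) * (\<i> * of_real \<xi> * m \<xi>)) \<le> norm (of_real \<xi> * m \<xi>)"
      by (simp add: norm_mult)
  qed simp_all
  thus ?thesis unfolding fourier_inv_def
    by (auto intro!: derivative_eq_intros)
qed

lemma fourier_inv_continuous: "multiplier m \<Longrightarrow> continuous_on UNIV (fourier_inv m)"
  using fourier_inv_has_derivative has_vector_derivative_imp_continuous by blast

lemma fourier_inv_measurable: "multiplier m \<Longrightarrow> fourier_inv m \<in> borel_measurable borel"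
  by (intro borel_measurable_continuous_onI fourier_inv_continuous)

lemma fourier_inv_add:
  assumes "multiplier m" "multiplier n"
  shows "fourier_inv (\<lambda>\<xi>. m \<xi> + n \<xi>) x = fourier_inv m x + fourier_inv n x"
proof -
  have "integrable lborel (\<lambda>\<xi>. exp (\<i> * of_real (x * \<xi>)) * m \<xi>)" "integrable lborel (\<lambda>\<xi>. exp (\<i> * of_real (x * \<xi>)) * n \<xi>)"
    using assms by (auto intro!: multiplier_integrable continuous_intros)
  thus ?thesis unfolding fourier_inv_def by (simp add: distrib_left)
qed

lemma fourier_inv_zero [simp]: "fourier_inv (\<lambda>\<xi>. 0) x = 0"
  unfolding fourier_inv_def by simp

lemma fourier_inv_cmult: "fourier_inv (\<lambda>\<xi>. c * m \<xi>) x = c * fourier_inv m x"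
proof -
  have "(\<lambda>\<xi>. exp (\<i> * of_real (x * \<xi>)) * (c * m \<xi>)) = (\<lambda>\<xi>. c * (exp (\<i> * of_real (x * \<xi>)) * m \<xi>))"
    by (auto simp: fun_eq_iff)
  thus ?thesis unfolding fourier_inv_def by (simp only: integral_mult_right_zero) simp
qed

lemma fourier_inv_modulate: "fourier_inv (\<lambda>\<xi>. exp (\<i> * of_real (a * \<xi>)) * m \<xi>) x = fourier_inv m (x + a)"
proof -
  have "exp (\<i> * of_real (x * \<xi>)) * (exp (\<i> * of_real (a * \<xi>)) * m \<xi>) = exp (\<i> * of_real ((x + a) * \<xi>)) * m \<xi>" for \<xi>
    by (simp add: distrib_right distrib_left exp_add)
  thus ?thesis unfolding fourier_inv_def by (simp only:)
qed

lemma fourier_inv_shift: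
  "fourier_inv (\<lambda>\<xi>. m (\<xi> + c)) x = exp (- \<i> * of_real (c * x)) * fourier_inv m x"
proof -
  have "(LINT \<xi>|lborel. exp (\<i> * of_real (x * \<xi>)) * m (\<xi> + c)) = 
     (LINT \<xi>|lborel. exp (\<i> * of_real (x * (\<xi> - c))) * m \<xi>)"
    using lborel_integral_real_affine[of 1 "\<lambda>\<xi>. exp (\<i> * of_real (x * (\<xi> - c))) * m \<xi>" c]
    by (simp add: add.commute)
  also have "\<dots> = (LINT \<xi>|lborel. exp (- \<i> * of_real (c * x)) * (exp (\<i> * of_real (x * \<xi>)) * m \<xi>))"
  proof (rule Bochner_Integration.integral_cong[OF refl])
    fix \<xi>
    have "exp (\<i> * of_real (x * (\<xi> - c))) = exp (- \<i> * of_real (c * x) + \<i> * of_real (x * \<xi>))"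
      by (simp add: algebra_simps)
    thus "exp (\<i> * of_real (x * (\<xi> - c))) * m \<xi> = exp (- \<i> * of_real (c * x)) * (exp (\<i> * of_real (x * \<xi>)) * m \<xi>)"
      by (simp only: exp_add mult.assoc)
  qed
  finally show ?thesis unfolding fourier_inv_def by simp
qed

lemma fourier_inv_scale:
  assumes "a > 0"
  shows "fourier_inv (\<lambda>\<xi>. m (a * \<xi>)) x = of_real (1 / a) * fourier_inv m (x / a)"
proof -
  have "(LINT \<xi>|lborel. exp (\<i> * of_real (x / a * \<xi>)) * m \<xi>) =
     of_real a * (LINT \<xi>|lborel. exp (\<i> * of_real (x * \<xi>)) * m (a * \<xi>))"
    using lborel_integral_real_affine[of a "\<lambda>\<xi>. exp (\<i> * of_real (x / a * \<xi>)) * m \<xi>" 0] assms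
    by (simp add: scaleR_conv_of_real)
  thus ?thesis unfolding fourier_inv_def using assms by simp
qed

lemma gauss_le_dk: "exp (- (z\<^sup>2) / 2) \<le> 2 * dk z"
proof -
  have "1 + z\<^sup>2 / 2 \<le> exp (z\<^sup>2 / 2)" using exp_ge_add_one_self by blast
  hence "exp (- (z\<^sup>2 / 2)) \<le> inverse (1 + z\<^sup>2 / 2)"
    unfolding exp_minus by (intro le_imp_inverse_le) (auto simp: add_pos_nonneg)
  also have "\<dots> \<le> 2 * dk z" unfolding dk_def by (simp add: divide_simps add_pos_nonneg)
  finally show ?thesis by simp
qed

lemma integrable_gauss: "integrable lborel (\<lambda>u. exp (- (u\<^sup>2) / 2) :: real)"
  by (rule integrable_dk_bound(1)[of _ 2 0]) (use gauss_le_dk in auto)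

lemma integral_gauss_iexp:
  "(LINT u|lborel. exp (\<i> * of_real (t * u)) * of_real (exp (- (u\<^sup>2) / 2))) = of_real (sqrt (2 * pi) * exp (- (t\<^sup>2) / 2))"
proof -
  have "char std_normal_distribution t = (LINT u|lborel. std_normal_density u *\<^sub>R exp (\<i> * of_real (t * u)))"
    unfolding char_def by (subst integral_density) (auto simp: mult.commute)
  also have "\<dots> = (LINT u|lborel. of_real (1 / sqrt (2 * pi)) * (exp (\<i> * of_real (t * u)) * of_real (exp (- (u\<^sup>2) / 2))))"
    by (rule Bochner_Integration.integral_cong) (auto simp: normal_density_def scaleR_conv_of_real)
  also have "\<dots> = of_real (1 / sqrt (2 * pi)) * (LINT u|lborel. (exp (\<i> * of_real (t * u)) * of_real (exp (- (u\<^sup>2) / 2))))"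
    by simp
  finally show ?thesis unfolding char_std_normal_distribution by (simp add: field_simps)
qed

lemma integral_gauss_iexp_scaled:
  assumes N: "N > 0"
  shows "(LINT z|lborel. exp (\<i> * of_real (z * \<xi>)) * of_real (exp (- ((z / N)\<^sup>2) / 2))) =
    of_real (N * sqrt (2 * pi) * exp (- ((\<xi> * N)\<^sup>2) / 2))"
proof -
  have "(LINT z|lborel. exp (\<i> * of_real (z * \<xi>)) * of_real (exp (- ((z / N)\<^sup>2) / 2))) =
    N *\<^sub>R (LINT u|lborel. exp (\<i> * of_real ((N * u) * \<xi>)) * of_real (exp (- ((N * u / N)\<^sup>2) / 2)))"
    using lborel_integral_real_affine[of N "\<lambda>z. exp (\<i> * of_real (z * \<xi>)) * of_real (exp (- ((z / N)\<^sup>2) / 2))" 0] N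
    by simp
  also have "(LINT u|lborel. exp (\<i> * of_real ((N * u) * \<xi>)) * of_real (exp (- ((N * u / N)\<^sup>2) / 2))) =
    (LINT u|lborel. exp (\<i> * of_real ((\<xi> * N) * u)) * of_real (exp (- (u\<^sup>2) / 2)))"
    using N by (intro Bochner_Integration.integral_cong) (simp_all add: mult_ac)
  also have "\<dots> = of_real (sqrt (2 * pi) * exp (- ((\<xi> * N)\<^sup>2) / 2))" by (rule integral_gauss_iexp)
  finally show ?thesis by (simp add: scaleR_conv_of_real)
qed

text \<open>Fourier inversion at the origin, by damping the kernel with \<open>exp (- (z / n)\<^sup>2 / 2)\<close>.\<close>

lemma integral_fourier_inv:
  assumes m: "multiplier m"
  shows "integral\<^sup>L lborel (fourier_inv m) = m 0"
proof -
  obtain C where C: "C \<ge> 0" "\<And>x. norm (fourier_inv m x) \<le> C * dk x" using multiplier_decay[OF m] by blast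
  note [measurable] = fourier_inv_measurable[OF m]
  have [measurable]: "m \<in> borel_measurable borel"
    by (intro borel_measurable_continuous_onI multiplier_continuous m)
  define I where "I = (\<lambda>n::nat. LINT z|lborel. fourier_inv m z * of_real (exp (- ((z / Suc n)\<^sup>2) / 2)))"
  have lim1: "I \<longlonglongrightarrow> integral\<^sup>L lborel (fourier_inv m)"
    unfolding I_def
  proof (rule integral_dominated_convergence[where w="\<lambda>z. C * dk z"])
    show "AE z in lborel. (\<lambda>n. fourier_inv m z * of_real (exp (- ((z / real (Suc n))\<^sup>2) / 2))) \<longlonglongrightarrow> fourier_inv m z"
    proof (rule AE_I2)
      fix z
      have "(\<lambda>n. z / real (Suc n)) \<longlonglongrightarrow> 0" by (rule LIMSEQ_Suc[OF lim_const_over_n])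
      hence "(\<lambda>n. exp (- ((z / real (Suc n))\<^sup>2) / 2)) \<longlonglongrightarrow> exp (- (0\<^sup>2) / 2)" by (intro tendsto_intros) auto
      hence "(\<lambda>n. exp (- ((z / real (Suc n))\<^sup>2) / 2)) \<longlonglongrightarrow> 1" by simp
      hence "(\<lambda>n. of_real (exp (- ((z / real (Suc n))\<^sup>2) / 2)) :: complex) \<longlonglongrightarrow> of_real 1" by (rule tendsto_of_real)
      from tendsto_mult_left[OF this, of "fourier_inv m z"]
      show "(\<lambda>n. fourier_inv m z * of_real (exp (- ((z / real (Suc n))\<^sup>2) / 2))) \<longlonglongrightarrow> fourier_inv m z" by simp
    qed
    show "AE z in lborel. norm (fourier_inv m z * of_real (exp (- ((z / real (Suc n))\<^sup>2) / 2))) \<le> C * dk z" for n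
      using C by (auto simp: norm_mult intro!: AE_I2 mult_left_le[THEN order_trans])
  qed auto
  \<comment> \<open>Fubini turns the damping into a Gaussian of width 1 / n around frequency 0;
    rescaled to width 1, it samples the symbol at \<open>u / Suc n\<close>.\<close>
  have I_eq: "I n = (LINT u|lborel. of_real (1 / sqrt (2 * pi)) * (m (u / Suc n) * of_real (exp (- (u\<^sup>2) / 2))))" for n
  proof -
    define N where "N = real (Suc n)"
    have N: "N > 0" by (simp add: N_def)
    have g: "integrable lborel (\<lambda>z. exp (- ((z / N)\<^sup>2) / 2))"
      using lborel_integrable_real_affine[OF integrable_gauss, of "1/N" 0] N by simp
    have "I n = (LINT z|lborel. LINT \<xi>|lborel. of_real (1 / (2 * pi)) * (exp (\<i> * of_real (z * \<xi>)) * m \<xi> * of_real (exp (- ((z / N)\<^sup>2) / 2))))"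
    proof -
      have "fourier_inv m z * w = (LINT \<xi>|lborel. of_real (1 / (2 * pi)) * (exp (\<i> * of_real (z * \<xi>)) * m \<xi> * w))" for z w
        unfolding fourier_inv_def by (simp only: integral_mult_right_zero integral_mult_left_zero) simp
      thus ?thesis unfolding I_def N_def by (intro Bochner_Integration.integral_cong refl) blast
    qed
    also have "\<dots> = (LINT \<xi>|lborel. LINT z|lborel. of_real (1 / (2 * pi)) * (exp (\<i> * of_real (z * \<xi>)) * m \<xi> * of_real (exp (- ((z / N)\<^sup>2) / 2))))"
    proof (rule Fubini_product_bound[where a="\<lambda>\<xi>. norm (m \<xi>)" and c="\<lambda>z. exp (- ((z / N)\<^sup>2) / 2)"])
      show "integrable lborel (\<lambda>\<xi>. norm (m \<xi>))"
        using multiplier_integrable[OF m, of "\<lambda>_. 1"] by (intro integrable_norm) simp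
      fix \<xi> z
      have "1 / (2 * pi) * (norm (m \<xi>) * exp (- ((z / N)\<^sup>2) / 2)) \<le> 1 * (norm (m \<xi>) * exp (- ((z / N)\<^sup>2) / 2))"
        using pi_ge_two by (intro mult_right_mono) auto
      thus "norm (of_real (1 / (2 * pi)) * (exp (\<i> * of_real (z * \<xi>)) * m \<xi> * of_real (exp (- ((z / N)\<^sup>2) / 2))))
           \<le> norm (m \<xi>) * exp (- ((z / N)\<^sup>2) / 2)"
        by (simp add: norm_mult norm_divide)
      show "(\<lambda>(\<xi>, z). of_real (1 / (2 * pi)) * (exp (\<i> * of_real (z * \<xi>)) * m \<xi> * of_real (exp (- ((z / N)\<^sup>2) / 2))))
          \<in> borel_measurable (lborel \<Otimes>\<^sub>M lborel)"
        by measurable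
    qed (rule g)
    also have "\<dots> = (LINT \<xi>|lborel. of_real (1 / (2 * pi)) * m \<xi> * of_real (N * sqrt (2 * pi) * exp (- ((\<xi> * N)\<^sup>2) / 2)))"
    proof (rule Bochner_Integration.integral_cong[OF refl])
      fix \<xi>
      have "(LINT z|lborel. of_real (1 / (2 * pi)) * (exp (\<i> * of_real (z * \<xi>)) * m \<xi> * of_real (exp (- ((z / N)\<^sup>2) / 2)))) =
        (LINT z|lborel. of_real (1 / (2 * pi)) * m \<xi> * (exp (\<i> * of_real (z * \<xi>)) * of_real (exp (- ((z / N)\<^sup>2) / 2))))"
        by (rule Bochner_Integration.integral_cong) (simp_all only: mult_ac)
      also have "\<dots> = of_real (1 / (2 * pi)) * m \<xi> * (LINT z|lborel. exp (\<i> * of_real (z * \<xi>)) * of_real (exp (- ((z / N)\<^sup>2) / 2)))"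
        by (rule integral_mult_right_zero)
      finally show "(LINT z|lborel. of_real (1 / (2 * pi)) * (exp (\<i> * of_real (z * \<xi>)) * m \<xi> * of_real (exp (- ((z / N)\<^sup>2) / 2)))) =
         of_real (1 / (2 * pi)) * m \<xi> * of_real (N * sqrt (2 * pi) * exp (- ((\<xi> * N)\<^sup>2) / 2))"
        by (simp only: integral_gauss_iexp_scaled[OF N])
    qed
    also have "\<dots> = (LINT u|lborel. of_real (1 / sqrt (2 * pi)) * (m (u / N) * of_real (exp (- (u\<^sup>2) / 2))))"
    proof -
      have s: "sqrt (2 * pi) / (2 * pi) = 1 / sqrt (2 * pi)"
        by (simp add: real_div_sqrt field_simps flip: real_sqrt_mult)
      have e: "of_real (1 / (2 * pi)) * m (u / N) * of_real (N * sqrt (2 * pi) * exp (- ((u / N * N)\<^sup>2) / 2)) =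
         of_real N * (of_real (1 / sqrt (2 * pi)) * (m (u / N) * of_real (exp (- (u\<^sup>2) / 2))))" for u
        unfolding s[symmetric] using N by simp
      have "(LINT \<xi>|lborel. of_real (1 / (2 * pi)) * m \<xi> * of_real (N * sqrt (2 * pi) * exp (- ((\<xi> * N)\<^sup>2) / 2))) =
         (1 / N) *\<^sub>R (LINT u|lborel. of_real (1 / (2 * pi)) * m (u / N) * of_real (N * sqrt (2 * pi) * exp (- ((u / N * N)\<^sup>2) / 2)))"
        using lborel_integral_real_affine[of "1/N" "\<lambda>\<xi>. of_real (1 / (2 * pi)) * m \<xi> * of_real (N * sqrt (2 * pi) * exp (- ((\<xi> * N)\<^sup>2) / 2))" 0] N
        by simp
      also have "\<dots> = (1 / N) *\<^sub>R (of_real N * (LINT u|lborel. of_real (1 / sqrt (2 * pi)) * (m (u / N) * of_real (exp (- (u\<^sup>2) / 2)))))"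
        unfolding e by (simp only: integral_mult_right_zero)
      also have "\<dots> = (LINT u|lborel. of_real (1 / sqrt (2 * pi)) * (m (u / N) * of_real (exp (- (u\<^sup>2) / 2))))"
        using N by (simp only: scaleR_conv_of_real) simp
      finally show ?thesis .
    qed
    finally show ?thesis unfolding N_def .
  qed
  have lim2: "(\<lambda>n. LINT u|lborel. of_real (1 / sqrt (2 * pi)) * (m (u / Suc n) * of_real (exp (- (u\<^sup>2) / 2)))) 
     \<longlonglongrightarrow> (LINT u|lborel. of_real (1 / sqrt (2 * pi)) * (m 0 * of_real (exp (- (u\<^sup>2) / 2))))"
  proof -
    obtain L where "\<And>\<xi>. L < \<bar>\<xi>\<bar> \<Longrightarrow> m \<xi> = 0" using m unfolding multiplier_def by blast
    then obtain B where B: "B \<ge> 0" "\<And>x. norm (m x) \<le> B"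
      using bounded_compact_support[OF multiplier_continuous[OF m]] by blast
    show ?thesis
    proof (rule integral_dominated_convergence[where w="\<lambda>u. 1 / sqrt (2 * pi) * (B * exp (- (u\<^sup>2) / 2))"])
      show "integrable lborel (\<lambda>u. 1 / sqrt (2 * pi) * (B * exp (- (u\<^sup>2) / 2)))" using integrable_gauss by auto
      show "AE u in lborel. norm (of_real (1 / sqrt (2 * pi)) * (m (u / real (Suc n)) * of_real (exp (- (u\<^sup>2) / 2)))) 
         \<le> 1 / sqrt (2 * pi) * (B * exp (- (u\<^sup>2) / 2))" for n
        using B(2) by (intro AE_I2) (auto simp: norm_mult norm_divide intro!: divide_right_mono mult_right_mono)
      show "AE u in lborel. (\<lambda>n. of_real (1 / sqrt (2 * pi)) * (m (u / real (Suc n)) * of_real (exp (- (u\<^sup>2) / 2))))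
         \<longlonglongrightarrow> of_real (1 / sqrt (2 * pi)) * (m 0 * of_real (exp (- (u\<^sup>2) / 2)))"
      proof (rule AE_I2)
        fix u :: real
        have "(\<lambda>n. u / real (Suc n)) \<longlonglongrightarrow> 0" by (rule LIMSEQ_Suc[OF lim_const_over_n])
        moreover have "isCont m 0" using multiplier_continuous[OF m] by (simp add: continuous_on_eq_continuous_at)
        ultimately have "(\<lambda>n. m (u / real (Suc n))) \<longlonglongrightarrow> m 0" by (rule isCont_tendsto_compose[rotated])
        thus "(\<lambda>n. of_real (1 / sqrt (2 * pi)) * (m (u / real (Suc n)) * of_real (exp (- (u\<^sup>2) / 2))))
         \<longlonglongrightarrow> of_real (1 / sqrt (2 * pi)) * (m 0 * of_real (exp (- (u\<^sup>2) / 2)))"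
          by (intro tendsto_intros)
      qed
    qed auto
  qed
  have val: "(LINT u|lborel. of_real (1 / sqrt (2 * pi)) * (m 0 * of_real (exp (- (u\<^sup>2) / 2)))) = m 0"
  proof -
    have "(LINT u|lborel. of_real (1 / sqrt (2 * pi)) * (m 0 * of_real (exp (- (u\<^sup>2) / 2)))) =
       of_real (1 / sqrt (2 * pi)) * (m 0 * (LINT u|lborel. exp (\<i> * of_real (0 * u)) * of_real (exp (- (u\<^sup>2) / 2))))"
      by (simp only: integral_mult_right_zero) simp
    thus ?thesis unfolding integral_gauss_iexp by simp
  qed
  have "I \<longlonglongrightarrow> m 0" using lim2 unfolding I_eq[symmetric] val .
  with lim1 show ?thesis by (rule LIMSEQ_unique)
qed

section \<open>Multiplier operators on bounded functions\<close>

definition bfun :: "(real \<Rightarrow> complex) \<Rightarrow> bool" where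
  "bfun f \<longleftrightarrow> f \<in> borel_measurable borel \<and> (\<exists>B. \<forall>x. norm (f x) \<le> B)"

text \<open>Convolution with the kernel, since a merely bounded function has no transform that is
  again a function. The operator is used on measurable rather than continuous functions because
  glued profiles may jump at the ends of their intervals.\<close>

definition fmul :: "(real \<Rightarrow> complex) \<Rightarrow> (real \<Rightarrow> complex) \<Rightarrow> real \<Rightarrow> complex" where
  "fmul m f x = (LINT y|lborel. fourier_inv m (x - y) * f y)"

lemma bfunI: "f \<in> borel_measurable borel \<Longrightarrow> (\<And>x. norm (f x) \<le> B) \<Longrightarrow> bfun f"
  unfolding bfun_def by blast

lemma bfunI_continuous: "continuous_on UNIV f \<Longrightarrow> (\<And>x. norm (f x) \<le> B) \<Longrightarrow> bfun f"
  by (intro bfunI borel_measurable_continuous_onI)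

lemma bfun_measurable: "bfun f \<Longrightarrow> f \<in> borel_measurable borel"
  unfolding bfun_def by simp

lemma bfunE:
  assumes "bfun f" obtains B where "B \<ge> 0" "\<And>x. norm (f x) \<le> B"
  using assms unfolding bfun_def by (metis norm_ge_zero order_trans)

lemma bfun_const: "bfun (\<lambda>x. c)" by (rule bfunI[of _ "norm c"]) auto

lemma bfun_add: "bfun f \<Longrightarrow> bfun g \<Longrightarrow> bfun (\<lambda>x. f x + g x)"
proof -
  assume f: "bfun f" and g: "bfun g"
  obtain B B' where "\<And>x. norm (f x) \<le> B" "\<And>x. norm (g x) \<le> B'" using f g by (meson bfunE)
  hence "norm (f x + g x) \<le> B + B'" for x by (intro norm_triangle_le add_mono)
  with bfun_measurable[OF f] bfun_measurable[OF g] show ?thesis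
    by (blast intro: bfunI[of _ "B + B'"] borel_measurable_add)
qed

lemma bfun_mult:
  assumes "bfun f" "bfun g" shows "bfun (\<lambda>x. f x * g x)"
proof -
  obtain B B' where "B \<ge> 0" "\<And>x. norm (f x) \<le> B" "B' \<ge> 0" "\<And>x. norm (g x) \<le> B'"
    using assms by (meson bfunE)
  hence "norm (f x * g x) \<le> B * B'" for x unfolding norm_mult by (intro mult_mono) auto
  with bfun_measurable[OF assms(1)] bfun_measurable[OF assms(2)] show ?thesis
    by (blast intro: bfunI[of _ "B * B'"] borel_measurable_times)
qed

lemma bfun_diff: "bfun f \<Longrightarrow> bfun g \<Longrightarrow> bfun (\<lambda>x. f x - g x)"
  using bfun_add[OF _ bfun_mult[OF bfun_const[of "-1"]], of f g] by simp

lemma bfun_sum: "(\<And>i. i \<in> I \<Longrightarrow> bfun (f i)) \<Longrightarrow> bfun (\<lambda>x. \<Sum>i\<in>I. f i x)"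
  by (induction I rule: infinite_finite_induct) (auto intro: bfun_add bfun_const)

lemma bfun_cnj: "bfun f \<Longrightarrow> bfun (\<lambda>x. cnj (f x))"
  unfolding bfun_def
  using measurable_compose[OF _ borel_measurable_continuous_onI[OF continuous_on_cnj[OF continuous_on_id]], of f borel]
  by (auto simp: o_def)

lemma bfun_shift: "bfun f \<Longrightarrow> bfun (\<lambda>x. f (x + c))"
  unfolding bfun_def by auto

lemma kernel_mult_decay:
  assumes "\<And>x. norm (fourier_inv m x) \<le> C * dk x" "\<And>x. norm (f x) \<le> B"
  shows "norm (fourier_inv m (x - y) * f y) \<le> (C * B) * dk (x - y)"
proof -
  have "norm (fourier_inv m (x - y)) * norm (f y) \<le> (C * dk (x - y)) * B"
    using assms by (intro mult_mono) (auto intro: order_trans[OF norm_ge_zero])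
  thus ?thesis by (simp add: norm_mult mult_ac)
qed

lemma fmul_measurable_integrand:
  assumes "multiplier m" "bfun f"
  shows "(\<lambda>y. fourier_inv m (x - y) * f y) \<in> borel_measurable borel"
  using fourier_inv_measurable[OF assms(1)] bfun_measurable[OF assms(2)] by measurable

lemma fmul_integrable:
  assumes "multiplier m" "bfun f"
  shows "integrable lborel (\<lambda>y. fourier_inv m (x - y) * f y)"
proof -
  obtain C B where "\<And>x. norm (fourier_inv m x) \<le> C * dk x" "\<And>x. norm (f x) \<le> B"
    using assms by (meson bfunE multiplier_decay)
  thus ?thesis
    by (intro integrable_dk_bound(1)[where C="C * B" and x=x] fmul_measurable_integrand assms kernel_mult_decay)
qed

lemma fmul_norm_le:
  assumes "multiplier m" "bfun f" "\<And>x. norm (fourier_inv m x) \<le> C * dk x" "\<And>x. norm (f x) \<le> B"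
  shows "norm (fmul m f x) \<le> C * dkc * B"
proof -
  have "norm (fmul m f x) \<le> C * B * dkc" unfolding fmul_def
    by (intro integrable_dk_bound(2)[where x=x] fmul_measurable_integrand assms kernel_mult_decay)
  thus ?thesis by (simp add: mult_ac)
qed

lemma fmul_add:
  assumes "multiplier m" "bfun f" "bfun g"
  shows "fmul m (\<lambda>x. f x + g x) x = fmul m f x + fmul m g x"
  unfolding fmul_def using fmul_integrable assms by (simp add: distrib_left)

lemma fmul_diff:
  assumes "multiplier m" "bfun f" "bfun g"
  shows "fmul m (\<lambda>x. f x - g x) x = fmul m f x - fmul m g x"
  unfolding fmul_def using fmul_integrable assms by (simp add: right_diff_distrib)

lemma fmul_zero_right [simp]: "fmul m (\<lambda>x. 0) x = 0" unfolding fmul_def by simp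
lemma fmul_zero_left [simp]: "fmul (\<lambda>x. 0) f x = 0" unfolding fmul_def by simp

lemma fmul_cmult: "fmul m (\<lambda>x. c * f x) x = c * fmul m f x"
proof -
  have "fourier_inv m (x - y) * (c * f y) = c * (fourier_inv m (x - y) * f y)" for y by simp
  thus ?thesis unfolding fmul_def by (simp only: integral_mult_right_zero)
qed

lemma fmul_cmult_left: "fmul (\<lambda>\<xi>. c * m \<xi>) f x = c * fmul m f x"
  unfolding fmul_def by (simp only: fourier_inv_cmult mult.assoc integral_mult_right_zero)

lemma fmul_sum:
  assumes "multiplier m" "\<And>i. i \<in> I \<Longrightarrow> bfun (f i)"
  shows "fmul m (\<lambda>x. \<Sum>i\<in>I. f i x) x = (\<Sum>i\<in>I. fmul m (f i) x)"
  using assms(2) by (induction I rule: infinite_finite_induct) (auto simp: fmul_add assms bfun_sum)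

lemma fmul_add_left:
  assumes "multiplier m" "multiplier n" "bfun f"
  shows "fmul (\<lambda>\<xi>. m \<xi> + n \<xi>) f x = fmul m f x + fmul n f x"
  unfolding fmul_def using fmul_integrable assms by (simp add: fourier_inv_add distrib_right)

lemma fmul_sum_left:
  assumes "\<And>i. i \<in> I \<Longrightarrow> multiplier (m i)" "bfun f"
  shows "fmul (\<lambda>\<xi>. \<Sum>i\<in>I. m i \<xi>) f x = (\<Sum>i\<in>I. fmul (m i) f x)"
  using assms(1) by (induction I rule: infinite_finite_induct) (auto simp: fmul_add_left assms(2) multiplier_sum)

lemma fmul_shift: "fmul m (\<lambda>y. f (y + c)) x = fmul m f (x + c)"
  using lborel_integral_real_affine[of 1 "\<lambda>y. fourier_inv m (x + c - y) * f y" c]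
  unfolding fmul_def by (simp add: algebra_simps)

lemma fmul_alt: "fmul m f x = (LINT z|lborel. fourier_inv m z * f (x - z))"
  using lborel_integral_real_affine[of "-1" "\<lambda>y. fourier_inv m (x - y) * f y" x]
  unfolding fmul_def by simp

lemma fmul_has_derivative:
  assumes m: "multiplier m" and f: "bfun f"
  shows "(fmul m f has_vector_derivative fmul (\<lambda>\<xi>. \<i> * of_real \<xi> * m \<xi>) f x) (at x)"
proof -
  let ?m = "\<lambda>\<xi>. \<i> * of_real \<xi> * m \<xi>"
  note m' = multiplier_times_id[OF m]
  obtain C B where C: "C \<ge> 0" "\<And>x. norm (fourier_inv ?m x) \<le> C * dk x" and B: "B \<ge> 0" "\<And>x. norm (f x) \<le> B"
    using m' f by (meson bfunE multiplier_decay)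
  \<comment> \<open>Within distance 1 of x all the majorants \<open>dk (r - y)\<close> are
    comparable with \<open>dk (x - y)\<close>, with the factor 2 (1 + 1^2) = 4 of
    \<open>dk_shift\<close>.\<close>
  have "((\<lambda>r. LINT y|lborel. fourier_inv m (r - y) * f y) has_vector_derivative
      (LINT y|lborel. fourier_inv ?m (x - y) * f y)) (at x within {x-1<..<x+1})"
  proof (rule has_vector_derivative_lebesgue_integral[where F'="\<lambda>r y. fourier_inv ?m (r - y) * f y" and h="\<lambda>y. (C * B * 4) * dk (x - y)"])
    show "integrable lborel (\<lambda>y. C * B * 4 * dk (x - y))" using integrable_dk_shift by auto
    show "(\<lambda>y. fourier_inv ?m (x - y) * f y) \<in> borel_measurable lborel"
      using fmul_measurable_integrand[OF m' f] by simp
    show "integrable lborel (\<lambda>y. fourier_inv m (r - y) * f y)" for r by (rule fmul_integrable[OF m f])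
    fix r y assume r: "r \<in> {x - 1<..<x + 1}"
    have "((\<lambda>r. fourier_inv m (r - y)) has_vector_derivative fourier_inv ?m (r - y)) (at r)"
    proof -
      have "((\<lambda>r. r - y) has_vector_derivative 1) (at r)" by (auto intro!: derivative_eq_intros)
      from vector_diff_chain_at[OF this fourier_inv_has_derivative[OF m]] show ?thesis by (simp add: o_def)
    qed
    thus "((\<lambda>r. fourier_inv m (r - y) * f y) has_vector_derivative fourier_inv ?m (r - y) * f y) (at r within {x-1<..<x+1})"
      by (rule has_vector_derivative_at_within[OF has_vector_derivative_mult_left])
    have "(r - x)\<^sup>2 \<le> 1" using r by (subst abs_square_le_1) (auto simp: abs_le_iff)
    have "dk ((x - y) + (r - x)) \<le> 2 * (1 + (r - x)\<^sup>2) * dk (x - y)" by (rule dk_shift)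
    also have "\<dots> \<le> 4 * dk (x - y)" using \<open>(r - x)\<^sup>2 \<le> 1\<close> by (intro mult_right_mono) auto
    finally have d: "dk (r - y) \<le> 4 * dk (x - y)" by simp
    have "norm (fourier_inv ?m (r - y) * f y) \<le> C * B * dk (r - y)" by (rule kernel_mult_decay[OF C(2) B(2)])
    also have "\<dots> \<le> C * B * (4 * dk (x - y))" using d C B by (intro mult_left_mono) auto
    finally show "norm (fourier_inv ?m (r - y) * f y) \<le> C * B * 4 * dk (x - y)" by simp
  qed simp_all
  hence "((\<lambda>r. LINT y|lborel. fourier_inv m (r - y) * f y) has_vector_derivative
      (LINT y|lborel. fourier_inv ?m (x - y) * f y)) (at x)"
    by (subst (asm) at_within_open) auto
  thus ?thesis unfolding fmul_def .
qed

lemma fmul_continuous: "multiplier m \<Longrightarrow> bfun f \<Longrightarrow> continuous_on UNIV (fmul m f)"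
  using fmul_has_derivative has_vector_derivative_imp_continuous by blast

lemma bfun_fmul:
  assumes "multiplier m" "bfun f" shows "bfun (fmul m f)"
proof -
  obtain C B where "\<And>x. norm (fourier_inv m x) \<le> C * dk x" "\<And>x. norm (f x) \<le> B"
    using assms by (meson bfunE multiplier_decay)
  thus ?thesis using fmul_norm_le[OF assms] fmul_continuous[OF assms] by (blast intro: bfunI_continuous)
qed

text \<open>The product formula: expanding the second factor into plane waves \<open>e\<^sup>i\<^sup>\<xi>\<^sup>z\<close> turns its effect on
  the multiplier \<open>m\<close> into a frequency shift by \<open>\<xi>\<close>.\<close>

lemma fmul_product:
  assumes m: "multiplier m" and n: "multiplier n" and g: "bfun g" and h: "bfun h"
  shows "fmul m (\<lambda>z. g z * fmul n h z) x =
    (LINT y|lborel. h y * (1 / (2 * of_real pi) * (LINT \<xi>|lborel. n \<xi> * exp (\<i> * of_real ((x - y) * \<xi>)) * fmul (\<lambda>\<zeta>. m (\<zeta> + \<xi>)) g x)))"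
proof -
  obtain C D where C: "C \<ge> 0" "\<And>x. norm (fourier_inv m x) \<le> C * dk x" and D: "D \<ge> 0" "\<And>x. norm (fourier_inv n x) \<le> D * dk x"
    using m n by (meson multiplier_decay)
  obtain G H where G: "G \<ge> 0" "\<And>x. norm (g x) \<le> G" and H: "H \<ge> 0" "\<And>x. norm (h x) \<le> H"
    using g h by (meson bfunE)
  note [measurable] = fourier_inv_measurable[OF m] fourier_inv_measurable[OF n] bfun_measurable[OF g] bfun_measurable[OF h]
  have [measurable]: "n \<in> borel_measurable borel"
    by (intro borel_measurable_continuous_onI multiplier_continuous n)
  let ?F = "\<lambda>z y. fourier_inv m (x - z) * g z * (fourier_inv n (z - y) * h y)"
  have "fmul m (\<lambda>z. g z * fmul n h z) x = (LINT z|lborel. LINT y|lborel. ?F z y)"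
    unfolding fmul_def by (simp only: integral_mult_right_zero mult.assoc)
  also have "\<dots> = (LINT y|lborel. LINT z|lborel. ?F z y)"
  proof (rule Fubini_conv_kernel[where a="\<lambda>z. C * G * dk (x - z)" and c="\<lambda>u. D * H * dk u", symmetric])
    show "case_prod ?F \<in> borel_measurable (lborel \<Otimes>\<^sub>M lborel)" by measurable
    show "integrable lborel (\<lambda>z. C * G * dk (x - z))" using integrable_dk_shift by auto
    show "integrable lborel (\<lambda>u. D * H * dk u)" by simp
    fix z y
    have "norm (fourier_inv m (x - z) * g z) * norm (fourier_inv n (z - y) * h y) \<le> (C * G * dk (x - z)) * (D * H * dk (z - y))"
      using kernel_mult_decay[OF C(2) G(2)] kernel_mult_decay[OF D(2) H(2)] C G by (intro mult_mono) auto
    thus "norm (?F z y) \<le> C * G * dk (x - z) * (D * H * dk (y - z))"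
      using dk_minus[of "y - z"] by (simp add: norm_mult)
  qed
  also have "\<dots> = (LINT y|lborel. h y * (1 / (2 * of_real pi) * (LINT \<xi>|lborel. n \<xi> * exp (\<i> * of_real ((x - y) * \<xi>)) * fmul (\<lambda>\<zeta>. m (\<zeta> + \<xi>)) g x)))"
  proof (rule Bochner_Integration.integral_cong[OF refl])
    fix y
    let ?G = "\<lambda>z \<xi>. fourier_inv m (x - z) * g z * (exp (\<i> * of_real ((z - y) * \<xi>)) * n \<xi>)"
    have "?F z y = h y * (1 / (2 * of_real pi) * (LINT \<xi>|lborel. ?G z \<xi>))" for z
      unfolding fourier_inv_def[of n] by (subst integral_mult_right_zero) (simp only: mult_ac)
    hence "(LINT z|lborel. ?F z y) = (LINT z|lborel. h y * (1 / (2 * of_real pi) * (LINT \<xi>|lborel. ?G z \<xi>)))"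
      by (intro Bochner_Integration.integral_cong refl)
    also have "\<dots> = h y * (1 / (2 * of_real pi) * (LINT z|lborel. LINT \<xi>|lborel. ?G z \<xi>))"
      by (simp only: integral_mult_right_zero)
    also have "(LINT z|lborel. LINT \<xi>|lborel. ?G z \<xi>) = (LINT \<xi>|lborel. LINT z|lborel. ?G z \<xi>)"
    proof (rule Fubini_product_bound[where a="\<lambda>z. C * G * dk (x - z)" and c="\<lambda>\<xi>. norm (n \<xi>)", symmetric])
      show "case_prod ?G \<in> borel_measurable (lborel \<Otimes>\<^sub>M lborel)" by measurable
      show "integrable lborel (\<lambda>z. C * G * dk (x - z))" using integrable_dk_shift by auto
      show "integrable lborel (\<lambda>\<xi>. norm (n \<xi>))"
        using multiplier_integrable[OF n, of "\<lambda>_. 1"] by (intro integrable_norm) simp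
      show "norm (?G z \<xi>) \<le> C * G * dk (x - z) * norm (n \<xi>)" for z \<xi>
        using kernel_mult_decay[where f=g, OF C(2) G(2), of x z] by (simp add: norm_mult mult_right_mono)
    qed
    also have "\<dots> = (LINT \<xi>|lborel. n \<xi> * exp (\<i> * of_real ((x - y) * \<xi>)) * fmul (\<lambda>\<zeta>. m (\<zeta> + \<xi>)) g x)"
    proof (rule Bochner_Integration.integral_cong[OF refl])
      fix \<xi>
      have e: "exp (\<i> * of_real ((z - y) * \<xi>)) = exp (\<i> * of_real ((x - y) * \<xi>)) * exp (- \<i> * of_real (\<xi> * (x - z)))" for z
        unfolding exp_add[symmetric] by (simp add: algebra_simps)
      have "(LINT z|lborel. ?G z \<xi>) = (LINT z|lborel. n \<xi> * exp (\<i> * of_real ((x - y) * \<xi>)) * (fourier_inv (\<lambda>\<zeta>. m (\<zeta> + \<xi>)) (x - z) * g z))"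
      proof (rule Bochner_Integration.integral_cong[OF refl])
        fix z
        show "?G z \<xi> = n \<xi> * exp (\<i> * of_real ((x - y) * \<xi>)) * (fourier_inv (\<lambda>\<zeta>. m (\<zeta> + \<xi>)) (x - z) * g z)"
          unfolding e[of z] fourier_inv_shift by (simp only: mult_ac)
      qed
      thus "(LINT z|lborel. ?G z \<xi>) = n \<xi> * exp (\<i> * of_real ((x - y) * \<xi>)) * fmul (\<lambda>\<zeta>. m (\<zeta> + \<xi>)) g x"
        unfolding fmul_def by (simp only: integral_mult_right_zero)
    qed
    finally show "(LINT z|lborel. ?F z y) = h y * (1 / (2 * of_real pi) * (LINT \<xi>|lborel. n \<xi> * exp (\<i> * of_real ((x - y) * \<xi>)) * fmul (\<lambda>\<zeta>. m (\<zeta> + \<xi>)) g x))" .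
  qed
  finally show ?thesis .
qed

lemma fmul_one:
  assumes "multiplier m" shows "fmul m (\<lambda>x. 1) x = m 0"
  unfolding fmul_alt using integral_fourier_inv[OF assms] by simp

text \<open>The product formula with first factor 1: a constant lives at frequency 0, so the symbol
  shifted by \<xi> acts on it as the number \<open>m \<xi>\<close>, and the remaining integral is
  the kernel of the product symbol.\<close>

lemma fmul_fmul:
  assumes m: "multiplier m" and n: "multiplier n" and f: "bfun f"
  shows "fmul m (fmul n f) x = fmul (\<lambda>\<xi>. m \<xi> * n \<xi>) f x"
proof -
  have "fmul m (fmul n f) x = fmul m (\<lambda>z. 1 * fmul n f z) x" by simp
  also have "\<dots> = (LINT y|lborel. f y * (1 / (2 * of_real pi) * (LINT \<xi>|lborel. n \<xi> * exp (\<i> * of_real ((x - y) * \<xi>)) * m \<xi>)))"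
    by (subst fmul_product[OF m n bfun_const f]) (simp add: fmul_one multiplier_shift[OF m])
  also have "\<dots> = fmul (\<lambda>\<xi>. m \<xi> * n \<xi>) f x"
    unfolding fmul_def fourier_inv_def
    by (rule Bochner_Integration.integral_cong) (simp_all only: mult_ac)
  finally show ?thesis .
qed

lemma fmul_cnj: "cnj (fmul m f x) = fmul (\<lambda>\<xi>. cnj (m (- \<xi>))) (\<lambda>x. cnj (f x)) x"
proof -
  have "cnj (fourier_inv m z) = fourier_inv (\<lambda>\<xi>. cnj (m (- \<xi>))) z" for z
  proof -
    have "(LINT \<xi>|lborel. exp (\<i> * of_real (z * \<xi>)) * cnj (m (- \<xi>))) = (LINT \<xi>|lborel. exp (\<i> * of_real (z * - \<xi>)) * cnj (m \<xi>))"
      using lborel_integral_real_affine[of "-1" "\<lambda>\<xi>. exp (\<i> * of_real (z * \<xi>)) * cnj (m (- \<xi>))" 0] by simp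
    also have "\<dots> = (LINT \<xi>|lborel. cnj (exp (\<i> * of_real (z * \<xi>)) * m \<xi>))"
      by (rule Bochner_Integration.integral_cong) (simp_all add: exp_cnj)
    also have "\<dots> = cnj (LINT \<xi>|lborel. exp (\<i> * of_real (z * \<xi>)) * m \<xi>)" by (rule Bochner_Integration.integral_cnj)
    finally show ?thesis unfolding fourier_inv_def by simp
  qed
  thus ?thesis unfolding fmul_def by (subst Bochner_Integration.integral_cnj[symmetric]) simp
qed

text \<open>The derivative moves from the function to the kernel by parts; the decay of the kernel
  removes the boundary terms although \<open>f\<close> itself does not decay.\<close>

lemma fmul_derivative:
  assumes m: "multiplier m" and f: "bfun f" and f': "bfun f'" "continuous_on UNIV f'"
    and D: "\<And>x. (f has_vector_derivative f' x) (at x)"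
  shows "fmul m f' x = fmul (\<lambda>\<xi>. \<i> * of_real \<xi> * m \<xi>) f x"
proof -
  let ?m = "\<lambda>\<xi>. \<i> * of_real \<xi> * m \<xi>"
  note m' = multiplier_times_id[OF m]
  obtain C C' where C: "C \<ge> 0" "\<And>x. norm (fourier_inv m x) \<le> C * dk x" and C': "C' \<ge> 0" "\<And>x. norm (fourier_inv ?m x) \<le> C' * dk x"
    using m m' by (meson multiplier_decay)
  obtain B B' where B: "B \<ge> 0" "\<And>x. norm (f x) \<le> B" and B': "B' \<ge> 0" "\<And>x. norm (f' x) \<le> B'"
    using f f' by (meson bfunE)
  have cf: "continuous_on UNIV f" using D has_vector_derivative_imp_continuous by blast
  have "(LINT y|lborel. fourier_inv m (x - y) * f' y - fourier_inv ?m (x - y) * f y) = 0"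
  proof (rule integral_derivative_dk_eq_0[where H="\<lambda>y. fourier_inv m (x - y) * f y" and x=x])
    fix y
    have "((\<lambda>y. fourier_inv m (x - y)) has_vector_derivative - fourier_inv ?m (x - y)) (at y)"
    proof -
      have "((\<lambda>y. x - y) has_vector_derivative - 1) (at y)" by (auto intro!: derivative_eq_intros)
      from vector_diff_chain_at[OF this fourier_inv_has_derivative[OF m]] show ?thesis by (simp add: o_def)
    qed
    from has_vector_derivative_mult[OF this D]
    show "((\<lambda>y. fourier_inv m (x - y) * f y) has_vector_derivative fourier_inv m (x - y) * f' y - fourier_inv ?m (x - y) * f y) (at y)"
      by simp
    show "norm (fourier_inv m (x - y) * f y) \<le> (C * B) * dk (x - y)" by (rule kernel_mult_decay[OF C(2) B(2)])
    have "norm (fourier_inv m (x - y) * f' y - fourier_inv ?m (x - y) * f y) \<le> (C * B') * dk (x - y) + (C' * B) * dk (x - y)"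
      by (intro order_trans[OF norm_triangle_ineq4] add_mono kernel_mult_decay C(2) C'(2) B(2) B'(2))
    thus "norm (fourier_inv m (x - y) * f' y - fourier_inv ?m (x - y) * f y) \<le> (C * B' + C' * B) * dk (x - y)"
      by (simp add: distrib_right)
  next
    show "continuous_on UNIV (\<lambda>y. fourier_inv m (x - y) * f' y - fourier_inv ?m (x - y) * f y)"
      by (intro continuous_intros f' cf continuous_on_compose2[OF fourier_inv_continuous[OF m]] continuous_on_compose2[OF fourier_inv_continuous[OF m']]) auto
  qed
  thus ?thesis unfolding fmul_def using fmul_integrable[OF m f'(1)] fmul_integrable[OF m' f] by simp
qed

text \<open>The known notion is inclusion of the Fourier support in \<open>{a..b}\<close>. Testing
  against symbols that vanish there gives it a meaning for functions that are merely
  bounded.\<close>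

definition spec :: "real \<Rightarrow> real \<Rightarrow> (real \<Rightarrow> complex) \<Rightarrow> bool" where
  "spec a b g \<longleftrightarrow> (\<forall>m x. multiplier m \<and> (\<forall>\<xi>\<in>{a..b}. m \<xi> = 0) \<longrightarrow> fmul m g x = 0)"

lemma spec_fmul:
  assumes "multiplier n" "bfun f" "\<And>\<xi>. \<xi> \<notin> {a..b} \<Longrightarrow> n \<xi> = 0"
  shows "spec a b (fmul n f)"
  unfolding spec_def
proof safe
  fix m x assume m: "multiplier m" "\<forall>\<xi>\<in>{a..b}. m \<xi> = 0"
  have "(\<lambda>\<xi>. m \<xi> * n \<xi>) = (\<lambda>\<xi>. 0)" using m assms(3) by fastforce
  thus "fmul m (fmul n f) x = 0" by (simp add: fmul_fmul m assms)
qed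

text \<open>In the product formula the first factor meets only symbols shifted by a frequency \<xi>
  of the second; for \<xi> in \<open>{c..d}\<close> such a shifted symbol vanishes on
  \<open>{a..b}\<close>. The second factor is displayed as a multiplier image because it is the one
  that is expanded into plane waves.\<close>

lemma spec_mult:
  assumes g: "spec a b g" "bfun g" and n: "multiplier n" "\<And>\<xi>. \<xi> \<notin> {c..d} \<Longrightarrow> n \<xi> = 0" and h: "bfun h"
  shows "spec (a + c) (b + d) (\<lambda>x. g x * fmul n h x)"
  unfolding spec_def
proof safe
  fix m x assume m: "multiplier m" "\<forall>\<xi>\<in>{a + c..b + d}. m \<xi> = 0"
  have "n \<xi> * exp (\<i> * of_real ((x - y) * \<xi>)) * fmul (\<lambda>\<zeta>. m (\<zeta> + \<xi>)) g x = 0" for y \<xi>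
  proof (cases "\<xi> \<in> {c..d}")
    case True
    have "fmul (\<lambda>\<zeta>. m (\<zeta> + \<xi>)) g x = 0"
      using g(1) multiplier_shift[OF m(1)] m(2) True unfolding spec_def by (auto intro!: add_mono)
    thus ?thesis by simp
  qed (use n in auto)
  thus "fmul m (\<lambda>x. g x * fmul n h x) x = 0"
    by (simp only: fmul_product[OF m(1) n(1) g(2) h]) simp
qed

text \<open>Dilating the symbol compresses its kernel to scale 1 / n and keeps the total mass
  \<open>m 0\<close>.\<close>

lemma fmul_approx_identity:
  assumes m: "multiplier m" and f: "bfun f" "continuous_on UNIV f"
  shows "(\<lambda>n. fmul (\<lambda>\<xi>. m (1 / Suc n * \<xi>)) f x) \<longlonglongrightarrow> m 0 * f x"
proof -
  obtain C B where C: "C \<ge> 0" "\<And>x. norm (fourier_inv m x) \<le> C * dk x" and B: "B \<ge> 0" "\<And>x. norm (f x) \<le> B"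
    using m f by (meson bfunE multiplier_decay)
  note [measurable] = fourier_inv_measurable[OF m] bfun_measurable[OF f(1)]
  have eq: "fmul (\<lambda>\<xi>. m (1 / Suc n * \<xi>)) f x = (LINT z|lborel. fourier_inv m z * f (x - z / Suc n))" for n
  proof -
    define N where "N = real (Suc n)"
    have N: "N > 0" by (simp add: N_def)
    have "fmul (\<lambda>\<xi>. m (1 / N * \<xi>)) f x = (LINT z|lborel. of_real N * (fourier_inv m (N * z) * f (x - z)))"
      unfolding fmul_alt using N by (subst fourier_inv_scale) (simp_all add: mult_ac)
    also have "\<dots> = (1 / N) *\<^sub>R (LINT z|lborel. of_real N * (fourier_inv m z * f (x - z / N)))"
      using lborel_integral_real_affine[of "1 / N" "\<lambda>z. of_real N * (fourier_inv m (N * z) * f (x - z))" 0] N by simp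
    also have "\<dots> = (LINT z|lborel. fourier_inv m z * f (x - z / N))"
      using N by (simp only: integral_mult_right_zero scaleR_conv_of_real) simp
    finally show ?thesis unfolding N_def .
  qed
  have "(\<lambda>n. LINT z|lborel. fourier_inv m z * f (x - z / Suc n)) \<longlonglongrightarrow> (LINT z|lborel. fourier_inv m z * f x)"
  proof (rule integral_dominated_convergence[where w="\<lambda>z. C * B * dk z"])
    show "AE z in lborel. norm (fourier_inv m z * f (x - z / Suc n)) \<le> C * B * dk z" for n
    proof (rule AE_I2)
      fix z
      have "norm (fourier_inv m z) * norm (f (x - z / Suc n)) \<le> (C * dk z) * B"
        using C B by (intro mult_mono) auto
      thus "norm (fourier_inv m z * f (x - z / Suc n)) \<le> C * B * dk z" by (simp add: norm_mult mult_ac)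
    qed
    show "AE z in lborel. (\<lambda>n. fourier_inv m z * f (x - z / Suc n)) \<longlonglongrightarrow> fourier_inv m z * f x"
    proof (rule AE_I2)
      fix z
      have "(\<lambda>n. z / real (Suc n)) \<longlonglongrightarrow> 0" by (rule LIMSEQ_Suc[OF lim_const_over_n])
      hence "(\<lambda>n. x - z / real (Suc n)) \<longlonglongrightarrow> x - 0" by (intro tendsto_intros)
      moreover have "isCont f x" using f(2) by (simp add: continuous_on_eq_continuous_at)
      ultimately have "(\<lambda>n. f (x - z / real (Suc n))) \<longlonglongrightarrow> f x" by (intro isCont_tendsto_compose[of x f]) simp_all
      thus "(\<lambda>n. fourier_inv m z * f (x - z / Suc n)) \<longlonglongrightarrow> fourier_inv m z * f x" by (intro tendsto_intros)
    qed
  qed auto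
  thus ?thesis unfolding eq using integral_fourier_inv[OF m] by simp
qed

lemma fmul_LIMSEQ:
  assumes m: "multiplier m" and f: "bfun f" "\<And>n. bfun (F n)"
    and u: "\<And>x n. norm (F n x - f x) \<le> e n" and e: "e \<longlonglongrightarrow> 0"
  shows "(\<lambda>n. fmul m (F n) x) \<longlonglongrightarrow> fmul m f x"
proof -
  obtain C where C: "C \<ge> 0" "\<And>x. norm (fourier_inv m x) \<le> C * dk x" using multiplier_decay[OF m] by blast
  have "norm (fmul m (F n) x - fmul m f x) \<le> C * dkc * e n" for n
    using fmul_norm_le[OF m bfun_diff[OF f(2) f(1)] C(2) u, of n x] by (simp add: fmul_diff m f)
  moreover have "(\<lambda>n. C * dkc * e n) \<longlonglongrightarrow> C * dkc * 0" by (intro tendsto_intros e)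
  ultimately have "(\<lambda>n. fmul m (F n) x - fmul m f x) \<longlonglongrightarrow> 0"
    by - (rule Lim_null_comparison, auto)
  thus ?thesis by (simp add: LIM_zero_iff)
qed

section \<open>Series over the integers\<close>

lemma int_interval_exhausts:
  assumes "finite (F :: int set)" shows "eventually (\<lambda>N. F \<subseteq> {- int N..int N}) sequentially"
proof -
  obtain M :: int where M: "\<forall>l\<in>F. \<bar>l\<bar> \<le> M" using assms by (metis finite_imageI Max_ge image_eqI)
  show ?thesis using eventually_ge_at_top[of "nat M"]
  proof eventually_elim
    case (elim N)
    hence "M \<le> int N" by linarith
    thus ?case using M by (force simp: abs_le_iff)
  qed
qed

text \<open>Unconditional sums become limits along symmetric intervals, since uniform limits and
  termwise differentiation are taken along sequences.\<close>

lemma has_sum_int_LIMSEQ: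
  assumes "(f has_sum a) (UNIV :: int set)"
  shows "(\<lambda>N. \<Sum>l\<in>{- int N..int N}. f l) \<longlonglongrightarrow> a"
proof -
  have "filterlim (\<lambda>N. {- int N..int N}) (finite_subsets_at_top UNIV) sequentially"
    unfolding filterlim_iff
  proof (intro allI impI)
    fix P assume "eventually P (finite_subsets_at_top (UNIV :: int set))"
    then obtain X where X: "finite X" "\<And>Y. finite Y \<Longrightarrow> X \<subseteq> Y \<Longrightarrow> P Y"
      unfolding eventually_finite_subsets_at_top by auto
    show "eventually (\<lambda>N. P {- int N..int N}) sequentially"
      using int_interval_exhausts[OF X(1)] by eventually_elim (auto intro: X(2))
  qed
  thus ?thesis using assms unfolding has_sum_def by (rule filterlim_compose[rotated])
qed

definition tl :: "(int \<Rightarrow> real) \<Rightarrow> nat \<Rightarrow> real" where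
  "tl e N = infsum e UNIV - (\<Sum>l\<in>{- int N..int N}. e l)"

lemma tl_LIMSEQ:
  assumes "e summable_on UNIV" shows "tl e \<longlonglongrightarrow> 0"
proof -
  have "(\<lambda>N. infsum e UNIV - (\<Sum>l\<in>{- int N..int N}. e l)) \<longlonglongrightarrow> infsum e UNIV - infsum e UNIV"
    by (intro tendsto_intros has_sum_int_LIMSEQ has_sum_infsum assms)
  thus ?thesis unfolding tl_def by simp
qed

lemma abs_summable_comparison:
  fixes g :: "'i \<Rightarrow> 'a::banach"
  assumes "e summable_on A" "\<And>l. l \<in> A \<Longrightarrow> norm (g l) \<le> e l"
  shows "(\<lambda>l. norm (g l)) summable_on A" "g summable_on A" "norm (infsum g A) \<le> infsum e A"
proof -
  have "(\<lambda>l. norm (e l)) summable_on A" by (rule summable_on_iff_abs_summable_on_real[THEN iffD1, OF assms(1)])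
  thus 1: "(\<lambda>l. norm (g l)) summable_on A"
    by (rule Infinite_Sum.abs_summable_on_comparison_test) (use assms(2) in \<open>force intro: order_trans\<close>)
  thus "g summable_on A" by (rule abs_summable_summable)
  have "norm (infsum g A) \<le> infsum (\<lambda>l. norm (g l)) A" by (rule norm_infsum_bound[OF 1])
  also have "\<dots> \<le> infsum e A" by (rule infsum_mono[OF 1 assms(1)]) (use assms(2) in auto)
  finally show "norm (infsum g A) \<le> infsum e A" .
qed

lemma norm_infsum_tail:
  fixes g :: "int \<Rightarrow> complex"
  assumes e: "e summable_on UNIV" "\<And>l. norm (g l) \<le> e l"
  shows "norm (infsum g UNIV - (\<Sum>l\<in>{- int N..int N}. g l)) \<le> tl e N"
proof -
  let ?I = "{- int N..int N}"
  have g: "g summable_on UNIV" by (rule abs_summable_comparison(2)[OF e(1)]) (use e in auto)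
  have U: "infsum h UNIV = sum h ?I + infsum h (- ?I)" if "h summable_on UNIV" for h :: "int \<Rightarrow> 'b::banach"
    using infsum_Un_disjoint[of h ?I "- ?I"] summable_on_subset_banach[OF that, of "- ?I"] by simp
  have e': "e summable_on (- ?I)" by (rule summable_on_subset_banach[OF e(1)]) simp
  have "norm (infsum g (- ?I)) \<le> infsum e (- ?I)"
    by (rule abs_summable_comparison(3)[OF e']) (use e in auto)
  thus ?thesis unfolding tl_def U[OF g] U[OF e(1)] by simp
qed

lemma summable_nonneg_comparison:
  fixes f g :: "'i \<Rightarrow> real"
  assumes "g summable_on A" "\<And>l. l \<in> A \<Longrightarrow> 0 \<le> f l" "\<And>l. l \<in> A \<Longrightarrow> f l \<le> g l"
  shows "f summable_on A" "infsum f A \<le> infsum g A"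
proof -
  show 1: "f summable_on A" by (rule abs_summable_comparison(2)[OF assms(1)]) (use assms in auto)
  show "infsum f A \<le> infsum g A" by (rule infsum_mono[OF 1 assms(1,3)])
qed

lemma summable_bounded_sums:
  fixes f :: "'i \<Rightarrow> real"
  assumes "\<And>l. 0 \<le> f l" "\<And>F. finite F \<Longrightarrow> sum f F \<le> M"
  shows "f summable_on UNIV" "infsum f UNIV \<le> M"
proof -
  show 1: "f summable_on UNIV"
    by (rule nonneg_bdd_above_summable_on) (use assms in \<open>auto simp: bdd_above_def\<close>)
  show "infsum f UNIV \<le> M" by (rule infsum_le_finite_sums[OF 1]) (use assms in auto)
qed

lemma sum_le_infsum:
  fixes f :: "'i \<Rightarrow> real"
  assumes "f summable_on UNIV" "\<And>l. 0 \<le> f l" "finite F"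
  shows "sum f F \<le> infsum f UNIV"
  by (rule finite_sum_le_infsum) (use assms in auto)

section \<open>Bounded continuous functions\<close>

definition cb :: "(real \<Rightarrow> complex) \<Rightarrow> bool" where
  "cb f \<longleftrightarrow> continuous_on UNIV f \<and> (\<exists>B. \<forall>x. norm (f x) \<le> B)"

lemma cbI: "continuous_on UNIV f \<Longrightarrow> (\<And>x. norm (f x) \<le> B) \<Longrightarrow> cb f"
  unfolding cb_def by blast

lemma cb_bfun: "cb f \<Longrightarrow> bfun f" unfolding cb_def using bfunI_continuous by blast
lemma cb_continuous: "cb f \<Longrightarrow> continuous_on UNIV f" unfolding cb_def by simp
lemma cbE: assumes "cb f" obtains B where "B \<ge> 0" "\<And>x. norm (f x) \<le> B"
  using bfunE[OF cb_bfun[OF assms]] by blast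

lemma cb_from_bfun: "continuous_on UNIV f \<Longrightarrow> bfun f \<Longrightarrow> cb f"
  unfolding cb_def bfun_def by blast

lemma cb_add: "cb f \<Longrightarrow> cb g \<Longrightarrow> cb (\<lambda>x. f x + g x)"
  using cb_from_bfun[OF continuous_on_add bfun_add] cb_continuous cb_bfun by blast
lemma cb_diff: "cb f \<Longrightarrow> cb g \<Longrightarrow> cb (\<lambda>x. f x - g x)"
  using cb_from_bfun[OF continuous_on_diff bfun_diff] cb_continuous cb_bfun by blast
lemma cb_mult: "cb f \<Longrightarrow> cb g \<Longrightarrow> cb (\<lambda>x. f x * g x)"
  using cb_from_bfun[OF continuous_on_mult bfun_mult] cb_continuous cb_bfun by blast
lemma cb_cnj: "cb f \<Longrightarrow> cb (\<lambda>x. cnj (f x))"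
  using cb_from_bfun[OF continuous_on_cnj bfun_cnj] cb_continuous cb_bfun by blast
lemma cb_const: "cb (\<lambda>x. c)"
  using cb_from_bfun[OF continuous_on_const bfun_const] .
lemma cb_shift:
  assumes "cb f" shows "cb (\<lambda>x. f (x + c))"
proof (rule cb_from_bfun[OF _ bfun_shift[OF cb_bfun[OF assms]]])
  show "continuous_on UNIV (\<lambda>x. f (x + c))"
    by (rule continuous_on_compose2[OF cb_continuous[OF assms]]) (auto intro!: continuous_intros)
qed
lemma cb_fmul: "multiplier m \<Longrightarrow> bfun f \<Longrightarrow> cb (fmul m f)"
  by (intro cb_from_bfun fmul_continuous bfun_fmul)

lemma continuous_on_uniform_bound:
  fixes f :: "real \<Rightarrow> complex"
  assumes "\<And>N. continuous_on UNIV (F N)" "\<And>N x. norm (F N x - f x) \<le> e N" "e \<longlonglongrightarrow> 0"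
  shows "continuous_on UNIV f"
proof (rule uniform_limit_theorem)
  show "uniform_limit UNIV F f sequentially"
    unfolding uniform_limit_iff
  proof (intro allI impI)
    fix d :: real assume "d > 0"
    hence "eventually (\<lambda>N. e N < d) sequentially" using order_tendstoD(2)[OF assms(3)] by blast
    thus "\<forall>\<^sub>F N in sequentially. \<forall>x\<in>UNIV. dist (F N x) (f x) < d"
      by eventually_elim (use assms(2) in \<open>auto simp: dist_norm intro: le_less_trans\<close>)
  qed
qed (use assms in auto)

lemma cb_infsum:
  fixes g :: "int \<Rightarrow> real \<Rightarrow> complex"
  assumes e: "e summable_on UNIV" and g: "\<And>l x. norm (g l x) \<le> e l" and c: "\<And>l. continuous_on UNIV (g l)"
  shows "cb (\<lambda>x. infsum (\<lambda>l. g l x) UNIV)"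
proof (rule cbI[of _ "infsum e UNIV"])
  show "norm (infsum (\<lambda>l. g l x) UNIV) \<le> infsum e UNIV" for x
    by (rule abs_summable_comparison(3)[OF e]) (use g in auto)
  show "continuous_on UNIV (\<lambda>x. infsum (\<lambda>l. g l x) UNIV)"
  proof (rule continuous_on_uniform_bound[where F="\<lambda>N x. \<Sum>l\<in>{- int N..int N}. g l x" and e="tl e"])
    show "continuous_on UNIV (\<lambda>x. \<Sum>l\<in>{- int N..int N}. g l x)" for N by (intro continuous_intros c)
    show "norm ((\<Sum>l\<in>{- int N..int N}. g l x) - infsum (\<lambda>l. g l x) UNIV) \<le> tl e N" for N x
      using norm_infsum_tail[OF e, of "\<lambda>l. g l x" N] g by (simp add: norm_minus_commute)
  qed (rule tl_LIMSEQ[OF e])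
qed

lemma fourier_inv_translate:
  "norm (fourier_inv (\<lambda>\<xi>. m (\<xi> - c)) x) = norm (fourier_inv m x)"
  using fourier_inv_shift[of m "- c" x] by (simp add: norm_mult)

section \<open>Frequency blocks\<close>

locale window =
  fixes \<eta> :: "real \<Rightarrow> real"
  assumes adm: "admissible_window \<eta>"
begin

definition eta :: "int \<Rightarrow> real \<Rightarrow> complex" where
  "eta k \<xi> = of_real (\<eta> (\<xi> - of_int k))"

text \<open>A fattened window, equal to 1 wherever \<open>eta k\<close> is nonzero. Inserting it in
  front of a block changes nothing, and lets an operator be estimated on \<open>blk k f\<close>
  instead of \<open>f\<close>, so that bounds come out in terms of \<open>bk k f\<close>.\<close>

definition etat :: "int \<Rightarrow> real \<Rightarrow> complex" where
  "etat k \<xi> = eta (k - 1) \<xi> + eta k \<xi> + eta (k + 1) \<xi>"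

lemma window_zero: "\<bar>\<xi>\<bar> \<ge> 1 \<Longrightarrow> \<eta> \<xi> = 0"
proof (rule ccontr)
  assume "\<bar>\<xi>\<bar> \<ge> 1" "\<eta> \<xi> \<noteq> 0"
  hence "\<xi> \<in> closure {\<xi>. \<eta> \<xi> \<noteq> 0}" using closure_subset[of "{\<xi>. \<eta> \<xi> \<noteq> 0}"] by auto
  hence "\<xi> \<in> {-1<..<1}" using adm unfolding admissible_window_def by blast
  thus False using \<open>\<bar>\<xi>\<bar> \<ge> 1\<close> by auto
qed

lemma window_even: "\<eta> (- \<xi>) = \<eta> \<xi>" using adm unfolding admissible_window_def by blast

lemma smooth_deriv:
  assumes "smooth (f :: real \<Rightarrow> 'a::real_normed_vector)"
  shows "(iter_deriv i f has_vector_derivative iter_deriv (Suc i) f x) (at x)"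
  using assms unfolding smooth_def iter_deriv_def by (simp add: vector_derivative_works)

lemma multiplier_window: "multiplier (\<lambda>\<xi>. of_real (\<eta> \<xi>))"
proof -
  have s: "smooth \<eta>" using adm unfolding admissible_window_def by blast
  let ?d = "\<lambda>i \<xi>. complex_of_real (iter_deriv i \<eta> \<xi>)"
  have d: "(?d i has_vector_derivative ?d (Suc i) \<xi>) (at \<xi>)" for i \<xi>
    by (rule bounded_linear.has_vector_derivative[OF bounded_linear_of_real smooth_deriv[OF s]])
  have "continuous_on UNIV (?d (Suc (Suc 0)))"
    by (rule has_vector_derivative_imp_continuous[OF d])
  hence "C2_with (?d 0) (?d (Suc 0)) (?d (Suc (Suc 0)))"
    using d unfolding C2_with_def by blast
  moreover have "?d 0 = (\<lambda>\<xi>. of_real (\<eta> \<xi>))" by (simp add: iter_deriv_def)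
  ultimately have "C2 (\<lambda>\<xi>. of_real (\<eta> \<xi>))" unfolding C2_def by metis
  thus ?thesis unfolding multiplier_def using window_zero by (auto intro!: exI[of _ 1])
qed

lemma multiplier_eta: "multiplier (eta k)"
  using multiplier_shift[OF multiplier_window, of "- of_int k"] unfolding eta_def[abs_def] by simp

lemma multiplier_etat: "multiplier (etat k)"
  unfolding etat_def[abs_def] by (intro multiplier_add multiplier_eta)

lemma eta_zero: "\<bar>\<xi> - of_int k\<bar> \<ge> 1 \<Longrightarrow> eta k \<xi> = 0"
  unfolding eta_def by (simp add: window_zero)

lemma etat_zero: "\<bar>\<xi> - of_int k\<bar> \<ge> 2 \<Longrightarrow> etat k \<xi> = 0"
  unfolding etat_def by (auto simp: eta_zero)

lemma eta_translate: "eta k \<xi> = eta 0 (\<xi> - of_int k)" by (simp add: eta_def)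
lemma etat_translate: "etat k \<xi> = etat 0 (\<xi> - of_int k)"
  by (simp add: etat_def eta_def algebra_simps)

lemma cnj_eta: "cnj (eta k (- \<xi>)) = eta (- k) \<xi>"
  using window_even[of "\<xi> + of_int k"] by (simp add: eta_def)

lemma eta_partition:
  assumes "finite F" "\<And>l. l \<notin> F \<Longrightarrow> \<bar>\<xi> - of_int l\<bar> \<ge> 1"
  shows "(\<Sum>l\<in>F. eta l \<xi>) = 1"
proof -
  have "((\<lambda>k::int. \<eta> (\<xi> - of_int k)) has_sum 1) UNIV" using adm unfolding admissible_window_def by blast
  hence "((\<lambda>k::int. \<eta> (\<xi> - of_int k)) has_sum 1) F"
    by (subst has_sum_cong_neutral[of UNIV F _ "\<lambda>k::int. \<eta> (\<xi> - of_int k)"]) (use assms window_zero in auto)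
  hence "(\<Sum>k\<in>F. \<eta> (\<xi> - of_int k)) = 1" using has_sum_finite[OF assms(1)] has_sum_unique by blast
  thus ?thesis unfolding eta_def by (metis of_real_1 of_real_sum)
qed

lemma etat_eta: "etat k \<xi> * eta k \<xi> = eta k \<xi>"
proof (cases "\<bar>\<xi> - of_int k\<bar> < 1")
  case True
  have "\<bar>\<xi> - of_int l\<bar> \<ge> 1" if "l \<notin> {k - 1, k, k + 1}" for l
  proof -
    have "l \<le> k - 2 \<or> l \<ge> k + 2" using that by auto
    hence "real_of_int l \<le> of_int k - 2 \<or> real_of_int l \<ge> of_int k + 2" by linarith
    thus ?thesis using True by linarith
  qed
  hence "(\<Sum>l\<in>{k - 1, k, k + 1}. eta l \<xi>) = 1" by (intro eta_partition) auto
  hence "etat k \<xi> = 1" unfolding etat_def by (simp add: add.assoc)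
  thus ?thesis by simp
qed (simp add: eta_zero)

lemma eta_0_0: "eta 0 0 = 1"
proof -
  have "(\<Sum>l\<in>{0}. eta l 0) = 1"
    by (rule eta_partition) (auto simp: abs_if)
  thus ?thesis by simp
qed

text \<open>All the multipliers are translates of finitely many, so their kernels obey common bounds.\<close>

definition decay_bound :: "(real \<Rightarrow> complex) \<Rightarrow> real" where
  "decay_bound m = (SOME C. C \<ge> 0 \<and> (\<forall>x. norm (fourier_inv m x) \<le> C * dk x))"

lemma decay_bound:
  assumes "multiplier m"
  shows "decay_bound m \<ge> 0" "norm (fourier_inv m x) \<le> decay_bound m * dk x"
proof -
  have "\<exists>C. C \<ge> 0 \<and> (\<forall>x. norm (fourier_inv m x) \<le> C * dk x)" using multiplier_decay[OF assms] by blast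
  from someI_ex[OF this] show "decay_bound m \<ge> 0" "norm (fourier_inv m x) \<le> decay_bound m * dk x"
    unfolding decay_bound_def by auto
qed

definition Ke :: real where "Ke = decay_bound (eta 0)"
definition Kt :: real where "Kt = decay_bound (etat 0)"
definition Kd :: real where "Kd = decay_bound (\<lambda>\<xi>. \<i> * of_real \<xi> * etat 0 \<xi>)"

lemma K_nonneg: "Ke \<ge> 0" "Kt \<ge> 0" "Kd \<ge> 0"
  unfolding Ke_def Kt_def Kd_def
  using decay_bound(1)[OF multiplier_eta] decay_bound(1)[OF multiplier_etat]
    decay_bound(1)[OF multiplier_times_id[OF multiplier_etat]] by auto

lemma eta_decay: "norm (fourier_inv (eta k) x) \<le> Ke * dk x"
proof -
  have "eta k = (\<lambda>\<xi>. eta 0 (\<xi> - of_int k))" by (intro ext) (rule eta_translate)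
  thus ?thesis using decay_bound(2)[OF multiplier_eta, of 0 x] unfolding Ke_def by (simp only: fourier_inv_translate)
qed

lemma etat_decay: "norm (fourier_inv (etat k) x) \<le> Kt * dk x"
proof -
  have "etat k = (\<lambda>\<xi>. etat 0 (\<xi> - of_int k))" by (intro ext) (rule etat_translate)
  thus ?thesis using decay_bound(2)[OF multiplier_etat, of 0 x] unfolding Kt_def by (simp only: fourier_inv_translate)
qed

text \<open>Splitting \<xi> into \<open>\<xi> - k\<close> and k gives a translate of one fixed
  symbol, whose kernel has a bound independent of k, plus k times the fattened window. Hence a
  derivative costs one power of the weight.\<close>

lemma detat_decay: "norm (fourier_inv (\<lambda>\<xi>. \<i> * of_real \<xi> * etat k \<xi>) x) \<le> (Kd + Kt) * (1 + \<bar>real_of_int k\<bar>) * dk x"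
proof -
  let ?d = "\<lambda>\<xi>. \<i> * of_real \<xi> * etat 0 \<xi>"
  have e: "(\<lambda>\<xi>. \<i> * of_real \<xi> * etat k \<xi>) = (\<lambda>\<xi>. ?d (\<xi> - of_int k) + \<i> * of_int k * etat k \<xi>)"
    by (auto simp: etat_translate[of k] fun_eq_iff algebra_simps)
  have m: "multiplier (\<lambda>\<xi>. ?d (\<xi> - of_int k))"
    using multiplier_shift[OF multiplier_times_id[OF multiplier_etat[of 0]], of "- of_int k"] by simp
  have m': "multiplier (\<lambda>\<xi>. \<i> * of_int k * etat k \<xi>)" by (intro multiplier_mult C2_const multiplier_etat)
  have "norm (fourier_inv (\<lambda>\<xi>. \<i> * of_real \<xi> * etat k \<xi>) x) \<le> norm (fourier_inv (\<lambda>\<xi>. ?d (\<xi> - of_int k)) x) + norm (\<i> * of_int k * fourier_inv (etat k) x)"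
    unfolding e fourier_inv_add[OF m m'] fourier_inv_cmult by (rule norm_triangle_ineq)
  also have "\<dots> \<le> Kd * dk x + \<bar>real_of_int k\<bar> * (Kt * dk x)"
  proof (rule add_mono)
    show "norm (fourier_inv (\<lambda>\<xi>. ?d (\<xi> - of_int k)) x) \<le> Kd * dk x"
      unfolding fourier_inv_translate[of ?d "of_int k"] Kd_def by (rule decay_bound(2)[OF multiplier_times_id[OF multiplier_etat]])
    show "norm (\<i> * of_int k * fourier_inv (etat k) x) \<le> \<bar>real_of_int k\<bar> * (Kt * dk x)"
      using etat_decay[of k x] by (simp add: norm_mult mult_left_mono)
  qed
  also have "\<dots> \<le> (Kd + Kt) * (1 + \<bar>real_of_int k\<bar>) * dk x"
    using K_nonneg by (simp add: algebra_simps)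
  finally show ?thesis .
qed

definition blk :: "int \<Rightarrow> (real \<Rightarrow> complex) \<Rightarrow> real \<Rightarrow> complex" where
  "blk k f = fmul (eta k) f"

definition bk :: "int \<Rightarrow> (real \<Rightarrow> complex) \<Rightarrow> real" where
  "bk k f = (SUP x. norm (blk k f x))"

lemma blk_norm_le: "bfun f \<Longrightarrow> (\<And>x. norm (f x) \<le> B) \<Longrightarrow> norm (blk k f x) \<le> Ke * dkc * B"
  unfolding blk_def by (rule fmul_norm_le[OF multiplier_eta _ eta_decay])

lemma bfun_blk: "bfun f \<Longrightarrow> bfun (blk k f)"
  unfolding blk_def by (intro bfun_fmul multiplier_eta)

lemma norm_blk_le_bk: "bfun f \<Longrightarrow> norm (blk k f x) \<le> bk k f"
  unfolding bk_def
proof (rule cSUP_upper)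
  assume "bfun f"
  then obtain B where "\<And>x. norm (blk k f x) \<le> B" using bfun_blk bfunE by metis
  thus "bdd_above (range (\<lambda>x. norm (blk k f x)))" by (auto simp: bdd_above_def)
qed simp

lemma bk_le: "(\<And>x. norm (blk k f x) \<le> C) \<Longrightarrow> bk k f \<le> C"
  unfolding bk_def by (rule cSUP_least) auto

lemma bk_nonneg: "bfun f \<Longrightarrow> bk k f \<ge> 0"
  using norm_blk_le_bk[of f k 0] by (meson norm_ge_zero order_trans)

lemma bk_le_sup: "bfun f \<Longrightarrow> (\<And>x. norm (f x) \<le> B) \<Longrightarrow> bk k f \<le> Ke * dkc * B"
  by (intro bk_le blk_norm_le)

lemma bk_add: "bfun f \<Longrightarrow> bfun g \<Longrightarrow> bk k (\<lambda>x. f x + g x) \<le> bk k f + bk k g"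
proof (rule bk_le)
  fix x assume a: "bfun f" "bfun g"
  have "blk k (\<lambda>x. f x + g x) x = blk k f x + blk k g x" unfolding blk_def by (rule fmul_add[OF multiplier_eta a])
  thus "norm (blk k (\<lambda>x. f x + g x) x) \<le> bk k f + bk k g"
    using norm_triangle_ineq[of "blk k f x" "blk k g x"] norm_blk_le_bk[of f k x] norm_blk_le_bk[of g k x] a by auto
qed

lemma bk_diff: "bfun f \<Longrightarrow> bfun g \<Longrightarrow> bk k (\<lambda>x. f x - g x) \<le> bk k f + bk k g"
proof (rule bk_le)
  fix x assume a: "bfun f" "bfun g"
  have "blk k (\<lambda>x. f x - g x) x = blk k f x - blk k g x" unfolding blk_def by (rule fmul_diff[OF multiplier_eta a])
  thus "norm (blk k (\<lambda>x. f x - g x) x) \<le> bk k f + bk k g"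
    using norm_triangle_ineq4[of "blk k f x" "blk k g x"] norm_blk_le_bk[of f k x] norm_blk_le_bk[of g k x] a by auto
qed

lemma bk_shift: "bk k (\<lambda>x. f (x + c)) = bk k f"
proof -
  have "range (\<lambda>x. norm (blk k f (x + c))) = range (\<lambda>x. norm (blk k f x))"
    by (auto simp: image_iff) (metis diff_add_cancel)
  thus ?thesis unfolding bk_def blk_def by (simp only: fmul_shift)
qed

lemma fmul_etat_blk: "bfun f \<Longrightarrow> fmul (etat k) (blk k f) x = blk k f x"
  unfolding blk_def by (simp add: fmul_fmul multiplier_eta multiplier_etat etat_eta)

lemma fmul_blk_norm_le:
  assumes "multiplier m" "bfun f" "\<And>x. norm (fourier_inv m x) \<le> C * dk x"
  shows "norm (fmul m (blk k f) x) \<le> C * dkc * bk k f"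
  using assms by (intro fmul_norm_le bfun_blk norm_blk_le_bk)

text \<open>Every symbol has compact support and is therefore covered by finitely many windows, so
  all multipliers annihilate \<open>f\<close>; an approximate identity made of multipliers then
  recovers \<open>f\<close> pointwise.\<close>

lemma blk_eq_0_imp_0:
  assumes f: "cb f" and z: "\<And>k x. blk k f x = 0"
  shows "f x = 0"
proof -
  have m: "fmul m f x = 0" if m: "multiplier m" for m
  proof -
    obtain L where L: "\<And>\<xi>. L < \<bar>\<xi>\<bar> \<Longrightarrow> m \<xi> = 0" using m unfolding multiplier_def by blast
    define N where "N = nat \<lceil>\<bar>L\<bar>\<rceil> + 1"
    have "m \<xi> = (\<Sum>l\<in>{- int N..int N}. m \<xi> * eta l \<xi>)" for \<xi>
    proof (cases "L < \<bar>\<xi>\<bar>")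
      case False
      have "\<bar>\<xi> - of_int l\<bar> \<ge> 1" if "l \<notin> {- int N..int N}" for l
      proof -
        have "\<bar>l\<bar> \<ge> int N + 1" using that by auto
        hence "\<bar>real_of_int l\<bar> \<ge> real N + 1" by linarith
        moreover have "\<bar>\<xi>\<bar> \<le> real N" using False unfolding N_def by linarith
        ultimately show ?thesis by linarith
      qed
      hence "(\<Sum>l\<in>{- int N..int N}. eta l \<xi>) = 1" by (intro eta_partition) auto
      thus ?thesis by (simp flip: sum_distrib_left)
    qed (use L in auto)
    hence "m = (\<lambda>\<xi>. \<Sum>l\<in>{- int N..int N}. m \<xi> * eta l \<xi>)" by blast
    moreover have "fmul (\<lambda>\<xi>. \<Sum>l\<in>{- int N..int N}. m \<xi> * eta l \<xi>) f x = 
        (\<Sum>l\<in>{- int N..int N}. fmul m (blk l f) x)"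
      unfolding blk_def using m f
      by (subst fmul_sum_left) (auto intro!: multiplier_mult multiplier_C2 multiplier_eta cb_bfun simp: fmul_fmul multiplier_eta cb_bfun[OF f])
    moreover have "blk l f = (\<lambda>x. 0)" for l using z by auto
    ultimately show ?thesis by (metis (no_types, lifting) fmul_zero_right sum.neutral)
  qed
  have "(\<lambda>n. fmul (\<lambda>\<xi>. eta 0 (1 / Suc n * \<xi>)) f x) \<longlonglongrightarrow> eta 0 0 * f x"
    by (rule fmul_approx_identity[OF multiplier_eta cb_bfun[OF f] cb_continuous[OF f]])
  moreover have "fmul (\<lambda>\<xi>. eta 0 (1 / Suc n * \<xi>)) f x = 0" for n
    using m[OF multiplier_affine[OF multiplier_eta, of "1 / Suc n" 0 0]] by simp
  ultimately show ?thesis by (simp add: eta_0_0 LIMSEQ_const_iff)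
qed

section \<open>Synthesis\<close>

text \<open>Reassembles a function from arbitrary bounded pieces, not only from its own blocks: each
  piece is first localised near its frequency. This freedom is essential for gluing, because cutting
  blocks off in space destroys their frequency localisation.\<close>

definition syn :: "(int \<Rightarrow> real \<Rightarrow> complex) \<Rightarrow> real \<Rightarrow> complex" where
  "syn G x = infsum (\<lambda>l. fmul (etat l) (G l) x) UNIV"

lemma syn_term_le:
  assumes "bfun (G l)" "\<And>x. norm (G l x) \<le> e l"
  shows "norm (fmul (etat l) (G l) x) \<le> Kt * dkc * e l"
  by (rule fmul_norm_le[OF multiplier_etat assms(1) etat_decay assms(2)])

context
  fixes G :: "int \<Rightarrow> real \<Rightarrow> complex" and e :: "int \<Rightarrow> real"
  assumes G: "\<And>l. bfun (G l)" "\<And>l x. norm (G l x) \<le> e l" and e: "e summable_on UNIV"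
begin

lemma syn_bound_summable: "(\<lambda>l. Kt * dkc * e l) summable_on UNIV"
  by (intro summable_on_cmult_right e)

lemma cb_syn: "cb (syn G)"
proof -
  have "cb (\<lambda>x. infsum (\<lambda>l. fmul (etat l) (G l) x) UNIV)"
    by (rule cb_infsum[OF syn_bound_summable]) (auto intro!: syn_term_le G fmul_continuous multiplier_etat)
  thus ?thesis unfolding syn_def[abs_def] .
qed

lemma syn_partial: "norm ((\<Sum>l\<in>{- int N..int N}. fmul (etat l) (G l) x) - syn G x) \<le> tl (\<lambda>l. Kt * dkc * e l) N"
  using norm_infsum_tail[OF syn_bound_summable, of "\<lambda>l. fmul (etat l) (G l) x" N] syn_term_le[of G _ e, OF G]
  unfolding syn_def by (simp add: norm_minus_commute)

text \<open>Only finitely many fattened windows overlap the symbol, so the images of the partial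
  sums are eventually constant; uniform convergence passes this to the limit.\<close>

lemma fmul_syn:
  assumes m: "multiplier m" and F: "finite F" "\<And>l \<xi>. l \<notin> F \<Longrightarrow> m \<xi> * etat l \<xi> = 0"
  shows "fmul m (syn G) x = (\<Sum>l\<in>F. fmul m (fmul (etat l) (G l)) x)"
proof -
  let ?S = "\<lambda>N x. \<Sum>l\<in>{- int N..int N}. fmul (etat l) (G l) x"
  have lim: "(\<lambda>N. fmul m (?S N) x) \<longlonglongrightarrow> fmul m (syn G) x"
    by (rule fmul_LIMSEQ[OF m cb_bfun[OF cb_syn] _ syn_partial tl_LIMSEQ[OF syn_bound_summable]])
      (intro bfun_sum bfun_fmul multiplier_etat G)
  have "\<forall>\<^sub>F N in sequentially. fmul m (?S N) x = (\<Sum>l\<in>F. fmul m (fmul (etat l) (G l)) x)"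
    using int_interval_exhausts[OF F(1)]
  proof eventually_elim
    case (elim N)
    have "fmul m (?S N) x = (\<Sum>l\<in>{- int N..int N}. fmul m (fmul (etat l) (G l)) x)"
      by (rule fmul_sum[OF m]) (intro bfun_fmul multiplier_etat G)
    also have "\<dots> = (\<Sum>l\<in>F. fmul m (fmul (etat l) (G l)) x)"
      by (rule sum.mono_neutral_right) (use elim F(1) in \<open>auto simp: fmul_fmul m multiplier_etat G F(2)\<close>)
    finally show ?case .
  qed
  hence "(\<lambda>N. fmul m (?S N) x) \<longlonglongrightarrow> (\<Sum>l\<in>F. fmul m (fmul (etat l) (G l)) x)" by (rule tendsto_eventually)
  with lim show ?thesis by (rule LIMSEQ_unique)
qed

lemma bk_syn: "bk k (syn G) \<le> Ke * dkc * Kt * dkc * (\<Sum>j\<in>{-2..2}. e (k + j))"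
proof (rule bk_le)
  fix x
  have "blk k (syn G) x = (\<Sum>l\<in>{k - 2..k + 2}. fmul (eta k) (fmul (etat l) (G l)) x)"
    unfolding blk_def
  proof (rule fmul_syn[OF multiplier_eta])
    \<comment> \<open>\<open>eta k\<close> lives within distance 1 of k and \<open>etat l\<close>
      within distance 2 of l, so frequencies at distance 3 or more do not interact and five
      neighbours remain.\<close>
    fix l \<xi> assume "l \<notin> {k - 2..k + 2}"
    hence "\<bar>k - l\<bar> \<ge> 3" by auto
    hence "\<bar>real_of_int k - real_of_int l\<bar> \<ge> 3" by linarith
    hence "\<bar>\<xi> - of_int k\<bar> \<ge> 1 \<or> \<bar>\<xi> - real_of_int l\<bar> \<ge> 2" by linarith
    thus "eta k \<xi> * etat l \<xi> = 0" using eta_zero etat_zero by auto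
  qed simp
  hence "norm (blk k (syn G) x) \<le> (\<Sum>l\<in>{k - 2..k + 2}. norm (fmul (eta k) (fmul (etat l) (G l)) x))"
    by (simp add: norm_sum)
  also have "\<dots> \<le> (\<Sum>l\<in>{k - 2..k + 2}. Ke * dkc * (Kt * dkc * e l))"
    by (intro sum_mono fmul_norm_le multiplier_eta eta_decay bfun_fmul multiplier_etat G syn_term_le)
  also have "\<dots> = Ke * dkc * Kt * dkc * (\<Sum>l\<in>{k - 2..k + 2}. e l)" by (simp add: sum_distrib_left mult_ac)
  also have "(\<Sum>l\<in>{k - 2..k + 2}. e l) = (\<Sum>j\<in>{-2..2}. e (k + j))"
    by (rule sum.reindex_bij_witness[of _ "\<lambda>j. k + j" "\<lambda>l. l - k"]) auto
  finally show "norm (blk k (syn G) x) \<le> Ke * dkc * Kt * dkc * (\<Sum>j\<in>{-2..2}. e (k + j))" .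
qed

end

lemma syn_diff:
  assumes G: "\<And>l. bfun (G l)" "\<And>l x. norm (G l x) \<le> e l" and e: "e summable_on UNIV"
    and G': "\<And>l. bfun (G' l)" "\<And>l x. norm (G' l x) \<le> e' l" and e': "e' summable_on UNIV"
  shows "syn G x - syn G' x = syn (\<lambda>l x. G l x - G' l x) x"
proof -
  have 1: "(\<lambda>l. fmul (etat l) (G l) x) summable_on UNIV"
    by (rule abs_summable_comparison(2)[OF syn_bound_summable[OF G e]]) (rule syn_term_le[OF G])
  have 2: "(\<lambda>l. fmul (etat l) (G' l) x) summable_on UNIV"
    by (rule abs_summable_comparison(2)[OF syn_bound_summable[OF G' e']]) (rule syn_term_le[OF G'])
  have "syn (\<lambda>l x. G l x - G' l x) x = infsum (\<lambda>l. fmul (etat l) (G l) x - fmul (etat l) (G' l) x) UNIV"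
    unfolding syn_def by (simp add: fmul_diff multiplier_etat G G')
  also have "\<dots> = syn G x - syn G' x"
    unfolding syn_def using infsum_add[OF 1, of "\<lambda>l. - fmul (etat l) (G' l) x"] 2
    by (simp add: infsum_uminus summable_on_uminus)
  finally show ?thesis ..
qed

text \<open>The difference has only zero blocks: on the support of \<open>eta k\<close> the windows
  from \<open>k - 2\<close> to \<open>k + 2\<close> already sum to 1, so synthesis and identity have
  the same block there.\<close>

lemma syn_blk:
  assumes f: "cb f" and s: "(\<lambda>k. bk k f) summable_on UNIV"
  shows "syn (\<lambda>l. blk l f) = f"
proof -
  note b = bfun_blk[OF cb_bfun[OF f]] norm_blk_le_bk[OF cb_bfun[OF f]]
  have "blk k (\<lambda>x. f x - syn (\<lambda>l. blk l f) x) x = 0" for k x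
  proof -
    have "fmul (eta k) (syn (\<lambda>l. blk l f)) x = (\<Sum>l\<in>{k - 2..k + 2}. fmul (eta k) (fmul (etat l) (blk l f)) x)"
    proof (rule fmul_syn[OF b s multiplier_eta])
      fix l \<xi> assume "l \<notin> {k - 2..k + 2}"
      hence "\<bar>k - l\<bar> \<ge> 3" by auto
      hence "\<bar>real_of_int k - real_of_int l\<bar> \<ge> 3" by linarith
      hence "\<bar>\<xi> - of_int k\<bar> \<ge> 1 \<or> \<bar>\<xi> - real_of_int l\<bar> \<ge> 2" by linarith
      thus "eta k \<xi> * etat l \<xi> = 0" using eta_zero etat_zero by auto
    qed simp
    also have "\<dots> = (\<Sum>l\<in>{k - 2..k + 2}. fmul (\<lambda>\<xi>. eta k \<xi> * eta l \<xi>) f x)"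
    proof (rule sum.cong[OF refl])
      fix l
      have "fmul (etat l) (blk l f) = blk l f" using fmul_etat_blk[OF cb_bfun[OF f]] by auto
      thus "fmul (eta k) (fmul (etat l) (blk l f)) x = fmul (\<lambda>\<xi>. eta k \<xi> * eta l \<xi>) f x"
        by (simp add: blk_def fmul_fmul multiplier_eta cb_bfun[OF f])
    qed
    also have "\<dots> = fmul (\<lambda>\<xi>. \<Sum>l\<in>{k - 2..k + 2}. eta k \<xi> * eta l \<xi>) f x"
      by (rule fmul_sum_left[symmetric]) (auto intro!: multiplier_mult multiplier_C2 multiplier_eta cb_bfun f)
    also have "(\<lambda>\<xi>. \<Sum>l\<in>{k - 2..k + 2}. eta k \<xi> * eta l \<xi>) = eta k"
    proof
      fix \<xi>
      show "(\<Sum>l\<in>{k - 2..k + 2}. eta k \<xi> * eta l \<xi>) = eta k \<xi>"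
      proof (cases "\<bar>\<xi> - of_int k\<bar> < 1")
        case True
        have "\<bar>\<xi> - of_int l\<bar> \<ge> 1" if "l \<notin> {k - 2..k + 2}" for l
        proof -
          have "\<bar>k - l\<bar> \<ge> 3" using that by auto
          hence "\<bar>real_of_int k - real_of_int l\<bar> \<ge> 3" by linarith
          thus ?thesis using True by linarith
        qed
        hence "(\<Sum>l\<in>{k - 2..k + 2}. eta l \<xi>) = 1" by (intro eta_partition) auto
        thus ?thesis by (simp flip: sum_distrib_left)
      qed (simp add: eta_zero)
    qed
    finally have "fmul (eta k) (syn (\<lambda>l. blk l f)) x = fmul (eta k) f x" .
    moreover have "fmul (eta k) (\<lambda>x. f x - syn (\<lambda>l. blk l f) x) x = fmul (eta k) f x - fmul (eta k) (syn (\<lambda>l. blk l f)) x"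
      by (rule fmul_diff[OF multiplier_eta cb_bfun[OF f] cb_bfun[OF cb_syn[OF b s]]])
    ultimately show ?thesis by (simp add: blk_def[of k])
  qed
  hence "f x - syn (\<lambda>l. blk l f) x = 0" for x
    by (intro blk_eq_0_imp_0[of "\<lambda>x. f x - syn (\<lambda>l. blk l f) x"] cb_diff f cb_syn[OF b s])
  thus ?thesis by auto
qed

end

section \<open>Weighted norms\<close>

text \<open>For \<open>\<epsilon> = 1\<close> this is comparable with the weight of the space. A
  small \<epsilon> leaves frequencies below \<open>1 / \<epsilon>\<close> almost unweighted while
  the growth at infinity keeps its order.\<close>

definition wt :: "real \<Rightarrow> nat \<Rightarrow> int \<Rightarrow> real" where
  "wt \<epsilon> s k = (1 + \<epsilon> * \<bar>real_of_int k\<bar>) ^ s"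

lemma wt_ge_1: "\<epsilon> \<ge> 0 \<Longrightarrow> wt \<epsilon> s k \<ge> 1" unfolding wt_def by (intro one_le_power) auto
lemma wt_nonneg: "\<epsilon> \<ge> 0 \<Longrightarrow> wt \<epsilon> s k \<ge> 0" using wt_ge_1[of \<epsilon> s k] by simp
lemma wt_minus [simp]: "wt \<epsilon> s (- k) = wt \<epsilon> s k" by (simp add: wt_def)
lemma wt_0 [simp]: "wt \<epsilon> 0 k = 1" by (simp add: wt_def)

lemma wt_mono: "0 \<le> \<epsilon> \<Longrightarrow> \<epsilon> \<le> 1 \<Longrightarrow> wt \<epsilon> s k \<le> wt 1 s k"
  unfolding wt_def by (intro power_mono add_left_mono mult_right_mono) auto

lemma wt_mono_exp: "\<epsilon> \<ge> 0 \<Longrightarrow> s \<le> s' \<Longrightarrow> wt \<epsilon> s k \<le> wt \<epsilon> s' k"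
  unfolding wt_def by (intro power_increasing) auto

text \<open>The discarded cross term
  \<open>\<epsilon> * \<bar>k\<bar> * (\<epsilon> * \<bar>l\<bar>)\<close> is nonnegative, so the
  constant is 1 for every \<epsilon>. Through this the cubic estimates are uniform in
  \<epsilon>.\<close>

lemma wt_add: "\<epsilon> \<ge> 0 \<Longrightarrow> wt \<epsilon> s (k + l) \<le> wt \<epsilon> s k * wt \<epsilon> s l"
proof -
  assume e: "\<epsilon> \<ge> 0"
  have "1 + \<epsilon> * \<bar>real_of_int (k + l)\<bar> \<le> 1 + \<epsilon> * (\<bar>real_of_int k\<bar> + \<bar>real_of_int l\<bar>)"
    using e by (intro add_left_mono mult_left_mono) auto
  also have "\<dots> \<le> (1 + \<epsilon> * \<bar>real_of_int k\<bar>) * (1 + \<epsilon> * \<bar>real_of_int l\<bar>)"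
    using e by (simp add: algebra_simps)
  finally show ?thesis unfolding wt_def power_mult_distrib[symmetric] using e by (intro power_mono) auto
qed

lemma wt_small: "0 \<le> \<epsilon> \<Longrightarrow> \<epsilon> \<le> 1 \<Longrightarrow> \<bar>j\<bar> \<le> n \<Longrightarrow> wt \<epsilon> s j \<le> (1 + real_of_int n) ^ s"
  unfolding wt_def by (intro power_mono add_left_mono order_trans[OF mult_right_mono[of \<epsilon> 1]]) auto

lemma wt_near:
  assumes "0 \<le> \<epsilon>" "\<epsilon> \<le> 1" "\<bar>k - l\<bar> \<le> n"
  shows "wt \<epsilon> s k \<le> (1 + real_of_int n) ^ s * wt \<epsilon> s l"
proof -
  have "wt \<epsilon> s k \<le> wt \<epsilon> s (k - l) * wt \<epsilon> s l" using wt_add[OF assms(1), of s "k - l" l] by simp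
  also have "\<dots> \<le> (1 + real_of_int n) ^ s * wt \<epsilon> s l"
    by (intro mult_right_mono wt_small assms wt_nonneg)
  finally show ?thesis .
qed

lemma sum_product3:
  fixes u v w :: "'i \<Rightarrow> 'a::comm_semiring_0"
  shows "(\<Sum>a\<in>A. u a) * (\<Sum>b\<in>B. v b) * (\<Sum>c\<in>C. w c) = (\<Sum>a\<in>A. \<Sum>b\<in>B. \<Sum>c\<in>C. u a * v b * w c)"
  by (subst sum_product, subst sum_distrib_right, rule sum.cong[OF refl], subst sum_distrib_right,
      rule sum.cong[OF refl], rule sum_distrib_left)

context window begin

definition X :: "nat \<Rightarrow> (real \<Rightarrow> complex) \<Rightarrow> bool" where
  "X s f \<longleftrightarrow> cb f \<and> (\<lambda>k. wt 1 s k * bk k f) summable_on UNIV"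

text \<open>The sum takes the default value 0 where it diverges, so a bound on \<open>nrm\<close>
  carries information only together with a membership \<open>X s f\<close>.\<close>

definition nrm :: "real \<Rightarrow> nat \<Rightarrow> (real \<Rightarrow> complex) \<Rightarrow> real" where
  "nrm \<epsilon> s f = infsum (\<lambda>k. wt \<epsilon> s k * bk k f) UNIV"

lemma X_cb: "X s f \<Longrightarrow> cb f" unfolding X_def by simp
lemma X_bfun: "X s f \<Longrightarrow> bfun f" using X_cb cb_bfun by blast

lemma X_bk_nonneg: "X s f \<Longrightarrow> bk k f \<ge> 0" using X_bfun bk_nonneg by blast

lemma term_nonneg: "X s f \<Longrightarrow> 0 \<le> \<epsilon> \<Longrightarrow> 0 \<le> wt \<epsilon> s' k * bk k f"
  by (intro mult_nonneg_nonneg wt_nonneg X_bk_nonneg)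

lemma X_summable:
  assumes "X s f" "0 \<le> \<epsilon>" "\<epsilon> \<le> 1" "s' \<le> s"
  shows "(\<lambda>k. wt \<epsilon> s' k * bk k f) summable_on UNIV"
proof (rule summable_nonneg_comparison(1))
  show "(\<lambda>k. wt 1 s k * bk k f) summable_on UNIV" using assms unfolding X_def by simp
  show "0 \<le> wt \<epsilon> s' k * bk k f" for k using term_nonneg[OF assms(1,2)] .
  show "wt \<epsilon> s' k * bk k f \<le> wt 1 s k * bk k f" for k
    using wt_mono[OF assms(2,3), of s' k] wt_mono_exp[of 1 s' s k] assms X_bk_nonneg[OF assms(1)]
    by (intro mult_right_mono) auto
qed

lemma X_mono: "X s f \<Longrightarrow> s' \<le> s \<Longrightarrow> X s' f"
  using X_summable[of s f 1 s'] unfolding X_def by simp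

lemma X_summable_bk: "X s f \<Longrightarrow> (\<lambda>k. bk k f) summable_on UNIV"
  using X_summable[of s f 1 0] by simp

lemma XI:
  assumes "cb f" "\<And>F. finite F \<Longrightarrow> (\<Sum>k\<in>F. wt 1 s k * bk k f) \<le> M"
  shows "X s f" "nrm 1 s f \<le> M"
proof -
  have nn: "0 \<le> wt 1 s k * bk k f" for k
    by (intro mult_nonneg_nonneg wt_nonneg bk_nonneg cb_bfun assms) simp
  show "X s f" unfolding X_def using summable_bounded_sums(1)[OF nn assms(2)] assms(1) by simp
  show "nrm 1 s f \<le> M" unfolding nrm_def using summable_bounded_sums(2)[OF nn assms(2)] .
qed

lemma nrm_le:
  assumes "X s f" "0 \<le> \<epsilon>" "\<And>F. finite F \<Longrightarrow> (\<Sum>k\<in>F. wt \<epsilon> s' k * bk k f) \<le> M"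
  shows "nrm \<epsilon> s' f \<le> M"
  unfolding nrm_def using summable_bounded_sums(2)[OF term_nonneg[OF assms(1,2)] assms(3)] .

lemma sum_le_nrm:
  assumes "X s f" "0 \<le> \<epsilon>" "\<epsilon> \<le> 1" "finite F"
  shows "(\<Sum>k\<in>F. wt \<epsilon> s k * bk k f) \<le> nrm \<epsilon> s f"
  unfolding nrm_def by (rule sum_le_infsum[OF X_summable[OF assms(1-3) order_refl] _ assms(4)]) (rule term_nonneg[OF assms(1,2)])

lemma nrm_nonneg: "X s f \<Longrightarrow> 0 \<le> \<epsilon> \<Longrightarrow> 0 \<le> nrm \<epsilon> s' f"
  unfolding nrm_def using term_nonneg by (intro infsum_nonneg)

lemma nrm_mono_weight:
  assumes "X s f" "0 \<le> \<epsilon>" "\<epsilon> \<le> 1" shows "nrm \<epsilon> s f \<le> nrm 1 s f"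
  unfolding nrm_def
  using X_summable[OF assms order_refl] X_summable[OF assms(1) _ _ order_refl, of 1] wt_mono[OF assms(2,3)] X_bk_nonneg[OF assms(1)]
  by (intro infsum_mono mult_right_mono) auto

lemma nrm_mono_exp:
  assumes "X s f" "s' \<le> s" shows "nrm 1 s' f \<le> nrm 1 s f"
  unfolding nrm_def
  using X_summable[OF assms(1) _ _ assms(2), of 1] X_summable[OF assms(1) _ _ order_refl, of 1] wt_mono_exp[OF _ assms(2), of 1] X_bk_nonneg[OF assms(1)]
  by (intro infsum_mono mult_right_mono) auto

lemma
  assumes f: "X s f" and g: "X s g"
  shows X_add: "X s (\<lambda>x. f x + g x)"
    and nrm_add: "0 \<le> \<epsilon> \<Longrightarrow> \<epsilon> \<le> 1 \<Longrightarrow> nrm \<epsilon> s (\<lambda>x. f x + g x) \<le> nrm \<epsilon> s f + nrm \<epsilon> s g"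
    and X_diff: "X s (\<lambda>x. f x - g x)"
    and nrm_diff: "0 \<le> \<epsilon> \<Longrightarrow> \<epsilon> \<le> 1 \<Longrightarrow> nrm \<epsilon> s (\<lambda>x. f x - g x) \<le> nrm \<epsilon> s f + nrm \<epsilon> s g"
proof -
  note b = X_bfun[OF f] X_bfun[OF g]
  have fin: "(\<Sum>k\<in>F. wt \<epsilon> s k * bk k h) \<le> nrm \<epsilon> s f + nrm \<epsilon> s g"
    if h: "\<And>k. bk k h \<le> bk k f + bk k g" and e: "0 \<le> \<epsilon>" "\<epsilon> \<le> 1" and F: "finite F" for \<epsilon> F h
  proof -
    have "(\<Sum>k\<in>F. wt \<epsilon> s k * bk k h) \<le> (\<Sum>k\<in>F. wt \<epsilon> s k * bk k f + wt \<epsilon> s k * bk k g)"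
      using h e by (intro sum_mono) (simp add: distrib_left[symmetric] mult_left_mono wt_nonneg)
    also have "\<dots> \<le> nrm \<epsilon> s f + nrm \<epsilon> s g"
      unfolding sum.distrib by (intro add_mono sum_le_nrm f g e F)
    finally show ?thesis .
  qed
  note h1 = bk_add[OF b] and h2 = bk_diff[OF b]
  show 1: "X s (\<lambda>x. f x + g x)" by (rule XI(1)[OF cb_add[OF X_cb[OF f] X_cb[OF g]] fin[OF h1]]) auto
  show 2: "X s (\<lambda>x. f x - g x)" by (rule XI(1)[OF cb_diff[OF X_cb[OF f] X_cb[OF g]] fin[OF h2]]) auto
  show "nrm \<epsilon> s (\<lambda>x. f x + g x) \<le> nrm \<epsilon> s f + nrm \<epsilon> s g" if "0 \<le> \<epsilon>" "\<epsilon> \<le> 1"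
    by (rule nrm_le[OF 1 that(1) fin[OF h1 that]])
  show "nrm \<epsilon> s (\<lambda>x. f x - g x) \<le> nrm \<epsilon> s f + nrm \<epsilon> s g" if "0 \<le> \<epsilon>" "\<epsilon> \<le> 1"
    by (rule nrm_le[OF 2 that(1) fin[OF h2 that]])
qed

lemma nrm_triangle_reverse:
  assumes f: "X s f" and g: "X s g" and e: "0 \<le> \<epsilon>" "\<epsilon> \<le> 1"
  shows "nrm \<epsilon> s f \<le> nrm \<epsilon> s g + nrm \<epsilon> s (\<lambda>x. f x - g x)"
  using nrm_add[OF g X_diff[OF f g] e] by simp

lemma X_shift: "X s f \<Longrightarrow> X s (\<lambda>x. f (x + c))"
  unfolding X_def by (simp add: bk_shift cb_shift)

lemma nrm_shift: "nrm \<epsilon> s (\<lambda>x. f (x + c)) = nrm \<epsilon> s f"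
  unfolding nrm_def bk_shift ..

lemma blk_bounds: 
  assumes "X s f"
  shows "bfun (blk l f)" "norm (blk l f x) \<le> bk l f" "(\<lambda>k. bk k f) summable_on UNIV"
  using bfun_blk[OF X_bfun[OF assms]] norm_blk_le_bk[OF X_bfun[OF assms]] X_summable_bk[OF assms] by auto

lemma X_reconstruct: "X s f \<Longrightarrow> infsum (\<lambda>l. blk l f x) UNIV = f x"
proof -
  assume f: "X s f"
  have "infsum (\<lambda>l. blk l f x) UNIV = syn (\<lambda>l. blk l f) x"
    unfolding syn_def by (simp only: fmul_etat_blk[OF X_bfun[OF f]])
  thus ?thesis using syn_blk[OF X_cb[OF f] X_summable_bk[OF f]] by simp
qed

lemma X_partial: "X s f \<Longrightarrow> norm (f x - (\<Sum>l\<in>{- int N..int N}. blk l f x)) \<le> tl (\<lambda>k. bk k f) N"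
  using norm_infsum_tail[where e="\<lambda>k. bk k f" and g="\<lambda>l. blk l f x" and N=N] blk_bounds(2,3)[of s f] X_reconstruct[of s f x] by simp

lemma X_norm_le: "X s f \<Longrightarrow> norm (f x) \<le> nrm 1 s f"
proof -
  assume f: "X s f"
  have "norm (f x) \<le> infsum (\<lambda>k. bk k f) UNIV"
    using abs_summable_comparison(3)[OF blk_bounds(3)[OF f], of "\<lambda>l. blk l f x"] blk_bounds(2)[OF f] X_reconstruct[OF f, of x] by simp
  also have "\<dots> = nrm 1 0 f" by (simp add: nrm_def)
  also have "\<dots> \<le> nrm 1 s f" by (rule nrm_mono_exp[OF f]) simp
  finally show ?thesis .
qed

text \<open>A piece with index l reaches only the five blocks within distance 2, and weights that
  close differ by at most \<open>3 ^ s\<close> for all \<epsilon> in the unit interval; this is the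
  factor \<open>5 * 3 ^ s\<close>.\<close>

lemma syn_nrm:
  assumes G: "\<And>l. bfun (G l)" "\<And>l x. norm (G l x) \<le> e l"
    and e: "\<And>l. e l \<ge> 0" "(\<lambda>l. wt 1 s l * e l) summable_on UNIV"
  shows "X s (syn G)"
    and "0 \<le> \<epsilon> \<Longrightarrow> \<epsilon> \<le> 1 \<Longrightarrow> nrm \<epsilon> s (syn G) \<le> Ke * dkc * Kt * dkc * (5 * 3 ^ s) * infsum (\<lambda>l. wt \<epsilon> s l * e l) UNIV"
proof -
  let ?C = "Ke * dkc * Kt * dkc"
  have C: "?C \<ge> 0" using K_nonneg dkc_nonneg by simp
  have es: "(\<lambda>l. wt \<epsilon> s l * e l) summable_on UNIV" if "0 \<le> \<epsilon>" "\<epsilon> \<le> 1" for \<epsilon>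
    by (rule summable_nonneg_comparison(1)[OF e(2)])
      (use that e in \<open>auto intro!: mult_nonneg_nonneg mult_right_mono wt_mono wt_nonneg\<close>)
  have e0: "e summable_on UNIV"
    by (rule summable_nonneg_comparison(1)[OF e(2)]) (use e wt_ge_1[of 1 s] mult_right_mono[of 1 "wt 1 s _"] in fastforce)+
  have fin: "(\<Sum>k\<in>F. wt \<epsilon> s k * bk k (syn G)) \<le> ?C * (5 * 3 ^ s) * infsum (\<lambda>l. wt \<epsilon> s l * e l) UNIV"
    if \<epsilon>: "0 \<le> \<epsilon>" "\<epsilon> \<le> 1" and F: "finite F" for \<epsilon> F
  proof -
    let ?S = "infsum (\<lambda>l. wt \<epsilon> s l * e l) UNIV"
    have sh: "(\<Sum>k\<in>F. wt \<epsilon> s k * e (k + j)) \<le> 3 ^ s * ?S" if "j \<in> {-2..2}" for j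
    proof -
      have "(\<Sum>k\<in>F. wt \<epsilon> s k * e (k + j)) \<le> (\<Sum>k\<in>F. (3 ^ s * wt \<epsilon> s (k + j)) * e (k + j))"
        using wt_near[OF \<epsilon>, of _ "_ + j" 2 s] that e by (intro sum_mono mult_right_mono) auto
      also have "\<dots> = 3 ^ s * (\<Sum>k\<in>F. wt \<epsilon> s (k + j) * e (k + j))" by (simp add: sum_distrib_left mult.assoc)
      also have "(\<Sum>k\<in>F. wt \<epsilon> s (k + j) * e (k + j)) = (\<Sum>l\<in>(\<lambda>k. k + j) ` F. wt \<epsilon> s l * e l)"
        by (subst sum.reindex) (auto simp: inj_on_def)
      also have "3 ^ s * (\<Sum>l\<in>(\<lambda>k. k + j) ` F. wt \<epsilon> s l * e l) \<le> 3 ^ s * ?S"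
        using F e \<epsilon> by (intro mult_left_mono sum_le_infsum es) (auto intro!: mult_nonneg_nonneg wt_nonneg)
      finally show ?thesis .
    qed
    have "(\<Sum>k\<in>F. wt \<epsilon> s k * bk k (syn G)) \<le> (\<Sum>k\<in>F. wt \<epsilon> s k * (?C * (\<Sum>j\<in>{-2..2}. e (k + j))))"
      by (intro sum_mono mult_left_mono bk_syn[OF G e0] wt_nonneg \<epsilon>)
    also have "\<dots> = ?C * (\<Sum>k\<in>F. \<Sum>j\<in>{-2..2}. wt \<epsilon> s k * e (k + j))"
      by (simp add: sum_distrib_left mult_ac)
    also have "(\<Sum>k\<in>F. \<Sum>j\<in>{-2..2}. wt \<epsilon> s k * e (k + j)) = (\<Sum>j\<in>{-2..2}. \<Sum>k\<in>F. wt \<epsilon> s k * e (k + j))"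
      by (rule sum.swap)
    also have "?C * \<dots> \<le> ?C * (\<Sum>j\<in>{-2..2::int}. 3 ^ s * ?S)"
      by (intro mult_left_mono sum_mono sh C)
    finally show ?thesis by (simp add: mult_ac)
  qed
  show 1: "X s (syn G)" by (rule XI(1)[OF cb_syn[OF G e0] fin[of 1]]) auto
  show "nrm \<epsilon> s (syn G) \<le> ?C * (5 * 3 ^ s) * infsum (\<lambda>l. wt \<epsilon> s l * e l) UNIV" if "0 \<le> \<epsilon>" "\<epsilon> \<le> 1"
    by (rule nrm_le[OF 1 that(1) fin[OF that]])
qed

subsection \<open>Derivatives\<close>

definition dX :: "(real \<Rightarrow> complex) \<Rightarrow> real \<Rightarrow> complex" where
  "dX f x = infsum (\<lambda>l. fmul (\<lambda>\<xi>. \<i> * of_real \<xi> * eta l \<xi>) f x) UNIV"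

definition Kdd :: real where "Kdd = (Kd + Kt) * dkc"

lemma Kdd_nonneg: "Kdd \<ge> 0" using K_nonneg dkc_nonneg by (simp add: Kdd_def)

lemma dblk_le:
  assumes "bfun f"
  shows "norm (fmul (\<lambda>\<xi>. \<i> * of_real \<xi> * eta l \<xi>) f x) \<le> Kdd * (wt 1 1 l * bk l f)"
proof -
  have "fmul (\<lambda>\<xi>. \<i> * of_real \<xi> * eta l \<xi>) f x = fmul (\<lambda>\<xi>. \<i> * of_real \<xi> * etat l \<xi>) (blk l f) x"
    unfolding blk_def fmul_fmul[OF multiplier_times_id[OF multiplier_etat] multiplier_eta assms]
    by (simp only: mult.assoc etat_eta)
  also have "norm \<dots> \<le> (Kd + Kt) * (1 + \<bar>real_of_int l\<bar>) * dkc * bk l f"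
    by (rule fmul_blk_norm_le[OF multiplier_times_id[OF multiplier_etat] assms detat_decay])
  finally show ?thesis by (simp add: Kdd_def wt_def mult_ac)
qed

text \<open>The extra power of the weight makes the series of differentiated blocks converge
  uniformly, so the block series may be differentiated termwise. The blocks of the derivative are
  then read off by moving the derivative onto the kernel.\<close>

lemma
  assumes f: "X (Suc s) f"
  shows X_has_derivative: "(f has_vector_derivative dX f x) (at x)"
    and X_dX: "X s (dX f)"
    and nrm_dX: "nrm 1 s (dX f) \<le> Kdd * nrm 1 (Suc s) f"
proof -
  let ?D = "\<lambda>l. fmul (\<lambda>\<xi>. \<i> * of_real \<xi> * eta l \<xi>) f"
  let ?e = "\<lambda>l. Kdd * (wt 1 1 l * bk l f)"
  note bf = X_bfun[OF f]
  have e: "?e summable_on UNIV" by (intro summable_on_cmult_right X_summable[OF f]) auto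
  have D: "norm (?D l x) \<le> ?e l" for l x by (rule dblk_le[OF bf])
  have cb: "cb (dX f)"
  proof -
    have "cb (\<lambda>x. infsum (\<lambda>l. ?D l x) UNIV)"
      by (rule cb_infsum[OF e D]) (intro fmul_continuous multiplier_times_id multiplier_eta bf)
    thus ?thesis unfolding dX_def[abs_def] .
  qed
  let ?S = "\<lambda>N x. \<Sum>l\<in>{- int N..int N}. blk l f x"
  have S: "(?S N has_derivative (\<lambda>h. h *\<^sub>R (\<Sum>l\<in>{- int N..int N}. ?D l x))) (at x within UNIV)" for N x
  proof -
    have "(?S N has_vector_derivative (\<Sum>l\<in>{- int N..int N}. ?D l x)) (at x)"
      unfolding blk_def by (intro has_vector_derivative_sum fmul_has_derivative multiplier_eta bf)
    thus ?thesis unfolding has_vector_derivative_def by simp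
  qed
  have dd: "\<forall>\<^sub>F N in sequentially. \<forall>x\<in>UNIV. \<forall>h. norm (h *\<^sub>R (\<Sum>l\<in>{- int N..int N}. ?D l x) - h *\<^sub>R dX f x) \<le> d * norm h"
    if d: "d > 0" for d :: real
  proof -
    have "\<forall>\<^sub>F N in sequentially. tl ?e N < d" using order_tendstoD(2)[OF tl_LIMSEQ[OF e] d] .
    thus ?thesis
    proof eventually_elim
      case (elim N)
      show ?case
      proof (intro ballI allI)
        fix x h :: real
        have "norm ((\<Sum>l\<in>{- int N..int N}. ?D l x) - dX f x) \<le> d"
          using norm_infsum_tail[OF e, of "\<lambda>l. ?D l x" N] D elim unfolding dX_def by (simp add: norm_minus_commute)
        hence "norm h * norm ((\<Sum>l\<in>{- int N..int N}. ?D l x) - dX f x) \<le> norm h * d"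
          by (intro mult_left_mono) auto
        thus "norm (h *\<^sub>R (\<Sum>l\<in>{- int N..int N}. ?D l x) - h *\<^sub>R dX f x) \<le> d * norm h"
          by (simp only: scaleR_diff_right[symmetric] norm_scaleR real_norm_def mult.commute)
      qed
    qed
  qed
  have lim: "(\<lambda>N. ?S N x) \<longlonglongrightarrow> f x" for x
  proof -
    have "(\<lambda>N. f x - ?S N x) \<longlonglongrightarrow> 0"
      by (rule Lim_null_comparison[OF always_eventually tl_LIMSEQ[OF blk_bounds(3)[OF f]]]) (use X_partial[OF f] in auto)
    from tendsto_diff[OF tendsto_const[of "f x"] this] show ?thesis by simp
  qed
  have "\<exists>g. \<forall>x\<in>UNIV. (\<lambda>N. ?S N x) \<longlonglongrightarrow> g x \<and> (g has_derivative (\<lambda>h. h *\<^sub>R dX f x)) (at x within UNIV)"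
    by (rule has_derivative_sequence[OF convex_UNIV S dd UNIV_I lim])
  then obtain g where g: "\<And>x. (\<lambda>N. ?S N x) \<longlonglongrightarrow> g x" "\<And>x. (g has_derivative (\<lambda>h. h *\<^sub>R dX f x)) (at x)"
    by auto
  have "g = f" using LIMSEQ_unique[OF g(1) lim] by auto
  thus der: "(f has_vector_derivative dX f x) (at x)" for x using g(2) unfolding has_vector_derivative_def by simp
  have bk: "bk k (dX f) \<le> Kdd * (wt 1 1 k * bk k f)" for k
  proof (rule bk_le)
    fix x
    have "blk k (dX f) x = ?D k x"
      unfolding blk_def by (rule fmul_derivative[OF multiplier_eta bf cb_bfun[OF cb] cb_continuous[OF cb] der])
    thus "norm (blk k (dX f) x) \<le> Kdd * (wt 1 1 k * bk k f)" using D by simp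
  qed
  have "(\<Sum>k\<in>F. wt 1 s k * bk k (dX f)) \<le> Kdd * nrm 1 (Suc s) f" if "finite F" for F
  proof -
    have "(\<Sum>k\<in>F. wt 1 s k * bk k (dX f)) \<le> (\<Sum>k\<in>F. Kdd * (wt 1 (Suc s) k * bk k f))"
    proof (rule sum_mono)
      fix k
      have "wt 1 s k * bk k (dX f) \<le> wt 1 s k * (Kdd * (wt 1 1 k * bk k f))"
        by (intro mult_left_mono bk wt_nonneg) simp
      thus "wt 1 s k * bk k (dX f) \<le> Kdd * (wt 1 (Suc s) k * bk k f)" by (simp add: wt_def mult_ac)
    qed
    also have "\<dots> \<le> Kdd * nrm 1 (Suc s) f"
      unfolding sum_distrib_left[symmetric] by (intro mult_left_mono sum_le_nrm f that Kdd_nonneg) auto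
    finally show ?thesis .
  qed
  thus "X s (dX f)" "nrm 1 s (dX f) \<le> Kdd * nrm 1 (Suc s) f" using XI[OF cb] by blast+
qed

subsection \<open>Cubic products\<close>

text \<open>The frequencies of a product of blocks add up, so only blocks with \<open>\<bar>k - (a + b - c)\<bar> \<le> 3\<close>
  of the product of the blocks \<open>a\<close>, \<open>b\<close> and the conjugate of the block \<open>c\<close> survive.\<close>

lemma blk_triple:
  assumes "bfun f" "bfun g" "bfun h" "\<bar>k - (a + b - c)\<bar> \<ge> 4"
  shows "blk k (\<lambda>x. blk a f x * blk b g x * cnj (blk c h x)) x = 0"
proof -
  have z: "eta k \<xi> = 0" if "\<xi> \<notin> {of_int k - 1..of_int k + 1}" for k \<xi>
    using that by (intro eta_zero) auto
  have s1: "spec (of_int a - 1) (of_int a + 1) (blk a f)"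
    unfolding blk_def by (rule spec_fmul[OF multiplier_eta assms(1) z])
  have s2: "spec (of_int a - 1 + (of_int b - 1)) (of_int a + 1 + (of_int b + 1)) (\<lambda>x. blk a f x * blk b g x)"
    unfolding blk_def[of b] by (rule spec_mult[OF s1 bfun_blk[OF assms(1)] multiplier_eta z assms(2)])
  have c: "cnj (blk c h x) = fmul (eta (- c)) (\<lambda>x. cnj (h x)) x" for x
    unfolding blk_def fmul_cnj by (simp add: cnj_eta)
  have s3: "spec (of_int a - 1 + (of_int b - 1) + (of_int (- c) - 1)) (of_int a + 1 + (of_int b + 1) + (of_int (- c) + 1))
     (\<lambda>x. blk a f x * blk b g x * cnj (blk c h x))"
    unfolding c by (rule spec_mult[OF s2 bfun_mult[OF bfun_blk[OF assms(1)] bfun_blk[OF assms(2)]] multiplier_eta z bfun_cnj[OF assms(3)]])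
  have "eta k \<xi> = 0" if "\<xi> \<in> {of_int a - 1 + (of_int b - 1) + (of_int (- c) - 1)..of_int a + 1 + (of_int b + 1) + (of_int (- c) + 1)}" for \<xi>
  proof (rule eta_zero)
    have "\<bar>real_of_int k - (real_of_int a + real_of_int b - real_of_int c)\<bar> \<ge> 4" using assms(4) by linarith
    thus "\<bar>\<xi> - of_int k\<bar> \<ge> 1" using that by auto
  qed
  thus ?thesis using s3 multiplier_eta unfolding spec_def blk_def[of k] by blast
qed

text \<open>Seven output frequencies for each triple of input frequencies, and a factor
  \<open>4 ^ 5\<close> for comparing weights at distance at most 3.\<close>

definition Kc :: real where "Kc = Ke * dkc * (7 * 4 ^ 5)"

lemma Kc_nonneg: "Kc \<ge> 0" using K_nonneg dkc_nonneg by (simp add: Kc_def)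

text \<open>An algebra property of l^1 type: for fixed input frequencies a, b, c the output
  frequency is within 3 of \<open>a + b - c\<close>, where the weight is at most a constant times
  the product of the three input weights. Summing over a, b, c then factorises. Everything is first
  done for truncated block series, where all sums are finite.\<close>

lemma
  assumes f: "X 5 f" and g: "X 5 g" and h: "X 5 h"
  shows X_cubic: "X 5 (\<lambda>x. f x * g x * cnj (h x))"
    and nrm_cubic: "0 \<le> \<epsilon> \<Longrightarrow> \<epsilon> \<le> 1 \<Longrightarrow>
      nrm \<epsilon> 5 (\<lambda>x. f x * g x * cnj (h x)) \<le> Kc * nrm \<epsilon> 5 f * nrm \<epsilon> 5 g * nrm \<epsilon> 5 h"
proof -
  note bf = X_bfun[OF f] and bg = X_bfun[OF g] and bh = X_bfun[OF h]
  let ?P = "\<lambda>f N x. \<Sum>l\<in>{- int N..int N}. blk l f x"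
  let ?p = "\<lambda>x. f x * g x * cnj (h x)"
  have cb: "cb ?p" by (rule cb_mult[OF cb_mult[OF X_cb[OF f] X_cb[OF g]] cb_cnj[OF X_cb[OF h]]])
  let ?q = "\<lambda>N x. ?P f N x * ?P g N x * cnj (?P h N x)"
  have bq: "bfun (?q N)" for N by (intro bfun_mult bfun_cnj bfun_sum bfun_blk bf bg bh)
  have Pb: "norm (?P u N x) \<le> infsum (\<lambda>l. bk l u) UNIV" if "X 5 u" for u N x
  proof -
    have "norm (?P u N x) \<le> (\<Sum>l\<in>{- int N..int N}. bk l u)"
      by (rule order_trans[OF norm_sum sum_mono]) (rule blk_bounds(2)[OF that])
    also have "\<dots> \<le> infsum (\<lambda>l. bk l u) UNIV"
      by (rule sum_le_infsum[OF blk_bounds(3)[OF that]]) (auto intro: X_bk_nonneg[OF that])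
    finally show ?thesis .
  qed
  have ub: "norm (u x) \<le> infsum (\<lambda>l. bk l u) UNIV" if "X 5 u" for u x
    using abs_summable_comparison(3)[OF blk_bounds(3)[OF that], of "\<lambda>l. blk l u x"] blk_bounds(2)[OF that] X_reconstruct[OF that, of x] by simp
  let ?I = "\<lambda>u. infsum (\<lambda>l. bk l u) UNIV"
  have I0: "?I u \<ge> 0" if "X 5 u" for u using ub[OF that, of 0] norm_ge_zero order_trans by blast
  \<comment> \<open>The error of truncating the three factors one after the other, each remaining
    factor being bounded by its sum of block norms.\<close>
  define en where "en = (\<lambda>N. tl (\<lambda>l. bk l f) N * ?I g * ?I h + ?I f * tl (\<lambda>l. bk l g) N * ?I h + ?I f * ?I g * tl (\<lambda>l. bk l h) N)"
  have en: "en \<longlonglongrightarrow> 0"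
  proof -
    have "en \<longlonglongrightarrow> 0 * ?I g * ?I h + ?I f * 0 * ?I h + ?I f * ?I g * 0"
      unfolding en_def by (intro tendsto_intros tl_LIMSEQ blk_bounds(3)[OF f] blk_bounds(3)[OF g] blk_bounds(3)[OF h])
    thus ?thesis by simp
  qed
  have close: "norm (?p x - ?q N x) \<le> en N" for x N
  proof -
    have eq: "?p x - ?q N x = (f x - ?P f N x) * g x * cnj (h x) + ?P f N x * (g x - ?P g N x) * cnj (h x)
        + ?P f N x * ?P g N x * cnj (h x - ?P h N x)" by (simp add: algebra_simps)
    have "norm ((f x - ?P f N x) * g x * cnj (h x)) \<le> tl (\<lambda>l. bk l f) N * ?I g * ?I h"
      unfolding norm_mult complex_mod_cnj
      by (intro mult_mono X_partial[OF f] ub g h mult_nonneg_nonneg I0 norm_ge_zero order_trans[OF norm_ge_zero X_partial[OF f]])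
    moreover have "norm (?P f N x * (g x - ?P g N x) * cnj (h x)) \<le> ?I f * tl (\<lambda>l. bk l g) N * ?I h"
      unfolding norm_mult complex_mod_cnj
      by (intro mult_mono X_partial[OF g] ub Pb f g h mult_nonneg_nonneg I0 norm_ge_zero order_trans[OF norm_ge_zero X_partial[OF g]])
    moreover have "norm (?P f N x * ?P g N x * cnj (h x - ?P h N x)) \<le> ?I f * ?I g * tl (\<lambda>l. bk l h) N"
      unfolding norm_mult complex_mod_cnj
      by (intro mult_mono X_partial[OF h] ub Pb f g h mult_nonneg_nonneg I0 norm_ge_zero)
    ultimately show ?thesis unfolding eq en_def by (intro norm_triangle_le add_mono)
  qed
  have fin: "(\<Sum>k\<in>F. wt \<epsilon> 5 k * bk k ?p) \<le> Kc * nrm \<epsilon> 5 f * nrm \<epsilon> 5 g * nrm \<epsilon> 5 h"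
    if \<epsilon>: "0 \<le> \<epsilon>" "\<epsilon> \<le> 1" and F: "finite F" for \<epsilon> F
  proof -
    let ?w = "wt \<epsilon> 5"
    let ?K = "Ke * dkc"
    have K: "?K \<ge> 0" using K_nonneg dkc_nonneg by simp
    define B where "B = (\<lambda>a b c. bk a f * bk b g * bk c h)"
    have B0: "B a b c \<ge> 0" for a b c unfolding B_def by (intro mult_nonneg_nonneg X_bk_nonneg[OF f] X_bk_nonneg[OF g] X_bk_nonneg[OF h])
    define S where "S = (\<lambda>N k. \<Sum>a\<in>{- int N..int N}. \<Sum>b\<in>{- int N..int N}. \<Sum>c\<in>{- int N..int N}.
        (if \<bar>k - (a + b - c)\<bar> \<le> 3 then ?K * B a b c else 0))"
    have blkq: "norm (blk k (?q N) x) \<le> S N k" for k N x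
    proof -
      have t: "bfun (\<lambda>x. blk a f x * blk b g x * cnj (blk c h x))" for a b c
        by (intro bfun_mult bfun_cnj bfun_blk bf bg bh)
      have "?q N = (\<lambda>x. \<Sum>a\<in>{- int N..int N}. \<Sum>b\<in>{- int N..int N}. \<Sum>c\<in>{- int N..int N}. blk a f x * blk b g x * cnj (blk c h x))"
        by (intro ext) (simp only: cnj_sum sum_product3)
      hence "blk k (?q N) x = (\<Sum>a\<in>{- int N..int N}. \<Sum>b\<in>{- int N..int N}. \<Sum>c\<in>{- int N..int N}. blk k (\<lambda>x. blk a f x * blk b g x * cnj (blk c h x)) x)"
        unfolding blk_def[of k] by (simp add: fmul_sum multiplier_eta bfun_sum t)
      also have "norm \<dots> \<le> S N k"
        unfolding S_def
      proof (intro order_trans[OF norm_sum sum_mono])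
        fix a b c
        show "norm (blk k (\<lambda>x. blk a f x * blk b g x * cnj (blk c h x)) x) \<le> (if \<bar>k - (a + b - c)\<bar> \<le> 3 then ?K * B a b c else 0)"
        proof (cases "\<bar>k - (a + b - c)\<bar> \<le> 3")
          case True
          have "norm (blk k (\<lambda>x. blk a f x * blk b g x * cnj (blk c h x)) x) \<le> ?K * B a b c"
          proof (rule blk_norm_le[OF t])
            show "norm (blk a f x * blk b g x * cnj (blk c h x)) \<le> B a b c" for x
              unfolding norm_mult complex_mod_cnj B_def
              by (intro mult_mono norm_blk_le_bk bf bg bh mult_nonneg_nonneg norm_ge_zero X_bk_nonneg[OF f] X_bk_nonneg[OF g])
          qed
          thus ?thesis using True by simp
        qed (use blk_triple[OF bf bg bh, of k a b c x] in auto)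
      qed
      finally show ?thesis .
    qed
    have bkp: "bk k ?p \<le> S N k + ?K * en N" for k N
    proof (rule bk_le)
      fix x
      have "blk k ?p x = blk k (?q N) x + blk k (\<lambda>x. ?p x - ?q N x) x"
        unfolding blk_def[of k] by (subst fmul_diff[OF multiplier_eta cb_bfun[OF cb] bq]) simp
      moreover have "norm (blk k (\<lambda>x. ?p x - ?q N x) x) \<le> ?K * en N"
        by (rule blk_norm_le[OF bfun_diff[OF cb_bfun[OF cb] bq] close])
      ultimately show "norm (blk k ?p x) \<le> S N k + ?K * en N"
        using norm_triangle_mono[OF blkq[of k N x]] by (simp only:)
    qed
    have SF: "(\<Sum>k\<in>F. ?w k * S N k) \<le> Kc * nrm \<epsilon> 5 f * nrm \<epsilon> 5 g * nrm \<epsilon> 5 h" for N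
    proof -
      have per: "(\<Sum>k\<in>F. ?w k * (if \<bar>k - (a + b - c)\<bar> \<le> 3 then ?K * B a b c else 0)) \<le> Kc * (?w a * bk a f) * (?w b * bk b g) * (?w c * bk c h)" for a b c
      proof -
        let ?n = "a + b - c"
        have wn: "?w ?n \<le> ?w a * ?w b * ?w c"
        proof -
          have "?w (a + b + (- c)) \<le> ?w (a + b) * ?w (- c)" by (rule wt_add[OF \<epsilon>(1)])
          also have "\<dots> \<le> (?w a * ?w b) * ?w (- c)" by (intro mult_right_mono wt_add wt_nonneg \<epsilon>)
          finally show ?thesis by simp
        qed
        have "(\<Sum>k\<in>F. ?w k * (if \<bar>k - ?n\<bar> \<le> 3 then ?K * B a b c else 0)) = (\<Sum>k\<in>{k\<in>F. \<bar>k - ?n\<bar> \<le> 3}. ?w k * (?K * B a b c))"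
          using F by (intro sum.mono_neutral_cong_right) auto
        also have "\<dots> \<le> (\<Sum>k\<in>{?n - 3..?n + 3}. ?w k * (?K * B a b c))"
          by (rule sum_mono2) (auto intro!: mult_nonneg_nonneg wt_nonneg \<epsilon> B0 K_nonneg dkc_nonneg)
        also have "\<dots> \<le> (\<Sum>k\<in>{?n - 3..?n + 3}. (4 ^ 5 * (?w a * ?w b * ?w c)) * (?K * B a b c))"
        proof (intro sum_mono mult_right_mono)
          fix k assume "k \<in> {?n - 3..?n + 3}"
          hence "?w k \<le> (1 + real_of_int 3) ^ 5 * ?w ?n" by (intro wt_near \<epsilon>) auto
          also have "\<dots> \<le> 4 ^ 5 * (?w a * ?w b * ?w c)" using wn by simp
          finally show "?w k \<le> 4 ^ 5 * (?w a * ?w b * ?w c)" .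
        qed (intro mult_nonneg_nonneg B0 K)
        also have "\<dots> = Kc * (?w a * bk a f) * (?w b * bk b g) * (?w c * bk c h)" by (simp add: Kc_def B_def)
        finally show ?thesis .
      qed
      let ?J = "{- int N..int N}"
      have "(\<Sum>k\<in>F. ?w k * S N k) = (\<Sum>a\<in>?J. \<Sum>b\<in>?J. \<Sum>c\<in>?J. \<Sum>k\<in>F. ?w k * (if \<bar>k - (a + b - c)\<bar> \<le> 3 then ?K * B a b c else 0))"
        unfolding S_def sum_distrib_left
        by (subst sum.swap, rule sum.cong[OF refl], subst sum.swap, rule sum.cong[OF refl], rule sum.swap)
      also have "\<dots> \<le> (\<Sum>a\<in>?J. \<Sum>b\<in>?J. \<Sum>c\<in>?J. Kc * (?w a * bk a f) * (?w b * bk b g) * (?w c * bk c h))"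
        by (intro sum_mono per)
      also have "\<dots> = Kc * (\<Sum>a\<in>?J. ?w a * bk a f) * (\<Sum>b\<in>?J. ?w b * bk b g) * (\<Sum>c\<in>?J. ?w c * bk c h)"
      proof -
        have "(\<Sum>a\<in>?J. \<Sum>b\<in>?J. \<Sum>c\<in>?J. Kc * (?w a * bk a f) * (?w b * bk b g) * (?w c * bk c h)) =
            (\<Sum>a\<in>?J. Kc * (?w a * bk a f)) * (\<Sum>b\<in>?J. ?w b * bk b g) * (\<Sum>c\<in>?J. ?w c * bk c h)"
          by (rule sum_product3[symmetric])
        thus ?thesis by (simp only: sum_distrib_left)
      qed
      also have "\<dots> \<le> Kc * nrm \<epsilon> 5 f * nrm \<epsilon> 5 g * nrm \<epsilon> 5 h"
        by (intro mult_mono mult_left_mono sum_le_nrm f g h \<epsilon> Kc_nonneg mult_nonneg_nonneg sum_nonneg nrm_nonneg[OF f] nrm_nonneg[OF g] wt_nonneg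
            X_bk_nonneg[OF f] X_bk_nonneg[OF g] X_bk_nonneg[OF h]) auto
      finally show ?thesis .
    qed
    have le: "(\<Sum>k\<in>F. ?w k * bk k ?p) \<le> Kc * nrm \<epsilon> 5 f * nrm \<epsilon> 5 g * nrm \<epsilon> 5 h + (\<Sum>k\<in>F. ?w k * ?K) * en N" for N
    proof -
      have "(\<Sum>k\<in>F. ?w k * bk k ?p) \<le> (\<Sum>k\<in>F. ?w k * (S N k + ?K * en N))"
        by (intro sum_mono mult_left_mono bkp wt_nonneg \<epsilon>)
      also have "\<dots> = (\<Sum>k\<in>F. ?w k * S N k) + (\<Sum>k\<in>F. ?w k * ?K) * en N"
        by (simp add: distrib_left sum.distrib sum_distrib_right mult.assoc)
      finally show ?thesis using SF[of N] by linarith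
    qed
    \<comment> \<open>For a fixed finite set \<open>F\<close> the truncation error has a coefficient
      independent of N, so it disappears in the limit while the main bound does not involve
      N.\<close>
    have "(\<lambda>N. Kc * nrm \<epsilon> 5 f * nrm \<epsilon> 5 g * nrm \<epsilon> 5 h + (\<Sum>k\<in>F. ?w k * ?K) * en N) \<longlonglongrightarrow> Kc * nrm \<epsilon> 5 f * nrm \<epsilon> 5 g * nrm \<epsilon> 5 h + (\<Sum>k\<in>F. ?w k * ?K) * 0"
      by (intro tendsto_intros en)
    thus ?thesis using le by (intro LIMSEQ_le_const) auto
  qed
  show 1: "X 5 ?p" by (rule XI(1)[OF cb fin[of 1]]) auto
  show "nrm \<epsilon> 5 ?p \<le> Kc * nrm \<epsilon> 5 f * nrm \<epsilon> 5 g * nrm \<epsilon> 5 h" if "0 \<le> \<epsilon>" "\<epsilon> \<le> 1"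
    by (rule nrm_le[OF 1 that(1) fin[OF that]])
qed

end

section \<open>The norms of \<open>X\<^sub>s\<close> and the blocks\<close>

lemma schwartz_decay:
  assumes "\<phi> \<in> schwartz"
  shows "norm (\<phi> x) \<le> (schwartz_seminorm 0 0 \<phi> + schwartz_seminorm 2 0 \<phi>) * dk x"
proof -
  have bdd: "bdd_above (range (\<lambda>x. norm (x ^ a *\<^sub>R iter_deriv b \<phi> x)))" for a b
    using assms unfolding schwartz_def bounded_iff bdd_above_def by fastforce
  have s: "norm (x ^ a *\<^sub>R iter_deriv 0 \<phi> x) \<le> schwartz_seminorm a 0 \<phi>" for a
    unfolding schwartz_seminorm_def by (rule cSUP_upper[OF UNIV_I bdd])
  have "norm (\<phi> x) * (1 + x\<^sup>2) \<le> schwartz_seminorm 0 0 \<phi> + schwartz_seminorm 2 0 \<phi>"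
    using s[of 0] s[of 2] by (simp add: iter_deriv_def algebra_simps)
  thus ?thesis unfolding dk_def by (simp add: pos_le_divide_eq add_pos_nonneg)
qed

lemma schwartz_seminorm_nonneg: 
  assumes "\<phi> \<in> schwartz" shows "schwartz_seminorm a b \<phi> \<ge> 0"
proof -
  have bdd: "bdd_above (range (\<lambda>x. norm (x ^ a *\<^sub>R iter_deriv b \<phi> x)))"
    using assms unfolding schwartz_def bounded_iff bdd_above_def by fastforce
  have "norm (0 ^ a *\<^sub>R iter_deriv b \<phi> 0) \<le> schwartz_seminorm a b \<phi>"
    unfolding schwartz_seminorm_def by (rule cSUP_upper[OF UNIV_I bdd])
  thus ?thesis by (meson norm_ge_zero order_trans)
qed

lemma schwartz_continuous: "\<phi> \<in> schwartz \<Longrightarrow> continuous_on UNIV \<phi>"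
proof -
  assume "\<phi> \<in> schwartz"
  hence "iter_deriv 0 \<phi> differentiable (at x)" for x unfolding schwartz_def smooth_def by blast
  hence "\<phi> differentiable (at x)" for x by (simp add: iter_deriv_def)
  thus ?thesis by (simp add: continuous_at_imp_continuous_on differentiable_imp_continuous_within)
qed

lemma schwartz_bfun_integrable:
  assumes "\<phi> \<in> schwartz" "bfun f" "\<And>x. norm (f x) \<le> B"
  shows "integrable lborel (\<lambda>x. f x * \<phi> x)"
    and "norm (LINT x|lborel. f x * \<phi> x) \<le> B * dkc * (schwartz_seminorm 0 0 \<phi> + schwartz_seminorm 2 0 \<phi>)"
proof -
  let ?S = "schwartz_seminorm 0 0 \<phi> + schwartz_seminorm 2 0 \<phi>"
  have m: "(\<lambda>x. f x * \<phi> x) \<in> borel_measurable borel"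
    using assms by (intro borel_measurable_times bfun_measurable borel_measurable_continuous_onI schwartz_continuous)
  have "norm (f x * \<phi> x) \<le> (B * ?S) * dk (0 - x)" for x
  proof -
    have "norm (f x) * norm (\<phi> x) \<le> B * (?S * dk x)"
      using assms(3) schwartz_decay[OF assms(1), of x] by (intro mult_mono) (auto intro: order_trans[OF norm_ge_zero])
    thus ?thesis by (simp add: norm_mult mult.assoc)
  qed
  from integrable_dk_bound[OF m this] show "integrable lborel (\<lambda>x. f x * \<phi> x)"
    "norm (LINT x|lborel. f x * \<phi> x) \<le> B * dkc * ?S" by (simp_all add: mult_ac)
qed

lemma tempered_distribution_of:
  assumes f: "bfun f" shows "tempered (distribution_of f)"
proof -
  obtain B where B: "B \<ge> 0" "\<And>x. norm (f x) \<le> B" using bfunE[OF f] by blast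
  note i = schwartz_bfun_integrable[OF _ f B(2)]
  have "norm (distribution_of f \<phi>) \<le> (B * dkc) * (\<Sum>a\<le>2. \<Sum>b\<le>2. schwartz_seminorm a b \<phi>)" if p: "\<phi> \<in> schwartz" for \<phi>
  proof -
    have s: "schwartz_seminorm a 0 \<phi> \<le> (\<Sum>b\<le>2. schwartz_seminorm a b \<phi>)" for a
      by (rule member_le_sum[of 0 "{..2}" "\<lambda>b. schwartz_seminorm a b \<phi>"]) (auto intro: schwartz_seminorm_nonneg[OF p])
    have "schwartz_seminorm 0 0 \<phi> + schwartz_seminorm 2 0 \<phi> \<le> (\<Sum>b\<le>2. schwartz_seminorm 0 b \<phi>) + (\<Sum>b\<le>2. schwartz_seminorm 2 b \<phi>)"
      by (intro add_mono s)
    also have "\<dots> = (\<Sum>a\<in>{0,2}. \<Sum>b\<le>2. schwartz_seminorm a b \<phi>)" by simp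
    also have "\<dots> \<le> (\<Sum>a\<le>2. \<Sum>b\<le>2. schwartz_seminorm a b \<phi>)"
      by (rule sum_mono2) (auto intro!: sum_nonneg schwartz_seminorm_nonneg[OF p])
    finally have "B * dkc * (schwartz_seminorm 0 0 \<phi> + schwartz_seminorm 2 0 \<phi>) \<le> B * dkc * (\<Sum>a\<le>2. \<Sum>b\<le>2. schwartz_seminorm a b \<phi>)"
      using B dkc_nonneg by (intro mult_left_mono) auto
    thus ?thesis using i(2)[OF p] unfolding distribution_of_def by linarith
  qed
  moreover have "distribution_of f (\<lambda>x. \<phi> x + \<psi> x) = distribution_of f \<phi> + distribution_of f \<psi>"
    if "\<phi> \<in> schwartz" "\<psi> \<in> schwartz" for \<phi> \<psi>
    unfolding distribution_of_def using i(1) that by (simp add: distrib_left)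
  moreover have "distribution_of f (\<lambda>x. c * \<phi> x) = c * distribution_of f \<phi>" for c \<phi>
    unfolding distribution_of_def by (simp only: mult.left_commute[of "f _" c] integral_mult_right_zero)
  ultimately show ?thesis unfolding tempered_def by blast
qed

section \<open>Test functions built from the window\<close>

context window begin

lemma window_smooth: "smooth \<eta>" using adm unfolding admissible_window_def by blast

text \<open>The class is closed under differentiation by construction, so smoothness and compact
  support of all iterated derivatives follow by induction, without a Leibniz formula for
  \<open>iter_deriv\<close>.\<close>

inductive bump_alg :: "real \<Rightarrow> real \<Rightarrow> (real \<Rightarrow> complex) \<Rightarrow> bool" for a b :: real where
  base: "bump_alg a b (\<lambda>y. of_real (iter_deriv i \<eta> (a * y + b)))"
| add: "bump_alg a b g \<Longrightarrow> bump_alg a b h \<Longrightarrow> bump_alg a b (\<lambda>y. g y + h y)"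
| mult: "bump_alg a b g \<Longrightarrow> bump_alg a b h \<Longrightarrow> bump_alg a b (\<lambda>y. g y * h y)"
| scale: "bump_alg a b g \<Longrightarrow> bump_alg a b (\<lambda>y. of_real c * g y)"

lemma bump_alg_derivative: "bump_alg a b g \<Longrightarrow> \<exists>g'. bump_alg a b g' \<and> (\<forall>x. (g has_vector_derivative g' x) (at x))"
proof (induction rule: bump_alg.induct)
  case (base i)
  have "((\<lambda>y. complex_of_real (iter_deriv i \<eta> (a * y + b))) has_vector_derivative of_real a * of_real (iter_deriv (Suc i) \<eta> (a * x + b))) (at x)" for x
  proof -
    have "((\<lambda>y. a * y + b) has_vector_derivative a) (at x)"
      by (auto intro!: derivative_eq_intros simp: has_real_derivative_iff_has_vector_derivative[symmetric])
    from vector_diff_chain_at[OF this smooth_deriv[OF window_smooth]]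
    have "((\<lambda>y. iter_deriv i \<eta> (a * y + b)) has_vector_derivative a *\<^sub>R iter_deriv (Suc i) \<eta> (a * x + b)) (at x)"
      by (simp add: o_def)
    from bounded_linear.has_vector_derivative[OF bounded_linear_of_real this] show ?thesis by simp
  qed
  thus ?case using bump_alg.scale[OF bump_alg.base] by blast
next
  case (add g h)
  then obtain g' h' where "bump_alg a b g'" "bump_alg a b h'"
    "\<And>x. (g has_vector_derivative g' x) (at x)" "\<And>x. (h has_vector_derivative h' x) (at x)" by blast
  thus ?case by (intro exI[of _ "\<lambda>x. g' x + h' x"]) (auto intro!: bump_alg.add has_vector_derivative_add)
next
  case (mult g h)
  then obtain g' h' where d: "bump_alg a b g'" "bump_alg a b h'"
    "\<And>x. (g has_vector_derivative g' x) (at x)" "\<And>x. (h has_vector_derivative h' x) (at x)" by blast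
  have "((\<lambda>y. g y * h y) has_vector_derivative g x * h' x + g' x * h x) (at x)" for x
    by (rule has_vector_derivative_mult[OF d(3,4)])
  thus ?case using bump_alg.add[OF bump_alg.mult[OF mult(1) d(2)] bump_alg.mult[OF d(1) mult(2)]] by blast
next
  case (scale g c)
  then obtain g' where "bump_alg a b g'" "\<And>x. (g has_vector_derivative g' x) (at x)" by blast
  thus ?case by (intro exI[of _ "\<lambda>x. of_real c * g' x"]) (auto intro!: bump_alg.scale has_vector_derivative_mult_right)
qed

lemma window_deriv_zero: "1 < \<bar>\<xi>\<bar> \<Longrightarrow> iter_deriv i \<eta> \<xi> = 0"
proof (induction i arbitrary: \<xi>)
  case 0 thus ?case by (simp add: iter_deriv_def window_zero)
next
  case (Suc i)
  show ?case by (rule has_vector_derivative_zero_on_support[where m="iter_deriv i \<eta>" and L=1, OF smooth_deriv[OF window_smooth]]) (use Suc in auto)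
qed

lemma bump_alg_zero: "bump_alg a b g \<Longrightarrow> 1 < \<bar>a * y + b\<bar> \<Longrightarrow> g y = 0"
  by (induction rule: bump_alg.induct) (auto simp: window_deriv_zero)

lemma bump_alg_iter_deriv: "bump_alg a b g \<Longrightarrow> bump_alg a b (iter_deriv i g)"
proof (induction i)
  case 0 thus ?case by (simp add: iter_deriv_def)
next
  case (Suc i)
  then obtain g' where g': "bump_alg a b g'" "\<And>x. (iter_deriv i g has_vector_derivative g' x) (at x)"
    using bump_alg_derivative by blast
  have "iter_deriv (Suc i) g = (\<lambda>x. vector_derivative (iter_deriv i g) (at x))" by (simp add: iter_deriv_def)
  also have "\<dots> = g'" using vector_derivative_at[OF g'(2)] by blast
  finally show ?case using g' by simp
qed

lemma bump_alg_schwartz: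
  assumes g: "bump_alg a b g" and a: "a \<noteq> 0"
  shows "g \<in> schwartz"
proof -
  have d: "\<exists>g'. \<forall>x. (iter_deriv i g has_vector_derivative g' x) (at x)" for i
    using bump_alg_derivative[OF bump_alg_iter_deriv[OF g]] by blast
  have "smooth g" unfolding smooth_def using d by (metis differentiableI_vector)
  moreover have "bounded (range (\<lambda>x. x ^ n *\<^sub>R iter_deriv i g x))" for n i
  proof -
    have c: "continuous_on UNIV (iter_deriv i g)" using d has_vector_derivative_imp_continuous by blast
    have "\<exists>C\<ge>0. \<forall>x. norm (x ^ n *\<^sub>R iter_deriv i g x) \<le> C"
    proof (rule bounded_compact_support[where L="(1 + \<bar>b\<bar>) / \<bar>a\<bar>"])
      show "continuous_on UNIV (\<lambda>x. x ^ n *\<^sub>R iter_deriv i g x)" by (intro continuous_intros c)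
      fix y assume "(1 + \<bar>b\<bar>) / \<bar>a\<bar> < \<bar>y\<bar>"
      hence "1 + \<bar>b\<bar> < \<bar>a * y\<bar>" using a by (simp add: divide_simps abs_mult mult.commute)
      hence "1 < \<bar>a * y + b\<bar>" by linarith
      thus "y ^ n *\<^sub>R iter_deriv i g y = 0" using bump_alg_zero[OF bump_alg_iter_deriv[OF g]] by simp
    qed
    thus ?thesis unfolding bounded_iff by blast
  qed
  ultimately show ?thesis unfolding schwartz_def by blast
qed

text \<open>Squared because the window may change sign, while an approximate identity that preserves
  bounds has to be nonnegative.\<close>

definition bump :: "real \<Rightarrow> real" where "bump z = (\<eta> z)\<^sup>2"

lemma bump_schwartz: "a \<noteq> 0 \<Longrightarrow> (\<lambda>y. complex_of_real (bump (a * y + b))) \<in> schwartz"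
proof -
  assume a: "a \<noteq> 0"
  have "bump_alg a b (\<lambda>y. of_real (iter_deriv 0 \<eta> (a * y + b)) * of_real (iter_deriv 0 \<eta> (a * y + b)))"
    by (intro bump_alg.mult bump_alg.base)
  from bump_alg_schwartz[OF this a] show ?thesis by (simp add: iter_deriv_def bump_def power2_eq_square)
qed

lemma continuous_on_window: "continuous_on UNIV \<eta>"
  using has_vector_derivative_imp_continuous[OF bounded_linear.has_vector_derivative[OF bounded_linear_of_real smooth_deriv[OF window_smooth, of 0]]]
    smooth_deriv[OF window_smooth, of 0]
  by (metis (no_types, lifting) continuous_at_imp_continuous_on has_vector_derivative_continuous iter_deriv_def funpow_0)

lemma continuous_on_bump: "continuous_on UNIV bump"
  unfolding bump_def[abs_def] by (intro continuous_intros continuous_on_window)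

lemma bump_nonneg: "bump z \<ge> 0" by (simp add: bump_def)

lemma bump_integrable: "integrable lborel bump"
  by (rule integral_compact_support(1)[OF continuous_on_bump, of 1]) (simp add: bump_def window_zero)

lemma window_0: "\<eta> 0 = 1" using eta_0_0 by (simp add: eta_def)

lemma bump_integral_pos: "integral\<^sup>L lborel bump > 0"
proof -
  have "isCont bump 0" using continuous_on_bump by (simp add: continuous_on_eq_continuous_at)
  hence "\<forall>e>0. \<exists>d>0. \<forall>z. \<bar>z\<bar> < d \<longrightarrow> \<bar>bump z - bump 0\<bar> < e"
    unfolding continuous_at_eps_delta by (simp add: dist_norm)
  from this[rule_format, of "1/2"]
  obtain d where d: "d > 0" "\<And>z. \<bar>z\<bar> < d \<Longrightarrow> \<bar>bump z - bump 0\<bar> < 1/2" by auto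
  have "bump 0 = 1" by (simp add: bump_def window_0)
  hence d2: "bump z \<ge> 1/2" if "\<bar>z\<bar> < d" for z using d(2)[OF that] by linarith
  have "0 < d / 2" using d by simp
  also have "\<dots> = (LINT z|lborel. indicator {-d/2..d/2} z * (1/2))" using d by simp
  also have "\<dots> \<le> integral\<^sup>L lborel bump"
  proof (rule integral_mono[OF _ bump_integrable])
    show "integrable lborel (\<lambda>z. indicator {-d/2..d/2} z * (1/2) :: real)"
      using d by (intro integrable_mult_left integrable_real_indicator) auto
    show "indicator {-d/2..d/2} z * (1/2) \<le> bump z" for z
      using d2[of z] bump_nonneg[of z] d by (auto simp: indicator_def abs_less_iff)
  qed
  finally show ?thesis .
qed

text \<open>A bounded representative of a continuous function bounds it pointwise: test against the
  concentrating bumps \<open>\<eta> (n (x - y))\<^sup>2\<close>.\<close>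

lemma sup_norm_test:
  assumes G: "cb G" and g: "g \<in> borel_measurable borel" "\<And>x. norm (g x) \<le> C"
    and eq: "\<And>\<phi>. \<phi> \<in> schwartz \<Longrightarrow> distribution_of G \<phi> = distribution_of g \<phi>"
  shows "norm (G x) \<le> C"
proof -
  let ?I = "integral\<^sup>L lborel bump"
  obtain B where B: "B \<ge> 0" "\<And>x. norm (G x) \<le> B" using cbE[OF G] by blast
  have [measurable]: "bump \<in> borel_measurable borel" "G \<in> borel_measurable borel" "g \<in> borel_measurable borel"
    using continuous_on_bump cb_continuous[OF G] g by (auto intro: borel_measurable_continuous_onI)
  have resc: "of_real (real (Suc n)) * distribution_of h (\<lambda>y. complex_of_real (bump (- real (Suc n) * y + real (Suc n) * x)))
      = (LINT z|lborel. h (x - z / Suc n) * of_real (bump z))" for h n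
  proof -
    define N where "N = real (Suc n)"
    have N: "N > 0" by (simp add: N_def)
    have "distribution_of h (\<lambda>y. complex_of_real (bump (- N * y + N * x))) =
       (1 / N) *\<^sub>R (LINT z|lborel. h (x - z / N) * of_real (bump z))"
      unfolding distribution_of_def
      using lborel_integral_real_affine[of "- (1 / N)" "\<lambda>y. h y * complex_of_real (bump (- N * y + N * x))" x] N
      by (simp add: algebra_simps)
    thus ?thesis using N unfolding N_def[symmetric] by (simp add: scaleR_conv_of_real)
  qed
  have "(\<lambda>n. LINT z|lborel. G (x - z / Suc n) * of_real (bump z)) \<longlonglongrightarrow> (LINT z|lborel. G x * of_real (bump z))"
  proof (rule integral_dominated_convergence[where w="\<lambda>z. B * bump z"])
    show "AE z in lborel. (\<lambda>n. G (x - z / Suc n) * of_real (bump z)) \<longlonglongrightarrow> G x * of_real (bump z)"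
    proof (rule AE_I2)
      fix z
      have "(\<lambda>n. z / real (Suc n)) \<longlonglongrightarrow> 0" by (rule LIMSEQ_Suc[OF lim_const_over_n])
      hence "(\<lambda>n. x - z / real (Suc n)) \<longlonglongrightarrow> x - 0" by (intro tendsto_intros)
      moreover have "isCont G x" using cb_continuous[OF G] by (simp add: continuous_on_eq_continuous_at)
      ultimately have "(\<lambda>n. G (x - z / real (Suc n))) \<longlonglongrightarrow> G x" by (intro isCont_tendsto_compose[of x G]) simp_all
      thus "(\<lambda>n. G (x - z / Suc n) * of_real (bump z)) \<longlonglongrightarrow> G x * of_real (bump z)" by (intro tendsto_intros)
    qed
    show "AE z in lborel. norm (G (x - z / Suc n) * of_real (bump z)) \<le> B * bump z" for n
      using B by (intro AE_I2) (auto simp: norm_mult bump_nonneg intro!: mult_right_mono)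
  qed (use bump_integrable in auto)
  moreover have "(LINT z|lborel. G x * of_real (bump z)) = G x * of_real ?I" by simp
  ultimately have lim: "(\<lambda>n. norm (LINT z|lborel. G (x - z / Suc n) * of_real (bump z))) \<longlonglongrightarrow> norm (G x) * ?I"
  proof -
    assume "(\<lambda>n. LINT z|lborel. G (x - z / Suc n) * of_real (bump z)) \<longlonglongrightarrow> (LINT z|lborel. G x * of_real (bump z))"
      and eq: "(LINT z|lborel. G x * of_real (bump z)) = G x * of_real ?I"
    from tendsto_norm[OF this(1)] show ?thesis
      unfolding eq using bump_integral_pos by (simp only: norm_mult norm_of_real abs_of_pos)
  qed
  have "norm (LINT z|lborel. G (x - z / Suc n) * of_real (bump z)) \<le> C * ?I" for n
  proof -
    have "(LINT z|lborel. G (x - z / Suc n) * of_real (bump z)) = (LINT z|lborel. g (x - z / Suc n) * of_real (bump z))"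
      unfolding resc[symmetric] using eq[OF bump_schwartz[of "- real (Suc n)" "real (Suc n) * x"]] by simp
    also have "norm \<dots> \<le> (LINT z|lborel. C * bump z)"
    proof (rule Bochner_Integration.integral_norm_bound_integral)
      show le: "norm (g (x - z / Suc n) * of_real (bump z)) \<le> C * bump z" for z
        using g(2) by (auto simp: norm_mult bump_nonneg intro!: mult_right_mono)
      show i: "integrable lborel (\<lambda>z. C * bump z)" using bump_integrable by auto
      show "integrable lborel (\<lambda>z. g (x - z / Suc n) * of_real (bump z))"
        by (rule Bochner_Integration.integrable_bound[OF i]) (use order_trans[OF le abs_ge_self] in \<open>auto intro!: AE_I2\<close>)
    qed
    finally show ?thesis by simp
  qed
  hence "norm (G x) * ?I \<le> C * ?I" using lim by (intro LIMSEQ_le_const2) auto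
  thus ?thesis using bump_integral_pos by simp
qed

text \<open>The distributional definition throws every transform onto \<phi>. The compact support of
  the window makes the frequency integral absolutely convergent, so that Fubini identifies the
  composed transforms as a convolution of \<phi> with the kernel; a second exchange moves that
  kernel over to \<open>f\<close>.\<close>

lemma freq_box_eq:
  assumes f: "bfun f" and p: "\<phi> \<in> schwartz"
  shows "freq_box \<eta> k (distribution_of f) \<phi> = distribution_of (blk k f) \<phi>"
proof -
  let ?S = "schwartz_seminorm 0 0 \<phi> + schwartz_seminorm 2 0 \<phi>"
  obtain B where B: "B \<ge> 0" "\<And>x. norm (f x) \<le> B" using bfunE[OF f] by blast
  have [measurable]: "\<phi> \<in> borel_measurable borel"
    by (intro borel_measurable_continuous_onI schwartz_continuous p)
  have [measurable]: "eta k \<in> borel_measurable borel"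
    by (intro borel_measurable_continuous_onI multiplier_continuous multiplier_eta)
  note [measurable] = bfun_measurable[OF f] fourier_inv_measurable[OF multiplier_eta[of k]]
  have pi: "integrable lborel (\<lambda>y. ?S * dk y)" by simp
  have inner: "fourier (\<lambda>\<xi>. of_real (\<eta> (\<xi> - of_int k)) * fourier_inv \<phi> \<xi>) x = (LINT y|lborel. \<phi> y * fourier_inv (eta k) (y - x))" for x
  proof -
    let ?F = "\<lambda>\<xi> y. (1 / (2 * of_real pi)) * (exp (- \<i> * of_real (x * \<xi>)) * eta k \<xi> * (exp (\<i> * of_real (\<xi> * y)) * \<phi> y))"
    have "fourier (\<lambda>\<xi>. of_real (\<eta> (\<xi> - of_int k)) * fourier_inv \<phi> \<xi>) x = (LINT \<xi>|lborel. LINT y|lborel. ?F \<xi> y)"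
      unfolding fourier_def fourier_inv_def eta_def[symmetric]
    proof (rule Bochner_Integration.integral_cong[OF refl], goal_cases)
      case (1 \<xi>)

      have "exp (- \<i> * of_real (x * \<xi>)) * (eta k \<xi> * (1 / (2 * of_real pi) * (LINT y|lborel. exp (\<i> * of_real (\<xi> * y)) * \<phi> y))) =
         1 / (2 * of_real pi) * (exp (- \<i> * of_real (x * \<xi>)) * eta k \<xi> * (LINT y|lborel. exp (\<i> * of_real (\<xi> * y)) * \<phi> y))"
        by simp
      hence "exp (- \<i> * of_real (x * \<xi>)) * (eta k \<xi> * (1 / (2 * of_real pi) * (LINT y|lborel. exp (\<i> * of_real (\<xi> * y)) * \<phi> y))) =
         (LINT y|lborel. ?F \<xi> y)" by (simp only: integral_mult_right_zero)
      thus ?case by (simp add: eta_def mult.assoc mult.commute[of _ "complex_of_real x"])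
    qed
    also have "\<dots> = (LINT y|lborel. LINT \<xi>|lborel. ?F \<xi> y)"
    proof (rule Fubini_product_bound[where a="\<lambda>\<xi>. norm (eta k \<xi>)" and c="\<lambda>y. ?S * dk y", symmetric])
      show "case_prod ?F \<in> borel_measurable (lborel \<Otimes>\<^sub>M lborel)" by measurable
      show "integrable lborel (\<lambda>\<xi>. norm (eta k \<xi>))"
        using multiplier_integrable[OF multiplier_eta, of "\<lambda>_. 1" k] by (intro integrable_norm) simp
      fix \<xi> y
      have "1 / (2 * pi) * (norm (eta k \<xi>) * norm (\<phi> y)) \<le> 1 * (norm (eta k \<xi>) * (?S * dk y))"
        using pi_ge_two schwartz_decay[OF p, of y] by (intro mult_mono mult_left_mono) auto
      thus "norm (?F \<xi> y) \<le> norm (eta k \<xi>) * (?S * dk y)" by (simp add: norm_mult norm_divide)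
    qed (rule pi)
    also have "\<dots> = (LINT y|lborel. \<phi> y * fourier_inv (eta k) (y - x))"
    proof (rule Bochner_Integration.integral_cong[OF refl])
      fix y
      have "?F \<xi> y = \<phi> y * ((1 / (2 * of_real pi)) * (exp (\<i> * of_real ((y - x) * \<xi>)) * eta k \<xi>))" for \<xi>
      proof -
        have "exp (\<i> * of_real ((y - x) * \<xi>)) = exp (- \<i> * of_real (x * \<xi>)) * exp (\<i> * of_real (\<xi> * y))"
          unfolding exp_add[symmetric] by (simp add: algebra_simps)
        thus ?thesis by (simp only: mult_ac)
      qed
      thus "(LINT \<xi>|lborel. ?F \<xi> y) = \<phi> y * fourier_inv (eta k) (y - x)"
        unfolding fourier_inv_def by (simp only: integral_mult_right_zero)
    qed
    finally show ?thesis .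
  qed
  have "freq_box \<eta> k (distribution_of f) \<phi> = (LINT x|lborel. f x * (LINT y|lborel. \<phi> y * fourier_inv (eta k) (y - x)))"
    unfolding freq_box_def dist_fourier_inv_def dist_mult_def dist_fourier_def distribution_of_def inner ..
  also have "\<dots> = (LINT x|lborel. LINT y|lborel. f x * (\<phi> y * fourier_inv (eta k) (y - x)))"
    by (simp only: integral_mult_right_zero)
  also have "\<dots> = (LINT y|lborel. LINT x|lborel. f x * (\<phi> y * fourier_inv (eta k) (y - x)))"
  proof (rule Fubini_conv_kernel[where a="\<lambda>y. ?S * dk y" and c="\<lambda>u. B * (Ke * dk u)"])
    show "(\<lambda>(y, x). f x * (\<phi> y * fourier_inv (eta k) (y - x))) \<in> borel_measurable (lborel \<Otimes>\<^sub>M lborel)" by measurable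
    show "integrable lborel (\<lambda>u. B * (Ke * dk u))" by simp
    fix y x
    have "norm (f x) * (norm (\<phi> y) * norm (fourier_inv (eta k) (y - x))) \<le> B * ((?S * dk y) * (Ke * dk (y - x)))"
      by (intro mult_mono B schwartz_decay p eta_decay mult_nonneg_nonneg norm_ge_zero order_trans[OF norm_ge_zero schwartz_decay[OF p]])
    thus "norm (f x * (\<phi> y * fourier_inv (eta k) (y - x))) \<le> ?S * dk y * (B * (Ke * dk (x - y)))"
      using dk_minus[of "x - y"] by (simp add: norm_mult mult_ac)
  qed (rule pi)
  also have "\<dots> = distribution_of (blk k f) \<phi>"
    unfolding distribution_of_def blk_def fmul_def
  proof (rule Bochner_Integration.integral_cong[OF refl])
    fix y
    have "(LINT x|lborel. f x * (\<phi> y * fourier_inv (eta k) (y - x))) = (LINT x|lborel. (fourier_inv (eta k) (y - x) * f x) * \<phi> y)"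
      by (rule Bochner_Integration.integral_cong) (simp_all only: mult_ac)
    thus "(LINT x|lborel. f x * (\<phi> y * fourier_inv (eta k) (y - x))) = (LINT x|lborel. fourier_inv (eta k) (y - x) * f x) * \<phi> y"
      by (simp only: integral_mult_left_zero)
  qed
  finally show ?thesis .
qed

text \<open>The infimum is attained by the block itself; a competing representative cannot have a
  smaller bound, because testing recovers the continuous block pointwise.\<close>

lemma dist_sup_norm_freq_box:
  assumes f: "bfun f"
  shows "dist_sup_norm (freq_box \<eta> k (distribution_of f)) = ennreal (bk k f)"
  unfolding dist_sup_norm_def
proof (rule antisym)
  have cb: "cb (blk k f)" unfolding blk_def by (intro cb_fmul multiplier_eta f)
  show "Inf {ennreal C |C. \<exists>g\<in>borel_measurable lborel. (\<forall>x. norm (g x) \<le> C) \<and>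
      (\<forall>\<phi>\<in>schwartz. freq_box \<eta> k (distribution_of f) \<phi> = distribution_of g \<phi>)} \<le> ennreal (bk k f)"
  proof (rule Inf_lower, intro CollectI exI conjI refl bexI[of _ "blk k f"] allI ballI)
    show "norm (blk k f x) \<le> bk k f" for x by (rule norm_blk_le_bk[OF f])
    show "freq_box \<eta> k (distribution_of f) \<phi> = distribution_of (blk k f) \<phi>" if "\<phi> \<in> schwartz" for \<phi>
      by (rule freq_box_eq[OF f that])
    show "blk k f \<in> borel_measurable lborel" using bfun_measurable[OF cb_bfun[OF cb]] by simp
  qed simp
  show "ennreal (bk k f) \<le> Inf {ennreal C |C. \<exists>g\<in>borel_measurable lborel. (\<forall>x. norm (g x) \<le> C) \<and>
      (\<forall>\<phi>\<in>schwartz. freq_box \<eta> k (distribution_of f) \<phi> = distribution_of g \<phi>)}"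
  proof (rule Inf_greatest, safe)
    fix C g assume g: "g \<in> borel_measurable lborel" "\<forall>x. norm (g x) \<le> C"
      "\<forall>\<phi>\<in>schwartz. freq_box \<eta> k (distribution_of f) \<phi> = distribution_of g \<phi>"
    have "bk k f \<le> C"
      by (rule bk_le, rule sup_norm_test[OF cb, of g]) (use g freq_box_eq[OF f] in auto)
    thus "ennreal (bk k f) \<le> ennreal C" by (rule ennreal_leI)
  qed
qed

text \<open>From (1 + a)^2 \<le> 2 (1 + a^2) the fifth powers compare with the constant sqrt 32. The
  value 8 is this rounded up; comparing squares avoids the root.\<close>

lemma bracket_bounds: "bracket k \<ge> 1" "bracket k \<le> 1 + \<bar>real_of_int k\<bar>" "(1 + \<bar>real_of_int k\<bar>) ^ 5 \<le> 8 * bracket k ^ 5"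
proof -
  let ?a = "\<bar>real_of_int k\<bar>"
  show b1: "bracket k \<ge> 1" by (simp add: bracket_def)
  show "bracket k \<le> 1 + ?a" unfolding bracket_def by (rule real_le_lsqrt) (auto simp: power2_eq_square algebra_simps)
  have sq: "(bracket k)\<^sup>2 = 1 + ?a\<^sup>2" by (simp add: bracket_def)
  have "(1 + ?a)\<^sup>2 \<le> 2 * (bracket k)\<^sup>2" unfolding sq using zero_le_power2[of "1 - ?a"] by (simp add: power2_eq_square algebra_simps)
  hence "((1 + ?a)\<^sup>2) ^ 5 \<le> (2 * (bracket k)\<^sup>2) ^ 5" by (rule power_mono) simp
  also have "\<dots> = 32 * (bracket k ^ 5)\<^sup>2" by (simp add: power_mult_distrib flip: power_mult)
  also have "\<dots> \<le> (8 * bracket k ^ 5)\<^sup>2" by (simp add: power_mult_distrib)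
  finally have "((1 + ?a) ^ 5)\<^sup>2 \<le> (8 * bracket k ^ 5)\<^sup>2" by (simp flip: power_mult)
  thus "(1 + ?a) ^ 5 \<le> 8 * bracket k ^ 5" by (rule power2_le_imp_le) (use b1 in auto)
qed

lemma X_norm_eq:
  assumes "bfun f"
  shows "X_norm \<eta> 5 f = (SUP F\<in>{F. finite F}. ennreal (\<Sum>k\<in>F. bracket k ^ 5 * bk k f))"
proof -
  have b: "bracket k > 0" for k using bracket_bounds(1)[of k] by linarith
  have "ennreal (bracket k powr 5) * ennreal (bk k f) = ennreal (bracket k ^ 5 * bk k f)" for k
    using b[of k] bk_nonneg[OF assms, of k] by (simp add: ennreal_mult powr_numeral less_imp_le)
  hence "X_norm \<eta> 5 f = infsum (\<lambda>k. ennreal (bracket k ^ 5 * bk k f)) UNIV"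
    unfolding X_norm_def dist_X_norm_def dist_sup_norm_freq_box[OF assms] by simp
  also have "\<dots> = (SUP F\<in>{F. finite F \<and> F \<subseteq> UNIV}. \<Sum>k\<in>F. ennreal (bracket k ^ 5 * bk k f))"
    by (rule nonneg_infsum_complete) simp
  finally show ?thesis
    using b bk_nonneg[OF assms] by (simp add: sum_ennreal less_imp_le)
qed

lemma X_norm_finite_imp_X:
  assumes f: "cb f" and n: "X_norm \<eta> 5 f \<le> ennreal M" "M \<ge> 0"
  shows "X 5 f" "nrm 1 5 f \<le> 8 * M"
proof -
  have "(\<Sum>k\<in>F. wt 1 5 k * bk k f) \<le> 8 * M" if "finite F" for F
  proof -
    have "ennreal (\<Sum>k\<in>F. bracket k ^ 5 * bk k f) \<le> X_norm \<eta> 5 f"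
      unfolding X_norm_eq[OF cb_bfun[OF f]] by (rule SUP_upper) (use that in simp)
    hence "ennreal (\<Sum>k\<in>F. bracket k ^ 5 * bk k f) \<le> ennreal M" using n(1) by (rule order_trans)
    hence "(\<Sum>k\<in>F. bracket k ^ 5 * bk k f) \<le> M" using n(2) by simp
    moreover have "(\<Sum>k\<in>F. wt 1 5 k * bk k f) \<le> (\<Sum>k\<in>F. 8 * (bracket k ^ 5 * bk k f))"
    proof (rule sum_mono)
      fix k show "wt 1 5 k * bk k f \<le> 8 * (bracket k ^ 5 * bk k f)"
        using mult_right_mono[OF bracket_bounds(3)[of k] bk_nonneg[OF cb_bfun[OF f], of k]] by (simp add: wt_def mult.assoc)
    qed
    ultimately show ?thesis unfolding sum_distrib_left[symmetric] by linarith
  qed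
  thus "X 5 f" "nrm 1 5 f \<le> 8 * M" using XI[OF f] by blast+
qed

lemma X_norm_le_nrm:
  assumes "X 5 f" shows "X_norm \<eta> 5 f \<le> ennreal (nrm 1 5 f)"
  unfolding X_norm_eq[OF X_bfun[OF assms]]
proof (rule SUP_least)
  fix F :: "int set" assume "F \<in> {F. finite F}"
  hence F: "finite F" by simp
  have "(\<Sum>k\<in>F. bracket k ^ 5 * bk k f) \<le> (\<Sum>k\<in>F. wt 1 5 k * bk k f)"
  proof (intro sum_mono mult_right_mono X_bk_nonneg[OF assms])
    fix k show "bracket k ^ 5 \<le> wt 1 5 k"
      unfolding wt_def using bracket_bounds(1,2)[of k] by (intro power_mono) auto
  qed
  also have "\<dots> \<le> nrm 1 5 f" by (rule sum_le_nrm[OF assms _ _ F]) auto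
  finally show "ennreal (\<Sum>k\<in>F. bracket k ^ 5 * bk k f) \<le> ennreal (nrm 1 5 f)" by (rule ennreal_leI)
qed

lemma X_space_iff: "f \<in> X_space \<eta> 5 \<longleftrightarrow> X 5 f"
proof
  assume f: "f \<in> X_space \<eta> 5"
  hence cb: "cb f" unfolding X_space_def cb_def bounded_iff by auto
  have "X_norm \<eta> 5 f < \<infinity>" using f unfolding X_space_def dist_X_def X_norm_def by simp
  then obtain M where "M \<ge> 0" "X_norm \<eta> 5 f = ennreal M" by (cases "X_norm \<eta> 5 f") auto
  thus "X 5 f" using X_norm_finite_imp_X(1)[OF cb, of M] by simp
next
  assume f: "X 5 f"
  have "X_norm \<eta> 5 f < \<infinity>" using le_less_trans[OF X_norm_le_nrm[OF f]] by simp
  moreover have "tempered (distribution_of f)" by (rule tempered_distribution_of[OF X_bfun[OF f]])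
  moreover have "continuous_on UNIV f" "bounded (range f)"
    using X_cb[OF f] unfolding cb_def bounded_iff by auto
  ultimately show "f \<in> X_space \<eta> 5" unfolding X_space_def dist_X_def X_norm_def by simp
qed

end

section \<open>Solutions\<close>

lemma gronwall_differential:
  fixes y y' :: "real \<Rightarrow> real"
  assumes D: "\<And>t. t \<in> {0..T} \<Longrightarrow> (y has_vector_derivative y' t) (at t within {0..T})"
    and le: "\<And>t. t \<in> {0..T} \<Longrightarrow> y' t \<le> a * y t + b" and a: "a \<ge> 0" and b: "b \<ge> 0" and t: "t \<in> {0..T}"
  shows "y t \<le> exp (a * t) * (y 0 + b * t)"
proof -
  \<comment> \<open>Since \<open>a \<ge> 0\<close>, the damping factor multiplying b in the
    derivative is at most 1, so subtracting \<open>b * t\<close> already makes \<open>z\<close>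
    nonincreasing.\<close>
  define z where "z = (\<lambda>t. exp (- a * t) * y t - b * t)"
  have cy: "continuous_on {0..T} y"
    using D has_vector_derivative_continuous by (metis continuous_on_eq_continuous_within)
  have "z t \<le> z 0"
  proof (rule DERIV_nonpos_imp_decreasing_open[of 0 t z])
    show "0 \<le> t" using t by simp
    show "continuous_on {0..t} z" unfolding z_def
      using continuous_on_subset[OF cy, of "{0..t}"] t by (intro continuous_intros) auto
    fix s assume s: "0 < s" "s < t"
    hence sT: "s \<in> {0..T}" "s \<in> {0<..<T}" using t by auto
    have "(y has_vector_derivative y' s) (at s within {0<..<T})"
      by (rule has_vector_derivative_within_subset[OF D[OF sT(1)]]) auto
    hence "(y has_vector_derivative y' s) (at s)" by (simp only: at_within_open[OF sT(2) open_greaterThanLessThan])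
    hence "DERIV y s :> y' s" by (simp add: has_real_derivative_iff_has_vector_derivative)
    hence "DERIV z s :> exp (- a * s) * (y' s - a * y s) - b"
      unfolding z_def by (auto intro!: derivative_eq_intros simp: algebra_simps)
    moreover have "exp (- a * s) * (y' s - a * y s) \<le> 1 * b"
    proof (cases "y' s - a * y s \<le> 0")
      case True
      hence "exp (- a * s) * (y' s - a * y s) \<le> 0" by (simp add: mult_nonneg_nonpos)
      thus ?thesis using b by linarith
    next
      case False
      thus ?thesis using le[OF sT(1)] a b s by (intro mult_mono) (auto simp: algebra_simps)
    qed
    ultimately show "\<exists>y. DERIV z s :> y \<and> y \<le> 0" by (intro exI conjI) auto
  qed
  hence "exp (- a * t) * y t \<le> y 0 + b * t" by (simp add: z_def)
  hence "exp (a * t) * (exp (- a * t) * y t) \<le> exp (a * t) * (y 0 + b * t)" by (rule mult_left_mono) simp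
  moreover have "exp (a * t) * (exp (- a * t) * y t) = y t"
    by (simp add: exp_minus field_simps)
  ultimately show ?thesis by linarith
qed

lemma gronwall_integral:
  fixes \<phi> :: "real \<Rightarrow> real"
  assumes c: "continuous_on {0..T} \<phi>" and A: "A \<ge> 0" and B: "B \<ge> 0"
    and le: "\<And>t. t \<in> {0..T} \<Longrightarrow> \<phi> t \<le> A + B * integral {0..t} \<phi>" and t: "t \<in> {0..T}"
  shows "\<phi> t \<le> A * exp (B * t)"
proof -
  define I where "I = (\<lambda>t. A + B * integral {0..t} \<phi>)"
  have D: "(I has_vector_derivative B * \<phi> t) (at t within {0..T})" if "t \<in> {0..T}" for t
  proof -
    have "((\<lambda>t. integral {0..t} \<phi>) has_vector_derivative \<phi> t) (at t within {0..T})"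
      by (rule integral_has_vector_derivative[OF c that])
    from has_vector_derivative_add[OF has_vector_derivative_const has_vector_derivative_mult_right[OF this]]
    show ?thesis unfolding I_def by simp
  qed
  have "I t \<le> exp (B * t) * (I 0 + 0 * t)"
    by (rule gronwall_differential[OF D _ B _ t]) (use le B in \<open>auto simp: I_def mult_left_mono\<close>)
  thus ?thesis using le[OF t] by (simp add: I_def mult.commute)
qed

text \<open>The nonlinearity in trilinear form, so that differences telescope into three products,
  each with one factor \<open>f x - g x\<close> or its conjugate.\<close>

definition cub :: "(real \<Rightarrow> complex) \<Rightarrow> real \<Rightarrow> complex" where
  "cub f x = f x * f x * cnj (f x)"

lemma cub_diff: "cub f x - cub g x = (f x - g x) * f x * cnj (f x) + g x * (f x - g x) * cnj (f x) + g x * g x * cnj (f x - g x)"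
  by (simp add: cub_def algebra_simps)

lemma cub_diff_le:
  assumes "norm (f x) \<le> K" "norm (g x) \<le> K"
  shows "norm (cub f x - cub g x) \<le> 3 * K\<^sup>2 * norm (f x - g x)"
proof -
  let ?d = "norm (f x - g x)"
  have K: "K \<ge> 0" using assms(1) norm_ge_zero order_trans by blast
  have "norm ((f x - g x) * f x * cnj (f x)) \<le> ?d * K * K"
    unfolding norm_mult complex_mod_cnj by (intro mult_mono assms mult_nonneg_nonneg K norm_ge_zero order_refl)
  moreover have "norm (g x * (f x - g x) * cnj (f x)) \<le> K * ?d * K"
    unfolding norm_mult complex_mod_cnj by (intro mult_mono assms mult_nonneg_nonneg K norm_ge_zero order_refl)
  moreover have "norm (g x * g x * cnj (f x - g x)) \<le> K * K * ?d"
    unfolding norm_mult complex_mod_cnj by (intro mult_mono assms mult_nonneg_nonneg K norm_ge_zero order_refl)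
  ultimately have "norm (cub f x - cub g x) \<le> ?d * K * K + K * ?d * K + K * K * ?d"
    unfolding cub_diff by (intro norm_triangle_le add_mono)
  thus ?thesis by (simp add: power2_eq_square algebra_simps)
qed

lemma dk_scale_le: "R \<ge> 1 \<Longrightarrow> dk (y / R) \<le> R\<^sup>2 * dk y"
proof -
  assume R: "R \<ge> 1"
  have "1 + y\<^sup>2 \<le> R\<^sup>2 * (1 + (y / R)\<^sup>2)" using R by (simp add: field_simps power2_eq_square) (smt (verit) mult_le_cancel_left1)
  thus ?thesis unfolding dk_def using R by (simp add: divide_simps add_pos_nonneg add_nonneg_eq_0_iff mult.commute)
qed

lemma dk_le_scale: "R \<ge> 1 \<Longrightarrow> dk y \<le> dk (y / R)"
proof -
  assume R: "R \<ge> 1"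
  have "y\<^sup>2 / R\<^sup>2 \<le> y\<^sup>2 / 1" using R by (intro divide_left_mono) auto
  thus ?thesis unfolding dk_def using R by (intro divide_left_mono) (auto simp: power_divide add_pos_nonneg intro!: mult_pos_pos add_pos_nonneg)
qed

text \<open>The sense in which the weight varies slowly: a derivative gains 1 / R and stays below
  the weight itself. The pointwise reason is \<open>2 * \<bar>s\<bar> * dk s \<le> 1\<close> for
  \<open>s = y / R\<close>.\<close>

lemma dk_scale_derivative:
  assumes R: "R \<ge> 1"
  obtains r' where "\<And>y. ((\<lambda>y. dk (y / R)) has_vector_derivative r' y) (at y)" "\<And>y. \<bar>r' y\<bar> \<le> dk (y / R) / R" "continuous_on UNIV r'"
proof -
  define r' where "r' = (\<lambda>y. - (2 * (y / R) / R) * (dk (y / R))\<^sup>2)"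
  show ?thesis
  proof
    fix y
    have p: "1 + (y / R)\<^sup>2 > 0" by (simp add: add_pos_nonneg)
    have "((\<lambda>y. 1 / (1 + (y / R)\<^sup>2)) has_real_derivative r' y) (at y)"
      using p R by (auto intro!: derivative_eq_intros simp: r'_def dk_def power2_eq_square field_simps)
    thus "((\<lambda>y. dk (y / R)) has_vector_derivative r' y) (at y)"
      unfolding dk_def by (simp add: has_real_derivative_iff_has_vector_derivative)
    let ?s = "y / R"
    have "2 * \<bar>?s\<bar> \<le> 1 + ?s\<^sup>2" using zero_le_power2[of "1 - \<bar>?s\<bar>"] by (simp add: power2_eq_square algebra_simps abs_mult_self_eq)
    hence "2 * \<bar>?s\<bar> * (1 / (1 + ?s\<^sup>2)) \<le> (1 + ?s\<^sup>2) * (1 / (1 + ?s\<^sup>2))" using p by (intro mult_right_mono) auto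
    also have "\<dots> = 1" using p by (simp del: times_divide_eq_right add: less_imp_neq[THEN not_sym] flip: inverse_eq_divide)
    finally have "2 * \<bar>?s\<bar> * dk ?s \<le> 1" unfolding dk_def .
    hence "(2 * \<bar>?s\<bar> * dk ?s) * (dk ?s / R) \<le> 1 * (dk ?s / R)" using R by (intro mult_right_mono) auto
    thus "\<bar>r' y\<bar> \<le> dk (y / R) / R" unfolding r'_def using R by (simp add: abs_mult power2_eq_square mult_ac)
    show "continuous_on UNIV r'" unfolding r'_def by (intro continuous_intros) (use R in auto)
  qed
qed

lemma inner_evolution:
  fixes a b c :: complex
  shows "a \<bullet> (of_real \<sigma> * (\<i> / 2 * b - \<i> * of_real \<kappa> * c)) = \<sigma> / 2 * (a \<bullet> (\<i> * b)) - \<sigma> * \<kappa> * (a \<bullet> (\<i> * c))"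
  by (simp add: inner_complex_def field_simps)

lemma inner_i: "z \<bullet> (\<i> * z) = 0" for z :: complex by (simp add: inner_complex_def)

text \<open>Passes from the weighted square integral back to pointwise values of a multiplier.
  Young's inequality with parameter \<delta> splits \<open>norm (w y)\<close> into a constant,
  integrated against the kernel, and a square, for which the kernel centred at x is dominated by the
  weight centred at 0 at the price \<open>1 + x ^ 2\<close>.\<close>

lemma fmul_local_bound:
  assumes m: "multiplier m" and C: "C \<ge> 0" "\<And>x. norm (fourier_inv m x) \<le> C * dk x"
    and w: "cb w" and R: "R \<ge> 1" and d: "\<delta> > 0"
  shows "norm (fmul m w x) \<le> C * (\<delta> * dkc / 2 + (1 + x\<^sup>2) / \<delta> * (LINT y|lborel. dk (y / R) * (norm (w y))\<^sup>2))"
proof -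
  obtain B where B: "B \<ge> 0" "\<And>x. norm (w x) \<le> B" using cbE[OF w] by blast
  have cw: "continuous_on UNIV (\<lambda>y. dk (y / R) * (norm (w y))\<^sup>2)"
    by (intro continuous_intros cb_continuous w) (use R in auto)
  have iw: "integrable lborel (\<lambda>y. dk (y / R) * (norm (w y))\<^sup>2)"
  proof (rule Bochner_Integration.integrable_bound[where f="\<lambda>y. dk (y / R) * B\<^sup>2"])
    show "integrable lborel (\<lambda>y. dk (y / R) * B\<^sup>2)" using integrable_dk_scale[of R] R by auto
    show "(\<lambda>y. dk (y / R) * (norm (w y))\<^sup>2) \<in> borel_measurable lborel" using cw by (simp add: borel_measurable_continuous_onI)
    show "AE y in lborel. norm (dk (y / R) * (norm (w y))\<^sup>2) \<le> norm (dk (y / R) * B\<^sup>2)"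
      using B by (intro AE_I2) (auto simp: abs_mult intro!: mult_left_mono power_mono)
  qed
  have "norm (fmul m w x) \<le> (LINT y|lborel. C * (\<delta> / 2) * dk (x - y) + C * ((1 + x\<^sup>2) / \<delta>) * (dk (y / R) * (norm (w y))\<^sup>2))"
    unfolding fmul_def
  proof (rule Bochner_Integration.integral_norm_bound_integral[OF fmul_integrable[OF m cb_bfun[OF w]]])
    show "integrable lborel (\<lambda>y. C * (\<delta> / 2) * dk (x - y) + C * ((1 + x\<^sup>2) / \<delta>) * (dk (y / R) * (norm (w y))\<^sup>2))"
      using iw integrable_dk_shift by auto
    fix y
    let ?n = "norm (w y)"
    have n: "?n \<le> \<delta> / 2 + ?n\<^sup>2 / (2 * \<delta>)"
    proof -
      have "2 * \<delta> * ?n \<le> \<delta>\<^sup>2 + ?n\<^sup>2" by (rule sum_squares_bound)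
      hence "(2 * \<delta> * ?n) / (2 * \<delta>) \<le> (\<delta>\<^sup>2 + ?n\<^sup>2) / (2 * \<delta>)" using d by (intro divide_right_mono) auto
      thus ?thesis using d by (simp add: add_divide_distrib power2_eq_square)
    qed
    have "dk (- y + x) \<le> 2 * (1 + x\<^sup>2) * dk (- y)" by (rule dk_shift)
    also have "\<dots> \<le> 2 * (1 + x\<^sup>2) * dk (y / R)" using dk_le_scale[OF R, of y] by (intro mult_left_mono) auto
    finally have k: "dk (x - y) \<le> 2 * (1 + x\<^sup>2) * dk (y / R)" by simp
    have "norm (fourier_inv m (x - y) * w y) \<le> (C * dk (x - y)) * (\<delta> / 2 + ?n\<^sup>2 / (2 * \<delta>))"
      unfolding norm_mult using C n by (intro mult_mono) auto
    also have "\<dots> = C * (\<delta> / 2) * dk (x - y) + (C * (?n\<^sup>2 / (2 * \<delta>))) * dk (x - y)" by (simp add: algebra_simps)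
    also have "\<dots> \<le> C * (\<delta> / 2) * dk (x - y) + (C * (?n\<^sup>2 / (2 * \<delta>))) * (2 * (1 + x\<^sup>2) * dk (y / R))"
      using C d k by (intro add_left_mono mult_left_mono) auto
    also have "(C * (?n\<^sup>2 / (2 * \<delta>))) * (2 * (1 + x\<^sup>2) * dk (y / R)) = C * ((1 + x\<^sup>2) / \<delta>) * (dk (y / R) * ?n\<^sup>2)"
      using d by (simp add: field_simps)
    finally show "norm (fourier_inv m (x - y) * w y) \<le> C * (\<delta> / 2) * dk (x - y) + C * ((1 + x\<^sup>2) / \<delta>) * (dk (y / R) * ?n\<^sup>2)" .
  qed
  also have "\<dots> = C * (\<delta> / 2) * dkc + C * ((1 + x\<^sup>2) / \<delta>) * (LINT y|lborel. dk (y / R) * (norm (w y))\<^sup>2)"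
    using iw integrable_dk_shift integral_dk_shift by simp
  finally show ?thesis by (simp add: algebra_simps)
qed

text \<open>The multiplier of the free evolution.\<close>

definition mt :: "real \<Rightarrow> (real \<Rightarrow> complex) \<Rightarrow> real \<Rightarrow> complex" where
  "mt a m \<xi> = exp (- \<i> * of_real (a * \<xi>\<^sup>2)) * m \<xi>"

lemma mt_0 [simp]: "mt 0 m = m" by (simp add: mt_def fun_eq_iff)

lemma multiplier_mt: "multiplier m \<Longrightarrow> multiplier (mt a m)"
  unfolding mt_def[abs_def] by (intro multiplier_mult C2_iexp_square)

text \<open>On the compact support the quadratic phase contributes only bounded powers of a and
  \<xi> to the second derivative, so one constant serves all bounded times.\<close>

lemma mt_decay:
  assumes m: "multiplier m" and T: "T \<ge> 0"
  obtains C where "C \<ge> 0" "\<And>a x. \<bar>a\<bar> \<le> T \<Longrightarrow> norm (fourier_inv (mt a m) x) \<le> C * dk x"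
proof -
  obtain m1 m2 L where C2: "C2_with m m1 m2" and L0: "\<And>\<xi>. L < \<bar>\<xi>\<bar> \<Longrightarrow> m \<xi> = 0"
    using m unfolding multiplier_def C2_def by blast
  define L' where "L' = max L 0"
  have L: "L' \<ge> 0" "\<And>\<xi>. L' < \<bar>\<xi>\<bar> \<Longrightarrow> m \<xi> = 0" using L0 by (auto simp: L'_def)
  note c = C2_with_continuous[OF C2]
  have d: "(m has_vector_derivative m1 \<xi>) (at \<xi>)" "(m1 has_vector_derivative m2 \<xi>) (at \<xi>)" for \<xi>
    using C2 unfolding C2_with_def by auto
  have z1: "m1 \<xi> = 0" if "L' < \<bar>\<xi>\<bar>" for \<xi>
    by (rule has_vector_derivative_zero_on_support[where m=m and L=L']) (use d(1) L that in auto)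
  have z2: "m2 \<xi> = 0" if "L' < \<bar>\<xi>\<bar>" for \<xi>
    by (rule has_vector_derivative_zero_on_support[where m=m1 and L=L']) (use d(2) z1 that in auto)
  obtain B0 B1 B2 where B: "B0 \<ge> 0" "\<And>x. norm (m x) \<le> B0" "B1 \<ge> 0" "\<And>x. norm (m1 x) \<le> B1" "B2 \<ge> 0" "\<And>x. norm (m2 x) \<le> B2"
    using bounded_compact_support[OF c(1) L(2)] bounded_compact_support[OF c(2) z1] bounded_compact_support[OF c(3) z2] by metis
  \<comment> \<open>Bounds for the coefficients of \<open>m\<close>, \<open>m1\<close> and
    \<open>m2\<close> in the second derivative of the product, for
    \<open>\<bar>a\<bar> \<le> T\<close> and \<open>\<bar>\<xi>\<bar> \<le> L'\<close>.\<close>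
  define C' where "C' = (2 * T + 4 * T\<^sup>2 * L'\<^sup>2) * B0 + 2 * (2 * T * L') * B1 + B2"
  have C': "C' \<ge> 0" unfolding C'_def using T L B by (intro add_nonneg_nonneg mult_nonneg_nonneg) auto
  have "norm (fourier_inv (mt a m) x) \<le> L' * (B0 + C') * dk x" if a: "\<bar>a\<bar> \<le> T" for a x
  proof -
    let ?g = "\<lambda>x. exp (- \<i> * of_real (a * x\<^sup>2))"
    have ng: "norm (?g x) = 1" for x by simp
    have C2g: "C2_with (mt a m) (\<lambda>x. (- 2 * \<i> * of_real (a * x)) * ?g x * m x + ?g x * m1 x)
       (\<lambda>x. (- 2 * \<i> * of_real a - 4 * of_real (a\<^sup>2 * x\<^sup>2)) * ?g x * m x + 2 * ((- 2 * \<i> * of_real (a * x)) * ?g x) * m1 x + ?g x * m2 x)"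
      unfolding mt_def[abs_def] by (rule C2_with_mult[OF C2_with_iexp_square C2])
    show ?thesis
    proof (rule kernel_decay[OF C2g L(1)])
      show "mt a m \<xi> = 0" if "L' < \<bar>\<xi>\<bar>" for \<xi> using L(2)[OF that] by (simp add: mt_def)
      show "norm (mt a m \<xi>) \<le> B0" for \<xi> using B(2) by (simp add: mt_def norm_mult)
      fix \<xi>
      show "norm ((- 2 * \<i> * of_real a - 4 * of_real (a\<^sup>2 * \<xi>\<^sup>2)) * ?g \<xi> * m \<xi> + 2 * ((- 2 * \<i> * of_real (a * \<xi>)) * ?g \<xi>) * m1 \<xi> + ?g \<xi> * m2 \<xi>) \<le> C'"
      proof (cases "L' < \<bar>\<xi>\<bar>")
        case True thus ?thesis using L(2) z1 z2 C' by simp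
      next
        case False
        hence x: "\<bar>\<xi>\<bar> \<le> L'" by simp
        have x2: "\<xi>\<^sup>2 \<le> L'\<^sup>2" using x L(1) by (simp add: abs_le_square_iff[symmetric])
        have a2: "a\<^sup>2 \<le> T\<^sup>2" using a T by (simp add: abs_le_square_iff[symmetric])
        have "norm ((- 2 * \<i> * of_real a - 4 * of_real (a\<^sup>2 * \<xi>\<^sup>2)) :: complex) \<le> 2 * \<bar>a\<bar> + 4 * (a\<^sup>2 * \<xi>\<^sup>2)"
          by (rule order_trans[OF norm_triangle_ineq4]) (simp add: norm_mult norm_power)
        also have "\<dots> \<le> 2 * T + 4 * (T\<^sup>2 * L'\<^sup>2)" using a x2 a2 by (intro add_mono mult_left_mono mult_mono) auto
        finally have 1: "norm ((- 2 * \<i> * of_real a - 4 * of_real (a\<^sup>2 * \<xi>\<^sup>2)) :: complex) \<le> 2 * T + 4 * T\<^sup>2 * L'\<^sup>2" by (simp add: mult.assoc)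
        have t1: "norm ((- 2 * \<i> * of_real a - 4 * of_real (a\<^sup>2 * \<xi>\<^sup>2)) * ?g \<xi> * m \<xi>) \<le> (2 * T + 4 * T\<^sup>2 * L'\<^sup>2) * B0"
          unfolding norm_mult ng using B T by (simp only: mult_1_right, intro mult_mono 1) (auto intro!: mult_nonneg_nonneg)
        have aL: "\<bar>a\<bar> * \<bar>\<xi>\<bar> \<le> T * L'" using a x T by (intro mult_mono) auto
        have t2: "norm (2 * ((- 2 * \<i> * of_real (a * \<xi>)) * ?g \<xi>) * m1 \<xi>) \<le> 2 * (2 * T * L') * B1"
        proof -
          have "norm (2 * ((- 2 * \<i> * of_real (a * \<xi>)) * ?g \<xi>) * m1 \<xi>) = (2 * (2 * (\<bar>a\<bar> * \<bar>\<xi>\<bar>))) * norm (m1 \<xi>)"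
            by (simp add: norm_mult abs_mult)
          also have "\<dots> \<le> (2 * (2 * (T * L'))) * B1"
            using aL B(4)[of \<xi>] T L(1) by (intro mult_mono[of _ "2 * (2 * (T * L'))"]) (auto simp: mult_nonneg_nonneg)
          finally show ?thesis by (simp add: mult.assoc)
        qed
        have t3: "norm (?g \<xi> * m2 \<xi>) \<le> B2" unfolding norm_mult ng using B by simp
        show ?thesis unfolding C'_def by (intro norm_triangle_le add_mono t1 t2 t3)
      qed
    qed
  qed
  thus ?thesis using that[of "L' * (B0 + C')"] L B C' by (simp add: mult_nonneg_nonneg)
qed

lemma multiplier_times_square: "multiplier m \<Longrightarrow> multiplier (\<lambda>\<xi>. - \<i> * of_real (\<xi>\<^sup>2) * m \<xi>)"
proof -
  assume m: "multiplier m"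
  have "C2 (\<lambda>\<xi>. - \<i> * (of_real \<xi> * of_real \<xi>))" by (intro C2_mult C2_const C2_of_real)
  from multiplier_mult[OF this m] show ?thesis by (simp only: power2_eq_square of_real_mult)
qed

lemma mt_has_derivative:
  assumes m: "multiplier m"
  shows "((\<lambda>a. fourier_inv (mt a m) z) has_vector_derivative fourier_inv (mt a (\<lambda>\<xi>. - \<i> * of_real (\<xi>\<^sup>2) * m \<xi>)) z) (at a)"
proof -
  let ?m = "\<lambda>\<xi>. - \<i> * of_real (\<xi>\<^sup>2) * m \<xi>"
  have "((\<lambda>a. LINT \<xi>|lborel. exp (\<i> * of_real (z * \<xi>)) * mt a m \<xi>) has_vector_derivative
      (LINT \<xi>|lborel. exp (\<i> * of_real (z * \<xi>)) * mt a ?m \<xi>)) (at a within UNIV)"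
  proof (rule has_vector_derivative_lebesgue_integral[where h="\<lambda>\<xi>. norm (of_real (\<xi>\<^sup>2) * m \<xi>)" and F'="\<lambda>a \<xi>. exp (\<i> * of_real (z * \<xi>)) * mt a ?m \<xi>"])
    show "integrable lborel (\<lambda>\<xi>. exp (\<i> * of_real (z * \<xi>)) * mt a m \<xi>)" for a
      by (intro multiplier_integrable multiplier_mt m continuous_intros)
    show "integrable lborel (\<lambda>\<xi>. norm (of_real (\<xi>\<^sup>2) * m \<xi>))"
      by (intro integrable_norm multiplier_integrable m continuous_intros)
    have "continuous_on UNIV (\<lambda>\<xi>. exp (\<i> * of_real (z * \<xi>)) * mt a ?m \<xi>)"
      by (intro continuous_intros multiplier_continuous multiplier_mt multiplier_times_square m)
    thus "(\<lambda>\<xi>. exp (\<i> * of_real (z * \<xi>)) * mt a ?m \<xi>) \<in> borel_measurable lborel"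
      by (simp add: borel_measurable_continuous_onI)
    fix a \<xi>
    have "((\<lambda>z. exp (- \<i> * (z * of_real (\<xi>\<^sup>2)))) has_field_derivative (- \<i> * of_real (\<xi>\<^sup>2)) * exp (- \<i> * of_real (a * \<xi>\<^sup>2))) (at (of_real a))"
      by (auto intro!: derivative_eq_intros)
    from has_vector_derivative_real_field[OF this]
    have e: "((\<lambda>a. exp (- \<i> * of_real (a * \<xi>\<^sup>2))) has_vector_derivative (- \<i> * of_real (\<xi>\<^sup>2)) * exp (- \<i> * of_real (a * \<xi>\<^sup>2))) (at a)"
      by simp
    have "((\<lambda>a. exp (\<i> * of_real (z * \<xi>)) * (exp (- \<i> * of_real (a * \<xi>\<^sup>2)) * m \<xi>)) has_vector_derivative
       exp (\<i> * of_real (z * \<xi>)) * (((- \<i> * of_real (\<xi>\<^sup>2)) * exp (- \<i> * of_real (a * \<xi>\<^sup>2))) * m \<xi>)) (at a)"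
      by (rule has_vector_derivative_mult_right[OF has_vector_derivative_mult_left[OF e]])
    thus "((\<lambda>a. exp (\<i> * of_real (z * \<xi>)) * mt a m \<xi>) has_vector_derivative exp (\<i> * of_real (z * \<xi>)) * mt a ?m \<xi>) (at a within UNIV)"
      unfolding mt_def by (simp add: mult_ac)
    show "norm (exp (\<i> * of_real (z * \<xi>)) * mt a ?m \<xi>) \<le> norm (of_real (\<xi>\<^sup>2) * m \<xi>)"
      by (simp add: mt_def norm_mult)
  qed simp_all
  thus ?thesis unfolding fourier_inv_def by (auto intro!: derivative_eq_intros)
qed

text \<open>Supremum bounds do not see where the kernel is centred. This is needed because the free
  evolution carries a block along with a velocity proportional to its frequency.\<close>

lemma fmul_norm_le_shift:
  assumes "multiplier m" "bfun f" "\<And>x. norm (fourier_inv m x) \<le> C * dk (x - c)" "\<And>x. norm (f x) \<le> B"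
  shows "norm (fmul m f x) \<le> C * dkc * B"
proof -
  have "norm (fourier_inv m (x - y) * f y) \<le> (C * B) * dk (x - c - y)" for y
  proof -
    have "norm (fourier_inv m (x - y)) * norm (f y) \<le> (C * dk (x - y - c)) * B"
      using assms by (intro mult_mono) (auto intro: order_trans[OF norm_ge_zero])
    thus ?thesis by (simp add: norm_mult mult_ac algebra_simps)
  qed
  from integrable_dk_bound(2)[OF fmul_measurable_integrand[OF assms(1,2)] this]
  show ?thesis unfolding fmul_def by (simp add: mult_ac)
qed

section \<open>Solutions and their elementary bounds\<close>

context window begin

text \<open>\<open>\<sigma> = - 1\<close> runs the equation backwards in time.\<close>

definition sol :: "real \<Rightarrow> real \<Rightarrow> (real \<Rightarrow> real \<Rightarrow> complex) \<Rightarrow> bool" where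
  "sol \<sigma> \<kappa> q \<longleftrightarrow> (\<forall>t. X 5 (q t)) \<and>
     (\<forall>t. ((\<lambda>r. nrm 1 5 (\<lambda>x. q r x - q t x)) \<longlongrightarrow> 0) (at t)) \<and>
     (\<forall>t x. ((\<lambda>r. q r x) has_vector_derivative
        of_real \<sigma> * (\<i> / 2 * dX (dX (q t)) x - \<i> * of_real \<kappa> * cub (q t) x)) (at t))"

lemma sol_X: "sol \<sigma> \<kappa> q \<Longrightarrow> X 5 (q t)" unfolding sol_def by blast

lemma
  assumes "X 5 f"
  shows dX_1: "(f has_vector_derivative dX f x) (at x)" "X 4 (dX f)" "nrm 1 4 (dX f) \<le> Kdd * nrm 1 5 f" "norm (dX f x) \<le> Kdd * nrm 1 5 f"
    and dX_2: "(dX f has_vector_derivative dX (dX f) x) (at x)" "X 3 (dX (dX f))" "norm (dX (dX f) x) \<le> Kdd * (Kdd * nrm 1 5 f)"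
proof -
  have s: "Suc 4 = 5" "Suc 3 = 4" by simp_all
  have f: "X (Suc 4) f" unfolding s by (rule assms)
  note d1 = X_has_derivative[OF f] X_dX[OF f] nrm_dX[OF f, unfolded s]
  show "(f has_vector_derivative dX f x) (at x)" "X 4 (dX f)" by (fact d1)+
  show n1: "nrm 1 4 (dX f) \<le> Kdd * nrm 1 5 f" by (fact d1)
  show "norm (dX f x) \<le> Kdd * nrm 1 5 f" using order_trans[OF X_norm_le[OF d1(2)] n1] .
  have g: "X (Suc 3) (dX f)" unfolding s by (rule d1(2))
  note d2 = X_has_derivative[OF g] X_dX[OF g] nrm_dX[OF g, unfolded s]
  show "(dX f has_vector_derivative dX (dX f) x) (at x)" "X 3 (dX (dX f))" by (fact d2)+
  have "norm (dX (dX f) x) \<le> nrm 1 3 (dX (dX f))" by (rule X_norm_le[OF d2(2)])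
  also have "\<dots> \<le> Kdd * nrm 1 4 (dX f)" by (fact d2(3))
  also have "\<dots> \<le> Kdd * (Kdd * nrm 1 5 f)" by (intro mult_left_mono n1 Kdd_nonneg)
  finally show "norm (dX (dX f) x) \<le> Kdd * (Kdd * nrm 1 5 f)" .
qed

lemma sol_diff_continuous:
  assumes u: "sol \<sigma> \<kappa> u" and v: "sol \<sigma> \<kappa> v" and e: "0 \<le> \<epsilon>" "\<epsilon> \<le> 1"
  shows "continuous_on UNIV (\<lambda>t. nrm \<epsilon> 5 (\<lambda>x. u t x - v t x))"
proof (rule continuous_at_imp_continuous_on, rule ballI)
  fix t
  let ?w = "\<lambda>t x. u t x - v t x"
  have X: "X 5 (?w t)" for t by (intro X_diff sol_X[OF u] sol_X[OF v])
  let ?d = "\<lambda>r. nrm 1 5 (\<lambda>x. u r x - u t x) + nrm 1 5 (\<lambda>x. v r x - v t x)"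
  have "norm (nrm \<epsilon> 5 (?w r) - nrm \<epsilon> 5 (?w t)) \<le> ?d r" for r
  proof -
    have X': "X 5 (\<lambda>x. u r x - u t x)" "X 5 (\<lambda>x. v r x - v t x)" for r t by (intro X_diff sol_X[OF u] sol_X[OF v])+
    have "nrm \<epsilon> 5 (\<lambda>x. ?w r x - ?w t x) = nrm \<epsilon> 5 (\<lambda>x. (u r x - u t x) - (v r x - v t x))" for r t
      by (rule arg_cong[where f="nrm \<epsilon> 5"]) (auto simp: algebra_simps)
    hence "nrm \<epsilon> 5 (\<lambda>x. ?w r x - ?w t x) \<le> nrm \<epsilon> 5 (\<lambda>x. u r x - u t x) + nrm \<epsilon> 5 (\<lambda>x. v r x - v t x)" for r t
      using nrm_diff[OF X' e, of r t] by simp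
    also have "\<dots> r t \<le> nrm 1 5 (\<lambda>x. u r x - u t x) + nrm 1 5 (\<lambda>x. v r x - v t x)" for r t
      by (intro add_mono nrm_mono_weight X' e)
    finally have b: "nrm \<epsilon> 5 (\<lambda>x. ?w r x - ?w t x) \<le> nrm 1 5 (\<lambda>x. u r x - u t x) + nrm 1 5 (\<lambda>x. v r x - v t x)" for r t .
    have sym: "nrm 1 5 (\<lambda>x. f t x - f r x) = nrm 1 5 (\<lambda>x. f r x - f t x)" for f :: "real \<Rightarrow> real \<Rightarrow> complex"
    proof -
      have "blk k (\<lambda>x. f t x - f r x) x = (-1) * blk k (\<lambda>x. f r x - f t x) x" for k x
        unfolding blk_def fmul_cmult[symmetric] by simp
      hence "bk k (\<lambda>x. f t x - f r x) = bk k (\<lambda>x. f r x - f t x)" for k unfolding bk_def by (simp add: norm_mult)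
      thus ?thesis unfolding nrm_def by simp
    qed
    show ?thesis
      using nrm_triangle_reverse[OF X X e, of r t] nrm_triangle_reverse[OF X X e, of t r] b[of r t] b[of t r] sym[of u] sym[of v]
      by (simp add: abs_le_iff)
  qed
  moreover have "(?d \<longlongrightarrow> 0 + 0) (at t)" using u v unfolding sol_def by (intro tendsto_intros) auto
  ultimately have "((\<lambda>r. nrm \<epsilon> 5 (?w r) - nrm \<epsilon> 5 (?w t)) \<longlongrightarrow> 0) (at t)"
    by - (rule Lim_null_comparison[where g="?d"], auto)
  thus "isCont (\<lambda>t. nrm \<epsilon> 5 (?w t)) t" by (simp add: isCont_def LIM_zero_iff)
qed

lemma sol_continuous:
  assumes u: "sol \<sigma> \<kappa> u" and e: "0 \<le> \<epsilon>" "\<epsilon> \<le> 1"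
  shows "continuous_on UNIV (\<lambda>t. nrm \<epsilon> 5 (u t))"
proof (rule continuous_at_imp_continuous_on, rule ballI)
  fix t
  let ?d = "\<lambda>r. nrm 1 5 (\<lambda>x. u r x - u t x)"
  have X': "X 5 (\<lambda>x. u r x - u t x)" for r t by (intro X_diff sol_X[OF u])
  have "norm (nrm \<epsilon> 5 (u r) - nrm \<epsilon> 5 (u t)) \<le> ?d r" for r
  proof -
    have "u r = (\<lambda>x. u t x + (u r x - u t x))" "u t = (\<lambda>x. u r x - (u r x - u t x))" by auto
    hence "nrm \<epsilon> 5 (u r) \<le> nrm \<epsilon> 5 (u t) + nrm \<epsilon> 5 (\<lambda>x. u r x - u t x)" "nrm \<epsilon> 5 (u t) \<le> nrm \<epsilon> 5 (u r) + nrm \<epsilon> 5 (\<lambda>x. u r x - u t x)"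
      using nrm_add[OF sol_X[OF u] X' e, of t r t] nrm_diff[OF sol_X[OF u] X' e, of r r t] by simp_all
    thus ?thesis using nrm_mono_weight[OF X' e, of r t] by (simp add: abs_le_iff)
  qed
  moreover have "(?d \<longlongrightarrow> 0) (at t)" using u unfolding sol_def by auto
  ultimately have "((\<lambda>r. nrm \<epsilon> 5 (u r) - nrm \<epsilon> 5 (u t)) \<longlongrightarrow> 0) (at t)"
    by - (rule Lim_null_comparison[where g="?d"], auto)
  thus "isCont (\<lambda>t. nrm \<epsilon> 5 (u t)) t" by (simp add: isCont_def LIM_zero_iff)
qed

lemma sol_bounded:
  assumes u: "sol \<sigma> \<kappa> u" obtains M where "M \<ge> 0" "\<And>t. t \<in> {0..T} \<Longrightarrow> nrm 1 5 (u t) \<le> M"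
proof -
  have "compact ((\<lambda>t. nrm 1 5 (u t)) ` {0..T})"
    by (rule compact_continuous_image[OF continuous_on_subset[OF sol_continuous[OF u]]]) auto
  then obtain M where M: "\<forall>y\<in>(\<lambda>t. nrm 1 5 (u t)) ` {0..T}. norm y \<le> M" using compact_imp_bounded bounded_iff by blast
  have "nrm 1 5 (u t) \<le> max M 0" if "t \<in> {0..T}" for t
    using bspec[OF M imageI[OF that]] by simp
  thus ?thesis by (intro that[of "max M 0"]) auto
qed

lemma sol_shift:
  assumes "sol \<sigma> \<kappa> u" shows "sol \<sigma> \<kappa> (\<lambda>t x. u t (x + c))"
proof -
  have d: "dX (\<lambda>x. f (x + c)) x = dX f (x + c)" for f x
    unfolding dX_def fmul_shift ..
  hence d2: "dX (dX (\<lambda>x. f (x + c))) x = dX (dX f) (x + c)" for f x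
  proof -
    have "dX (\<lambda>x. f (x + c)) = (\<lambda>x. dX f (x + c))" using d by auto
    thus ?thesis using d by simp
  qed
  have "nrm 1 5 (\<lambda>x. u r (x + c) - u t (x + c)) = nrm 1 5 (\<lambda>x. u r x - u t x)" for r t
    using nrm_shift[of 1 5 "\<lambda>x. u r x - u t x" c] by simp
  thus ?thesis using assms unfolding sol_def d2 by (simp add: X_shift cub_def)
qed

text \<open>Galilean invariance. Expanding the phase around k, a \<xi>^2 = a k^2 + 2 a k (\<xi> - k)
  + a (\<xi> - k)^2, leaves a unimodular constant, a translation of the kernel by 2 a k, and the
  propagator for k = 0. Hence the free evolution is bounded on every block with a constant
  independent of k.\<close>

lemma mt_eta_le:
  assumes C: "C \<ge> 0" "\<And>a x. \<bar>a\<bar> \<le> T \<Longrightarrow> norm (fourier_inv (mt a (etat 0)) x) \<le> C * dk x" and a: "\<bar>a\<bar> \<le> T" and f: "bfun f"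
  shows "norm (fmul (mt a (eta k)) f x) \<le> C * dkc * bk k f"
proof -
  have "mt a (eta k) = (\<lambda>\<xi>. mt a (etat k) \<xi> * eta k \<xi>)" by (simp add: mt_def fun_eq_iff mult.assoc etat_eta)
  hence "fmul (mt a (eta k)) f x = fmul (mt a (etat k)) (blk k f) x"
    unfolding blk_def by (simp add: fmul_fmul[OF multiplier_mt[OF multiplier_etat] multiplier_eta f])
  also have "norm \<dots> \<le> C * dkc * bk k f"
  proof (rule fmul_norm_le_shift[OF multiplier_mt[OF multiplier_etat] bfun_blk[OF f] _ norm_blk_le_bk[OF f]])
    fix x
    let ?n = "\<lambda>\<zeta>. exp (- \<i> * of_real (a * (of_int k)\<^sup>2)) * (exp (\<i> * of_real (- 2 * a * of_int k * \<zeta>)) * mt a (etat 0) \<zeta>)"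
    have "mt a (etat k) \<xi> = ?n (\<xi> - of_int k)" for \<xi>
    proof -
      have e: "exp (- \<i> * of_real (a * \<xi>\<^sup>2)) = exp (- \<i> * of_real (a * (of_int k)\<^sup>2)) * (exp (\<i> * of_real (- 2 * a * of_int k * (\<xi> - of_int k))) * exp (- \<i> * of_real (a * (\<xi> - of_int k)\<^sup>2)))"
        unfolding exp_add[symmetric] by (simp add: algebra_simps power2_eq_square)
      show ?thesis unfolding mt_def e by (simp add: etat_translate[of k] mult.assoc)
    qed
    hence "mt a (etat k) = (\<lambda>\<xi>. ?n (\<xi> - of_int k))" by blast
    hence "norm (fourier_inv (mt a (etat k)) x) = norm (fourier_inv (\<lambda>\<xi>. ?n (\<xi> - of_int k)) x)" by (rule arg_cong)
    also have "\<dots> = norm (fourier_inv ?n x)" by (rule fourier_inv_translate)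
    also have "\<dots> = norm (fourier_inv (mt a (etat 0)) (x + (- 2 * a * of_int k)))"
      unfolding fourier_inv_cmult fourier_inv_modulate by (simp add: norm_mult)
    also have "\<dots> \<le> C * dk (x + (- 2 * a * of_int k))" by (rule C(2)[OF a])
    finally show "norm (fourier_inv (mt a (etat k)) x) \<le> C * dk (x - 2 * a * of_int k)" by simp
  qed
  finally show ?thesis .
qed

lemma bk_lipschitz:
  assumes "bfun f" "bfun g" "\<And>x. norm (f x - g x) \<le> B"
  shows "\<bar>bk k f - bk k g\<bar> \<le> Ke * dkc * B"
proof -
  have d: "bk k (\<lambda>x. f x - g x) \<le> Ke * dkc * B" by (rule bk_le_sup[OF bfun_diff[OF assms(1,2)] assms(3)])
  have d': "bk k (\<lambda>x. g x - f x) \<le> Ke * dkc * B" 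
    by (rule bk_le_sup[OF bfun_diff[OF assms(2,1)]]) (use assms(3) in \<open>simp add: norm_minus_commute\<close>)
  have "bk k f \<le> bk k g + bk k (\<lambda>x. f x - g x)" using bk_add[OF assms(2) bfun_diff[OF assms(1,2)], of k] by simp
  moreover have "bk k g \<le> bk k f + bk k (\<lambda>x. g x - f x)" using bk_add[OF assms(1) bfun_diff[OF assms(2,1)], of k] by simp
  ultimately show ?thesis using d d' by linarith
qed

section \<open>Local comparison in \<open>L\<^sup>2\<close>\<close>

context
  fixes \<sigma> \<kappa> T K R :: real and u v :: "real \<Rightarrow> real \<Rightarrow> complex"
  assumes u: "sol \<sigma> \<kappa> u" and v: "sol \<sigma> \<kappa> v" and \<sigma>: "\<bar>\<sigma>\<bar> \<le> 1" and \<kappa>: "\<bar>\<kappa>\<bar> \<le> 1"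
    and K: "\<forall>t\<in>{0..T}. nrm 1 5 (u t) \<le> K \<and> nrm 1 5 (v t) \<le> K"
    and R: "R \<ge> 1"
begin

lemma Ku: "t \<in> {0..T} \<Longrightarrow> nrm 1 5 (u t) \<le> K" and Kv: "t \<in> {0..T} \<Longrightarrow> nrm 1 5 (v t) \<le> K"
  using K by auto

abbreviation (input) "dw \<equiv> \<lambda>t x. u t x - v t x"
abbreviation (input) "dwx \<equiv> \<lambda>t x. dX (u t) x - dX (v t) x"
abbreviation (input) "dwxx \<equiv> \<lambda>t x. dX (dX (u t)) x - dX (dX (v t)) x"
abbreviation (input) "dN \<equiv> \<lambda>t x. cub (u t) x - cub (v t) x"
abbreviation (input) "dwt \<equiv> \<lambda>t x. of_real \<sigma> * (\<i> / 2 * dwxx t x - \<i> * of_real \<kappa> * dN t x)"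

lemma w_derivs:
  "((\<lambda>r. dw r x) has_vector_derivative dwt t x) (at t)"
  "(dw t has_vector_derivative dwx t x) (at x)" "(dwx t has_vector_derivative dwxx t x) (at x)"
proof -
  have "((\<lambda>r. dw r x) has_vector_derivative of_real \<sigma> * (\<i> / 2 * dX (dX (u t)) x - \<i> * of_real \<kappa> * cub (u t) x)
     - of_real \<sigma> * (\<i> / 2 * dX (dX (v t)) x - \<i> * of_real \<kappa> * cub (v t) x)) (at t)"
    using u v unfolding sol_def by (intro has_vector_derivative_diff) blast+
  thus "((\<lambda>r. dw r x) has_vector_derivative dwt t x) (at t)" by (simp add: algebra_simps)
  show "(dw t has_vector_derivative dwx t x) (at x)"
    by (intro has_vector_derivative_diff dX_1 sol_X[OF u] sol_X[OF v])
  show "(dwx t has_vector_derivative dwxx t x) (at x)"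
    by (intro has_vector_derivative_diff dX_2 sol_X[OF u] sol_X[OF v])
qed

lemma cb_w: "cb (dw t)" "cb (dwx t)" "cb (dwxx t)" "cb (dN t)" "cb (dwt t)"
proof -
  note Xu = sol_X[OF u, of t] and Xv = sol_X[OF v, of t]
  show "cb (dw t)" by (intro cb_diff X_cb[OF Xu] X_cb[OF Xv])
  show "cb (dwx t)" by (intro cb_diff X_cb[OF dX_1(2)[OF Xu]] X_cb[OF dX_1(2)[OF Xv]])
  show x: "cb (dwxx t)" by (intro cb_diff X_cb[OF dX_2(2)[OF Xu]] X_cb[OF dX_2(2)[OF Xv]])
  show d: "cb (dN t)" unfolding cub_def by (intro cb_diff cb_mult cb_cnj X_cb[OF Xu] X_cb[OF Xv])
  show "cb (dwt t)" by (intro cb_diff cb_mult cb_const x d)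
qed

lemma w_bounds:
  assumes t: "t \<in> {0..T}"
  shows "norm (u t x) \<le> K" "norm (v t x) \<le> K" "norm (dw t x) \<le> 2 * K" "norm (dwx t x) \<le> 2 * (Kdd * K)" "norm (dwxx t x) \<le> 2 * (Kdd * (Kdd * K))"
    "norm (dN t x) \<le> 3 * K\<^sup>2 * norm (dw t x)" "norm (dwt t x) \<le> Kdd * (Kdd * K) + 6 * K ^ 3"
proof -
  note Xu = sol_X[OF u, of t] and Xv = sol_X[OF v, of t]
  show u1: "norm (u t x) \<le> K" and v1: "norm (v t x) \<le> K"
    using order_trans[OF X_norm_le[OF Xu] Ku[OF t]] order_trans[OF X_norm_le[OF Xv] Kv[OF t]] by auto
  show w1: "norm (dw t x) \<le> 2 * K" using norm_triangle_le_diff[of "u t x" "v t x" "2 * K"] u1 v1 by simp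
  have d: "norm (dX (u t) x) \<le> Kdd * K" "norm (dX (v t) x) \<le> Kdd * K"
    using order_trans[OF dX_1(4)[OF Xu] mult_left_mono[OF Ku[OF t] Kdd_nonneg]]
      order_trans[OF dX_1(4)[OF Xv] mult_left_mono[OF Kv[OF t] Kdd_nonneg]] by auto
  show "norm (dwx t x) \<le> 2 * (Kdd * K)" using norm_triangle_le_diff[of "dX (u t) x" "dX (v t) x" "2 * (Kdd * K)"] d by simp
  have d: "norm (dX (dX (u t)) x) \<le> Kdd * (Kdd * K)" "norm (dX (dX (v t)) x) \<le> Kdd * (Kdd * K)"
    using order_trans[OF dX_2(3)[OF Xu] mult_left_mono[OF mult_left_mono[OF Ku[OF t] Kdd_nonneg] Kdd_nonneg]]
      order_trans[OF dX_2(3)[OF Xv] mult_left_mono[OF mult_left_mono[OF Kv[OF t] Kdd_nonneg] Kdd_nonneg]] by auto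
  show w2: "norm (dwxx t x) \<le> 2 * (Kdd * (Kdd * K))"
    using norm_triangle_le_diff[of "dX (dX (u t)) x" "dX (dX (v t)) x" "2 * (Kdd * (Kdd * K))"] d by simp
  show D: "norm (dN t x) \<le> 3 * K\<^sup>2 * norm (dw t x)" using cub_diff_le[of "u t" x K "v t"] u1 v1 by blast
  have "3 * K\<^sup>2 * norm (dw t x) \<le> 3 * K\<^sup>2 * (2 * K)" by (intro mult_left_mono w1) auto
  hence D': "norm (dN t x) \<le> 6 * K ^ 3" using D by (simp add: power2_eq_square power3_eq_cube)
  have "norm (\<i> / 2 * dwxx t x) \<le> Kdd * (Kdd * K)" using w2 by (simp add: norm_mult norm_divide)
  moreover have "norm (\<i> * of_real \<kappa> * dN t x) \<le> 1 * (6 * K ^ 3)"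
  proof -
    have "\<bar>\<kappa>\<bar> * norm (dN t x) \<le> 1 * (6 * K ^ 3)" using \<kappa> D' by (intro mult_mono[of _ 1]) auto
    thus ?thesis by (simp add: norm_mult)
  qed
  ultimately have "norm (\<i> / 2 * dwxx t x - \<i> * of_real \<kappa> * dN t x) \<le> Kdd * (Kdd * K) + 6 * K ^ 3"
    by (intro norm_triangle_le_diff) linarith
  moreover have "norm (dwt t x) \<le> 1 * norm (\<i> / 2 * dwxx t x - \<i> * of_real \<kappa> * dN t x)"
    unfolding norm_mult using \<sigma> by (intro mult_right_mono) auto
  ultimately show "norm (dwt t x) \<le> Kdd * (Kdd * K) + 6 * K ^ 3" by linarith
qed

definition energy :: "real \<Rightarrow> real" where
  "energy t = (LINT y|lborel. dk (y / R) * (norm (dw t y))\<^sup>2)"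

lemma rho_integrable:
  assumes "continuous_on UNIV g" "\<And>y. norm (g y) \<le> C"
  shows "integrable lborel (\<lambda>y. dk (y / R) * g y :: real)"
proof (rule integrable_dk_bound(1)[where x=0 and C="R\<^sup>2 * C"])
  show "(\<lambda>y. dk (y / R) * g y) \<in> borel_measurable borel"
    by (intro borel_measurable_continuous_onI continuous_intros assms) (use R in auto)
  fix y
  have "dk (y / R) * norm (g y) \<le> (R\<^sup>2 * dk y) * C"
    by (intro mult_mono dk_scale_le R assms) auto
  thus "norm (dk (y / R) * g y) \<le> R\<^sup>2 * C * dk (0 - y)" by (simp add: abs_mult mult_ac)
qed

text \<open>For constant weight the dispersive term would be an exact derivative; a variable weight
  leaves a flux containing the first derivative of the difference. That derivative is only bounded,
  not controlled by the energy, but the slope of the weight supplies a factor 1 / R. The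
  inhomogeneous term therefore tends to 0 as R grows, while the exponential rate does not depend on
  R.\<close>

lemma energy_ineq:
  assumes t: "t \<in> {0..T}"
  shows "energy t \<le> exp ((6 * K\<^sup>2 + 1) * t) * (energy 0 + ((Kdd * K)\<^sup>2 * dkc / R) * t)"
proof -
  obtain r' where r': "\<And>y. ((\<lambda>y. dk (y / R)) has_vector_derivative r' y) (at y)" "\<And>y. \<bar>r' y\<bar> \<le> dk (y / R) / R" "continuous_on UNIV r'"
    using dk_scale_derivative[OF R] by blast
  let ?rho = "\<lambda>y. dk (y / R)"
  have crho: "continuous_on UNIV ?rho" by (intro continuous_intros) (use R in auto)
  note cw = cb_w[THEN cb_continuous]
  let ?F' = "\<lambda>t y. ?rho y * (2 * (dw t y \<bullet> dwt t y))"
  let ?C = "Kdd * (Kdd * K) + 6 * K ^ 3"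
  have D: "(energy has_vector_derivative integral\<^sup>L lborel (?F' t)) (at t within {0..T})" if t: "t \<in> {0..T}" for t
    unfolding energy_def[abs_def]
  proof (rule has_vector_derivative_lebesgue_integral[where h="\<lambda>y. ?rho y * (2 * (2 * K * ?C))"])
    fix s y assume s: "s \<in> {0..T}"
    show "integrable lborel (\<lambda>y. ?rho y * (norm (dw s y))\<^sup>2)"
    proof (rule rho_integrable)
      show "continuous_on UNIV (\<lambda>y. (norm (dw s y))\<^sup>2)" by (intro continuous_intros cw)
      show "norm ((norm (dw s y))\<^sup>2) \<le> (2 * K)\<^sup>2" for y using power_mono[OF w_bounds(3)[OF s, of y], of 2] by simp
    qed
    have "((\<lambda>r. dw r y \<bullet> dw r y) has_vector_derivative dw s y \<bullet> dwt s y + dwt s y \<bullet> dw s y) (at s)"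
      by (rule bounded_bilinear.has_vector_derivative[OF bounded_bilinear_inner w_derivs(1) w_derivs(1)])
    hence "((\<lambda>r. (norm (dw r y))\<^sup>2) has_vector_derivative 2 * (dw s y \<bullet> dwt s y)) (at s)"
      by (simp add: power2_norm_eq_inner inner_commute)
    from has_vector_derivative_at_within[OF has_vector_derivative_mult_right[OF this]]
    show "((\<lambda>r. ?rho y * (norm (dw r y))\<^sup>2) has_vector_derivative ?F' s y) (at s within {0..T})" .
    have "\<bar>dw s y \<bullet> dwt s y\<bar> \<le> norm (dw s y) * norm (dwt s y)" by (rule Cauchy_Schwarz_ineq2)
    also have "\<dots> \<le> 2 * K * ?C" by (intro mult_mono w_bounds s norm_ge_zero order_trans[OF norm_ge_zero w_bounds(3)[OF s]])
    finally show "norm (?F' s y) \<le> ?rho y * (2 * (2 * K * ?C))" by (simp add: abs_mult mult_left_mono)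
  next
    show "integrable lborel (\<lambda>y. ?rho y * (2 * (2 * K * ?C)))" by (rule rho_integrable[of _ "\<bar>2 * (2 * K * ?C)\<bar>"]) auto
    have "continuous_on UNIV (?F' t)" by (intro continuous_intros crho cw)
    thus "?F' t \<in> borel_measurable lborel" by (simp add: borel_measurable_continuous_onI)
  qed (use t in auto)
  have le: "integral\<^sup>L lborel (?F' t) \<le> (6 * K\<^sup>2 + 1) * energy t + (Kdd * K)\<^sup>2 * dkc / R" if t: "t \<in> {0..T}" for t
  proof -
    let ?K1 = "Kdd * K"
    \<comment> \<open>The derivative of the flux density; the term with two first derivatives drops
      out by \<open>inner_i\<close>.\<close>
    let ?H' = "\<lambda>y. ?rho y * (dw t y \<bullet> (\<i> * dwxx t y)) + r' y * (dw t y \<bullet> (\<i> * dwx t y))"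
    have K0: "K \<ge> 0" using order_trans[OF norm_ge_zero w_bounds(1)[OF t]] .
    have cr: "\<bar>dw t y \<bullet> (\<i> * z)\<bar> \<le> norm (dw t y) * norm z" for y z
      using Cauchy_Schwarz_ineq2[of "dw t y" "\<i> * z"] by (simp add: norm_mult)
    have H0: "integral\<^sup>L lborel ?H' = 0"
    proof (rule integral_derivative_dk_eq_0[where H="\<lambda>y. ?rho y * (dw t y \<bullet> (\<i> * dwx t y))" and x=0])
      fix y
      have "((\<lambda>y. dw t y \<bullet> (\<i> * dwx t y)) has_vector_derivative dw t y \<bullet> (\<i> * dwxx t y) + dwx t y \<bullet> (\<i> * dwx t y)) (at y)"
        by (rule bounded_bilinear.has_vector_derivative[OF bounded_bilinear_inner w_derivs(2) has_vector_derivative_mult_right[OF w_derivs(3)]])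
      from has_vector_derivative_mult[OF r'(1) this[unfolded inner_i]]
      show "((\<lambda>y. ?rho y * (dw t y \<bullet> (\<i> * dwx t y))) has_vector_derivative ?H' y) (at y)" by simp
      have w1: "\<bar>dw t y \<bullet> (\<i> * dwx t y)\<bar> \<le> 2 * K * (2 * ?K1)"
        by (rule order_trans[OF cr]) (intro mult_mono w_bounds t norm_ge_zero mult_nonneg_nonneg K0 zero_le_numeral)
      have w2: "\<bar>dw t y \<bullet> (\<i> * dwxx t y)\<bar> \<le> 2 * K * (2 * (Kdd * ?K1))"
        by (rule order_trans[OF cr]) (intro mult_mono w_bounds t norm_ge_zero mult_nonneg_nonneg K0 zero_le_numeral)
      have rr: "\<bar>r' y\<bar> \<le> ?rho y" using r'(2)[of y] R dk_nonneg[of "y / R"] by (smt (verit) divide_le_eq_1 mult_left_mono div_by_1 divide_left_mono zero_less_one mult_1 mult_pos_pos)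
      have "\<bar>?rho y * (dw t y \<bullet> (\<i> * dwx t y))\<bar> \<le> (R\<^sup>2 * dk y) * (2 * K * (2 * ?K1))"
        unfolding abs_mult by (intro mult_mono w1) (use dk_scale_le[OF R, of y] R in auto)
      thus "norm (?rho y * (dw t y \<bullet> (\<i> * dwx t y))) \<le> (R\<^sup>2 * (2 * K * (2 * ?K1))) * dk (0 - y)" by (simp add: mult_ac)
      have "\<bar>?H' y\<bar> \<le> (R\<^sup>2 * dk y) * (2 * K * (2 * (Kdd * ?K1))) + (R\<^sup>2 * dk y) * (2 * K * (2 * ?K1))"
        by (rule order_trans[OF abs_triangle_ineq], unfold abs_mult, intro add_mono mult_mono w1 w2)
          (use dk_scale_le[OF R, of y] order_trans[OF rr dk_scale_le[OF R]] R in auto)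
      thus "norm (?H' y) \<le> (R\<^sup>2 * (2 * K * (2 * (Kdd * ?K1))) + R\<^sup>2 * (2 * K * (2 * ?K1))) * dk (0 - y)"
        by (simp add: algebra_simps)
    next
      show "continuous_on UNIV ?H'" by (intro continuous_intros crho cw r'(3))
    qed
    have i1: "integrable lborel (\<lambda>y. ?rho y * (dw t y \<bullet> (\<i> * dwxx t y)))"
    proof (rule rho_integrable)
      show "continuous_on UNIV (\<lambda>y. dw t y \<bullet> (\<i> * dwxx t y))" by (intro continuous_intros cw)
      show "norm (dw t y \<bullet> (\<i> * dwxx t y)) \<le> 2 * K * (2 * (Kdd * ?K1))" for y
        unfolding real_norm_def
        by (rule order_trans[OF cr]) (intro mult_mono w_bounds t norm_ge_zero mult_nonneg_nonneg K0 zero_le_numeral)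
    qed
    have iw: "integrable lborel (\<lambda>y. ?rho y * (norm (dw t y))\<^sup>2)"
    proof (rule rho_integrable)
      show "continuous_on UNIV (\<lambda>y. (norm (dw t y))\<^sup>2)" by (intro continuous_intros cw)
      show "norm ((norm (dw t y))\<^sup>2) \<le> (2 * K)\<^sup>2" for y using power_mono[OF w_bounds(3)[OF t, of y], of 2] by simp
    qed
    have ir: "integrable lborel (\<lambda>y. r' y * (dw t y \<bullet> (\<i> * dwx t y)))"
    proof (rule Bochner_Integration.integrable_bound[where f="\<lambda>y. ?rho y * (2 * K * (2 * ?K1))"])
      show "integrable lborel (\<lambda>y. ?rho y * (2 * K * (2 * ?K1)))" by (rule rho_integrable[of _ "\<bar>2 * K * (2 * ?K1)\<bar>"]) auto
      have "continuous_on UNIV (\<lambda>y. r' y * (dw t y \<bullet> (\<i> * dwx t y)))" by (intro continuous_intros crho cw r'(3))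
      thus "(\<lambda>y. r' y * (dw t y \<bullet> (\<i> * dwx t y))) \<in> borel_measurable lborel" by (simp add: borel_measurable_continuous_onI)
      show "AE y in lborel. norm (r' y * (dw t y \<bullet> (\<i> * dwx t y))) \<le> norm (?rho y * (2 * K * (2 * ?K1)))"
      proof (rule AE_I2)
        fix y
        have "?rho y / R \<le> ?rho y / 1" using R by (intro divide_left_mono) auto
        hence rr: "\<bar>r' y\<bar> \<le> ?rho y" using r'(2)[of y] by simp
        have w1: "\<bar>dw t y \<bullet> (\<i> * dwx t y)\<bar> \<le> 2 * K * (2 * ?K1)"
          by (rule order_trans[OF cr]) (intro mult_mono w_bounds t norm_ge_zero mult_nonneg_nonneg K0 zero_le_numeral)
        have "\<bar>r' y * (dw t y \<bullet> (\<i> * dwx t y))\<bar> \<le> ?rho y * (2 * K * (2 * ?K1))"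
          unfolding abs_mult by (intro mult_mono rr w1) auto
        thus "norm (r' y * (dw t y \<bullet> (\<i> * dwx t y))) \<le> norm (?rho y * (2 * K * (2 * ?K1)))" by simp
      qed
    qed
    have flux: "(LINT y|lborel. ?rho y * (dw t y \<bullet> (\<i> * dwxx t y))) = - (LINT y|lborel. r' y * (dw t y \<bullet> (\<i> * dwx t y)))"
      using H0[unfolded Bochner_Integration.integral_add[OF i1 ir]] by linarith
    have iD: "integrable lborel (\<lambda>y. ?rho y * (dw t y \<bullet> (\<i> * dN t y)))"
    proof (rule rho_integrable)
      show "continuous_on UNIV (\<lambda>y. dw t y \<bullet> (\<i> * dN t y))" by (intro continuous_intros cw)
      fix y
      have "norm (dw t y) * norm (dN t y) \<le> 2 * K * (3 * K\<^sup>2 * (2 * K))"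
        by (intro mult_mono w_bounds t order_trans[OF w_bounds(6)[OF t] mult_left_mono[OF w_bounds(3)[OF t]]]) (use K0 in auto)
      thus "norm (dw t y \<bullet> (\<i> * dN t y)) \<le> 2 * K * (3 * K\<^sup>2 * (2 * K))"
        unfolding real_norm_def by (rule order_trans[OF cr])
    qed
    have e: "?F' t y = \<sigma> * (?rho y * (dw t y \<bullet> (\<i> * dwxx t y))) - 2 * \<sigma> * \<kappa> * (?rho y * (dw t y \<bullet> (\<i> * dN t y)))" for y
      by (simp only: inner_evolution) (simp add: algebra_simps)
    have "integral\<^sup>L lborel (?F' t) = \<sigma> * (LINT y|lborel. ?rho y * (dw t y \<bullet> (\<i> * dwxx t y))) - 2 * \<sigma> * \<kappa> * (LINT y|lborel. ?rho y * (dw t y \<bullet> (\<i> * dN t y)))"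
      unfolding e using i1 iD by simp
    also have "\<dots> = (LINT y|lborel. - \<sigma> * (r' y * (dw t y \<bullet> (\<i> * dwx t y))) - 2 * \<sigma> * \<kappa> * (?rho y * (dw t y \<bullet> (\<i> * dN t y))))"
      unfolding flux using ir iD by simp
    \<comment> \<open>In the rate, \<open>6 * K\<^sup>2\<close> comes from the cubic term and 1 from
      Young's inequality for the flux. The remainder \<open>?K1\<^sup>2 / R\<^sup>2\<close> is
      integrated against a weight of mass \<open>R * dkc\<close>, which costs one power of
      R.\<close>
    also have "\<dots> \<le> (LINT y|lborel. (6 * K\<^sup>2 + 1) * (?rho y * (norm (dw t y))\<^sup>2) + (?K1\<^sup>2 / R\<^sup>2) * ?rho y)"
    proof (rule integral_mono)
      show "integrable lborel (\<lambda>y. - \<sigma> * (r' y * (dw t y \<bullet> (\<i> * dwx t y))) - 2 * \<sigma> * \<kappa> * (?rho y * (dw t y \<bullet> (\<i> * dN t y))))"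
        using ir iD by auto
      show "integrable lborel (\<lambda>y. (6 * K\<^sup>2 + 1) * (?rho y * (norm (dw t y))\<^sup>2) + (?K1\<^sup>2 / R\<^sup>2) * ?rho y)"
        using iw integrable_dk_scale[of R] R by auto
      fix y
      let ?n = "norm (dw t y)"
      have "\<bar>- \<sigma> * (r' y * (dw t y \<bullet> (\<i> * dwx t y)))\<bar> \<le> 1 * ((?rho y / R) * (?n * (2 * ?K1)))"
        unfolding abs_mult abs_minus_cancel
        by (intro mult_mono \<sigma> r'(2) order_trans[OF cr] w_bounds t) (use R in auto)
      moreover have "\<bar>2 * \<sigma> * \<kappa> * (?rho y * (dw t y \<bullet> (\<i> * dN t y)))\<bar> \<le> 2 * 1 * 1 * (?rho y * (?n * (3 * K\<^sup>2 * ?n)))"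
        unfolding abs_mult abs_numeral
        by (intro mult_mono \<sigma> \<kappa> order_trans[OF cr] w_bounds t) auto
      moreover have "(?rho y / R) * (?n * (2 * ?K1)) \<le> ?rho y * (?n\<^sup>2 + ?K1\<^sup>2 / R\<^sup>2)"
      proof -
        have "2 * ?n * (?K1 / R) \<le> ?n\<^sup>2 + (?K1 / R)\<^sup>2" by (rule sum_squares_bound)
        hence "?rho y * (2 * ?n * (?K1 / R)) \<le> ?rho y * (?n\<^sup>2 + (?K1 / R)\<^sup>2)" by (intro mult_left_mono) auto
        thus ?thesis by (simp add: power_divide mult_ac)
      qed
      ultimately have "- \<sigma> * (r' y * (dw t y \<bullet> (\<i> * dwx t y))) - 2 * \<sigma> * \<kappa> * (?rho y * (dw t y \<bullet> (\<i> * dN t y)))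
         \<le> ?rho y * (?n\<^sup>2 + ?K1\<^sup>2 / R\<^sup>2) + 2 * (?rho y * (?n * (3 * K\<^sup>2 * ?n)))"
        by linarith
      also have "\<dots> = (6 * K\<^sup>2 + 1) * (?rho y * ?n\<^sup>2) + (?K1\<^sup>2 / R\<^sup>2) * ?rho y"
        by (simp add: algebra_simps power2_eq_square)
      finally show "- \<sigma> * (r' y * (dw t y \<bullet> (\<i> * dwx t y))) - 2 * \<sigma> * \<kappa> * (?rho y * (dw t y \<bullet> (\<i> * dN t y)))
         \<le> (6 * K\<^sup>2 + 1) * (?rho y * ?n\<^sup>2) + (?K1\<^sup>2 / R\<^sup>2) * ?rho y" .
    qed
    also have "\<dots> = (6 * K\<^sup>2 + 1) * energy t + (?K1\<^sup>2 / R\<^sup>2) * (R * dkc)"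
      unfolding energy_def using iw integrable_dk_scale[of R] R integral_dk_scale[of R] by simp
    also have "(?K1\<^sup>2 / R\<^sup>2) * (R * dkc) = ?K1\<^sup>2 * dkc / R" using R by (simp add: power2_eq_square)
    finally show ?thesis .
  qed
  show ?thesis
    by (rule gronwall_differential[OF D le _ _ t]) (use R dkc_nonneg in auto)
qed

subsection \<open>Duhamel's formula\<close>

text \<open>The difference is pulled forward to time \<open>t0\<close> by the free evolution, which
  removes the dispersion: differentiating the propagator in s puts \<xi>^2 on the symbol, and two
  integrations by parts turn the second space derivative into the same expression with the opposite
  sign.\<close>

lemma duhamel_derivative:
  assumes m: "multiplier m" and t0: "t0 \<in> {0..T}" and s: "s \<in> {0..t0}"
  shows "((\<lambda>s. fmul (mt (\<sigma> / 2 * (t0 - s)) m) (dw s) x) has_vector_derivative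
     - \<i> * of_real (\<sigma> * \<kappa>) * fmul (mt (\<sigma> / 2 * (t0 - s)) m) (dN s) x) (at s within {0..t0})"
proof -
  let ?m2 = "\<lambda>\<xi>. - \<i> * of_real (\<xi>\<^sup>2) * m \<xi>"
  let ?a = "\<lambda>s. \<sigma> / 2 * (t0 - s)"
  note m2 = multiplier_times_square[OF m]
  have T: "T \<ge> 0" using t0 by auto
  obtain C where C: "C \<ge> 0" "\<And>a x. \<bar>a\<bar> \<le> T \<Longrightarrow> norm (fourier_inv (mt a m) x) \<le> C * dk x" using mt_decay[OF m T] by blast
  obtain C' where C': "C' \<ge> 0" "\<And>a x. \<bar>a\<bar> \<le> T \<Longrightarrow> norm (fourier_inv (mt a ?m2) x) \<le> C' * dk x" using mt_decay[OF m2 T] by blast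
  let ?W = "Kdd * (Kdd * K) + 6 * K ^ 3"
  let ?F' = "\<lambda>s y. (of_real (- \<sigma> / 2) * fourier_inv (mt (?a s) ?m2) (x - y)) * dw s y + fourier_inv (mt (?a s) m) (x - y) * dwt s y"
  have rT: "r \<in> {0..T}" "\<bar>?a r\<bar> \<le> T" if "r \<in> {0..t0}" for r
  proof -
    show "r \<in> {0..T}" using that t0 by auto
    have "\<bar>\<sigma> / 2\<bar> * \<bar>t0 - r\<bar> \<le> 1 * T" using that t0 \<sigma> by (intro mult_mono) auto
    thus "\<bar>?a r\<bar> \<le> T" by (simp add: abs_mult)
  qed
  have "((\<lambda>s. LINT y|lborel. fourier_inv (mt (?a s) m) (x - y) * dw s y) has_vector_derivative integral\<^sup>L lborel (?F' s)) (at s within {0..t0})"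
  proof (rule has_vector_derivative_lebesgue_integral[where h="\<lambda>y. (1 * (C' * (2 * K)) + C * ?W) * dk (x - y)"])
    show "integrable lborel (\<lambda>y. (1 * (C' * (2 * K)) + C * ?W) * dk (x - y))" using integrable_dk_shift by auto
    fix r y assume r: "r \<in> {0..t0}"
    show "integrable lborel (\<lambda>y. fourier_inv (mt (?a r) m) (x - y) * dw r y)"
      by (rule fmul_integrable[OF multiplier_mt[OF m] cb_bfun[OF cb_w(1)]])
    have "((\<lambda>s. ?a s) has_vector_derivative - \<sigma> / 2) (at r)"
      by (auto intro!: derivative_eq_intros simp: has_real_derivative_iff_has_vector_derivative[symmetric])
    from vector_diff_chain_at[OF this mt_has_derivative[OF m]]
    have "((\<lambda>s. fourier_inv (mt (?a s) m) (x - y)) has_vector_derivative of_real (- \<sigma> / 2) * fourier_inv (mt (?a r) ?m2) (x - y)) (at r)"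
      by (simp only: o_def scaleR_conv_of_real)
    from has_vector_derivative_mult[OF this w_derivs(1)]
    have "((\<lambda>s. fourier_inv (mt (?a s) m) (x - y) * dw s y) has_vector_derivative ?F' r y) (at r)"
      by (simp only: add.commute)
    thus "((\<lambda>s. fourier_inv (mt (?a s) m) (x - y) * dw s y) has_vector_derivative ?F' r y) (at r within {0..t0})"
      by (rule has_vector_derivative_at_within)
    have "norm (fourier_inv (mt (?a r) ?m2) (x - y) * dw r y) \<le> C' * (2 * K) * dk (x - y)"
      by (rule kernel_mult_decay[OF C'(2)[OF rT(2)[OF r]] w_bounds(3)[OF rT(1)[OF r]]])
    hence "\<bar>\<sigma> / 2\<bar> * norm (fourier_inv (mt (?a r) ?m2) (x - y) * dw r y) \<le> 1 * (C' * (2 * K) * dk (x - y))"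
      using \<sigma> by (intro mult_mono) auto
    hence 1: "norm ((of_real (- \<sigma> / 2) * fourier_inv (mt (?a r) ?m2) (x - y)) * dw r y) \<le> 1 * (C' * (2 * K) * dk (x - y))"
      by (simp add: norm_mult mult.assoc)
    have 2: "norm (fourier_inv (mt (?a r) m) (x - y) * dwt r y) \<le> C * ?W * dk (x - y)"
      by (rule kernel_mult_decay[OF C(2)[OF rT(2)[OF r]] w_bounds(7)[OF rT(1)[OF r]]])
    have "norm (?F' r y) \<le> 1 * (C' * (2 * K) * dk (x - y)) + C * ?W * dk (x - y)"
      by (intro norm_triangle_le add_mono 1 2)
    thus "norm (?F' r y) \<le> (1 * (C' * (2 * K)) + C * ?W) * dk (x - y)" by (simp add: distrib_right)
  next
    have "?F' s \<in> borel_measurable borel"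
      using fmul_measurable_integrand[OF multiplier_mt[OF m2] cb_bfun[OF cb_w(1)], of "?a s" x s]
        fmul_measurable_integrand[OF multiplier_mt[OF m] cb_bfun[OF cb_w(5)], of "?a s" x s]
      unfolding mult.assoc by (intro borel_measurable_add borel_measurable_times[OF borel_measurable_const])
    thus "?F' s \<in> borel_measurable lborel" by simp
  qed (use s in auto)
  also have "integral\<^sup>L lborel (?F' s) = - \<i> * of_real (\<sigma> * \<kappa>) * fmul (mt (?a s) m) (dN s) x"
  proof -
    let ?M = "mt (?a s) m"
    note M = multiplier_mt[OF m, of "?a s"]
    note bb = cb_w[THEN cb_bfun, of s]
    have "integral\<^sup>L lborel (?F' s) = of_real (- \<sigma> / 2) * fmul (mt (?a s) ?m2) (dw s) x + fmul ?M (dwt s) x"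
    proof -
      have i1: "integrable lborel (\<lambda>y. of_real (- \<sigma> / 2) * (fourier_inv (mt (?a s) ?m2) (x - y) * dw s y))"
        by (intro integrable_mult_right fmul_integrable[OF multiplier_mt[OF m2] bb(1)])
      show ?thesis
        unfolding fmul_def integral_mult_right_zero[symmetric]
        by (subst Bochner_Integration.integral_add[OF i1 fmul_integrable[OF M bb(5)], symmetric]) (simp only: mult.assoc)
    qed
    also have "fmul ?M (dwt s) x = of_real \<sigma> * (\<i> / 2 * fmul ?M (dwxx s) x - \<i> * of_real \<kappa> * fmul ?M (dN s) x)"
    proof -
      have "fmul ?M (dwt s) x = of_real \<sigma> * fmul ?M (\<lambda>x. \<i> / 2 * dwxx s x - \<i> * of_real \<kappa> * dN s x) x"
        by (rule fmul_cmult)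
      also have "fmul ?M (\<lambda>x. \<i> / 2 * dwxx s x - \<i> * of_real \<kappa> * dN s x) x = fmul ?M (\<lambda>x. \<i> / 2 * dwxx s x) x - fmul ?M (\<lambda>x. \<i> * of_real \<kappa> * dN s x) x"
        by (rule fmul_diff[OF M bfun_mult[OF bfun_const bb(3)] bfun_mult[OF bfun_const bb(4)]])
      finally show ?thesis by (simp only: fmul_cmult)
    qed
    also have "fmul ?M (dwxx s) x = fmul (\<lambda>\<xi>. \<i> * of_real \<xi> * (\<i> * of_real \<xi> * ?M \<xi>)) (dw s) x"
    proof -
      have "fmul ?M (dwxx s) x = fmul (\<lambda>\<xi>. \<i> * of_real \<xi> * ?M \<xi>) (\<lambda>x. dX (u s) x - dX (v s) x) x"
        by (rule fmul_derivative[OF M bb(2,3) cb_continuous[OF cb_w(3)] w_derivs(3)])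
      also have "\<dots> = fmul (\<lambda>\<xi>. \<i> * of_real \<xi> * (\<i> * of_real \<xi> * ?M \<xi>)) (dw s) x"
        by (rule fmul_derivative[OF multiplier_times_id[OF M] bb(1,2) cb_continuous[OF cb_w(2)] w_derivs(2)])
      finally show ?thesis .
    qed
    \<comment> \<open>With this factor \<open>- \<i>\<close> and the coefficient
      \<open>\<i> / 2\<close> of the equation the term becomes \<open>\<sigma> / 2\<close> times the
      one produced by the propagator, whose own coefficient is
      \<open>- \<sigma> / 2\<close>.\<close>
    also have "(\<lambda>\<xi>. \<i> * of_real \<xi> * (\<i> * of_real \<xi> * ?M \<xi>)) = (\<lambda>\<xi>. (- \<i>) * mt (?a s) ?m2 \<xi>)"
      by (auto simp: mt_def fun_eq_iff power2_eq_square)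
    also have "fmul (\<lambda>\<xi>. (- \<i>) * mt (?a s) ?m2 \<xi>) (dw s) x = (- \<i>) * fmul (mt (?a s) ?m2) (dw s) x" by (rule fmul_cmult_left)
    finally show ?thesis by (simp add: algebra_simps)
  qed
  finally show ?thesis unfolding fmul_def .
qed

lemma bk_dN_continuous: "continuous_on {0..T} (\<lambda>s. bk k (dN s))"
proof (rule continuous_on_eq_continuous_within[THEN iffD2], rule ballI)
  fix s assume s: "s \<in> {0..T}"
  let ?g = "\<lambda>r. Ke * dkc * (3 * K\<^sup>2 * nrm 1 5 (\<lambda>x. u r x - u s x) + 3 * K\<^sup>2 * nrm 1 5 (\<lambda>x. v r x - v s x))"
  have "norm (bk k (dN r) - bk k (dN s)) \<le> ?g r" if r: "r \<in> {0..T}" for r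
    unfolding real_norm_def
  proof (rule bk_lipschitz[OF cb_bfun[OF cb_w(4)] cb_bfun[OF cb_w(4)]])
    fix x
    have "norm (cub (u r) x - cub (u s) x) \<le> 3 * K\<^sup>2 * norm (u r x - u s x)"
      by (rule cub_diff_le) (use w_bounds(1)[OF r] w_bounds(1)[OF s] in blast)+
    also have "\<dots> \<le> 3 * K\<^sup>2 * nrm 1 5 (\<lambda>x. u r x - u s x)"
      by (intro mult_left_mono X_norm_le[OF X_diff[OF sol_X[OF u] sol_X[OF u]]]) auto
    finally have 1: "norm (cub (u r) x - cub (u s) x) \<le> 3 * K\<^sup>2 * nrm 1 5 (\<lambda>x. u r x - u s x)" .
    have "norm (cub (v r) x - cub (v s) x) \<le> 3 * K\<^sup>2 * norm (v r x - v s x)"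
      by (rule cub_diff_le) (use w_bounds(2)[OF r] w_bounds(2)[OF s] in blast)+
    also have "\<dots> \<le> 3 * K\<^sup>2 * nrm 1 5 (\<lambda>x. v r x - v s x)"
      by (intro mult_left_mono X_norm_le[OF X_diff[OF sol_X[OF v] sol_X[OF v]]]) auto
    finally have 2: "norm (cub (v r) x - cub (v s) x) \<le> 3 * K\<^sup>2 * nrm 1 5 (\<lambda>x. v r x - v s x)" .
    have "dN r x - dN s x = (cub (u r) x - cub (u s) x) - (cub (v r) x - cub (v s) x)" by simp
    thus "norm (dN r x - dN s x) \<le> 3 * K\<^sup>2 * nrm 1 5 (\<lambda>x. u r x - u s x) + 3 * K\<^sup>2 * nrm 1 5 (\<lambda>x. v r x - v s x)"
      using norm_triangle_le_diff[OF add_mono[OF 1 2]] by (simp only:)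
  qed
  hence ev: "\<forall>\<^sub>F r in at s within {0..T}. norm (bk k (dN r) - bk k (dN s)) \<le> ?g r"
    unfolding eventually_at_filter by (intro always_eventually) auto
  have "((\<lambda>r. nrm 1 5 (\<lambda>x. q r x - q s x)) \<longlongrightarrow> 0) (at s within {0..T})" if "sol \<sigma> \<kappa> q" for q
  proof -
    have "((\<lambda>r. nrm 1 5 (\<lambda>x. q r x - q s x)) \<longlongrightarrow> 0) (at s within UNIV)" using that unfolding sol_def by blast
    thus ?thesis by (rule tendsto_within_subset) simp
  qed
  hence "(?g \<longlongrightarrow> Ke * dkc * (3 * K\<^sup>2 * 0 + 3 * K\<^sup>2 * 0)) (at s within {0..T})" using u v by (intro tendsto_intros) auto
  hence "(?g \<longlongrightarrow> 0) (at s within {0..T})" by simp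
  from Lim_null_comparison[OF ev this]
  show "continuous (at s within {0..T}) (\<lambda>s. bk k (dN s))" by (simp add: continuous_within LIM_zero_iff)
qed

text \<open>Stated for each block separately and with a constant independent of k, so that it can be
  summed against any of the weights.\<close>

lemma duhamel:
  assumes C: "C \<ge> 0" "\<And>a x. \<bar>a\<bar> \<le> T \<Longrightarrow> norm (fourier_inv (mt a (etat 0)) x) \<le> C * dk x" and t: "t \<in> {0..T}"
  shows "bk k (dw t) \<le> C * dkc * (bk k (dw 0) + integral {0..t} (\<lambda>s. bk k (dN s)))"
proof (rule bk_le)
  fix x
  let ?G = "\<lambda>s. fmul (mt (\<sigma> / 2 * (t - s)) (eta k)) (dw s) x"
  let ?G' = "\<lambda>s. - \<i> * of_real (\<sigma> * \<kappa>) * fmul (mt (\<sigma> / 2 * (t - s)) (eta k)) (dN s) x"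
  have a: "\<bar>\<sigma> / 2 * (t - s)\<bar> \<le> T" if "s \<in> {0..t}" for s
  proof -
    have "\<bar>\<sigma> / 2\<bar> * \<bar>t - s\<bar> \<le> 1 * T" using that t \<sigma> by (intro mult_mono) auto
    thus ?thesis by (simp add: abs_mult)
  qed
  have G: "(?G' has_integral (?G t - ?G 0)) {0..t}"
    by (rule fundamental_theorem_of_calculus) (use t duhamel_derivative[OF multiplier_eta t] in auto)
  have gi: "(\<lambda>s. C * dkc * bk k (dN s)) integrable_on {0..t}"
    by (intro integrable_continuous_interval continuous_intros continuous_on_subset[OF bk_dN_continuous]) (use t in auto)
  have n1: "norm (integral {0..t} ?G') \<le> integral {0..t} (\<lambda>s. C * dkc * bk k (dN s))"
  proof (rule Henstock_Kurzweil_Integration.integral_norm_bound_integral[OF has_integral_integrable[OF G] gi])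
    fix s assume s: "s \<in> {0..t}"
    have "\<bar>\<sigma>\<bar> * \<bar>\<kappa>\<bar> \<le> 1 * 1" using \<sigma> \<kappa> by (intro mult_mono) auto
    hence "\<bar>\<sigma> * \<kappa>\<bar> * norm (fmul (mt (\<sigma> / 2 * (t - s)) (eta k)) (dN s) x) \<le> 1 * (C * dkc * bk k (dN s))"
      by (intro mult_mono mt_eta_le[OF C a[OF s] cb_bfun[OF cb_w(4)]]) (auto simp: abs_mult)
    thus "norm (?G' s) \<le> C * dkc * bk k (dN s)" by (simp add: norm_mult abs_mult)
  qed
  have n2: "integral {0..t} ?G' = ?G t - ?G 0" using G by (rule integral_unique)
  have n3: "?G t = blk k (dw t) x" by (simp add: blk_def)
  have n4: "norm (?G 0) \<le> C * dkc * bk k (dw 0)"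
    by (rule mt_eta_le[OF C a cb_bfun[OF cb_w(1)]]) (use t in auto)
  have n5: "norm (?G t) \<le> norm (?G t - ?G 0) + norm (?G 0)" using norm_triangle_sub[of "?G t" "?G 0"] by linarith
  have n6: "integral {0..t} (\<lambda>s. C * dkc * bk k (dN s)) = C * dkc * integral {0..t} (\<lambda>s. bk k (dN s))" by simp
  have "norm (?G t) \<le> C * dkc * integral {0..t} (\<lambda>s. bk k (dN s)) + C * dkc * bk k (dw 0)"
    using n1[unfolded n2 n6] n4 n5 by linarith
  thus "norm (blk k (dw t) x) \<le> C * dkc * (bk k (dw 0) + integral {0..t} (\<lambda>s. bk k (dN s)))"
    unfolding n3 by (simp only: distrib_left add.commute)
qed

text \<open>The bound K on the full norms enters only qualitatively, through continuity and
  integrability in time. The conclusion involves only C, which belongs to the time horizon, and the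
  Lipschitz constant B in the flattened norm; hence its uniformity in \<epsilon>.\<close>

lemma duhamel_nrm:
  assumes C: "C \<ge> 0" "\<And>a x. \<bar>a\<bar> \<le> T \<Longrightarrow> norm (fourier_inv (mt a (etat 0)) x) \<le> C * dk x" and t: "t \<in> {0..T}"
    and e: "0 \<le> \<epsilon>" "\<epsilon> \<le> 1" and B: "\<And>s. s \<in> {0..t} \<Longrightarrow> nrm \<epsilon> 5 (dN s) \<le> B * nrm \<epsilon> 5 (dw s)"
  shows "nrm \<epsilon> 5 (dw t) \<le> C * dkc * nrm \<epsilon> 5 (dw 0) + C * dkc * B * integral {0..t} (\<lambda>s. nrm \<epsilon> 5 (dw s))"
proof (rule nrm_le[OF X_diff[OF sol_X[OF u] sol_X[OF v]] e(1)])
  fix F :: "int set" assume F: "finite F"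
  have Cd: "C * dkc \<ge> 0" using C dkc_nonneg by simp
  have Xd: "X 5 (dw s)" for s by (rule X_diff[OF sol_X[OF u] sol_X[OF v]])
  have XN: "X 5 (dN s)" for s unfolding cub_def by (intro X_diff X_cubic sol_X[OF u] sol_X[OF v])
  have cN: "continuous_on {0..t} (\<lambda>s. bk k (dN s))" for k
    by (rule continuous_on_subset[OF bk_dN_continuous]) (use t in auto)
  have cw: "continuous_on {0..t} (\<lambda>s. nrm \<epsilon> 5 (dw s))"
    by (rule continuous_on_subset[OF sol_diff_continuous[OF u v e]]) auto
  have "(\<Sum>k\<in>F. wt \<epsilon> 5 k * bk k (dw t)) \<le> (\<Sum>k\<in>F. wt \<epsilon> 5 k * (C * dkc * (bk k (dw 0) + integral {0..t} (\<lambda>s. bk k (dN s)))))"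
    by (intro sum_mono mult_left_mono duhamel C t wt_nonneg e)
  also have "\<dots> = C * dkc * (\<Sum>k\<in>F. wt \<epsilon> 5 k * bk k (dw 0)) + C * dkc * (\<Sum>k\<in>F. wt \<epsilon> 5 k * integral {0..t} (\<lambda>s. bk k (dN s)))"
    by (simp add: sum_distrib_left sum.distrib algebra_simps)
  also have "(\<Sum>k\<in>F. wt \<epsilon> 5 k * integral {0..t} (\<lambda>s. bk k (dN s))) = integral {0..t} (\<lambda>s. \<Sum>k\<in>F. wt \<epsilon> 5 k * bk k (dN s))"
    using F by (subst integral_sum) (auto intro!: integrable_continuous_interval continuous_intros cN)
  also have "C * dkc * (\<Sum>k\<in>F. wt \<epsilon> 5 k * bk k (dw 0)) + C * dkc * integral {0..t} (\<lambda>s. \<Sum>k\<in>F. wt \<epsilon> 5 k * bk k (dN s))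
     \<le> C * dkc * nrm \<epsilon> 5 (dw 0) + C * dkc * integral {0..t} (\<lambda>s. B * nrm \<epsilon> 5 (dw s))"
  proof (intro add_mono mult_left_mono Cd sum_le_nrm[OF Xd e F] integral_le)
    show "(\<lambda>s. \<Sum>k\<in>F. wt \<epsilon> 5 k * bk k (dN s)) integrable_on {0..t}"
      by (intro integrable_continuous_interval continuous_intros cN)
    show "(\<lambda>s. B * nrm \<epsilon> 5 (dw s)) integrable_on {0..t}"
      by (intro integrable_continuous_interval continuous_intros cw)
    show "(\<Sum>k\<in>F. wt \<epsilon> 5 k * bk k (dN s)) \<le> B * nrm \<epsilon> 5 (dw s)" if "s \<in> {0..t}" for s
      by (rule order_trans[OF sum_le_nrm[OF XN e F] B[OF that]])
  qed
  also have "\<dots> = C * dkc * nrm \<epsilon> 5 (dw 0) + C * dkc * B * integral {0..t} (\<lambda>s. nrm \<epsilon> 5 (dw s))" by simp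
  finally show "(\<Sum>k\<in>F. wt \<epsilon> 5 k * bk k (dw t)) \<le> C * dkc * nrm \<epsilon> 5 (dw 0) + C * dkc * B * integral {0..t} (\<lambda>s. nrm \<epsilon> 5 (dw s))" .
qed

end

text \<open>The parameters are fixed backwards from \<epsilon>. \<open>d1\<close> makes the first
  term of \<open>fmul_local_bound\<close> at most \<epsilon> / 2, and \<open>Q\<close> is an energy
  level that does the same for the second. \<open>R\<close> brings the flux below Q / 2, the radius
  \<open>r\<close> the part of the initial energy outside it below Q / 4, and \<delta> the part
  inside below Q / 4. The solutions enter these choices only through K.\<close>

lemma local_compare:
  assumes \<sigma>: "\<bar>\<sigma>\<bar> \<le> 1" and \<kappa>: "\<bar>\<kappa>\<bar> \<le> 1" and T: "T \<ge> 0" and A: "A \<ge> 0" and m: "multiplier m" and e: "\<epsilon> > 0"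
  obtains r \<delta> where "r \<ge> 0" "\<delta> > 0"
    "\<And>u v t x. sol \<sigma> \<kappa> u \<Longrightarrow> sol \<sigma> \<kappa> v \<Longrightarrow> (\<And>t. t \<in> {0..T} \<Longrightarrow> nrm 1 5 (u t) \<le> K) \<Longrightarrow>
      (\<And>t. t \<in> {0..T} \<Longrightarrow> nrm 1 5 (v t) \<le> K) \<Longrightarrow> (\<And>x. \<bar>x\<bar> \<le> r \<Longrightarrow> norm (u 0 x - v 0 x) \<le> \<delta>) \<Longrightarrow>
      t \<in> {0..T} \<Longrightarrow> \<bar>x\<bar> \<le> A \<Longrightarrow> norm (fmul m (\<lambda>x. u t x - v t x) x) \<le> \<epsilon>"
proof -
  obtain C where C: "C \<ge> 0" "\<And>x. norm (fourier_inv m x) \<le> C * dk x" using multiplier_decay[OF m] by blast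
  define d1 where "d1 = \<epsilon> / (C * dkc + 1)"
  have Cd: "C * dkc \<ge> 0" using C dkc_nonneg by simp
  have d1: "d1 > 0" unfolding d1_def using e Cd by simp
  have d1': "C * (d1 * dkc / 2) \<le> \<epsilon> / 2"
  proof -
    have "C * dkc * \<epsilon> \<le> (C * dkc + 1) * \<epsilon>" using e by simp
    hence "C * dkc * \<epsilon> / (C * dkc + 1) \<le> \<epsilon>" using Cd by (simp add: pos_divide_le_eq mult.commute)
    moreover have "c * (e / q * d / 2) = (c * d * e / q) / 2" for c d e q :: real by simp
    ultimately show ?thesis unfolding d1_def by (metis divide_right_mono zero_le_numeral)
  qed
  define Q where "Q = \<epsilon> * d1 / (2 * (C + 1) * (1 + A\<^sup>2))"
  have Q: "Q > 0" unfolding Q_def using e d1 C by (intro divide_pos_pos mult_pos_pos) (auto simp: add_pos_nonneg)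
  have Q': "C * ((1 + x\<^sup>2) / d1 * Y) \<le> \<epsilon> / 2" if "\<bar>x\<bar> \<le> A" "0 \<le> Y" "Y \<le> Q" for x Y
  proof -
    have "x\<^sup>2 \<le> A\<^sup>2" using that A by (simp add: abs_le_square_iff[symmetric])
    hence "C * ((1 + x\<^sup>2) / d1 * Y) \<le> (C + 1) * ((1 + A\<^sup>2) / d1 * Q)"
      using that C d1 by (intro mult_mono divide_right_mono) (auto intro!: mult_nonneg_nonneg divide_nonneg_nonneg)
    also have "\<dots> = \<epsilon> / 2" unfolding Q_def using C d1 by (simp add: field_simps add_pos_nonneg add_nonneg_eq_0_iff)
    finally show ?thesis .
  qed
  define E where "E = exp ((6 * K\<^sup>2 + 1) * T)"
  have E: "E > 0" by (simp add: E_def)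
  define b where "b = (Kdd * K)\<^sup>2 * dkc"
  have b: "b \<ge> 0" unfolding b_def using dkc_nonneg by simp
  define R where "R = 1 + 2 * E * b * T / Q"
  have R: "R \<ge> 1" unfolding R_def using E b T Q by simp
  have R': "E * ((b / R) * T) \<le> Q / 2"
  proof -
    have "2 * E * b * T \<le> Q * R" unfolding R_def using Q by (simp add: distrib_left)
    thus ?thesis using R Q by (simp add: field_simps)
  qed
  define \<tau> where "\<tau> = Q / (16 * E * (K\<^sup>2 + 1))"
  have \<tau>: "\<tau> > 0" unfolding \<tau>_def using Q E by (intro divide_pos_pos mult_pos_pos) (auto simp: add_nonneg_pos)
  have \<tau>': "E * (4 * K\<^sup>2 * \<tau>) \<le> Q / 4"
  proof -
    have "E * (4 * k * (Q / (16 * E * p))) = Q / 4 * (k / p)" for k p using E by simp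
    hence "E * (4 * K\<^sup>2 * \<tau>) = Q / 4 * (K\<^sup>2 / (K\<^sup>2 + 1))" unfolding \<tau>_def by (simp only:)
    also have "\<dots> \<le> Q / 4 * 1" using Q by (intro mult_left_mono) (auto simp: divide_le_eq_1 add_nonneg_pos)
    finally show ?thesis by simp
  qed
  have Rp: "R > 0" using R by simp
  obtain r where r: "r \<ge> 0" "\<forall>R'\<ge>r. (LINT y|lborel. indicator {y. \<bar>y\<bar> > R'} y * \<bar>dk (y / R)\<bar>) < \<tau>"
    using integral_tail_small[OF integrable_dk_scale[OF Rp] \<tau>] by blast
  define \<delta> where "\<delta> = sqrt (Q / (4 * E * (R * dkc + 1)))"
  have q0: "Q / (4 * E * (R * dkc + 1)) > 0" using Q E R dkc_nonneg by (intro divide_pos_pos mult_pos_pos) (auto simp: add_nonneg_pos)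
  have \<delta>: "\<delta> > 0" unfolding \<delta>_def using q0 by simp
  have \<delta>': "E * (\<delta>\<^sup>2 * (R * dkc)) \<le> Q / 4"
  proof -
    have Rd: "R * dkc \<ge> 0" using R dkc_nonneg by simp
    have "\<delta>\<^sup>2 = Q / (4 * E * (R * dkc + 1))" unfolding \<delta>_def using q0 by simp
    hence "E * (\<delta>\<^sup>2 * (R * dkc)) = (Q / 4) * ((R * dkc) / (R * dkc + 1))" using E by simp
    also have "\<dots> \<le> (Q / 4) * 1" using Q Rd by (intro mult_left_mono) auto
    finally show ?thesis by simp
  qed
  have "norm (fmul m (\<lambda>x. u t x - v t x) x) \<le> \<epsilon>"
    if u: "sol \<sigma> \<kappa> u" and v: "sol \<sigma> \<kappa> v" and Ku: "\<And>t. t \<in> {0..T} \<Longrightarrow> nrm 1 5 (u t) \<le> K"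
      and Kv: "\<And>t. t \<in> {0..T} \<Longrightarrow> nrm 1 5 (v t) \<le> K" and close: "\<And>x. \<bar>x\<bar> \<le> r \<Longrightarrow> norm (u 0 x - v 0 x) \<le> \<delta>"
      and t: "t \<in> {0..T}" and x: "\<bar>x\<bar> \<le> A" for u v t x
  proof -
    have K: "\<forall>t\<in>{0..T}. nrm 1 5 (u t) \<le> K \<and> nrm 1 5 (v t) \<le> K" using Ku Kv by blast
    note ctx = u v \<sigma> \<kappa> K R
    let ?en = "\<lambda>t. LINT y|lborel. dk (y / R) * (norm (u t y - v t y))\<^sup>2"
    have en: "?en t \<le> exp ((6 * K\<^sup>2 + 1) * t) * (?en 0 + (b / R) * t)"
      using energy_ineq[OF ctx t] unfolding energy_def[OF ctx] b_def by simp
    have 0: "0 \<in> {0..T}" using T by simp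
    note wb = w_bounds[OF ctx 0]
    have e0: "?en 0 \<le> \<delta>\<^sup>2 * (R * dkc) + 4 * K\<^sup>2 * \<tau>"
    proof -
      let ?ind = "\<lambda>y. indicator {y. \<bar>y\<bar> > r} y :: real"
      have it: "integrable lborel (\<lambda>y. ?ind y * \<bar>dk (y / R)\<bar>)"
        by (rule Bochner_Integration.integrable_bound[OF integrable_dk_scale[OF Rp]]) (auto simp: indicator_def intro!: AE_I2)
      have "?en 0 \<le> (LINT y|lborel. \<delta>\<^sup>2 * dk (y / R) + 4 * K\<^sup>2 * (?ind y * \<bar>dk (y / R)\<bar>))"
      proof (rule integral_mono)
        show "integrable lborel (\<lambda>y. dk (y / R) * (norm (u 0 y - v 0 y))\<^sup>2)"
        proof (rule rho_integrable[OF ctx])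
          show "continuous_on UNIV (\<lambda>y. (norm (u 0 y - v 0 y))\<^sup>2)"
            by (intro continuous_intros cb_continuous X_cb[OF sol_X[OF u]] X_cb[OF sol_X[OF v]])
          show "norm ((norm (u 0 y - v 0 y))\<^sup>2) \<le> (2 * K)\<^sup>2" for y using power_mono[OF wb(3)[of y], of 2] by simp
        qed
        show "integrable lborel (\<lambda>y. \<delta>\<^sup>2 * dk (y / R) + 4 * K\<^sup>2 * (?ind y * \<bar>dk (y / R)\<bar>))"
          using integrable_dk_scale[OF Rp] it by auto
        fix y
        show "dk (y / R) * (norm (u 0 y - v 0 y))\<^sup>2 \<le> \<delta>\<^sup>2 * dk (y / R) + 4 * K\<^sup>2 * (?ind y * \<bar>dk (y / R)\<bar>)"
        proof (cases "\<bar>y\<bar> \<le> r")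
          case True
          have "(norm (u 0 y - v 0 y))\<^sup>2 \<le> \<delta>\<^sup>2" using close[OF True] by (intro power_mono) auto
          hence "dk (y / R) * (norm (u 0 y - v 0 y))\<^sup>2 \<le> dk (y / R) * \<delta>\<^sup>2" by (intro mult_left_mono) auto
          thus ?thesis using True by (simp add: mult.commute)
        next
          case False
          have "(norm (u 0 y - v 0 y))\<^sup>2 \<le> 4 * K\<^sup>2" using power_mono[OF wb(3)[of y], of 2] by (simp add: power_mult_distrib)
          hence "dk (y / R) * (norm (u 0 y - v 0 y))\<^sup>2 \<le> dk (y / R) * (4 * K\<^sup>2)" by (intro mult_left_mono) auto
          moreover have "\<delta>\<^sup>2 * dk (y / R) \<ge> 0" by simp
          ultimately have "dk (y / R) * (norm (u 0 y - v 0 y))\<^sup>2 \<le> \<delta>\<^sup>2 * dk (y / R) + 4 * K\<^sup>2 * dk (y / R)"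
            unfolding mult.commute[of "dk (y / R)" "4 * K\<^sup>2"] by linarith
          thus ?thesis using False by (simp add: not_le)
        qed
      qed
      also have "\<dots> = \<delta>\<^sup>2 * (R * dkc) + 4 * K\<^sup>2 * (LINT y|lborel. ?ind y * \<bar>dk (y / R)\<bar>)"
        using integrable_dk_scale[OF Rp] it integral_dk_scale[OF Rp] by simp
      also have "\<dots> \<le> \<delta>\<^sup>2 * (R * dkc) + 4 * K\<^sup>2 * \<tau>"
        using r(2) by (intro add_left_mono mult_left_mono) (auto simp: less_imp_le)
      finally show ?thesis .
    qed
    have en0: "?en s \<ge> 0" for s by (rule integral_nonneg_AE) auto
    have "?en t \<le> E * ((\<delta>\<^sup>2 * (R * dkc) + 4 * K\<^sup>2 * \<tau>) + (b / R) * T)"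
    proof (rule order_trans[OF en], rule mult_mono)
      show "exp ((6 * K\<^sup>2 + 1) * t) \<le> E" unfolding E_def using t by (auto intro!: mult_left_mono)
      show "?en 0 + (b / R) * t \<le> (\<delta>\<^sup>2 * (R * dkc) + 4 * K\<^sup>2 * \<tau>) + (b / R) * T"
        using e0 t b R by (intro add_mono mult_left_mono) auto
      show "0 \<le> ?en 0 + (b / R) * t" using en0 t b R by (intro add_nonneg_nonneg mult_nonneg_nonneg) auto
    qed (use E in simp)
    also have "\<dots> \<le> Q" using \<delta>' \<tau>' R' by (simp add: distrib_left)
    finally have Y: "?en t \<le> Q" .
    have "norm (fmul m (\<lambda>x. u t x - v t x) x) \<le> C * (d1 * dkc / 2 + (1 + x\<^sup>2) / d1 * ?en t)"
      by (rule fmul_local_bound[OF m C _ R d1]) (intro cb_diff X_cb[OF sol_X[OF u]] X_cb[OF sol_X[OF v]])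
    also have "\<dots> = C * (d1 * dkc / 2) + C * ((1 + x\<^sup>2) / d1 * ?en t)" by (simp add: distrib_left)
    also have "\<dots> \<le> \<epsilon> / 2 + \<epsilon> / 2" by (intro add_mono d1' Q' x en0 Y)
    finally show ?thesis by simp
  qed
  thus ?thesis using that r(1) \<delta> by blast
qed

section \<open>Stability in the weighted norms\<close>

lemma nrm_cub_diff:
  assumes f: "X 5 f" and g: "X 5 g" and e: "0 \<le> \<epsilon>" "\<epsilon> \<le> 1" and M: "nrm \<epsilon> 5 f \<le> M" "nrm \<epsilon> 5 g \<le> M"
  shows "nrm \<epsilon> 5 (\<lambda>x. cub f x - cub g x) \<le> 3 * Kc * M\<^sup>2 * nrm \<epsilon> 5 (\<lambda>x. f x - g x)"
proof -
  let ?d = "\<lambda>x. f x - g x"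
  let ?a = "\<lambda>x. ?d x * f x * cnj (f x)" and ?b = "\<lambda>x. g x * ?d x * cnj (f x)" and ?c = "\<lambda>x. g x * g x * cnj (?d x)"
  note d = X_diff[OF f g]
  note Xa = X_cubic[OF d f f] and Xb = X_cubic[OF g d f] and Xc = X_cubic[OF g g d]
  have M0: "M \<ge> 0" using nrm_nonneg[OF f e(1)] M(1) by (rule order_trans)
  note nn = nrm_nonneg[OF d e(1)] nrm_nonneg[OF f e(1)] nrm_nonneg[OF g e(1)] Kc_nonneg M0
  have "nrm \<epsilon> 5 (\<lambda>x. cub f x - cub g x) = nrm \<epsilon> 5 (\<lambda>x. ?a x + ?b x + ?c x)"
    by (rule arg_cong[where f="nrm \<epsilon> 5"]) (simp add: cub_diff fun_eq_iff)
  also have "\<dots> \<le> nrm \<epsilon> 5 ?a + nrm \<epsilon> 5 ?b + nrm \<epsilon> 5 ?c"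
    using nrm_add[OF X_add[OF Xa Xb] Xc e] nrm_add[OF Xa Xb e] by linarith
  also have "\<dots> \<le> Kc * nrm \<epsilon> 5 ?d * M * M + Kc * M * nrm \<epsilon> 5 ?d * M + Kc * M * M * nrm \<epsilon> 5 ?d"
  proof (intro add_mono)
    show "nrm \<epsilon> 5 ?a \<le> Kc * nrm \<epsilon> 5 ?d * M * M"
      by (rule order_trans[OF nrm_cubic[OF d f f e]]) (intro mult_mono mult_nonneg_nonneg nn M order_refl)
    show "nrm \<epsilon> 5 ?b \<le> Kc * M * nrm \<epsilon> 5 ?d * M"
      by (rule order_trans[OF nrm_cubic[OF g d f e]]) (intro mult_mono mult_nonneg_nonneg nn M order_refl)
    show "nrm \<epsilon> 5 ?c \<le> Kc * M * M * nrm \<epsilon> 5 ?d"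
      by (rule order_trans[OF nrm_cubic[OF g g d e]]) (intro mult_mono mult_nonneg_nonneg nn M order_refl)
  qed
  also have "\<dots> = 3 * Kc * M\<^sup>2 * nrm \<epsilon> 5 ?d" by (simp add: power2_eq_square)
  finally show ?thesis .
qed

text \<open>A continuity argument. While the distance is at most 1, both solutions stay below M + 1,
  and Gronwall improves the distance to 1 / 2; being continuous in time, it cannot jump across the
  gap. Only M and T enter \<delta>, since the cubic estimate and the free evolution have constants
  independent of \<epsilon>.\<close>

lemma perturbation:
  assumes \<sigma>: "\<bar>\<sigma>\<bar> \<le> 1" and \<kappa>: "\<bar>\<kappa>\<bar> \<le> 1" and T: "T \<ge> 0" and M: "M \<ge> 0"
  obtains \<delta> where "\<delta> > 0"
    "\<And>\<epsilon> u v t. 0 \<le> \<epsilon> \<Longrightarrow> \<epsilon> \<le> 1 \<Longrightarrow> sol \<sigma> \<kappa> u \<Longrightarrow> sol \<sigma> \<kappa> v \<Longrightarrow> \<forall>t\<in>{0..T}. nrm \<epsilon> 5 (u t) \<le> M \<Longrightarrow>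
      nrm \<epsilon> 5 (\<lambda>x. v 0 x - u 0 x) \<le> \<delta> \<Longrightarrow> t \<in> {0..T} \<Longrightarrow> nrm \<epsilon> 5 (\<lambda>x. v t x - u t x) \<le> 1"
proof -
  obtain C where C: "C \<ge> 0" "\<And>a x. \<bar>a\<bar> \<le> T \<Longrightarrow> norm (fourier_inv (mt a (etat 0)) x) \<le> C * dk x"
    using mt_decay[OF multiplier_etat T] by blast
  define P where "P = C * dkc"
  have P: "P \<ge> 0" unfolding P_def using C dkc_nonneg by simp
  define B where "B = 3 * Kc * (M + 1)\<^sup>2"
  have B: "B \<ge> 0" unfolding B_def using Kc_nonneg by simp
  \<comment> \<open>The exponential undoes the Gronwall factor. The denominator never vanishes,
    turns P into a factor below 1 / 2, and gives \<open>\<delta> \<le> 1 / 2\<close>, so that the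
    distance starts below 3 / 4.\<close>
  define \<delta> where "\<delta> = exp (- (P * B * T)) / (2 * (P + 1))"
  have \<delta>: "\<delta> > 0" unfolding \<delta>_def using P by simp
  have \<delta>2: "\<delta> \<le> 1 / 2" unfolding \<delta>_def
    using P B T by (simp add: divide_simps mult_nonneg_nonneg) (smt (verit) exp_le_one_iff mult_nonneg_nonneg)
  have P\<delta>: "P * \<delta> * exp (P * B * T) \<le> 1 / 2"
  proof -
    have "exp (- (P * B * T)) * exp (P * B * T) = 1" by (simp add: exp_minus)
    hence "P * \<delta> * exp (P * B * T) = P / (P + 1) / 2" unfolding \<delta>_def by (simp add: mult.assoc)
    also have "\<dots> \<le> 1 / 2" using P by simp
    finally show ?thesis .
  qed
  have "nrm \<epsilon> 5 (\<lambda>x. v t1 x - u t1 x) \<le> 1"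
    if e: "0 \<le> \<epsilon>" "\<epsilon> \<le> 1" and u: "sol \<sigma> \<kappa> u" and v: "sol \<sigma> \<kappa> v" and uM: "\<forall>t\<in>{0..T}. nrm \<epsilon> 5 (u t) \<le> M"
      and init: "nrm \<epsilon> 5 (\<lambda>x. v 0 x - u 0 x) \<le> \<delta>" and t1: "t1 \<in> {0..T}" for \<epsilon> u v t1
  proof (rule ccontr)
    define \<phi> where "\<phi> = (\<lambda>t. nrm \<epsilon> 5 (\<lambda>x. v t x - u t x))"
    assume "\<not> nrm \<epsilon> 5 (\<lambda>x. v t1 x - u t1 x) \<le> 1"
    hence big: "\<phi> t1 > 1" by (simp add: \<phi>_def)
    have c\<phi>: "continuous_on S \<phi>" for S
      unfolding \<phi>_def by (rule continuous_on_subset[OF sol_diff_continuous[OF v u e]]) simp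
    have \<phi>0: "\<phi> 0 \<le> \<delta>" using init by (simp add: \<phi>_def)
    obtain Ku where Ku: "\<And>t. t \<in> {0..T} \<Longrightarrow> nrm 1 5 (u t) \<le> Ku" using sol_bounded[OF u] by blast
    obtain Kv where Kv: "\<And>t. t \<in> {0..T} \<Longrightarrow> nrm 1 5 (v t) \<le> Kv" using sol_bounded[OF v] by blast
    have K: "\<forall>t\<in>{0..T}. nrm 1 5 (v t) \<le> max Ku Kv \<and> nrm 1 5 (u t) \<le> max Ku Kv"
      using Ku Kv by (auto simp: le_max_iff_disj)
    have half: "\<phi> t \<le> 1 / 2" if t: "t \<in> {0..T}" and le: "\<And>s. s \<in> {0..t} \<Longrightarrow> \<phi> s \<le> 1" for t
    proof -
      have ineq: "\<phi> t' \<le> P * \<delta> + P * B * integral {0..t'} \<phi>" if t': "t' \<in> {0..t}" for t'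
      proof -
        have tT: "t' \<in> {0..T}" using t t' by auto
        have "\<phi> t' \<le> C * dkc * \<phi> 0 + C * dkc * B * integral {0..t'} \<phi>"
          unfolding \<phi>_def
        proof (rule duhamel_nrm[OF v u \<sigma> \<kappa> K order_refl C tT e])
          fix s assume s: "s \<in> {0..t'}"
          have sT: "s \<in> {0..T}" and st: "s \<in> {0..t}" using s t t' by auto
          have uM1: "nrm \<epsilon> 5 (u s) \<le> M + 1" using uM sT by force
          have "nrm \<epsilon> 5 (v s) \<le> nrm \<epsilon> 5 (u s) + \<phi> s"
            unfolding \<phi>_def by (rule nrm_triangle_reverse[OF sol_X[OF v] sol_X[OF u] e])
          hence vM1: "nrm \<epsilon> 5 (v s) \<le> M + 1" using le[OF st] uM sT by force
          show "nrm \<epsilon> 5 (\<lambda>x. cub (v s) x - cub (u s) x) \<le> B * nrm \<epsilon> 5 (\<lambda>x. v s x - u s x)"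
            unfolding B_def by (rule nrm_cub_diff[OF sol_X[OF v] sol_X[OF u] e vM1 uM1])
        qed
        also have "\<dots> \<le> P * \<delta> + P * B * integral {0..t'} \<phi>"
          unfolding P_def[symmetric] using \<phi>0 P by (intro add_right_mono mult_left_mono) auto
        finally show ?thesis .
      qed
      have "\<phi> t \<le> P * \<delta> * exp (P * B * t)"
      proof (rule gronwall_integral[OF c\<phi>, where T=t])
        show "0 \<le> P * \<delta>" "0 \<le> P * B" "t \<in> {0..t}" using P B \<delta> t by simp_all
      qed (rule ineq)
      also have "\<dots> \<le> P * \<delta> * exp (P * B * T)"
        using P B \<delta> t by (intro mult_left_mono) (auto intro!: mult_left_mono)
      finally show ?thesis using P\<delta> by linarith
    qed
    \<comment> \<open>The infimum of this closed set is the first time at which the distance reaches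
      1; before it the hypothesis of \<open>half\<close> holds.\<close>
    define S where "S = {t \<in> {0..t1}. 1 \<le> \<phi> t}"
    have "closed S" unfolding S_def using continuous_on_closed_Collect_le[OF continuous_on_const c\<phi>, of "{0..t1}" 1] by simp
    moreover have S1: "t1 \<in> S" unfolding S_def using big t1 by simp
    moreover have bb: "bdd_below S" unfolding S_def bdd_below_def by (auto intro!: exI[of _ 0])
    ultimately have IS: "Inf S \<in> S" using closed_contains_Inf[of S] by blast
    define ts where "ts = Inf S"
    have ts: "ts \<in> {0..t1}" "\<phi> ts \<ge> 1" using IS unfolding S_def ts_def by auto
    have below: "\<phi> s < 1" if "0 \<le> s" "s < ts" for s
    proof (rule ccontr)
      assume "\<not> \<phi> s < 1"
      hence "s \<in> S" unfolding S_def using that ts by auto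
      hence "Inf S \<le> s" by (rule cInf_lower[OF _ bb])
      thus False using that by (simp add: ts_def)
    qed
    \<comment> \<open>Any value strictly between 1 / 2 and 1 would do: it is attained before the
      first time of distance 1, where the improved bound 1 / 2 forbids it.\<close>
    have "\<exists>x\<ge>0. x \<le> ts \<and> \<phi> x = 3 / 4"
      by (rule IVT'[OF _ _ _ c\<phi>]) (use \<phi>0 \<delta>2 ts in auto)
    then obtain t' where t': "0 \<le> t'" "t' \<le> ts" "\<phi> t' = 3 / 4" by blast
    have "t' < ts" using t' ts by (cases "t' = ts") auto
    hence "\<phi> t' \<le> 1 / 2" using t' ts t1 below by (intro half) (auto intro!: less_imp_le)
    thus False using t' by simp
  qed
  thus ?thesis using that \<delta> by blast
qed

section \<open>The flow\<close>

text \<open>Uniqueness of derivatives identifies the space derivatives of a classical solution with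
  \<open>dX\<close>, which puts the equation into a form on which multipliers can act.\<close>

lemma flow_sol:
  assumes flow: "is_flow \<eta> \<kappa> \<Phi>" and q0: "X 5 q\<^sub>0" and \<sigma>: "\<sigma> \<in> {1, -1}"
  shows "sol \<sigma> \<kappa> (\<lambda>t. \<Phi> (\<sigma> * t) q\<^sub>0)" "\<Phi> 0 q\<^sub>0 = q\<^sub>0"
proof -
  let ?q = "\<lambda>t. \<Phi> t q\<^sub>0"
  have fl: "classical_solution \<kappa> ?q" "?q 0 = q\<^sub>0" "X_continuous \<eta> 5 ?q"
    using flow[unfolded is_flow_def Let_def, rule_format, of q\<^sub>0] q0 by (simp_all add: X_space_iff)
  show "\<Phi> 0 q\<^sub>0 = q\<^sub>0" by (fact fl(2))
  have X: "X 5 (?q t)" for t using fl(3) by (simp add: X_continuous_def X_space_iff)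
  have cont: "((\<lambda>r. nrm 1 5 (\<lambda>x. ?q r x - ?q t x)) \<longlongrightarrow> 0) (at t)" for t
  proof (rule tendstoI)
    fix e :: real assume e: "e > 0"
    have "((\<lambda>r. X_norm \<eta> 5 (\<lambda>x. ?q r x - ?q t x)) \<longlongrightarrow> 0) (at t)" using fl(3) by (simp add: X_continuous_def)
    \<comment> \<open>The 16 is twice the factor 8 lost between the two versions of the norm, which
      leaves e / 2 and hence a strict inequality.\<close>
    moreover have "(0::ennreal) < ennreal (e / 16)" using e by simp
    ultimately have "\<forall>\<^sub>F r in at t. X_norm \<eta> 5 (\<lambda>x. ?q r x - ?q t x) < ennreal (e / 16)" by (rule order_tendstoD(2))
    thus "\<forall>\<^sub>F r in at t. dist (nrm 1 5 (\<lambda>x. ?q r x - ?q t x)) 0 < e"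
    proof eventually_elim
      case (elim r)
      have "nrm 1 5 (\<lambda>x. ?q r x - ?q t x) \<le> 8 * (e / 16)"
        by (rule X_norm_finite_imp_X(2)[OF cb_diff[OF X_cb[OF X] X_cb[OF X]] less_imp_le[OF elim]]) (use e in simp)
      moreover have "nrm 1 5 (\<lambda>x. ?q r x - ?q t x) \<ge> 0" by (rule nrm_nonneg[OF X_diff[OF X X]]) simp
      ultimately show ?case using e by simp
    qed
  qed
  obtain vt vx vxx where v:
    "\<And>t x. ((\<lambda>r. ?q r x) has_vector_derivative vt t x) (at t)" "\<And>t x. ((\<lambda>y. ?q t y) has_vector_derivative vx t x) (at x)"
    "\<And>t x. ((\<lambda>y. vx t y) has_vector_derivative vxx t x) (at x)"
    "\<And>t x. \<i> * vt t x = - (1 / 2) * vxx t x + of_real (\<kappa> * (norm (?q t x))\<^sup>2) * ?q t x"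
    using fl(1) unfolding classical_solution_def by blast
  have vx: "vx t = dX (?q t)" for t
    using vector_derivative_unique_at[OF v(2) dX_1(1)[OF X]] by blast
  have vxx: "vxx t x = dX (dX (?q t)) x" for t x
    by (rule vector_derivative_unique_at[OF v(3)[of t x, unfolded vx] dX_2(1)[OF X, of t x]])
  have eq: "vt t x = \<i> / 2 * dX (dX (?q t)) x - \<i> * of_real \<kappa> * cub (?q t) x" for t x
  proof -
    have "of_real (\<kappa> * (norm (?q t x))\<^sup>2) * ?q t x = of_real \<kappa> * cub (?q t) x"
      by (simp add: cub_def complex_norm_square mult_ac flip: of_real_power)
    hence "\<i> * vt t x = - (1 / 2) * dX (dX (?q t)) x + of_real \<kappa> * cub (?q t) x" using v(4)[of t x] unfolding vxx by simp
    hence "(- \<i>) * (\<i> * vt t x) = (- \<i>) * (- (1 / 2) * dX (dX (?q t)) x + of_real \<kappa> * cub (?q t) x)" by simp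
    thus ?thesis by (simp add: algebra_simps)
  qed
  show "sol \<sigma> \<kappa> (\<lambda>t. ?q (\<sigma> * t))"
    unfolding sol_def
  proof (intro conjI allI)
    show "X 5 (?q (\<sigma> * t))" for t by (rule X)
    fix t
    have "\<forall>\<^sub>F r in at t. \<sigma> * r \<in> UNIV \<and> \<sigma> * r \<noteq> \<sigma> * t"
      unfolding eventually_at_filter using \<sigma> by (auto intro!: always_eventually)
    moreover have "((\<lambda>r. \<sigma> * r) \<longlongrightarrow> \<sigma> * t) (at t)" by (intro tendsto_intros)
    ultimately have "filterlim (\<lambda>r. \<sigma> * r) (at (\<sigma> * t)) (at t)" unfolding filterlim_at by blast
    thus "((\<lambda>r. nrm 1 5 (\<lambda>x. ?q (\<sigma> * r) x - ?q (\<sigma> * t) x)) \<longlongrightarrow> 0) (at t)"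
      by (rule filterlim_compose[OF cont])
    fix x
    have "((\<lambda>r. \<sigma> * r) has_vector_derivative \<sigma>) (at t)"
      by (auto intro!: derivative_eq_intros simp: has_real_derivative_iff_has_vector_derivative[symmetric])
    from vector_diff_chain_at[OF this v(1)]
    show "((\<lambda>r. ?q (\<sigma> * r) x) has_vector_derivative of_real \<sigma> * (\<i> / 2 * dX (dX (?q (\<sigma> * t))) x - \<i> * of_real \<kappa> * cub (?q (\<sigma> * t)) x)) (at t)"
      unfolding eq by (simp only: o_def scaleR_conv_of_real)
  qed
qed

section \<open>Gluing\<close>

text \<open>Used with the finitely many blocks that nearly realise the norm of a solution, and with
  the derivatives of low frequency blocks. Finiteness allows a common radius and a common
  tolerance.\<close>

lemma local_compare_finite:
  assumes \<sigma>: "\<bar>\<sigma>\<bar> \<le> 1" and \<kappa>: "\<bar>\<kappa>\<bar> \<le> 1" and T: "T \<ge> 0" and A: "A \<ge> 0" and e: "\<epsilon> > 0"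
    and F: "finite F" and m: "\<And>k. k \<in> F \<Longrightarrow> multiplier (m k)"
  shows "\<exists>r\<ge>0. \<exists>\<delta>>0. \<forall>u v. sol \<sigma> \<kappa> u \<longrightarrow> sol \<sigma> \<kappa> v \<longrightarrow> (\<forall>t\<in>{0..T}. nrm 1 5 (u t) \<le> K \<and> nrm 1 5 (v t) \<le> K) \<longrightarrow>
      (\<forall>x. \<bar>x\<bar> \<le> r \<longrightarrow> norm (u 0 x - v 0 x) \<le> \<delta>) \<longrightarrow>
      (\<forall>k\<in>F. \<forall>t\<in>{0..T}. \<forall>x. \<bar>x\<bar> \<le> A \<longrightarrow> norm (fmul (m k) (\<lambda>x. u t x - v t x) x) \<le> \<epsilon>)"
  using F m
proof (induction F)
  case empty
  show ?case by (intro exI[of _ 0] exI[of _ 1] conjI) auto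
next
  case (insert k F)
  have mk: "multiplier (m k)" and mF: "\<And>k. k \<in> F \<Longrightarrow> multiplier (m k)" using insert.prems by auto
  obtain r1 d1 where rd1: "r1 \<ge> 0" "d1 > 0"
    and 1: "\<And>u v t x. sol \<sigma> \<kappa> u \<Longrightarrow> sol \<sigma> \<kappa> v \<Longrightarrow> (\<And>t. t \<in> {0..T} \<Longrightarrow> nrm 1 5 (u t) \<le> K) \<Longrightarrow>
      (\<And>t. t \<in> {0..T} \<Longrightarrow> nrm 1 5 (v t) \<le> K) \<Longrightarrow> (\<And>x. \<bar>x\<bar> \<le> r1 \<Longrightarrow> norm (u 0 x - v 0 x) \<le> d1) \<Longrightarrow>
      t \<in> {0..T} \<Longrightarrow> \<bar>x\<bar> \<le> A \<Longrightarrow> norm (fmul (m k) (\<lambda>x. u t x - v t x) x) \<le> \<epsilon>"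
  proof (rule local_compare[OF \<sigma> \<kappa> T A mk e, of K])
    fix r \<delta> :: real
    assume rd: "r \<ge> 0" "\<delta> > 0" and l: "\<And>u v t x. sol \<sigma> \<kappa> u \<Longrightarrow> sol \<sigma> \<kappa> v \<Longrightarrow> (\<And>t. t \<in> {0..T} \<Longrightarrow> nrm 1 5 (u t) \<le> K) \<Longrightarrow>
      (\<And>t. t \<in> {0..T} \<Longrightarrow> nrm 1 5 (v t) \<le> K) \<Longrightarrow> (\<And>x. \<bar>x\<bar> \<le> r \<Longrightarrow> norm (u 0 x - v 0 x) \<le> \<delta>) \<Longrightarrow>
      t \<in> {0..T} \<Longrightarrow> \<bar>x\<bar> \<le> A \<Longrightarrow> norm (fmul (m k) (\<lambda>x. u t x - v t x) x) \<le> \<epsilon>"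
    show thesis by (rule that[OF rd]) (fact l)
  qed
  obtain r2 d2 where rd2: "r2 \<ge> 0" "d2 > 0"
    and 2: "\<forall>u v. sol \<sigma> \<kappa> u \<longrightarrow> sol \<sigma> \<kappa> v \<longrightarrow> (\<forall>t\<in>{0..T}. nrm 1 5 (u t) \<le> K \<and> nrm 1 5 (v t) \<le> K) \<longrightarrow>
      (\<forall>x. \<bar>x\<bar> \<le> r2 \<longrightarrow> norm (u 0 x - v 0 x) \<le> d2) \<longrightarrow>
      (\<forall>k\<in>F. \<forall>t\<in>{0..T}. \<forall>x. \<bar>x\<bar> \<le> A \<longrightarrow> norm (fmul (m k) (\<lambda>x. u t x - v t x) x) \<le> \<epsilon>)"
    using insert.IH[OF mF] by blast
  have "norm (fmul (m k') (\<lambda>x. u t x - v t x) x) \<le> \<epsilon>"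
    if u: "sol \<sigma> \<kappa> u" and v: "sol \<sigma> \<kappa> v" and K: "\<forall>t\<in>{0..T}. nrm 1 5 (u t) \<le> K \<and> nrm 1 5 (v t) \<le> K"
      and c: "\<forall>x. \<bar>x\<bar> \<le> max r1 r2 \<longrightarrow> norm (u 0 x - v 0 x) \<le> min d1 d2"
      and k': "k' \<in> insert k F" and t: "t \<in> {0..T}" and x: "\<bar>x\<bar> \<le> A" for u v k' t x
  proof (cases "k' = k")
    case True
    show ?thesis unfolding True by (rule 1[OF u v _ _ _ t x]) (use K c in auto)
  next
    case False
    have "\<forall>x. \<bar>x\<bar> \<le> r2 \<longrightarrow> norm (u 0 x - v 0 x) \<le> d2" using c by auto
    with 2 u v K have "\<forall>k\<in>F. \<forall>t\<in>{0..T}. \<forall>x. \<bar>x\<bar> \<le> A \<longrightarrow> norm (fmul (m k) (\<lambda>x. u t x - v t x) x) \<le> \<epsilon>" by simp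
    thus ?thesis using k' False t x by simp
  qed
  moreover have "max r1 r2 \<ge> 0" "min d1 d2 > 0" using rd1 rd2 by auto
  ultimately show ?case by (intro exI[of _ "max r1 r2"] exI[of _ "min d1 d2"] conjI) simp_all
qed

lemma syn_shift: "syn G (x + c) = syn (\<lambda>l x. G l (x + c)) x"
  unfolding syn_def fmul_shift ..

lemma fmul_etat_far:
  assumes D: "bfun D" "\<And>x. norm (D x) \<le> b" "\<And>z. \<bar>z\<bar> < \<rho> \<Longrightarrow> D z = 0" and x: "\<bar>x\<bar> + R < \<rho>"
  shows "norm (fmul (etat l) D x) \<le> Kt * b * (LINT y|lborel. indicator {y. \<bar>y\<bar> > R} y * \<bar>dk y\<bar>)"
proof -
  have i: "integrable lborel (\<lambda>y. indicator {y. \<bar>y\<bar> > R} y * \<bar>dk y\<bar>)"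
    by (rule Bochner_Integration.integrable_bound[OF integrable_dk]) (auto simp: indicator_def intro!: AE_I2)
  have i': "integrable lborel (\<lambda>y. indicator {y. \<bar>y\<bar> > R} (x - y) * \<bar>dk (x - y)\<bar>)"
    using lborel_integrable_real_affine[OF i, of "-1" x] by simp
  have b: "b \<ge> 0" using D(2)[of 0] norm_ge_zero order_trans by blast
  have "norm (fmul (etat l) D x) \<le> (LINT y|lborel. (Kt * b) * (indicator {y. \<bar>y\<bar> > R} (x - y) * \<bar>dk (x - y)\<bar>))"
    unfolding fmul_def
  proof (rule Bochner_Integration.integral_norm_bound_integral[OF fmul_integrable[OF multiplier_etat D(1)]])
    show "integrable lborel (\<lambda>y. (Kt * b) * (indicator {y. \<bar>y\<bar> > R} (x - y) * \<bar>dk (x - y)\<bar>))" using i' by auto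
    fix y
    show "norm (fourier_inv (etat l) (x - y) * D y) \<le> (Kt * b) * (indicator {y. \<bar>y\<bar> > R} (x - y) * \<bar>dk (x - y)\<bar>)"
    proof (cases "\<bar>y\<bar> < \<rho>")
      case True thus ?thesis using D(3) K_nonneg b by simp
    next
      case False
      hence "\<bar>x - y\<bar> > R" using x by linarith
      thus ?thesis using kernel_mult_decay[OF etat_decay D(2), of l x y] by simp
    qed
  qed
  also have "\<dots> = (Kt * b) * (LINT y|lborel. indicator {y. \<bar>y\<bar> > R} y * \<bar>dk y\<bar>)"
    using lborel_integral_real_affine[of "-1" "\<lambda>y. indicator {y. \<bar>y\<bar> > R} y * \<bar>dk y\<bar>" x] by simp
  finally show ?thesis .
qed

text \<open>The translated profiles live on disjoint intervals. As the kernels of the synthesis are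
  integrable, each interval can be chosen so long that the others are not felt near its middle.\<close>

lemma glue_datum:
  fixes G :: "nat \<Rightarrow> int \<Rightarrow> real \<Rightarrow> complex"
  assumes G: "\<And>j l. bfun (G j l)" "\<And>j l x. norm (G j l x) \<le> e l"
    and e: "\<And>l. e l \<ge> 0" "(\<lambda>l. wt 1 5 l * e l) summable_on UNIV"
    and d: "\<And>j. \<delta> j > 0" and r: "\<And>j. r j \<ge> 0"
  obtains q y where "X 5 q" "\<And>j x. \<bar>x\<bar> \<le> r j \<Longrightarrow> norm (q (x + y j) - syn (G j) x) \<le> \<delta> j"
proof -
  have e0: "e summable_on UNIV"
  proof (rule summable_nonneg_comparison(1)[OF e(2)])
    fix l show "e l \<le> wt 1 5 l * e l" using mult_right_mono[OF wt_ge_1[of 1 5 l] e(1)[of l]] by simp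
  qed (rule e(1))
  define E where "E = infsum e UNIV"
  have E: "E \<ge> 0" unfolding E_def by (intro infsum_nonneg e)
  \<comment> \<open>Near the middle of interval j the pieces differ by at most
    \<open>2 * e l\<close> and only outside the buffer, so the synthesised error is at most
    \<open>2 * Kt * E\<close> times the kernel tail; adding 1 keeps the quotient defined when this
    constant is 0.\<close>
  have "\<exists>R\<ge>0. (LINT y|lborel. indicator {y. \<bar>y\<bar> > R} y * \<bar>dk y\<bar>) < \<delta> j / (2 * Kt * E + 1)" for j
  proof -
    have "2 * Kt * E + 1 > 0" using K_nonneg E by (simp add: add_nonneg_pos)
    hence "\<delta> j / (2 * Kt * E + 1) > 0" using d[of j] by simp
    from integral_tail_small[OF integrable_dk this] show ?thesis by blast
  qed
  then obtain R where R: "\<And>j. R j \<ge> 0" "\<And>j. (LINT y|lborel. indicator {y. \<bar>y\<bar> > R j} y * \<bar>dk y\<bar>) < \<delta> j / (2 * Kt * E + 1)"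
    by metis
  \<comment> \<open>Half length of interval j: the radius on which closeness is wanted plus the
    buffer for the kernel tail, and 1 to make inequalities strict.\<close>
  define \<rho> where "\<rho> = (\<lambda>j. R j + r j + 1)"
  have \<rho>: "\<rho> j > 0" for j unfolding \<rho>_def using R(1)[of j] r[of j] by linarith
  \<comment> \<open>Centres of adjacent intervals of lengths \<open>2 * \<rho> i\<close>, laid out
    from the origin to the right.\<close>
  define y where "y = (\<lambda>j. (\<Sum>i<j. 2 * \<rho> i) + \<rho> j)"
  have sep: "y i + \<rho> i \<le> y j - \<rho> j" if "i < j" for i j
  proof -
    have "(\<Sum>k\<le>i. 2 * \<rho> k) \<le> (\<Sum>k<j. 2 * \<rho> k)" using that \<rho> by (intro sum_mono2) (auto simp: less_imp_le)
    moreover have "(\<Sum>k\<le>i. 2 * \<rho> k) = (\<Sum>k<i. 2 * \<rho> k) + 2 * \<rho> i" by (simp flip: lessThan_Suc_atMost)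
    ultimately show ?thesis by (simp add: y_def)
  qed
  have disj: "i = j" if "\<bar>x - y i\<bar> < \<rho> i" "\<bar>x - y j\<bar> < \<rho> j" for i j x
    using sep[of i j] sep[of j i] that by (cases i j rule: linorder_cases) auto
  define I where "I = (\<lambda>j. {x. \<bar>x - y j\<bar> < \<rho> j})"
  \<comment> \<open>At most one summand is nonzero at each point, so the series is a case
    distinction written in a form that is evidently measurable.\<close>
  define H where "H = (\<lambda>l x. \<Sum>j. indicator (I j) x *\<^sub>R G j l (x - y j))"
  have H1: "H l x = G j l (x - y j)" if "x \<in> I j" for l x j
  proof -
    have "(\<lambda>i. indicator (I i) x *\<^sub>R G i l (x - y i)) = (\<lambda>i. if i = j then G j l (x - y j) else 0)"
    proof
      fix i
      have "x \<notin> I i" if "i \<noteq> j" using disj[of x i j] \<open>x \<in> I j\<close> that unfolding I_def by blast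
      thus "indicator (I i) x *\<^sub>R G i l (x - y i) = (if i = j then G j l (x - y j) else 0)"
        using that by simp
    qed
    thus ?thesis unfolding H_def using sums_unique[OF sums_single[of j "\<lambda>_. G j l (x - y j)"]] by simp
  qed
  have H0: "H l x = 0" if "\<And>j. x \<notin> I j" for l x
    unfolding H_def using that by simp
  have Hm: "H l \<in> borel_measurable borel" for l
  proof -
    have "(\<lambda>x. indicator (I j) x *\<^sub>R G j l (x - y j)) \<in> borel_measurable borel" for j
    proof -
      have "I j \<in> sets borel" unfolding I_def by measurable
      moreover have "(\<lambda>x. G j l (x - y j)) \<in> borel_measurable borel"
        using bfun_measurable[OF bfun_shift[OF G(1), of j l "- y j"]] by simp
      ultimately show ?thesis by (intro borel_measurable_scaleR borel_measurable_indicator)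
    qed
    thus ?thesis unfolding H_def by (rule borel_measurable_suminf)
  qed
  have Hb: "norm (H l x) \<le> e l" for l x
  proof (cases "\<exists>j. x \<in> I j")
    case True
    then obtain j where "x \<in> I j" by blast
    thus ?thesis using H1 G(2) by simp
  qed (use H0 e(1) in auto)
  have HB: "bfun (H l)" for l by (rule bfunI[OF Hm Hb])
  have q: "X 5 (syn H)" by (rule syn_nrm(1)[OF HB Hb e])
  have close: "norm (syn H (x + y j) - syn (G j) x) \<le> \<delta> j" if x: "\<bar>x\<bar> \<le> r j" for j x
  proof -
    let ?D = "\<lambda>l x. H l (x + y j) - G j l x"
    have sh: "bfun (\<lambda>x. H l (x + y j))" "norm (H l (x + y j)) \<le> e l" for l x by (rule bfun_shift[OF HB], rule Hb)
    have "syn H (x + y j) - syn (G j) x = syn ?D x"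
      unfolding syn_shift by (rule syn_diff[OF sh e0 G e0])
    also have "norm \<dots> \<le> infsum (\<lambda>l. Kt * (2 * e l) * (LINT y|lborel. indicator {y. \<bar>y\<bar> > R j} y * \<bar>dk y\<bar>)) UNIV"
      unfolding syn_def
    proof (rule abs_summable_comparison(3))
      show "(\<lambda>l. Kt * (2 * e l) * (LINT y|lborel. indicator {y. \<bar>y\<bar> > R j} y * \<bar>dk y\<bar>)) summable_on UNIV"
        by (intro summable_on_cmult_left summable_on_cmult_right e0)
      fix l
      show "norm (fmul (etat l) (?D l) x) \<le> Kt * (2 * e l) * (LINT y|lborel. indicator {y. \<bar>y\<bar> > R j} y * \<bar>dk y\<bar>)"
      proof (rule fmul_etat_far[where \<rho>="\<rho> j"])
        show "bfun (?D l)" by (rule bfun_diff[OF sh(1) G(1)])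
        show "norm (?D l x) \<le> 2 * e l" for x
          using norm_triangle_le_diff[OF add_mono[OF sh(2)[of l x] G(2)[of j l x]]] by simp
        show "?D l z = 0" if "\<bar>z\<bar> < \<rho> j" for z using H1[of "z + y j" j l] that by (simp add: I_def)
        show "\<bar>x\<bar> + R j < \<rho> j" using x by (simp add: \<rho>_def)
      qed
    qed
    also have "\<dots> = 2 * Kt * E * (LINT y|lborel. indicator {y. \<bar>y\<bar> > R j} y * \<bar>dk y\<bar>)"
      unfolding E_def by (simp add: infsum_cmult_left' infsum_cmult_right' mult.assoc mult.left_commute[of Kt 2])
    also have "\<dots> \<le> 2 * Kt * E * (\<delta> j / (2 * Kt * E + 1))"
      using R(2)[of j] K_nonneg E by (intro mult_left_mono) (auto simp: less_imp_le)
    also have "\<dots> = \<delta> j * ((2 * Kt * E) / (2 * Kt * E + 1))" by simp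
    also have "\<dots> \<le> \<delta> j * 1"
    proof (rule mult_left_mono)
      have "2 * Kt * E \<ge> 0" using K_nonneg E by simp
      thus "(2 * Kt * E) / (2 * Kt * E + 1) \<le> 1" by (subst divide_le_eq_1) linarith
    qed (use d[of j] in simp)
    finally show ?thesis by simp
  qed
  show ?thesis by (rule that[OF q close])
qed

text \<open>Replaces lower semicontinuity of the norm: up to a bounded error the norm is seen by
  finitely many blocks, each at one point, and such data survive locally uniform approximation. The
  2 collects two errors \<open>1 / (W + 1)\<close> per block, one from choosing the point and one
  from the comparison, whose weighted sum is below 2.\<close>

lemma nrm_norming:
  assumes f: "X s f" and "\<mu> > 0"
  obtains F x where "finite F"
    "\<And>g B. X s g \<Longrightarrow> (\<And>k. k \<in> F \<Longrightarrow> norm (blk k f (x k)) \<le> norm (blk k g (x k)) + 1 / ((\<Sum>k\<in>F. wt 1 s k) + 1)) \<Longrightarrow>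
      nrm 1 s f \<le> nrm 1 s g + \<mu> + 2"
proof -
  have "\<exists>F. finite F \<and> nrm 1 s f - \<mu> \<le> (\<Sum>k\<in>F. wt 1 s k * bk k f)"
  proof (rule ccontr)
    assume "\<not> ?thesis"
    hence "(\<Sum>k\<in>F. wt 1 s k * bk k f) \<le> nrm 1 s f - \<mu>" if "finite F" for F using that by fastforce
    from nrm_le[OF f zero_le_one this] show False using \<open>\<mu> > 0\<close> by simp
  qed
  then obtain F where F: "finite F" "nrm 1 s f - \<mu> \<le> (\<Sum>k\<in>F. wt 1 s k * bk k f)" by blast
  define W where "W = (\<Sum>k\<in>F. wt 1 s k)"
  have W: "W \<ge> 0" unfolding W_def by (intro sum_nonneg wt_nonneg) simp
  have "\<exists>x. bk k f - 1 / (W + 1) \<le> norm (blk k f x)" for k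
  proof (rule ccontr)
    assume "\<not> ?thesis"
    hence "norm (blk k f x) \<le> bk k f - 1 / (W + 1)" for x by (meson linear)
    from bk_le[OF this] show False using W by (simp add: divide_simps)
  qed
  then obtain x where x: "\<And>k. bk k f - 1 / (W + 1) \<le> norm (blk k f (x k))" by metis
  have "nrm 1 s f \<le> nrm 1 s g + \<mu> + 2"
    if g: "X s g" and le: "\<And>k. k \<in> F \<Longrightarrow> norm (blk k f (x k)) \<le> norm (blk k g (x k)) + 1 / (W + 1)" for g
  proof -
    have "(\<Sum>k\<in>F. wt 1 s k * bk k f) \<le> (\<Sum>k\<in>F. wt 1 s k * (bk k g + 2 / (W + 1)))"
    proof (intro sum_mono mult_left_mono wt_nonneg)
      fix k assume "k \<in> F"
      have "bk k f \<le> norm (blk k g (x k)) + (1 / (W + 1) + 1 / (W + 1))" using x[of k] le[OF \<open>k \<in> F\<close>] by linarith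
      thus "bk k f \<le> bk k g + 2 / (W + 1)" using norm_blk_le_bk[OF X_bfun[OF g], of k "x k"] by simp
    qed simp
    also have "\<dots> = (\<Sum>k\<in>F. wt 1 s k * bk k g) + 2 * (W / (W + 1))"
      unfolding W_def by (simp add: sum.distrib distrib_left sum_divide_distrib[symmetric] sum_distrib_right[symmetric])
    also have "\<dots> \<le> nrm 1 s g + 2 * 1"
      using W sum_le_nrm[OF g _ _ F(1), of 1] by (intro add_mono mult_left_mono) auto
    finally show ?thesis using F(2) by simp
  qed
  thus ?thesis using that[OF F(1)] unfolding W_def by blast
qed

end

text \<open>The abstraction lets forward and backward evolution, \<open>\<sigma> = 1\<close> and
  \<open>\<sigma> = - 1\<close>, be treated on the same interval \<open>{0..T}\<close>.\<close>

locale evolution = window +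
  fixes \<sigma> \<kappa> T :: real and S :: "(real \<Rightarrow> complex) \<Rightarrow> real \<Rightarrow> real \<Rightarrow> complex"
  assumes \<sigma>: "\<bar>\<sigma>\<bar> \<le> 1" and \<kappa>: "\<bar>\<kappa>\<bar> \<le> 1" and T: "T \<ge> 0"
    and sol_S: "X 5 q \<Longrightarrow> sol \<sigma> \<kappa> (S q)" and S_0: "X 5 q \<Longrightarrow> S q 0 = q"
begin

text \<open>The radius \<open>r j\<close> of the comparison depends on a bound for the glued solution, which is only
  known after gluing. It is therefore chosen for the bound \<open>real j\<close>, which is good enough for large \<open>j\<close>.\<close>

lemma glue_bound:
  fixes G :: "nat \<Rightarrow> int \<Rightarrow> real \<Rightarrow> complex"
  assumes G: "\<And>j l. bfun (G j l)" "\<And>j l x. norm (G j l x) \<le> e l"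
    and e: "\<And>l. e l \<ge> 0" "(\<lambda>l. wt 1 5 l * e l) summable_on UNIV"
  shows "\<exists>B. \<forall>j. \<forall>t\<in>{0..T}. nrm 1 5 (S (syn (G j)) t) \<le> B"
proof -
  define u where "u = (\<lambda>j. S (syn (G j)))"
  have Xg: "X 5 (syn (G j))" for j by (rule syn_nrm(1)[OF G e])
  have u: "sol \<sigma> \<kappa> (u j)" and u0: "u j 0 = syn (G j)" for j
    unfolding u_def by (rule sol_S[OF Xg], rule S_0[OF Xg])
  \<comment> \<open>Working at a time of maximal norm reduces each solution to a single function,
    for which finitely many norming points suffice.\<close>
  have "\<exists>t\<in>{0..T}. \<forall>s\<in>{0..T}. nrm 1 5 (u j s) \<le> nrm 1 5 (u j t)" for j
    by (rule continuous_attains_sup) (use T in \<open>auto intro: continuous_on_subset[OF sol_continuous[OF u]]\<close>)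
  then obtain tm where tm: "\<And>j. tm j \<in> {0..T}" "\<And>j s. s \<in> {0..T} \<Longrightarrow> nrm 1 5 (u j s) \<le> nrm 1 5 (u j (tm j))" by metis
  define M where "M = (\<lambda>j. nrm 1 5 (u j (tm j)))"
  \<comment> \<open>A detector for large norm: a solution that starts close to \<open>u j\<close>
    and obeys the guessed bound must be almost as large as \<open>u j\<close> at its peak. The 3 is
    the loss \<open>\<mu> + 2\<close> of \<open>nrm_norming\<close> with
    \<open>\<mu> = 1\<close>.\<close>
  define near where "near = (\<lambda>j r \<delta>. \<forall>v. sol \<sigma> \<kappa> v \<longrightarrow> (\<forall>t\<in>{0..T}. nrm 1 5 (v t) \<le> real j) \<longrightarrow>
      (\<forall>x. \<bar>x\<bar> \<le> r \<longrightarrow> norm (u j 0 x - v 0 x) \<le> \<delta>) \<longrightarrow> M j \<le> nrm 1 5 (v (tm j)) + 3)"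
  have "\<exists>r\<ge>0. \<exists>\<delta>>0. near j r \<delta>" for j
  proof -
    obtain F x where F: "finite F"
      and norming: "\<And>g. X 5 g \<Longrightarrow> (\<And>k. k \<in> F \<Longrightarrow> norm (blk k (u j (tm j)) (x k)) \<le> norm (blk k g (x k)) + 1 / ((\<Sum>k\<in>F. wt 1 5 k) + 1)) \<Longrightarrow>
        M j \<le> nrm 1 5 g + 1 + 2"
      using nrm_norming[OF sol_X[OF u[of j], of "tm j"] zero_less_one] unfolding M_def by metis
    define \<epsilon> where "\<epsilon> = 1 / ((\<Sum>k\<in>F. wt 1 5 k) + 1)"
    have e0: "\<epsilon> > 0" unfolding \<epsilon>_def using sum_nonneg[of F "wt 1 5"] wt_nonneg[of 1 5] by (simp add: add_nonneg_pos)
    define A where "A = (\<Sum>k\<in>F. \<bar>x k\<bar>)"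
    have A: "\<bar>x k\<bar> \<le> A" if "k \<in> F" for k unfolding A_def by (rule member_le_sum[OF that]) (use F in auto)
    have A0: "A \<ge> 0" unfolding A_def by (intro sum_nonneg) simp
    \<comment> \<open>The comparison needs one bound for both solutions, namely the true maximum for
      \<open>u j\<close> and the guess for \<open>v\<close>.\<close>
    obtain r \<delta> where rd: "r \<ge> 0" "\<delta> > 0" and cmp: "\<forall>u' v. sol \<sigma> \<kappa> u' \<longrightarrow> sol \<sigma> \<kappa> v \<longrightarrow>
      (\<forall>t\<in>{0..T}. nrm 1 5 (u' t) \<le> max (M j) (real j) \<and> nrm 1 5 (v t) \<le> max (M j) (real j)) \<longrightarrow>
      (\<forall>x. \<bar>x\<bar> \<le> r \<longrightarrow> norm (u' 0 x - v 0 x) \<le> \<delta>) \<longrightarrow>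
      (\<forall>k\<in>F. \<forall>t\<in>{0..T}. \<forall>x. \<bar>x\<bar> \<le> A \<longrightarrow> norm (fmul (eta k) (\<lambda>x. u' t x - v t x) x) \<le> \<epsilon>)"
      using local_compare_finite[where m=eta and K="max (M j) (real j)", OF \<sigma> \<kappa> T A0 e0 F multiplier_eta]
      by (elim exE conjE) (rule that)
    have "near j r \<delta>"
      unfolding near_def
    proof (intro allI impI)
      fix v
      assume v: "sol \<sigma> \<kappa> v" and vj: "\<forall>t\<in>{0..T}. nrm 1 5 (v t) \<le> real j" and c: "\<forall>x. \<bar>x\<bar> \<le> r \<longrightarrow> norm (u j 0 x - v 0 x) \<le> \<delta>"
      have "\<forall>t\<in>{0..T}. nrm 1 5 (u j t) \<le> max (M j) (real j) \<and> nrm 1 5 (v t) \<le> max (M j) (real j)"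
        using tm(2) vj by (simp add: M_def le_max_iff_disj)
      hence d: "norm (fmul (eta k) (\<lambda>x. u j (tm j) x - v (tm j) x) (x k)) \<le> \<epsilon>" if "k \<in> F" for k
        using cmp[rule_format, OF u v _ _ that tm(1) A[OF that]] c by blast
      have "M j \<le> nrm 1 5 (v (tm j)) + 1 + 2"
      proof (rule norming[OF sol_X[OF v]])
        fix k assume k: "k \<in> F"
        have "blk k (u j (tm j)) (x k) - blk k (v (tm j)) (x k) = fmul (eta k) (\<lambda>x. u j (tm j) x - v (tm j) x) (x k)"
          unfolding blk_def by (rule fmul_diff[OF multiplier_eta X_bfun[OF sol_X[OF u]] X_bfun[OF sol_X[OF v]], symmetric])
        thus "norm (blk k (u j (tm j)) (x k)) \<le> norm (blk k (v (tm j)) (x k)) + 1 / ((\<Sum>k\<in>F. wt 1 5 k) + 1)"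
          using d[OF k] norm_triangle_sub[of "blk k (u j (tm j)) (x k)" "blk k (v (tm j)) (x k)"] unfolding \<epsilon>_def by simp
      qed
      thus "M j \<le> nrm 1 5 (v (tm j)) + 3" by simp
    qed
    thus ?thesis using rd by blast
  qed
  then obtain r \<delta> where rd: "\<And>j. r j \<ge> 0" "\<And>j. \<delta> j > 0" and near: "\<And>j. near j (r j) (\<delta> j)" by metis
  obtain q y where q: "X 5 q" and close: "\<And>j x. \<bar>x\<bar> \<le> r j \<Longrightarrow> norm (q (x + y j) - syn (G j) x) \<le> \<delta> j"
    using glue_datum[where G=G and e=e and \<delta>=\<delta> and r=r, OF G e rd(2,1)] by blast
  obtain L where L: "\<And>t. t \<in> {0..T} \<Longrightarrow> nrm 1 5 (S q t) \<le> L" using sol_bounded[OF sol_S[OF q]] by blast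
  have large: "M j \<le> L + 3" if j: "L \<le> real j" for j
  proof -
    let ?v = "\<lambda>t x. S q t (x + y j)"
    have "M j \<le> nrm 1 5 (?v (tm j)) + 3"
    proof (rule near[of j, unfolded near_def, rule_format])
      show "sol \<sigma> \<kappa> ?v" by (rule sol_shift[OF sol_S[OF q]])
      show "nrm 1 5 (?v t) \<le> real j" if "t \<in> {0..T}" for t unfolding nrm_shift using L[OF that] j by simp
      show "norm (u j 0 x - ?v 0 x) \<le> \<delta> j" if "\<bar>x\<bar> \<le> r j" for x
        using close[OF that] unfolding u0 S_0[OF q] by (simp add: norm_minus_commute)
    qed
    thus ?thesis unfolding nrm_shift using L[OF tm(1)[of j]] by linarith
  qed
  \<comment> \<open>For the finitely many j below L the guessed bound was too small and the detector
    says nothing; their maxima are simply added.\<close>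
  define B where "B = \<bar>L\<bar> + 3 + (\<Sum>j<nat \<lceil>L\<rceil>. \<bar>M j\<bar>)"
  have "M j \<le> B" for j
  proof (cases "L \<le> real j")
    case True
    have "0 \<le> (\<Sum>j<nat \<lceil>L\<rceil>. \<bar>M j\<bar>)" by (intro sum_nonneg) simp
    thus ?thesis using large[OF True] unfolding B_def by linarith
  next
    case False
    hence "j \<in> {..<nat \<lceil>L\<rceil>}" by (simp add: not_le less_ceiling_iff zless_nat_eq_int_zless)
    hence "\<bar>M j\<bar> \<le> (\<Sum>j<nat \<lceil>L\<rceil>. \<bar>M j\<bar>)" by (rule member_le_sum) auto
    thus ?thesis unfolding B_def by linarith
  qed
  hence "\<forall>j. \<forall>t\<in>{0..T}. nrm 1 5 (u j t) \<le> B" using tm(2) unfolding M_def by (blast intro: order_trans)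
  thus ?thesis unfolding u_def by blast
qed

end

section \<open>Selection of frequency profiles\<close>

text \<open>The diagonal argument in the form of compactness: a countable power of an interval is
  compact and metrizable, hence sequentially compact.\<close>

lemma pointwise_convergent_subsequence:
  fixes a :: "nat \<Rightarrow> 'k::countable \<Rightarrow> real"
  assumes a: "\<And>i k. a i k \<in> {0..M}"
  shows "\<exists>s al. strict_mono (s :: nat \<Rightarrow> nat) \<and> (\<forall>k. (\<lambda>i. a (s i) k) \<longlonglongrightarrow> al k)"
proof -
  let ?K = "PiE UNIV (\<lambda>_. {0..M}) :: ('k \<Rightarrow> real) set"
  have "compactin (product_topology (\<lambda>_. euclidean) UNIV) ?K" unfolding compactin_PiE by simp
  hence "compact ?K" unfolding euclidean_product_topology compactin_euclidean_iff .
  hence "seq_compact ?K" by (simp add: compact_eq_seq_compact_metric)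
  moreover have "\<forall>i. a i \<in> ?K" using a by auto
  ultimately obtain al s where "strict_mono s" and lim: "(a \<circ> s) \<longlonglongrightarrow> al" unfolding seq_compact_def by blast
  moreover have "(\<lambda>i. a (s i) k) \<longlonglongrightarrow> al k" for k
    using continuous_on_tendsto_compose[OF continuous_on_product_coordinates[of k] lim] by (simp add: o_def)
  ultimately show ?thesis by blast
qed

lemma summable_half_powers: "(\<lambda>k::'k::countable. (1 / 2 :: real) ^ to_nat k) summable_on UNIV"
proof (rule summable_bounded_sums(1))
  fix F :: "'k set" assume F: "finite F"
  have "(\<Sum>k\<in>F. (1 / 2 :: real) ^ to_nat k) = (\<Sum>n\<in>to_nat ` F. (1 / 2) ^ n)"
    by (simp add: sum.reindex inj_on_subset[OF inj_to_nat])
  also have "\<dots> \<le> (\<Sum>n. (1 / 2) ^ n)" by (rule sum_le_suminf) (use F in auto)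
  finally show "(\<Sum>k\<in>F. (1 / 2 :: real) ^ to_nat k) \<le> (\<Sum>n. (1 / 2) ^ n)" .
qed simp

context window begin

text \<open>For fixed \<epsilon> the flattened norm is equivalent to the full one, because
  \<open>1 + \<bar>k\<bar>\<close> is at most \<open>1 / \<epsilon>\<close> times
  \<open>1 + \<epsilon> * \<bar>k\<bar>\<close>.\<close>

lemma nrm_weight_le:
  assumes f: "X s f" and e: "0 < \<epsilon>" "\<epsilon> \<le> 1"
  shows "nrm 1 s f \<le> (1 / \<epsilon>) ^ s * nrm \<epsilon> s f"
proof (rule nrm_le[OF f zero_le_one])
  fix F :: "int set" assume F: "finite F"
  have "(\<Sum>k\<in>F. wt 1 s k * bk k f) \<le> (\<Sum>k\<in>F. (1 / \<epsilon>) ^ s * (wt \<epsilon> s k * bk k f))"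
  proof (rule sum_mono)
    fix k
    have "1 + \<bar>real_of_int k\<bar> \<le> 1 / \<epsilon> * (1 + \<epsilon> * \<bar>real_of_int k\<bar>)" using e by (simp add: field_simps)
    hence "wt 1 s k \<le> (1 / \<epsilon>) ^ s * wt \<epsilon> s k" unfolding wt_def by (simp flip: power_mult_distrib add: power_mono)
    from mult_right_mono[OF this X_bk_nonneg[OF f, of k]]
    show "wt 1 s k * bk k f \<le> (1 / \<epsilon>) ^ s * (wt \<epsilon> s k * bk k f)" by (simp add: mult.assoc)
  qed
  also have "\<dots> \<le> (1 / \<epsilon>) ^ s * nrm \<epsilon> s f"
    unfolding sum_distrib_left[symmetric] using sum_le_nrm[OF f _ e(2) F] e by (intro mult_left_mono) auto
  finally show "(\<Sum>k\<in>F. wt 1 s k * bk k f) \<le> (1 / \<epsilon>) ^ s * nrm \<epsilon> s f" .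
qed

text \<open>Beyond j the number 1 is at most \<open>(1 + \<bar>l\<bar>) / (j + 1)\<close>, so the
  flattened weight is small relative to the full one. Removing low frequencies is not a sharp
  cutoff, but the remainder is again a synthesis, namely of the omitted blocks.\<close>

lemma high_frequencies_small:
  assumes f: "X s f" and e: "0 \<le> \<epsilon>" "\<epsilon> \<le> 1"
  shows "nrm \<epsilon> s (\<lambda>x. f x - syn (\<lambda>l. if \<bar>l\<bar> \<le> int j then blk l f else (\<lambda>_. 0)) x)
    \<le> Ke * dkc * Kt * dkc * (5 * 3 ^ s) * (\<epsilon> + 1 / (real j + 1)) ^ s * nrm 1 s f"
proof -
  define C where "C = Ke * dkc * Kt * dkc * (5 * 3 ^ s)"
  have C: "C \<ge> 0" unfolding C_def using K_nonneg dkc_nonneg by simp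
  let ?G = "\<lambda>l. if \<bar>l\<bar> \<le> int j then blk l f else (\<lambda>_. 0)"
  let ?H = "\<lambda>l. if \<bar>l\<bar> \<le> int j then (\<lambda>_. 0) else blk l f"
  let ?h = "\<lambda>l. if \<bar>l\<bar> \<le> int j then 0 else bk l f"
  note b = blk_bounds[OF f]
  have z: "bfun (\<lambda>x. 0)" by (rule bfunI_continuous[where B=0]) auto
  have nn: "bk l f \<ge> 0" for l by (rule X_bk_nonneg[OF f])
  have H: "bfun (?H l)" "norm (?H l x) \<le> ?h l" for l x using b z by simp_all
  have G: "bfun (?G l)" "norm (?G l x) \<le> bk l f" for l x using b z nn by simp_all
  have h0: "?h l \<ge> 0" for l using nn by simp
  have hs: "(\<lambda>l. wt 1 s l * ?h l) summable_on UNIV"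
    by (rule summable_nonneg_comparison(1)[OF X_summable[OF f _ _ order_refl, of 1]]) (use nn wt_nonneg in auto)
  have "(\<lambda>x. f x - syn ?G x) = (\<lambda>x. syn (\<lambda>l. blk l f) x - syn ?G x)" unfolding syn_blk[OF X_cb[OF f] b(3)] ..
  also have "\<dots> = syn (\<lambda>l x. blk l f x - ?G l x)" using syn_diff[OF b(1,2,3) G b(3)] by (intro ext)
  also have "(\<lambda>l x. blk l f x - ?G l x) = ?H" by (simp add: fun_eq_iff)
  finally have eq: "(\<lambda>x. f x - syn ?G x) = syn ?H" .
  have "infsum (\<lambda>l. wt \<epsilon> s l * ?h l) UNIV \<le> infsum (\<lambda>l. (\<epsilon> + 1 / (real j + 1)) ^ s * (wt 1 s l * bk l f)) UNIV"
  proof (rule summable_nonneg_comparison(2))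
    show "(\<lambda>l. (\<epsilon> + 1 / (real j + 1)) ^ s * (wt 1 s l * bk l f)) summable_on UNIV"
      by (intro summable_on_cmult_right X_summable[OF f]) auto
    fix l
    show "0 \<le> wt \<epsilon> s l * ?h l" by (intro mult_nonneg_nonneg wt_nonneg e h0)
    show "wt \<epsilon> s l * ?h l \<le> (\<epsilon> + 1 / (real j + 1)) ^ s * (wt 1 s l * bk l f)"
    proof (cases "\<bar>l\<bar> \<le> int j")
      case True thus ?thesis using e nn wt_nonneg[of 1 s l] by simp
    next
      case False
      hence "real j + 1 \<le> \<bar>real_of_int l\<bar>" by linarith
      hence "1 \<le> 1 / (real j + 1) * (1 + \<bar>real_of_int l\<bar>)" by (simp add: divide_simps)
      moreover have "1 + \<epsilon> * L \<le> (\<epsilon> + a) * (1 + L)" if "1 \<le> a * (1 + L)" for a L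
        using that e by (simp add: algebra_simps)
      ultimately have "1 + \<epsilon> * \<bar>real_of_int l\<bar> \<le> (\<epsilon> + 1 / (real j + 1)) * (1 + \<bar>real_of_int l\<bar>)" by blast
      hence "wt \<epsilon> s l \<le> (\<epsilon> + 1 / (real j + 1)) ^ s * wt 1 s l"
        unfolding wt_def power_mult_distrib[symmetric] using e by (intro power_mono) auto
      from mult_right_mono[OF this nn[of l]] False show ?thesis by (simp add: mult.assoc)
    qed
  qed
  also have "\<dots> = (\<epsilon> + 1 / (real j + 1)) ^ s * nrm 1 s f" unfolding nrm_def by (rule infsum_cmult_right')
  finally have "C * infsum (\<lambda>l. wt \<epsilon> s l * ?h l) UNIV \<le> C * ((\<epsilon> + 1 / (real j + 1)) ^ s * nrm 1 s f)"
    using C by (intro mult_left_mono)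
  moreover have "nrm \<epsilon> s (syn ?H) \<le> C * infsum (\<lambda>l. wt \<epsilon> s l * ?h l) UNIV"
    unfolding C_def by (rule syn_nrm(2)[OF H h0 hs e])
  ultimately show ?thesis unfolding eq C_def[symmetric] by (simp add: mult.assoc)
qed

end

context evolution begin

text \<open>By contradiction, from solutions of unbounded norm. The truncations of all orders j are
  glued at once, which bounds their solutions before any j is chosen; stability around them then
  fixes \<epsilon>, and only afterwards j. The difference of a solution and its truncated companion
  is thus bounded in the full norm by a constant independent of j.\<close>

lemma uniform_bound:
  assumes f: "\<And>n. X 5 (f n)" and M: "\<And>n. nrm 1 5 (f n) \<le> M"
  shows "\<exists>B. \<forall>n. \<forall>t\<in>{0..T}. nrm 1 5 (S (f n) t) \<le> B"
proof (rule ccontr)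
  assume "\<not> ?thesis"
  hence "\<exists>n. \<exists>t\<in>{0..T}. real i < nrm 1 5 (S (f n) t)" for i :: nat by (meson linear not_le)
  then obtain n tm where tm: "\<And>i. tm i \<in> {0..T}" and big: "\<And>i. real i < nrm 1 5 (S (f (n i)) (tm i))" by metis
  define F where "F = (\<lambda>i. f (n i))"
  have F: "X 5 (F i)" "nrm 1 5 (F i) \<le> M" for i unfolding F_def by (rule f, rule M)
  have M0: "M \<ge> 0" using nrm_nonneg[OF F(1)[of 0], of 1 5] F(2)[of 0] by simp
  define a where "a = (\<lambda>i k. wt 1 5 k * bk k (F i))"
  have a0: "a i k \<ge> 0" for i k unfolding a_def by (rule term_nonneg[OF F(1)]) simp
  have asum: "(\<Sum>k\<in>K. a i k) \<le> M" if "finite K" for i K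
    using sum_le_nrm[OF F(1)[of i] _ _ that, of 1] F(2)[of i] unfolding a_def by simp
  have aM: "a i k \<in> {0..M}" for i k using asum[of "{k}" i] a0[of i k] by simp
  obtain s al where s: "strict_mono (s :: nat \<Rightarrow> nat)" and al: "\<And>k. (\<lambda>i. a (s i) k) \<longlonglongrightarrow> al k"
    using pointwise_convergent_subsequence[of a M, OF aM] by (elim exE conjE) (rule that, assumption, rule spec)
  have al0: "al k \<ge> 0" for k by (rule LIMSEQ_le_const[OF al]) (use a0 in auto)
  have als: "al summable_on UNIV"
  proof (rule summable_bounded_sums(1)[OF al0])
    fix K :: "int set" assume K: "finite K"
    show "sum al K \<le> M"
      by (rule LIMSEQ_le_const2[OF tendsto_sum[OF al]]) (use asum[OF K] in auto)
  qed
  \<comment> \<open>A positive summable slack: block norms converge only pointwise, so the limit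
    itself need not dominate them, but limit plus slack eventually does on each finite
    range.\<close>
  define c :: "int \<Rightarrow> real" where "c = (\<lambda>k. (1 / 2) ^ to_nat k)"
  have c: "c k > 0" for k unfolding c_def by simp
  have "\<exists>i\<ge>j. \<forall>k\<in>{- int j..int j}. a (s i) k < al k + c k" for j
  proof -
    have "\<forall>\<^sub>F i in sequentially. \<forall>k\<in>{- int j..int j}. a (s i) k < al k + c k"
      by (intro eventually_ball_finite ballI order_tendstoD(2)[OF al]) (use c in auto)
    from eventually_conj[OF this eventually_ge_at_top[of j]]
    show ?thesis using eventually_happens'[OF sequentially_bot] by blast
  qed
  hence "\<exists>i. \<forall>j. i j \<ge> j \<and> (\<forall>k\<in>{- int j..int j}. a (s (i j)) k < al k + c k)" by (intro choice allI)
  then obtain i where i': "\<forall>j. i j \<ge> j \<and> (\<forall>k\<in>{- int j..int j}. a (s (i j)) k < al k + c k)" ..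
  have i: "i j \<ge> j" "\<bar>k\<bar> \<le> int j \<Longrightarrow> a (s (i j)) k < al k + c k" for j k
    using spec[OF i', of j] by (simp_all add: Ball_def abs_le_iff minus_le_iff)
  define p where "p = (\<lambda>j. s (i j))"
  have pj: "p j \<ge> j" for j unfolding p_def using seq_suble[OF s, of "i j"] i(1)[of j] by linarith
  define e where "e = (\<lambda>k. (al k + c k) / wt 1 5 k)"
  have wpos: "wt 1 5 k > 0" for k using wt_ge_1[of 1 5 k] by simp
  have e0: "e k \<ge> 0" for k unfolding e_def using al0[of k] c[of k] wpos[of k] by simp
  have es: "(\<lambda>k. wt 1 5 k * e k) summable_on UNIV"
  proof -
    have "(\<lambda>k. al k + c k) summable_on UNIV" unfolding c_def by (intro summable_on_add als summable_half_powers)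
    moreover have "wt 1 5 k * e k = al k + c k" for k unfolding e_def using wpos[of k] by simp
    ultimately show ?thesis by simp
  qed
  \<comment> \<open>Truncation at j matches the range on which the member \<open>F (p j)\<close> is
    known to lie below the envelope, so the envelope holds for all pieces.\<close>
  define G where "G = (\<lambda>j l. if \<bar>l\<bar> \<le> int j then blk l (F (p j)) else (\<lambda>_. 0))"
  have G: "bfun (G j l)" "norm (G j l x) \<le> e l" for j l x
  proof -
    have "bfun (\<lambda>x. 0)" by (rule bfunI_continuous[where B=0]) auto
    thus "bfun (G j l)" unfolding G_def using blk_bounds(1)[OF F(1)] by simp
    have "norm (blk l (F (p j)) x) \<le> e l" if "\<bar>l\<bar> \<le> int j"
    proof -
      have "wt 1 5 l * bk l (F (p j)) \<le> al l + c l" using i(2)[OF that] unfolding p_def a_def by simp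
      hence "bk l (F (p j)) \<le> e l" unfolding e_def using wpos[of l] by (simp add: field_simps)
      thus ?thesis using blk_bounds(2)[OF F(1)] by (rule order_trans[rotated])
    qed
    thus "norm (G j l x) \<le> e l" unfolding G_def using e0 by simp
  qed
  obtain B' where B': "\<forall>j. \<forall>t\<in>{0..T}. nrm 1 5 (S (syn (G j)) t) \<le> B'" using glue_bound[where G=G, OF G e0 es] ..
  define B where "B = max B' 0"
  have B: "nrm 1 5 (S (syn (G j)) t) \<le> B" if "t \<in> {0..T}" for j t using bspec[OF spec[OF B', of j] that] unfolding B_def by simp
  have B0: "B \<ge> 0" unfolding B_def by simp
  have g: "X 5 (syn (G j))" for j by (rule syn_nrm(1)[OF G e0 es])
  obtain \<delta> where \<delta>: "\<delta> > 0" and pert: "\<And>\<epsilon> u v t. 0 \<le> \<epsilon> \<Longrightarrow> \<epsilon> \<le> 1 \<Longrightarrow> sol \<sigma> \<kappa> u \<Longrightarrow> sol \<sigma> \<kappa> v \<Longrightarrow> \<forall>t\<in>{0..T}. nrm \<epsilon> 5 (u t) \<le> B \<Longrightarrow>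
      nrm \<epsilon> 5 (\<lambda>x. v 0 x - u 0 x) \<le> \<delta> \<Longrightarrow> t \<in> {0..T} \<Longrightarrow> nrm \<epsilon> 5 (\<lambda>x. v t x - u t x) \<le> 1"
    by (rule perturbation[OF \<sigma> \<kappa> T B0]) blast
  define C where "C = Ke * dkc * Kt * dkc * (5 * 3 ^ 5)"
  have C: "C \<ge> 0" unfolding C_def using K_nonneg dkc_nonneg by simp
  \<comment> \<open>With \<open>1 / (real j + 1) \<le> \<epsilon>\<close> the high frequencies are
    of size \<open>C * (2 * \<epsilon>) ^ 5 * M\<close>. The cap 1 / 2 lets the fifth power be
    estimated by the first, and the second entry then brings the product below \<delta>.\<close>
  define \<epsilon> where "\<epsilon> = min (1 / 2) (\<delta> / (C * M + 1) / 2)"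
  have CM: "C * M \<ge> 0" using C M0 by simp
  have e: "0 < \<epsilon>" "\<epsilon> \<le> 1" unfolding \<epsilon>_def using \<delta> CM by auto
  have e2: "C * (2 * \<epsilon>) ^ 5 * M \<le> \<delta>"
  proof -
    have min2: "(2 * min (1 / 2) (a / 2)) ^ 1 \<le> a" for a :: real by (simp add: min_def)
    have "(2 * \<epsilon>) ^ 5 \<le> (2 * \<epsilon>) ^ 1" by (rule power_decreasing) (use e \<epsilon>_def in auto)
    also have "\<dots> \<le> \<delta> / (C * M + 1)" unfolding \<epsilon>_def by (rule min2)
    finally have "(C * M) * (2 * \<epsilon>) ^ 5 \<le> (C * M) * (\<delta> / (C * M + 1))" by (rule mult_left_mono) (fact CM)
    also have "\<dots> = \<delta> * ((C * M) / (C * M + 1))" by simp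
    also have "\<dots> \<le> \<delta> * 1" by (rule mult_left_mono) (use \<delta> CM in \<open>auto simp: divide_le_eq_1\<close>)
    finally show ?thesis by (simp add: mult_ac)
  qed
  \<comment> \<open>The first summand makes the high frequencies small enough; the rest exceeds the
    bound on the solution of \<open>F (p j)\<close>, whose norm is larger than \<open>p j\<close>
    and hence than j.\<close>
  define j where "j = nat \<lceil>1 / \<epsilon> + (B + (1 / \<epsilon>) ^ 5)\<rceil>"
  have j1: "real j \<ge> 1 / \<epsilon> + (B + (1 / \<epsilon>) ^ 5)" unfolding j_def by linarith
  have j: "real j \<ge> B + (1 / \<epsilon>) ^ 5" "1 / (real j + 1) \<le> \<epsilon>"
  proof -
    have pos: "1 / \<epsilon> > 0" "(1 / \<epsilon>) ^ 5 \<ge> 0" using e by auto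
    show "real j \<ge> B + (1 / \<epsilon>) ^ 5" using j1 pos by linarith
    have "real j + 1 \<ge> 1 / \<epsilon>" using j1 pos B0 by linarith
    thus "1 / (real j + 1) \<le> \<epsilon>" using e by (simp add: field_simps)
  qed
  let ?u = "S (syn (G j))" and ?v = "S (F (p j))"
  have u: "sol \<sigma> \<kappa> ?u" by (rule sol_S[OF g])
  have v: "sol \<sigma> \<kappa> ?v" by (rule sol_S[OF F(1)])
  have t: "tm (p j) \<in> {0..T}" by (rule tm)
  have "nrm \<epsilon> 5 (\<lambda>x. ?v (tm (p j)) x - ?u (tm (p j)) x) \<le> 1"
  proof (rule pert[OF less_imp_le[OF e(1)] e(2) u v _ _ t])
    show "\<forall>t\<in>{0..T}. nrm \<epsilon> 5 (?u t) \<le> B"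
      using nrm_mono_weight[OF sol_X[OF u] less_imp_le[OF e(1)] e(2)] B by (meson order_trans)
    have "nrm \<epsilon> 5 (\<lambda>x. F (p j) x - syn (G j) x) \<le> C * (\<epsilon> + 1 / (real j + 1)) ^ 5 * nrm 1 5 (F (p j))"
      unfolding G_def C_def by (rule high_frequencies_small[OF F(1) less_imp_le[OF e(1)] e(2)])
    also have "\<dots> \<le> C * (2 * \<epsilon>) ^ 5 * M"
      using C M0 F e j(2) by (intro mult_mono mult_nonneg_nonneg power_mono zero_le_power nrm_nonneg[OF F(1)]) auto
    also have "\<dots> \<le> \<delta>" by (fact e2)
    finally show "nrm \<epsilon> 5 (\<lambda>x. ?v 0 x - ?u 0 x) \<le> \<delta>" unfolding S_0[OF g] S_0[OF F(1)] .
  qed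
  hence "(1 / \<epsilon>) ^ 5 * nrm \<epsilon> 5 (\<lambda>x. ?v (tm (p j)) x - ?u (tm (p j)) x) \<le> (1 / \<epsilon>) ^ 5 * 1"
    using e by (intro mult_left_mono) auto
  hence "nrm 1 5 (\<lambda>x. ?v (tm (p j)) x - ?u (tm (p j)) x) \<le> (1 / \<epsilon>) ^ 5"
    using nrm_weight_le[OF X_diff[OF sol_X[OF v] sol_X[OF u]] e, of "tm (p j)" "tm (p j)"] by linarith
  hence "nrm 1 5 (?v (tm (p j))) \<le> B + (1 / \<epsilon>) ^ 5"
    using nrm_triangle_reverse[OF sol_X[OF v] sol_X[OF u], of 1 "tm (p j)" "tm (p j)"] B[OF t, of j] by linarith
  moreover have "nrm 1 5 (?v (tm (p j))) > real (p j)" using big[of "p j"] unfolding F_def .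
  ultimately show False using j(1) pj[of j] by linarith
qed

end

section \<open>Convergence of the derivatives\<close>

lemma multiplier_times_id_power: "multiplier m \<Longrightarrow> multiplier (\<lambda>\<xi>. (\<i> * of_real \<xi>) ^ j * m \<xi>)"
proof (induction j)
  case (Suc j)
  show ?case using multiplier_times_id[OF Suc.IH[OF Suc.prems]] by (simp add: mult.assoc)
qed simp

context window begin

text \<open>The clause on multipliers turns blocks of a derivative into multipliers of the
  undifferentiated function, to which the local comparison of solutions applies.\<close>

lemma X_dX_power:
  assumes "X (j + s) w"
  shows "X s ((dX ^^ j) w)" "nrm 1 s ((dX ^^ j) w) \<le> Kdd ^ j * nrm 1 (j + s) w"
    "multiplier m \<Longrightarrow> fmul m ((dX ^^ j) w) x = fmul (\<lambda>\<xi>. (\<i> * of_real \<xi>) ^ j * m \<xi>) w x"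
    "iter_deriv j w = (dX ^^ j) w"
proof -
  have "X s ((dX ^^ j) w) \<and> nrm 1 s ((dX ^^ j) w) \<le> Kdd ^ j * nrm 1 (j + s) w \<and>
    (\<forall>m x. multiplier m \<longrightarrow> fmul m ((dX ^^ j) w) x = fmul (\<lambda>\<xi>. (\<i> * of_real \<xi>) ^ j * m \<xi>) w x) \<and> iter_deriv j w = (dX ^^ j) w"
    using assms
  proof (induction j arbitrary: s)
    case 0
    thus ?case by (simp add: iter_deriv_def)
  next
    case (Suc j)
    let ?v = "(dX ^^ j) w"
    have IH: "X (Suc s) ?v" "nrm 1 (Suc s) ?v \<le> Kdd ^ j * nrm 1 (j + Suc s) w"
      "\<And>m x. multiplier m \<Longrightarrow> fmul m ?v x = fmul (\<lambda>\<xi>. (\<i> * of_real \<xi>) ^ j * m \<xi>) w x" "iter_deriv j w = ?v"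
      using Suc.IH[of "Suc s"] Suc.prems by simp_all
    note D = X_has_derivative[OF IH(1)] and X = X_dX[OF IH(1)]
    have "nrm 1 s (dX ?v) \<le> Kdd * nrm 1 (Suc s) ?v" by (rule nrm_dX[OF IH(1)])
    also have "\<dots> \<le> Kdd * (Kdd ^ j * nrm 1 (j + Suc s) w)" by (rule mult_left_mono[OF IH(2) Kdd_nonneg])
    finally have n: "nrm 1 s (dX ?v) \<le> Kdd ^ Suc j * nrm 1 (Suc j + s) w" by (simp add: mult.assoc)
    have m: "fmul m (dX ?v) x = fmul (\<lambda>\<xi>. (\<i> * of_real \<xi>) ^ Suc j * m \<xi>) w x" if m: "multiplier m" for m x
    proof -
      have "fmul m (dX ?v) x = fmul (\<lambda>\<xi>. \<i> * of_real \<xi> * m \<xi>) ?v x"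
        by (rule fmul_derivative[OF m X_bfun[OF IH(1)] X_bfun[OF X] cb_continuous[OF X_cb[OF X]] D])
      also have "\<dots> = fmul (\<lambda>\<xi>. (\<i> * of_real \<xi>) ^ j * (\<i> * of_real \<xi> * m \<xi>)) w x" by (rule IH(3)[OF multiplier_times_id[OF m]])
      also have "(\<lambda>\<xi>. (\<i> * of_real \<xi>) ^ j * (\<i> * of_real \<xi> * m \<xi>)) = (\<lambda>\<xi>. (\<i> * of_real \<xi>) ^ Suc j * m \<xi>)" by (simp add: fun_eq_iff)
      finally show ?thesis .
    qed
    have "iter_deriv (Suc j) w = (\<lambda>x. vector_derivative (iter_deriv j w) (at x))" by (simp add: iter_deriv_def)
    also have "\<dots> = dX ?v" unfolding IH(4) using vector_derivative_at[OF D] by (intro ext)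
    finally show ?case using X n m by simp
  qed
  thus "X s ((dX ^^ j) w)" "nrm 1 s ((dX ^^ j) w) \<le> Kdd ^ j * nrm 1 (j + s) w"
    "multiplier m \<Longrightarrow> fmul m ((dX ^^ j) w) x = fmul (\<lambda>\<xi>. (\<i> * of_real \<xi>) ^ j * m \<xi>) w x"
    "iter_deriv j w = (dX ^^ j) w" by blast+
qed

text \<open>One power of the weight beyond mere summability gives the rate
  \<open>1 / (N + 1)\<close> for the high blocks. Derivatives up to order four of elements of
  \<open>X 5\<close> have exactly this one power to spare.\<close>

lemma norm_le_blocks:
  assumes h: "X 1 h"
  shows "norm (h x) \<le> (\<Sum>l\<in>{- int N..int N}. norm (blk l h x)) + nrm 1 1 h / (real N + 1)"
proof -
  let ?I = "{- int N..int N}"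
  have nn: "bk l h \<ge> 0" for l by (rule X_bk_nonneg[OF h])
  have "infsum (\<lambda>l. bk l h) UNIV \<le> (\<Sum>l\<in>?I. bk l h) + nrm 1 1 h / (real N + 1)"
  proof (rule summable_bounded_sums(2)[OF nn])
    fix F :: "int set" assume F: "finite F"
    have "(\<Sum>l\<in>F. bk l h) \<le> (\<Sum>l\<in>?I \<union> (F - ?I). bk l h)" by (rule sum_mono2) (use F nn in auto)
    also have "\<dots> = (\<Sum>l\<in>?I. bk l h) + (\<Sum>l\<in>F - ?I. bk l h)" by (rule sum.union_disjoint) (use F in auto)
    also have "(\<Sum>l\<in>F - ?I. bk l h) \<le> (\<Sum>l\<in>F - ?I. wt 1 1 l * bk l h / (real N + 1))"
    proof (rule sum_mono)
      fix l assume "l \<in> F - ?I"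
      hence "real N + 1 \<le> wt 1 1 l" unfolding wt_def by auto
      hence "(real N + 1) * bk l h \<le> wt 1 1 l * bk l h" using nn by (rule mult_right_mono)
      thus "bk l h \<le> wt 1 1 l * bk l h / (real N + 1)" by (simp add: field_simps)
    qed
    also have "\<dots> \<le> nrm 1 1 h / (real N + 1)"
      unfolding sum_divide_distrib[symmetric] using sum_le_nrm[OF h, of 1 "F - ?I"] F by (intro divide_right_mono) auto
    finally show "(\<Sum>l\<in>F. bk l h) \<le> (\<Sum>l\<in>?I. bk l h) + nrm 1 1 h / (real N + 1)" by simp
  qed
  hence "tl (\<lambda>l. bk l h) N \<le> nrm 1 1 h / (real N + 1)" unfolding tl_def by simp
  moreover have "norm (h x) \<le> norm (\<Sum>l\<in>?I. blk l h x) + norm (h x - (\<Sum>l\<in>?I. blk l h x))" by (rule norm_triangle_sub)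
  moreover have "norm (\<Sum>l\<in>?I. blk l h x) \<le> (\<Sum>l\<in>?I. norm (blk l h x))" by (rule norm_sum)
  ultimately show ?thesis using X_partial[OF h, of x N] by linarith
qed

end

context evolution begin

text \<open>High blocks of the differentiated difference are small because of the a priori bound K
  alone; the low blocks are finitely many multipliers of the difference and obey the local
  comparison.\<close>

lemma local_compare_deriv:
  assumes A: "A \<ge> 0" and e: "\<epsilon> > 0"
  shows "\<exists>r\<ge>0. \<exists>\<delta>>0. \<forall>u v. sol \<sigma> \<kappa> u \<longrightarrow> sol \<sigma> \<kappa> v \<longrightarrow> (\<forall>t\<in>{0..T}. nrm 1 5 (u t) \<le> K \<and> nrm 1 5 (v t) \<le> K) \<longrightarrow>
      (\<forall>x. \<bar>x\<bar> \<le> r \<longrightarrow> norm (u 0 x - v 0 x) \<le> \<delta>) \<longrightarrow>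
      (\<forall>j\<le>4. \<forall>t\<in>{0..T}. \<forall>x. \<bar>x\<bar> \<le> A \<longrightarrow> norm (iter_deriv j (\<lambda>x. u t x - v t x) x) \<le> \<epsilon>)"
proof -
  \<comment> \<open>A bound for the \<open>X 1\<close> norm of every derivative up to order four of
    the difference: at most \<open>Kdd + 1\<close> per derivative and
    \<open>2 * \<bar>K\<bar>\<close> for the difference itself.\<close>
  define D where "D = (Kdd + 1) ^ 4 * (2 * \<bar>K\<bar>)"
  have D: "D \<ge> 0" unfolding D_def using Kdd_nonneg by simp
  obtain N :: nat where N: "2 * D / \<epsilon> \<le> real N" using real_arch_simple by blast
  have DN: "D / (real N + 1) \<le> \<epsilon> / 2"
  proof -
    have "2 * D \<le> real N * \<epsilon>" using N e by (simp add: field_simps)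
    also have "\<dots> \<le> (real N + 1) * \<epsilon>" using e by simp
    finally show ?thesis by (simp add: field_simps)
  qed
  \<comment> \<open>The low blocks, \<open>2 * N + 1\<close> in number, share the half of \<epsilon>
    that the high blocks leave.\<close>
  define \<epsilon>' where "\<epsilon>' = \<epsilon> / (2 * (2 * real N + 1))"
  have e': "\<epsilon>' > 0" unfolding \<epsilon>'_def using e by simp
  let ?m = "\<lambda>p \<xi>. (\<i> * of_real \<xi>) ^ fst p * eta (snd p) \<xi>"
  let ?F = "{..4::nat} \<times> {- int N..int N}"
  have "\<exists>r\<ge>0. \<exists>\<delta>>0. \<forall>u v. sol \<sigma> \<kappa> u \<longrightarrow> sol \<sigma> \<kappa> v \<longrightarrow> (\<forall>t\<in>{0..T}. nrm 1 5 (u t) \<le> K \<and> nrm 1 5 (v t) \<le> K) \<longrightarrow>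
      (\<forall>x. \<bar>x\<bar> \<le> r \<longrightarrow> norm (u 0 x - v 0 x) \<le> \<delta>) \<longrightarrow>
      (\<forall>p\<in>?F. \<forall>t\<in>{0..T}. \<forall>x. \<bar>x\<bar> \<le> A \<longrightarrow> norm (fmul (?m p) (\<lambda>x. u t x - v t x) x) \<le> \<epsilon>')"
    by (rule local_compare_finite[where m="?m", OF \<sigma> \<kappa> T A e' _ multiplier_times_id_power[OF multiplier_eta]]) simp
  then obtain r \<delta> where rd: "r \<ge> 0" "\<delta> > 0" and cmp: "\<forall>u v. sol \<sigma> \<kappa> u \<longrightarrow> sol \<sigma> \<kappa> v \<longrightarrow> (\<forall>t\<in>{0..T}. nrm 1 5 (u t) \<le> K \<and> nrm 1 5 (v t) \<le> K) \<longrightarrow>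
      (\<forall>x. \<bar>x\<bar> \<le> r \<longrightarrow> norm (u 0 x - v 0 x) \<le> \<delta>) \<longrightarrow>
      (\<forall>p\<in>?F. \<forall>t\<in>{0..T}. \<forall>x. \<bar>x\<bar> \<le> A \<longrightarrow> norm (fmul (?m p) (\<lambda>x. u t x - v t x) x) \<le> \<epsilon>')"
    by (elim exE conjE) (rule that)
  have main: "norm (iter_deriv j (\<lambda>x. u t x - v t x) x) \<le> \<epsilon>"
    if u: "sol \<sigma> \<kappa> u" and v: "sol \<sigma> \<kappa> v" and K: "\<forall>t\<in>{0..T}. nrm 1 5 (u t) \<le> K \<and> nrm 1 5 (v t) \<le> K"
      and c: "\<forall>x. \<bar>x\<bar> \<le> r \<longrightarrow> norm (u 0 x - v 0 x) \<le> \<delta>" and j: "j \<le> 4" and t: "t \<in> {0..T}" and x: "\<bar>x\<bar> \<le> A" for u v j t x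
  proof -
    let ?w = "\<lambda>x. u t x - v t x"
    let ?h = "(dX ^^ j) ?w"
    have w: "X (j + (5 - j)) ?w" using X_diff[OF sol_X[OF u] sol_X[OF v], of t t] j by simp
    note d = X_dX_power[OF w]
    have h: "X 1 ?h" by (rule X_mono[OF d(1)]) (use j in simp)
    have "nrm 1 1 ?h \<le> nrm 1 (5 - j) ?h" by (rule nrm_mono_exp[OF d(1)]) (use j in simp)
    also have "\<dots> \<le> Kdd ^ j * nrm 1 5 ?w" using d(2) j by simp
    also have "\<dots> \<le> (Kdd + 1) ^ 4 * (2 * \<bar>K\<bar>)"
    proof (rule mult_mono)
      have "Kdd ^ j \<le> (Kdd + 1) ^ j" using Kdd_nonneg by (intro power_mono) auto
      also have "\<dots> \<le> (Kdd + 1) ^ 4" using Kdd_nonneg j by (intro power_increasing) auto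
      finally show "Kdd ^ j \<le> (Kdd + 1) ^ 4" .
      have "nrm 1 5 ?w \<le> nrm 1 5 (u t) + nrm 1 5 (v t)" by (rule nrm_diff[OF sol_X[OF u] sol_X[OF v]]) auto
      thus "nrm 1 5 ?w \<le> 2 * \<bar>K\<bar>" using bspec[OF K t] by linarith
      show "0 \<le> nrm 1 5 ?w" by (rule nrm_nonneg[OF w]) simp
    qed (use Kdd_nonneg in simp)
    finally have hD: "nrm 1 1 ?h / (real N + 1) \<le> D / (real N + 1)" unfolding D_def by (rule divide_right_mono) simp
    have cmp': "\<forall>p\<in>?F. \<forall>t\<in>{0..T}. \<forall>x. \<bar>x\<bar> \<le> A \<longrightarrow> norm (fmul (?m p) (\<lambda>x. u t x - v t x) x) \<le> \<epsilon>'"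
      using cmp u v K c by simp
    have "norm (blk l ?h x) \<le> \<epsilon>'" if "l \<in> {- int N..int N}" for l
      using bspec[OF cmp', of "(j, l)"] that j t x unfolding blk_def d(3)[OF multiplier_eta] by simp
    hence "(\<Sum>l\<in>{- int N..int N}. norm (blk l ?h x)) \<le> (\<Sum>l\<in>{- int N..int N}. \<epsilon>')" by (rule sum_mono)
    also have "\<dots> = (2 * real N + 1) * \<epsilon>'" by simp
    also have "\<dots> = \<epsilon> / 2" unfolding \<epsilon>'_def by (simp add: divide_simps)
    finally show ?thesis unfolding d(4) using norm_le_blocks[OF h, of x N] hD DN by linarith
  qed
  show ?thesis by (rule exI[of _ r], rule conjI[OF rd(1)], rule exI[of _ \<delta>], rule conjI[OF rd(2)]) (use main in blast)
qed

lemma flow_convergence: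
  assumes f: "\<And>n. X 5 (f n)" "\<And>n. nrm 1 5 (f n) \<le> M" and g: "X 5 g"
    and lim: "\<And>r \<delta>. r \<ge> 0 \<Longrightarrow> \<delta> > 0 \<Longrightarrow> \<forall>\<^sub>F n in sequentially. \<forall>x. \<bar>x\<bar> \<le> r \<longrightarrow> norm (f n x - g x) \<le> \<delta>"
    and A: "A \<ge> 0" and e: "\<epsilon> > 0"
  shows "\<forall>\<^sub>F n in sequentially. \<forall>j\<le>4. \<forall>t\<in>{0..T}. \<forall>x. \<bar>x\<bar> \<le> A \<longrightarrow> norm (iter_deriv j (\<lambda>x. S (f n) t x - S g t x) x) \<le> \<epsilon>"
proof -
  obtain B where B: "\<forall>n. \<forall>t\<in>{0..T}. nrm 1 5 (S (f n) t) \<le> B" using uniform_bound[OF f] ..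
  obtain L where L: "\<And>t. t \<in> {0..T} \<Longrightarrow> nrm 1 5 (S g t) \<le> L" using sol_bounded[OF sol_S[OF g]] by blast
  have K: "\<forall>t\<in>{0..T}. nrm 1 5 (S (f n) t) \<le> max B L \<and> nrm 1 5 (S g t) \<le> max B L" for n
    using B L by (simp add: le_max_iff_disj)
  obtain r \<delta> where rd: "r \<ge> 0" "\<delta> > 0" and cmp: "\<forall>u v. sol \<sigma> \<kappa> u \<longrightarrow> sol \<sigma> \<kappa> v \<longrightarrow>
      (\<forall>t\<in>{0..T}. nrm 1 5 (u t) \<le> max B L \<and> nrm 1 5 (v t) \<le> max B L) \<longrightarrow>
      (\<forall>x. \<bar>x\<bar> \<le> r \<longrightarrow> norm (u 0 x - v 0 x) \<le> \<delta>) \<longrightarrow>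
      (\<forall>j\<le>4. \<forall>t\<in>{0..T}. \<forall>x. \<bar>x\<bar> \<le> A \<longrightarrow> norm (iter_deriv j (\<lambda>x. u t x - v t x) x) \<le> \<epsilon>)"
    using local_compare_deriv[OF A e, of "max B L"] by (elim exE conjE) (rule that)
  from lim[OF rd] show ?thesis
  proof eventually_elim
    case (elim n)
    thus ?case using cmp[THEN spec, THEN spec, THEN mp, OF sol_S[OF f(1)], THEN mp, OF sol_S[OF g], THEN mp, OF K]
      unfolding S_0[OF f(1)] S_0[OF g] by blast
  qed
qed

end

section \<open>From pointwise estimates to local C^k norms\<close>

lemma Ck_norm_bound:
  assumes "\<And>j x. j \<le> k \<Longrightarrow> x \<in> {-A..A} \<Longrightarrow> norm (iter_deriv j w x) \<le> e" "e \<ge> 0"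
  shows "Ck_norm k A w \<le> ennreal ((real k + 1) * e)"
proof -
  have "Ck_norm k A w \<le> (\<Sum>j\<le>k. ennreal e)"
    unfolding Ck_norm_def by (intro sum_mono SUP_least ennreal_leI assms) auto
  also have "\<dots> = ennreal ((real k + 1) * e)"
    using sum_ennreal[of "{..k}" "\<lambda>_. e"] assms(2) by (simp add: add.commute)
  finally show ?thesis .
qed

lemma Ck_loc_tendsto_uniform:
  assumes "Ck_loc_tendsto k f g" "\<delta> > 0"
  shows "\<forall>\<^sub>F n in sequentially. \<forall>x. \<bar>x\<bar> \<le> r \<longrightarrow> norm (f n x - g x) \<le> \<delta>"
proof -
  have "(\<lambda>n. Ck_norm k r (\<lambda>x. f n x - g x)) \<longlonglongrightarrow> 0" using assms(1) unfolding Ck_loc_tendsto_def by blast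
  moreover have "(0::ennreal) < ennreal \<delta>" using assms(2) by simp
  ultimately have "\<forall>\<^sub>F n in sequentially. Ck_norm k r (\<lambda>x. f n x - g x) < ennreal \<delta>" by (rule order_tendstoD(2))
  thus ?thesis
  proof eventually_elim
    case (elim n)
    show ?case
    proof (intro allI impI)
      fix x assume x: "\<bar>x\<bar> \<le> r"
      let ?s = "\<lambda>j. SUP x\<in>{-r..r}. ennreal (norm (iter_deriv j (\<lambda>x. f n x - g x) x))"
      have "ennreal (norm (iter_deriv 0 (\<lambda>x. f n x - g x) x)) \<le> ?s 0" by (rule SUP_upper) (use x in auto)
      also have "\<dots> \<le> (\<Sum>j\<le>k. ?s j)" by (rule member_le_sum) auto
      also have "\<dots> < ennreal \<delta>" using elim unfolding Ck_norm_def .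
      finally show "norm (f n x - g x) \<le> \<delta>" using assms(2) by (simp add: iter_deriv_def ennreal_less_iff)
    qed
  qed
qed

theorem proposition47:
  fixes \<eta> :: "real \<Rightarrow> real" and \<kappa> A T :: real
    and \<Phi> :: "real \<Rightarrow> (real \<Rightarrow> complex) \<Rightarrow> real \<Rightarrow> complex"
    and f :: "nat \<Rightarrow> real \<Rightarrow> complex" and g :: "real \<Rightarrow> complex"
  assumes "admissible_window \<eta>"
    and "\<kappa> \<in> {1, -1}"
    and "is_flow \<eta> \<kappa> \<Phi>"
    and "\<And>n. f n \<in> X_space \<eta> 5"
    and "g \<in> X_space \<eta> 5"
    and "(SUP n. X_norm \<eta> 5 (f n)) + X_norm \<eta> 5 g < \<infinity>"
    and "Ck_loc_tendsto 4 f g"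
  shows "(\<lambda>n. SUP t\<in>{-T..T}. Ck_norm 4 A (\<lambda>x. \<Phi> t (f n) x - \<Phi> t g x)) \<longlonglongrightarrow> 0"
proof -
  interpret window \<eta> by unfold_locales (rule assms(1))
  have f: "X 5 (f n)" and g: "X 5 g" for n using assms(4,5) by (simp_all add: X_space_iff)
  obtain M where M: "M \<ge> 0" "(SUP n. X_norm \<eta> 5 (f n)) + X_norm \<eta> 5 g = ennreal M"
    using assms(6) by (cases "(SUP n. X_norm \<eta> 5 (f n)) + X_norm \<eta> 5 g") auto
  have fM: "nrm 1 5 (f n) \<le> 8 * M" for n
  proof (rule X_norm_finite_imp_X(2)[OF X_cb[OF f] _ M(1)])
    have "X_norm \<eta> 5 (f n) \<le> (SUP n. X_norm \<eta> 5 (f n))" by (rule SUP_upper) simp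
    also have "\<dots> \<le> ennreal M" unfolding M(2)[symmetric] by simp
    finally show "X_norm \<eta> 5 (f n) \<le> ennreal M" .
  qed
  \<comment> \<open>For negative T or A the original intervals are empty; the estimates are proved
    on possibly larger nonempty ones.\<close>
  define T' A' where "T' = max T 0" and "A' = max A 0"
  have conv: "\<forall>\<^sub>F n in sequentially. \<forall>j\<le>4. \<forall>t\<in>{0..T'}. \<forall>x. \<bar>x\<bar> \<le> A' \<longrightarrow>
      norm (iter_deriv j (\<lambda>x. \<Phi> (\<sigma> * t) (f n) x - \<Phi> (\<sigma> * t) g x) x) \<le> \<epsilon>"
    if \<sigma>: "\<sigma> \<in> {1, -1}" and e: "\<epsilon> > 0" for \<sigma> \<epsilon>
  proof -
    interpret evolution \<eta> \<sigma> \<kappa> T' "\<lambda>q t. \<Phi> (\<sigma> * t) q"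
      by unfold_locales (use \<sigma> assms(2) flow_sol[OF assms(3) _ \<sigma>] in \<open>auto simp: T'_def\<close>)
    show ?thesis
      by (rule flow_convergence[OF f fM g Ck_loc_tendsto_uniform[OF assms(7)] _ e]) (simp_all add: A'_def)
  qed
  show ?thesis
  proof (rule tendsto_zero_ennreal)
    fix r :: real assume r: "0 < r"
    \<comment> \<open>Five orders of derivatives contribute r / 10 each, a total of r / 2, strictly
      below r.\<close>
    hence e: "r / 10 > 0" by simp
    have "1 \<in> {1, - 1 :: real}" "- 1 \<in> {1, - 1 :: real}" by simp_all
    from conv[OF this(1) e] conv[OF this(2) e]
    have "\<forall>\<^sub>F n in sequentially. (SUP t\<in>{-T..T}. Ck_norm 4 A (\<lambda>x. \<Phi> t (f n) x - \<Phi> t g x)) \<le> ennreal ((real 4 + 1) * (r / 10))"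
    proof eventually_elim
      case (elim n)
      show ?case
      proof (intro SUP_least Ck_norm_bound)
        fix t j x assume t: "t \<in> {-T..T}" and j: "j \<le> (4::nat)" and x: "x \<in> {-A..A}"
        have x': "\<bar>x\<bar> \<le> A'" unfolding A'_def using x by auto
        show "norm (iter_deriv j (\<lambda>x. \<Phi> t (f n) x - \<Phi> t g x) x) \<le> r / 10"
        proof (cases "t \<ge> 0")
          case True
          hence "t \<in> {0..T'}" unfolding T'_def using t by auto
          thus ?thesis using elim(1) j x' by simp
        next
          case False
          hence "- t \<in> {0..T'}" unfolding T'_def using t by auto
          with elim(2) j x' have "norm (iter_deriv j (\<lambda>x. \<Phi> (- 1 * - t) (f n) x - \<Phi> (- 1 * - t) g x) x) \<le> r / 10" by blast
          thus ?thesis by simp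
        qed
      qed (use r in simp)
    qed
    thus "\<forall>\<^sub>F n in sequentially. (SUP t\<in>{-T..T}. Ck_norm 4 A (\<lambda>x. \<Phi> t (f n) x - \<Phi> t g x)) < ennreal r"
    proof eventually_elim
      case (elim n)
      also have "ennreal ((real 4 + 1) * (r / 10)) < ennreal r" using r by (simp add: ennreal_less_iff)
      finally show ?case .
    qed
  qed
qed

end
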